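(* Let $\Omega\subset\mathbb{R}^d$ be a bounded Lipschitz domain and let $s>0$. Assume that $S:H^{-s}(\Omega)\to H^s_0(\Omega)$ is an isomorphism. Then, for $t>s+d/2$, $$g_n(S,H^{-s+t}(\Omega),H^s(\Omega))=g_n^{\mathrm{lin}}(S,H^{-s+t}(\Omega),H^s(\Omega))\asymp n^{(s-t)/d}.$$
   Context: Isomorphism means a bounded linear bijection with bounded inverse. $a_n\asymp b_n$ means each is bounded by a constant multiple of the other, with constants independent of $n\in\mathbb{N}$. Function spaces (real-valued): $H^0(\Omega)=L_2(\Omega)$; for $m\in\mathbb{N}$, $H^m(\Omega)$ is the usual Sobolev space of functions with distributional derivatives up to order $m$ in $L_2(\Omega)$, a Hilbert space; for positive noninteger $s$, $H^s(\Omega)=B^s_2(L_2(\Omega))$ is the Besov space of all $u\in L_2(\Omega)$ with $\int_0^\infty[\tau^{-s}\omega_r(u,\tau)_{L_2(\Omega)}]^2\,d\tau/\tau<\infty$, $r\in\mathbb{N}$, $s<r\le s+1$, where $\omega_r(u,\tau)_{L_2(\Omega)}=\sup_{|h|\le\tau}\|\Delta_h^ru\|_{L_2(\Omega_{rh})}$ and $\Omega_{rh}=\{x\in\Omega:[x,x+rh]\subset\Omega\}$. All these spaces are regarded as Hilbert spaces (with a Hilbert space norm). For $s>0$, $H^s_0(\Omega)$ is the closure of $C_c^\infty(\Omega)$ in $H^s(\Omega)$. For $s>0$ with $s\ne\frac12+k$ ($k\in\mathbb{N}_0$), $H^{-s}(\Omega)=(H^s_0(\Omega))'$; for $s=\frac12+k$,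 $H^{-s}(\Omega)=(\widetilde H^s(\Omega))'$, where $\widetilde H^s(\Omega)$ is the space of $u\in L_2(\Omega)$ that are restrictions of some $g\in H^s(\mathbb{R}^d)$ with $\operatorname{supp}g\subset\overline\Omega$, with the induced norm. $H^{-s+t}(\Omega)$ is regarded as a subspace of $H^{-s}(\Omega)$ in the natural way; for $t>s+d/2$ function evaluation $f\mapsto f(x)$ is continuous on $H^{-s+t}(\Omega)$. Sampling numbers: put $F=H^{-s+t}(\Omega)$, $H=H^s(\Omega)$, and regard $S$ as a mapping $F\to H$ by restriction. For $S_n:F\to H$ put $e(S_n,F,H)=\sup_{\|f\|_F\le1}\|S(f)-S_n(f)\|_H$. The linear sampling number $g_n^{\mathrm{lin}}(S,F,H)$ is $\inf e(S_n,F,H)$ over all $S_n$ of the form $S_n(f)=\sum_{i=1}^nf(x_i)\,\tilde h_i$ with $x_i\in\Omega$, $\tilde h_i\in H$. The sampling number $g_n(S,F,H)$ is $\inf e(S_n,F,H)$ over all $S_n=\varphi_n\circ N_n$ with $N_n(f)=(f(x_1),\dots,f(x_n))$, $x_i\in\Omega$, and arbitrary $\varphi_n:\mathbb{R}^n\to H$. *)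

theory Defs
  imports "HOL-Analysis.Analysis"
begin

section \<open>Square integrable functions modulo equality almost everywhere\<close>

definition square_integrable :: "('a::euclidean_space \<Rightarrow> real) \<Rightarrow> bool" where
  "square_integrable f \<longleftrightarrow>
     f \<in> borel_measurable lebesgue \<and> integrable lebesgue (\<lambda>x. (f x)\<^sup>2)"

lemma square_integrable_mult:
  assumes "square_integrable f" "square_integrable g"
  shows "integrable lebesgue (\<lambda>x. f x * g x)"
proof (rule Bochner_Integration.integrable_bound)
  show "integrable lebesgue (\<lambda>x. (f x)\<^sup>2 + (g x)\<^sup>2)"
    using assms by (auto simp: square_integrable_def)
  show "(\<lambda>x. f x * g x) \<in> borel_measurable lebesgue"
    using assms by (auto simp: square_integrable_def)
  have "\<bar>a * b\<bar> \<le> a\<^sup>2 + b\<^sup>2" for a b :: real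
  proof -
    have "\<bar>a\<bar> * \<bar>b\<bar> \<ge> 0" by simp
    then show ?thesis
      using sum_squares_bound[of "\<bar>a\<bar>" "\<bar>b\<bar>"] unfolding abs_mult power2_abs by linarith
  qed
  then show "AE x in lebesgue. norm (f x * g x) \<le> norm ((f x)\<^sup>2 + (g x)\<^sup>2)"
    by (auto intro!: always_eventually)
qed

lemma square_integrable_zero [simp]: "square_integrable (\<lambda>x. 0)"
  by (simp add: square_integrable_def)

lemma square_integrable_add:
  assumes "square_integrable f" "square_integrable g"
  shows "square_integrable (\<lambda>x. f x + g x)"
proof -
  have "integrable lebesgue (\<lambda>x. (f x)\<^sup>2 + 2 * (f x * g x) + (g x)\<^sup>2)"
    using assms square_integrable_mult[OF assms] by (auto simp: square_integrable_def)
  then show ?thesis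
    using assms by (auto simp: square_integrable_def power2_sum algebra_simps)
qed

lemma square_integrable_scale:
  "square_integrable f \<Longrightarrow> square_integrable (\<lambda>x. c * f x)"
  by (auto simp: square_integrable_def power_mult_distrib)

definition ae_equal :: "('a::euclidean_space \<Rightarrow> real) \<Rightarrow> ('a \<Rightarrow> real) \<Rightarrow> bool" where
  "ae_equal f g \<longleftrightarrow>
     square_integrable f \<and> square_integrable g \<and> (AE x in lebesgue. f x = g x)"

quotient_type (overloaded) 'a L2 = "'a::euclidean_space \<Rightarrow> real" / partial: ae_equal
  morphisms rep_L2 abs_L2
proof (rule part_equivpI)
  show "\<exists>f::'a \<Rightarrow> real. ae_equal f f"
    by (rule exI[of _ "\<lambda>x. 0"]) (simp add: ae_equal_def)
  show "symp (ae_equal :: ('a \<Rightarrow> real) \<Rightarrow> _)"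
    by (rule sympI) (auto simp: ae_equal_def elim: eventually_mono)
  show "transp (ae_equal :: ('a \<Rightarrow> real) \<Rightarrow> _)"
    by (rule transpI) (auto simp: ae_equal_def elim: eventually_elim2)
qed

instantiation L2 :: (euclidean_space) real_inner
begin

lift_definition zero_L2 :: "'a L2" is "\<lambda>x. 0"
  by (simp add: ae_equal_def)

lift_definition plus_L2 :: "'a L2 \<Rightarrow> 'a L2 \<Rightarrow> 'a L2" is "\<lambda>f g x. f x + g x"
  by (auto simp: ae_equal_def intro: square_integrable_add elim: eventually_elim2)

lift_definition scaleR_L2 :: "real \<Rightarrow> 'a L2 \<Rightarrow> 'a L2" is "\<lambda>c f x. c * f x"
  by (auto simp: ae_equal_def intro: square_integrable_scale elim: eventually_mono)

lift_definition inner_L2 :: "'a L2 \<Rightarrow> 'a L2 \<Rightarrow> real"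
  is "\<lambda>f g. integral\<^sup>L lebesgue (\<lambda>x. f x * g x)"
  unfolding ae_equal_def
  by (intro integral_cong_AE) (auto simp: square_integrable_def elim: eventually_elim2)

definition uminus_L2 :: "'a L2 \<Rightarrow> 'a L2" where "- u = (- 1) *\<^sub>R (u :: 'a L2)"
definition minus_L2 :: "'a L2 \<Rightarrow> 'a L2 \<Rightarrow> 'a L2" where "u - v = u + - (v :: 'a L2)"
definition norm_L2 :: "'a L2 \<Rightarrow> real" where "norm u = sqrt (inner u (u :: 'a L2))"
definition sgn_L2 :: "'a L2 \<Rightarrow> 'a L2" where "sgn u = inverse (norm u) *\<^sub>R (u :: 'a L2)"
definition dist_L2 :: "'a L2 \<Rightarrow> 'a L2 \<Rightarrow> real" where "dist u v = norm (u - (v :: 'a L2))"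
definition uniformity_L2 :: "('a L2 \<times> 'a L2) filter" where
  "uniformity = (INF e\<in>{0<..}. principal {(u :: 'a L2, v). dist u v < e})"
definition open_L2 :: "'a L2 set \<Rightarrow> bool" where
  "open U \<longleftrightarrow> (\<forall>u\<in>U. \<forall>\<^sub>F (u', v) in uniformity. u' = u \<longrightarrow> v \<in> (U :: 'a L2 set))"

instance
proof
  fix u v w :: "'a L2" and a b :: real
  show "u + v + w = u + (v + w)"
    by transfer (auto simp: ae_equal_def add.assoc intro!: square_integrable_add)
  show "u + v = v + u"
    by transfer (auto simp: ae_equal_def add.commute intro!: square_integrable_add)
  show "0 + u = u"
    by transfer (auto simp: ae_equal_def)
  show "- u + u = 0"
    unfolding uminus_L2_def
    by transfer
      (auto simp: ae_equal_def intro!: square_integrable_add square_integrable_scale[of _ "-1", simplified])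
  show "u - v = u + - v"
    by (simp add: minus_L2_def)
  show "a *\<^sub>R (u + v) = a *\<^sub>R u + a *\<^sub>R v"
    by transfer
      (auto simp: ae_equal_def distrib_left intro!: square_integrable_add square_integrable_scale)
  show "(a + b) *\<^sub>R u = a *\<^sub>R u + b *\<^sub>R u"
    by transfer
      (auto simp: ae_equal_def distrib_right intro!: square_integrable_add square_integrable_scale)
  show "a *\<^sub>R b *\<^sub>R u = (a * b) *\<^sub>R u"
    by transfer (auto simp: ae_equal_def mult.assoc intro!: square_integrable_scale)
  show "1 *\<^sub>R u = u"
    by transfer (auto simp: ae_equal_def)
  show "dist u v = norm (u - v)"
    by (simp add: dist_L2_def)
  show "sgn u = inverse (norm u) *\<^sub>R u"
    by (simp add: sgn_L2_def)
  show "uniformity = (INF e\<in>{0<..}. principal {(u :: 'a L2, v). dist u v < e})"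
    by (simp add: uniformity_L2_def)
  show "open U \<longleftrightarrow> (\<forall>u\<in>U. \<forall>\<^sub>F (u', v) in uniformity. u' = u \<longrightarrow> v \<in> U)" for U :: "'a L2 set"
    by (simp add: open_L2_def)
  show "inner u v = inner v u"
    by transfer (simp add: mult.commute)
  show "inner (u + v) w = inner u w + inner v w"
    by transfer (auto simp: ae_equal_def distrib_right square_integrable_mult)
  show "inner (a *\<^sub>R u) v = a * inner u v"
    by transfer (simp add: mult.assoc)
  show "0 \<le> inner u u"
    by transfer simp
  show "inner u u = 0 \<longleftrightarrow> u = 0"
  proof transfer
    fix f :: "'a \<Rightarrow> real"
    assume "ae_equal f f"
    then have f: "square_integrable f" by (simp add: ae_equal_def)
    have "integral\<^sup>L lebesgue (\<lambda>x. f x * f x) = 0 \<longleftrightarrow> (AE x in lebesgue. f x * f x = 0)"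
      by (rule integral_nonneg_eq_0_iff_AE) (auto simp: square_integrable_mult f)
    then show "integral\<^sup>L lebesgue (\<lambda>x. f x * f x) = 0 \<longleftrightarrow> ae_equal f (\<lambda>x. 0)"
      by (simp add: ae_equal_def f)
  qed
  show "norm u = sqrt (inner u u)"
    by (simp add: norm_L2_def)
qed

end

text \<open>\<open>L\<^sub>2(\<Omega>)\<close> is realised inside \<open>L\<^sub>2\<close> of the whole space, by extending functions by zero.\<close>

definition L2_on :: "'a::euclidean_space set \<Rightarrow> 'a L2 set" where
  "L2_on \<Omega> = {u. AE x in lebesgue. x \<notin> \<Omega> \<longrightarrow> rep_L2 u x = 0}"

text \<open>Restriction to \<open>\<Omega>\<close>, meaningful for measurable \<open>\<Omega>\<close>.\<close>

definition restrict_L2 :: "'a::euclidean_space set \<Rightarrow> 'a L2 \<Rightarrow> 'a L2" where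
  "restrict_L2 \<Omega> u = abs_L2 (\<lambda>x. indicator \<Omega> x * rep_L2 u x)"


section \<open>Bounded Lipschitz domains\<close>

definition bounded_Lipschitz_domain :: "'a::euclidean_space set \<Rightarrow> bool" where
  "bounded_Lipschitz_domain \<Omega> \<longleftrightarrow>
     open \<Omega> \<and> connected \<Omega> \<and> \<Omega> \<noteq> {} \<and> bounded \<Omega> \<and>
     (\<forall>p\<in>frontier \<Omega>. \<exists>r>0. \<exists>e L. \<exists>\<gamma> :: 'a \<Rightarrow> real.
        norm e = 1 \<and> L-lipschitz_on {y. y \<bullet> e = 0} \<gamma> \<and>
        \<Omega> \<inter> ball p r = {x \<in> ball p r. \<gamma> (x - (x \<bullet> e) *\<^sub>R e) < x \<bullet> e})"


section \<open>Test functions and Sobolev spaces of integer order\<close>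

text \<open>A partial derivative of order \<open>k\<close> is given by a list of \<open>k\<close> coordinate directions.\<close>

primrec partial_derivs ::
    "'a::euclidean_space list \<Rightarrow> ('a \<Rightarrow> real) \<Rightarrow> 'a \<Rightarrow> real" where
  "partial_derivs [] f = f"
| "partial_derivs (b # bs) f = (\<lambda>x. frechet_derivative (partial_derivs bs f) (at x) b)"

definition smooth :: "('a::euclidean_space \<Rightarrow> real) \<Rightarrow> bool" where
  "smooth f \<longleftrightarrow> (\<forall>bs. set bs \<subseteq> Basis \<longrightarrow> partial_derivs bs f differentiable_on UNIV)"

definition test_functions :: "'a::euclidean_space set \<Rightarrow> ('a \<Rightarrow> real) set" where
  "test_functions \<Omega> =
     {\<phi>. smooth \<phi> \<and> compact (closure {x. \<phi> x \<noteq> 0}) \<and> closure {x. \<phi> x \<noteq> 0} \<subseteq> \<Omega>}"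

definition is_weak_deriv ::
    "'a::euclidean_space set \<Rightarrow> 'a list \<Rightarrow> 'a L2 \<Rightarrow> 'a L2 \<Rightarrow> bool" where
  "is_weak_deriv \<Omega> bs u v \<longleftrightarrow>
     (\<forall>\<phi>\<in>test_functions \<Omega>.
        (LINT x:\<Omega>|lebesgue. rep_L2 u x * partial_derivs bs \<phi> x) =
        (- 1) ^ length bs * (LINT x:\<Omega>|lebesgue. rep_L2 v x * \<phi> x))"

definition weak_deriv :: "'a::euclidean_space set \<Rightarrow> 'a list \<Rightarrow> 'a L2 \<Rightarrow> 'a L2" where
  "weak_deriv \<Omega> bs u = (THE v. v \<in> L2_on \<Omega> \<and> is_weak_deriv \<Omega> bs u v)"

definition Sobolev :: "nat \<Rightarrow> 'a::euclidean_space set \<Rightarrow> 'a L2 set" where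
  "Sobolev m \<Omega> =
     {u \<in> L2_on \<Omega>. \<forall>bs. set bs \<subseteq> Basis \<and> length bs \<le> m \<longrightarrow>
        (\<exists>v\<in>L2_on \<Omega>. is_weak_deriv \<Omega> bs u v)}"

text \<open>The sum counts a mixed derivative once for every order of its directions; this changes
  the usual Sobolev norm only by an equivalent Hilbert norm.\<close>

definition Sobolev_norm :: "nat \<Rightarrow> 'a::euclidean_space set \<Rightarrow> 'a L2 \<Rightarrow> real" where
  "Sobolev_norm m \<Omega> u =
     sqrt (\<Sum>bs\<in>{bs. set bs \<subseteq> Basis \<and> length bs \<le> m}. (norm (weak_deriv \<Omega> bs u))\<^sup>2)"


section \<open>Besov spaces \<open>B\<^sup>s\<^sub>2(L\<^sub>2(\<Omega>))\<close>\<close>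

definition fwd_diff ::
    "nat \<Rightarrow> 'a::euclidean_space \<Rightarrow> ('a \<Rightarrow> real) \<Rightarrow> 'a \<Rightarrow> real" where
  "fwd_diff r h f x = (\<Sum>j\<le>r. (- 1) ^ (r - j) * real (r choose j) * f (x + real j *\<^sub>R h))"

definition diff_domain :: "'a::euclidean_space set \<Rightarrow> nat \<Rightarrow> 'a \<Rightarrow> 'a set" where
  "diff_domain \<Omega> r h = {x \<in> \<Omega>. closed_segment x (x + real r *\<^sub>R h) \<subseteq> \<Omega>}"

definition modulus_of_smoothness ::
    "nat \<Rightarrow> 'a::euclidean_space set \<Rightarrow> 'a L2 \<Rightarrow> real \<Rightarrow> real" where
  "modulus_of_smoothness r \<Omega> u \<tau> =
     (SUP h\<in>cball 0 \<tau>.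
        sqrt (LINT x:diff_domain \<Omega> r h|lebesgue. (fwd_diff r h (rep_L2 u) x)\<^sup>2))"

lemma modulus_order_unique:
  assumes "0 < s"
  shows "s < real r \<and> real r \<le> s + 1 \<longleftrightarrow> r = nat \<lfloor>s\<rfloor> + 1"
  using assms by linarith

definition Besov_integral :: "real \<Rightarrow> 'a::euclidean_space set \<Rightarrow> 'a L2 \<Rightarrow> ennreal" where
  "Besov_integral s \<Omega> u =
     (\<integral>\<^sup>+\<tau>\<in>{0<..}.
        ennreal ((\<tau> powr (- s) * modulus_of_smoothness (nat \<lfloor>s\<rfloor> + 1) \<Omega> u \<tau>)\<^sup>2 / \<tau>) \<partial>lborel)"

definition Besov :: "real \<Rightarrow> 'a::euclidean_space set \<Rightarrow> 'a L2 set" where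
  "Besov s \<Omega> = {u \<in> L2_on \<Omega>. Besov_integral s \<Omega> u < \<infinity>}"

definition Besov_norm :: "real \<Rightarrow> 'a::euclidean_space set \<Rightarrow> 'a L2 \<Rightarrow> real" where
  "Besov_norm s \<Omega> u = norm u + sqrt (enn2real (Besov_integral s \<Omega> u))"


section \<open>The scale \<open>H\<^sup>s(\<Omega>)\<close>\<close>

text \<open>\<open>H\<^sup>s(\<Omega>)\<close> for \<open>s \<ge> 0\<close>. As \<open>Besov_norm\<close> does not come from an inner product,
  \<open>H_norm\<close> only fixes \<open>H\<^sup>s(\<Omega>)\<close> as a normed space up to equivalence of norms;
  see \<open>Hilbert_norm_for\<close> below.\<close>

definition H_space :: "real \<Rightarrow> 'a::euclidean_space set \<Rightarrow> 'a L2 set" where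
  "H_space s \<Omega> = (if s \<in> \<nat> then Sobolev (nat \<lfloor>s\<rfloor>) \<Omega> else Besov s \<Omega>)"

definition H_norm :: "real \<Rightarrow> 'a::euclidean_space set \<Rightarrow> 'a L2 \<Rightarrow> real" where
  "H_norm s \<Omega> u = (if s \<in> \<nat> then Sobolev_norm (nat \<lfloor>s\<rfloor>) \<Omega> u else Besov_norm s \<Omega> u)"

lemma H_space_0: "H_space 0 \<Omega> = L2_on \<Omega>"
  by (auto simp: H_space_def Sobolev_def is_weak_deriv_def)

definition H0_space :: "real \<Rightarrow> 'a::euclidean_space set \<Rightarrow> 'a L2 set" where
  "H0_space s \<Omega> =
     {u \<in> H_space s \<Omega>. \<forall>\<epsilon>>0. \<exists>\<phi>\<in>test_functions \<Omega>. H_norm s \<Omega> (u - abs_L2 \<phi>) < \<epsilon>}"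

text \<open>The extensions \<open>g \<in> H\<^sup>s(\<real>\<^sup>d)\<close> of \<open>u\<close> with support in the closure of \<open>\<Omega>\<close>, the
  space \<open>H\<close>-tilde of all \<open>u\<close> that possess such an extension, and its induced norm.\<close>

definition supported_extensions ::
    "real \<Rightarrow> 'a::euclidean_space set \<Rightarrow> 'a L2 \<Rightarrow> 'a L2 set" where
  "supported_extensions s \<Omega> u =
     {g \<in> H_space s UNIV. g \<in> L2_on (closure \<Omega>) \<and> restrict_L2 \<Omega> g = u}"

definition Htilde_space :: "real \<Rightarrow> 'a::euclidean_space set \<Rightarrow> 'a L2 set" where
  "Htilde_space s \<Omega> = {u \<in> L2_on \<Omega>. supported_extensions s \<Omega> u \<noteq> {}}"

definition Htilde_norm :: "real \<Rightarrow> 'a::euclidean_space set \<Rightarrow> 'a L2 \<Rightarrow> real" where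
  "Htilde_norm s \<Omega> u = (INF g\<in>supported_extensions s \<Omega> u. H_norm s UNIV g)"


section \<open>Dual spaces and \<open>H\<^sup>-\<^sup>s(\<Omega>)\<close>\<close>

text \<open>A functional on \<open>V\<close> is represented by the function that agrees with it on \<open>V\<close> and is
  zero elsewhere, so that equality of functionals is equality of functions.\<close>

definition dual_space ::
    "'v::real_vector set \<Rightarrow> ('v \<Rightarrow> real) \<Rightarrow> ('v \<Rightarrow> real) set" where
  "dual_space V N =
     {l. (\<forall>u. u \<notin> V \<longrightarrow> l u = 0) \<and>
         (\<forall>u\<in>V. \<forall>v\<in>V. l (u + v) = l u + l v) \<and>
         (\<forall>c. \<forall>u\<in>V. l (c *\<^sub>R u) = c * l u) \<and>
         (\<exists>C. \<forall>u\<in>V. \<bar>l u\<bar> \<le> C * N u)}"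

definition dual_norm :: "'v set \<Rightarrow> ('v \<Rightarrow> real) \<Rightarrow> ('v \<Rightarrow> real) \<Rightarrow> real" where
  "dual_norm V N l = (SUP u\<in>{u \<in> V. N u \<le> 1}. \<bar>l u\<bar>)"

text \<open>The space of which \<open>H\<^sup>-\<^sup>s(\<Omega>)\<close>, \<open>s > 0\<close>, is the dual, and its norm.\<close>

definition predual_space :: "real \<Rightarrow> 'a::euclidean_space set \<Rightarrow> 'a L2 set" where
  "predual_space s \<Omega> = (if s - 1/2 \<in> \<nat> then Htilde_space s \<Omega> else H0_space s \<Omega>)"

definition predual_norm :: "real \<Rightarrow> 'a::euclidean_space set \<Rightarrow> 'a L2 \<Rightarrow> real" where
  "predual_norm s \<Omega> = (if s - 1/2 \<in> \<nat> then Htilde_norm s \<Omega> else H_norm s \<Omega>)"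

definition Hneg_space :: "real \<Rightarrow> 'a::euclidean_space set \<Rightarrow> ('a L2 \<Rightarrow> real) set" where
  "Hneg_space s \<Omega> = dual_space (predual_space s \<Omega>) (predual_norm s \<Omega>)"

definition Hneg_norm :: "real \<Rightarrow> 'a::euclidean_space set \<Rightarrow> ('a L2 \<Rightarrow> real) \<Rightarrow> real" where
  "Hneg_norm s \<Omega> = dual_norm (predual_space s \<Omega>) (predual_norm s \<Omega>)"

text \<open>The natural embedding of \<open>L\<^sub>2(\<Omega>)\<close> into \<open>H\<^sup>-\<^sup>s(\<Omega>)\<close>.\<close>

definition Hneg_embed ::
    "real \<Rightarrow> 'a::euclidean_space set \<Rightarrow> 'a L2 \<Rightarrow> ('a L2 \<Rightarrow> real)" where
  "Hneg_embed s \<Omega> f = (\<lambda>u. if u \<in> predual_space s \<Omega> then f \<bullet> u else 0)"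

text \<open>Bounded linear bijections with bounded inverse from a space \<open>D\<close> of functionals (with
  pointwise operations) to a subspace \<open>Y\<close> of a vector space.\<close>

definition isomorphism_on ::
    "('v \<Rightarrow> real) set \<Rightarrow> (('v \<Rightarrow> real) \<Rightarrow> real) \<Rightarrow> 'w::real_vector set \<Rightarrow> ('w \<Rightarrow> real)
      \<Rightarrow> (('v \<Rightarrow> real) \<Rightarrow> 'w) \<Rightarrow> bool" where
  "isomorphism_on D ND Y NY S \<longleftrightarrow>
     (\<forall>f\<in>D. \<forall>g\<in>D. S (\<lambda>u. f u + g u) = S f + S g) \<and>
     (\<forall>c. \<forall>f\<in>D. S (\<lambda>u. c * f u) = c *\<^sub>R S f) \<and>
     bij_betw S D Y \<and>
     (\<exists>C. \<forall>f\<in>D. NY (S f) \<le> C * ND f) \<and>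
     (\<exists>C. \<forall>y\<in>Y. ND (inv_into D S y) \<le> C * NY y)"


section \<open>Hilbert space norms\<close>

definition Hilbert_norm_on :: "'v::real_vector set \<Rightarrow> ('v \<Rightarrow> real) \<Rightarrow> bool" where
  "Hilbert_norm_on V N \<longleftrightarrow>
     (\<exists>ip :: 'v \<Rightarrow> 'v \<Rightarrow> real.
        (\<forall>u\<in>V. \<forall>v\<in>V. ip u v = ip v u) \<and>
        (\<forall>u\<in>V. \<forall>v\<in>V. \<forall>w\<in>V. ip (u + v) w = ip u w + ip v w) \<and>
        (\<forall>c. \<forall>u\<in>V. \<forall>v\<in>V. ip (c *\<^sub>R u) v = c * ip u v) \<and>
        (\<forall>u\<in>V. u \<noteq> 0 \<longrightarrow> ip u u > 0) \<and>
        (\<forall>u\<in>V. N u = sqrt (ip u u))) \<and>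
     (\<forall>X :: nat \<Rightarrow> 'v. range X \<subseteq> V \<and> (\<forall>\<epsilon>>0. \<exists>M. \<forall>m\<ge>M. \<forall>n\<ge>M. N (X m - X n) < \<epsilon>) \<longrightarrow>
        (\<exists>l\<in>V. (\<lambda>n. N (X n - l)) \<longlonglongrightarrow> 0))"

definition equivalent_norms_on :: "'v set \<Rightarrow> ('v \<Rightarrow> real) \<Rightarrow> ('v \<Rightarrow> real) \<Rightarrow> bool" where
  "equivalent_norms_on V N N' \<longleftrightarrow> (\<exists>C>0. \<forall>u\<in>V. N u \<le> C * N' u \<and> N' u \<le> C * N u)"

definition Hilbert_norm_for :: "real \<Rightarrow> 'a::euclidean_space set \<Rightarrow> ('a L2 \<Rightarrow> real) \<Rightarrow> bool" where
  "Hilbert_norm_for s \<Omega> N \<longleftrightarrow>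
     Hilbert_norm_on (H_space s \<Omega>) N \<and> equivalent_norms_on (H_space s \<Omega>) N (H_norm s \<Omega>)"


section \<open>Sampling numbers\<close>

text \<open>The value at \<open>x \<in> \<Omega>\<close> of the continuous representative of \<open>f\<close> on the open set \<open>\<Omega>\<close>.\<close>

definition point_eval :: "'a::euclidean_space set \<Rightarrow> 'a L2 \<Rightarrow> 'a \<Rightarrow> real" where
  "point_eval \<Omega> f x =
     (THE y. \<exists>g. continuous_on \<Omega> g \<and> (AE z in lebesgue. z \<in> \<Omega> \<longrightarrow> g z = rep_L2 f z) \<and> y = g x)"

definition worst_case_error ::
    "('w::real_vector \<Rightarrow> 'v::real_vector) \<Rightarrow> ('w \<Rightarrow> 'v) \<Rightarrow> 'w set \<Rightarrow> ('w \<Rightarrow> real)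
      \<Rightarrow> ('v \<Rightarrow> real) \<Rightarrow> ennreal" where
  "worst_case_error S A F NF NH = (SUP f\<in>{f \<in> F. NF f \<le> 1}. ennreal (NH (S f - A f)))"

definition sampling_methods ::
    "nat \<Rightarrow> 'a::euclidean_space set \<Rightarrow> 'v set \<Rightarrow> ('a L2 \<Rightarrow> 'v) set" where
  "sampling_methods n \<Omega> H =
     {(\<lambda>f. \<phi> (map (\<lambda>i. point_eval \<Omega> f (x i)) [0..<n])) | \<phi> x.
        (\<forall>i<n. x i \<in> \<Omega>) \<and> (\<forall>ys. length ys = n \<longrightarrow> \<phi> ys \<in> H)}"

definition linear_sampling_methods ::
    "nat \<Rightarrow> 'a::euclidean_space set \<Rightarrow> 'v::real_vector set \<Rightarrow> ('a L2 \<Rightarrow> 'v) set" where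
  "linear_sampling_methods n \<Omega> H =
     {(\<lambda>f. \<Sum>i<n. point_eval \<Omega> f (x i) *\<^sub>R h i) | h x.
        (\<forall>i<n. x i \<in> \<Omega>) \<and> (\<forall>i<n. h i \<in> H)}"

definition sampling_number ::
    "nat \<Rightarrow> 'a::euclidean_space set \<Rightarrow> ('a L2 \<Rightarrow> 'v::real_vector) \<Rightarrow> 'a L2 set \<Rightarrow> ('a L2 \<Rightarrow> real)
      \<Rightarrow> 'v set \<Rightarrow> ('v \<Rightarrow> real) \<Rightarrow> ennreal" where
  "sampling_number n \<Omega> S F NF H NH =
     (INF A\<in>sampling_methods n \<Omega> H. worst_case_error S A F NF NH)"

definition linear_sampling_number ::
    "nat \<Rightarrow> 'a::euclidean_space set \<Rightarrow> ('a L2 \<Rightarrow> 'v::real_vector) \<Rightarrow> 'a L2 set \<Rightarrow> ('a L2 \<Rightarrow> real)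
      \<Rightarrow> 'v set \<Rightarrow> ('v \<Rightarrow> real) \<Rightarrow> ennreal" where
  "linear_sampling_number n \<Omega> S F NF H NH =
     (INF A\<in>linear_sampling_methods n \<Omega> H. worst_case_error S A F NF NH)"

text \<open>The relation \<open>a\<^sub>n \<asymp> b\<^sub>n\<close>, for \<open>n \<ge> 1\<close>.\<close>

definition weakly_equivalent :: "(nat \<Rightarrow> ennreal) \<Rightarrow> (nat \<Rightarrow> real) \<Rightarrow> bool" where
  "weakly_equivalent a b \<longleftrightarrow>
     (\<exists>c>0. \<exists>C>0. \<forall>n\<ge>1. ennreal (c * b n) \<le> a n \<and> a n \<le> ennreal (C * b n))"

end

theory Submission
  imports Defs "HOL-Computational_Algebra.Polynomial"
begin

text \<open>Splines in the Hilbert space \<open>F\<close> and an antipodal argument show that both sampling numbers equal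
the smallest norm, over all choices of \<open>n\<close> points, of \<open>S\<close> on the functions in \<open>F\<close> vanishing at these
points. Since \<open>S\<close> is an isomorphism and \<open>L\<^sub>2(\<Omega>)\<close> embeds into \<open>H\<^sup>-\<^sup>s(\<Omega>)\<close>, the upper bound follows from an
estimate of the \<open>L\<^sub>2\<close> norm of such functions. They are compared with local polynomials built from
cell averages: a discrete Whitney estimate bounds the change of these polynomials from one dyadic
scale to the next by finite differences, all taken inside cones given by the Lipschitz charts, and
the finite differences of an \<open>H\<^sup>\<sigma>\<close> function, \<open>\<sigma> = t - s\<close>, are of order \<open>\<bar>h\<bar>\<^sup>\<sigma>\<close> in \<open>L\<^sub>2\<close>. For the
lower bound, a sum of bumps that avoid the sample points is paired with a fixed test function.\<close>

text \<open>The spaces on \<open>\<Omega>\<close> are defined intrinsically, through differences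
  whose segments stay inside \<open>\<Omega>\<close>, and no extension to the whole space is used.
  So the polynomials at a point \<open>y\<close> may use only cells in a cone at \<open>y\<close>;
  the point sits at or just behind the corner of these cells, and the polynomial is extrapolated to
  it by at most one cell. Passing from an \<open>L\<^sub>2\<close> bound for differences of step
  \<open>h / 2 ^ k\<close> to a single point costs a factor \<open>2 ^ (k d)\<close> in the square,
  against a gain of \<open>2 powr (- 2 \<sigma> k)\<close>. This produces the geometric ratio
  \<open>2 powr (d / 2 - \<sigma>)\<close>, and it is what \<open>t > s + d / 2\<close> is for.
  Estimating the norm of \<open>H\<^sup>-\<^sup>s\<close> by that of \<open>L\<^sub>2\<close> loses
  nothing in the rate: the fooling functions are nonnegative, hence do not oscillate, and their
  pairing with one fixed smooth function stays bounded below while their \<open>L\<^sub>2\<close>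
  norms stay bounded. A negative norm is therefore of no smaller order on them.\<close>

abbreviation borel_fun :: "('a::euclidean_space => 'b::topological_space) => bool" where
 "borel_fun f \<equiv> f \<in> borel_measurable borel"

abbreviation sq_int :: "('a::euclidean_space => real) => ennreal" where
 "sq_int f \<equiv> \<integral>\<^sup>+x. ennreal ((f x)^2) \<partial>lborel"

section \<open>Reconstruction of a polynomial in one variable from its cell integrals\<close>

definition lagrange_poly :: "nat => nat => real poly" where
 "lagrange_poly n i = (\<Prod>k\<in>{..n} - {i}. smult (1 / (real i - real k)) [:- real k, 1:])"

lemma poly_lagrange_poly:
 assumes "i <= n" "j <= n"
 shows "poly (lagrange_poly n i) (real j) = (if i = j then 1 else 0)"
proof (cases "i = j")
 case True
 thus ?thesis by (auto simp: lagrange_poly_def poly_prod diff_divide_distrib[symmetric] intro!: prod.neutral)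
next
 case False
 hence "j \<in> {..n} - {i}" using assms by auto
 moreover have "finite ({..n} - {i})" by simp
 ultimately show ?thesis using False unfolding lagrange_poly_def poly_prod by (intro trans[OF prod_zero]) (auto intro!: bexI[of _ j])
qed

lemma degree_lagrange_poly: "i <= n ==> degree (lagrange_poly n i) <= n"
proof -
 assume i: "i <= n"
 have "degree (lagrange_poly n i) <= (\<Sum>k\<in>{..n} - {i}. degree (smult (1 / (real i - real k)) [:- real k, 1:]))"
  unfolding lagrange_poly_def by (intro degree_prod_sum_le[unfolded comp_def]) simp
 also have "\<dots> <= (\<Sum>k\<in>{..n} - {i}. 1)" by (intro sum_mono order_trans[OF degree_smult_le]) simp
 also have "\<dots> = n" using i by simp
 finally show ?thesis .
qed

lemma lagrange_interpolation:
 assumes "degree Q <= n"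
 shows "Q = (\<Sum>i\<le>n. smult (poly Q (real i)) (lagrange_poly n i))"
proof (rule poly_eqI_degree[where A = "real ` {..n}"])
 show "poly Q x = poly (\<Sum>i\<le>n. smult (poly Q (real i)) (lagrange_poly n i)) x"
  if x: "x \<in> real ` {..n}" for x
 proof -
  from x obtain j where j: "j <= n" "x = real j" by auto
  have "(\<Sum>i\<le>n. poly Q (real i) * poly (lagrange_poly n i) (real j)) =
   (\<Sum>i\<le>n. if i = j then poly Q (real j) else 0)" by (intro sum.cong) (auto simp: poly_lagrange_poly j)
  thus ?thesis by (simp add: j poly_sum)
 qed
 have "card (real ` {..n}) = Suc n" by (simp add: card_image inj_on_def)
 thus "degree Q < card (real ` {..n})"
  "degree (\<Sum>i\<le>n. smult (poly Q (real i)) (lagrange_poly n i)) < card (real ` {..n})" using assms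
  by (auto simp: less_Suc_eq_le intro!: degree_sum_le order_trans[OF degree_smult_le] degree_lagrange_poly)
qed

text \<open>The weights recover \<open>q\<close>, a polynomial of degree less than \<open>r\<close>, from its integrals over the
 cells \<open>[m, m + 1]\<close>, \<open>m < r\<close>. To avoid integrals, \<open>q\<close> is given as the derivative of \<open>Q\<close>.\<close>

definition cell_weight :: "nat => nat => real poly" where
 "cell_weight r m = (\<Sum>i\<in>{m<..r}. pderiv (lagrange_poly r i))"

lemma pderiv_sum: "pderiv (\<Sum>i\<in>A. f i) = (\<Sum>i\<in>A. pderiv (f i))" by (induction A rule: infinite_finite_induct) (auto simp: pderiv_add)

lemma sum_pderiv_lagrange_poly: "(\<Sum>i\<le>r. pderiv (lagrange_poly r i)) = 0"
proof -
 have "(1 :: real poly) = (\<Sum>i\<le>r. lagrange_poly r i)" using lagrange_interpolation[of "1 :: real poly" r] by simp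
 from arg_cong[OF this, of pderiv] show ?thesis by (simp add: pderiv_sum)
qed

text \<open>Lagrange interpolation of \<open>Q\<close> at \<open>0, ..., r\<close>, differentiated.
  Abel summation turns the nodal values into the increments of \<open>Q\<close>, and this collects
  the derivatives of the basis polynomials into the tail sums that define
  \<open>cell_weight\<close>.\<close>

lemma cell_weight_reproduces:
 assumes "degree Q <= r"
 shows "(\<Sum>m<r. poly (cell_weight r m) x * (poly Q (real m + 1) - poly Q (real m))) = poly (pderiv Q) x"
proof -
 let ?l = "\<lambda>i. poly (pderiv (lagrange_poly r i)) x"
 have "poly (pderiv Q) x = (\<Sum>i\<le>r. poly Q (real i) * ?l i)"
  by (subst lagrange_interpolation[OF assms]) (simp add: pderiv_sum pderiv_smult poly_sum)
 \<comment> \<open>The derivatives of the basis polynomials sum to 0, so the constant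
   \<open>poly Q 0\<close> can be subtracted, and the coefficients become telescoping sums starting
   at 0.\<close>
 also have "\<dots> = (\<Sum>i\<le>r. (poly Q (real i) - poly Q 0) * ?l i)"
  using arg_cong[OF sum_pderiv_lagrange_poly[of r], of "\<lambda>p. poly p x"]
  by (simp add: left_diff_distrib sum_subtractf poly_sum flip: sum_distrib_left)
 also have "\<dots> = (\<Sum>i\<le>r. (\<Sum>m<i. poly Q (real m + 1) - poly Q (real m)) * ?l i)"
 proof -
  have "(\<Sum>m<i. poly Q (real m + 1) - poly Q (real m)) = poly Q (real i) - poly Q 0" for i
   using sum_lessThan_telescope[of "\<lambda>m. poly Q (real m)" i] by (simp add: add.commute)
  thus ?thesis by simp
 qed
 also have "\<dots> = (\<Sum>i\<le>r. \<Sum>m<r. if m < i then (poly Q (real m + 1) - poly Q (real m)) * ?l i else 0)"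
  by (intro sum.cong refl, subst sum_distrib_right, rule sum.mono_neutral_cong_left) auto
 also have "\<dots> = (\<Sum>m<r. \<Sum>i\<le>r. if m < i then (poly Q (real m + 1) - poly Q (real m)) * ?l i else 0)" by (rule sum.swap)
 also have "\<dots> = (\<Sum>m<r. (\<Sum>i\<in>{m<..r}. ?l i) * (poly Q (real m + 1) - poly Q (real m)))"
  by (intro sum.cong refl, subst sum_distrib_right, rule sum.mono_neutral_cong_right)
   (auto simp: mult.commute split: if_splits)
 finally show ?thesis by (simp add: cell_weight_def poly_sum)
qed

section \<open>Finite differences of sequences and a discrete Whitney estimate\<close>

definition seq_diff :: "nat => (nat => real) => nat => real" where
 "seq_diff r u i = (\<Sum>j\<le>r. (- 1) ^ (r - j) * real (r choose j) * u (i + j))"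

text \<open>Pascal's rule with signs. Putting the first difference inside, onto the sequence, lets
  the inductions on the order proceed with a new sequence.\<close>

lemma seq_diff_Suc: "seq_diff (Suc r) u i = seq_diff r (\<lambda>n. u (Suc n) - u n) i"
proof -
 define c where "c r j = (- 1 :: real) ^ (r - j) * real (r choose j)" for r j
 have 1: "c (Suc r) (Suc j) = c r j - c r (Suc j)" if "j <= r" for j
 proof (cases "j = r")
  case False
  hence "(-1 :: real) ^ (r - j) = - ((-1) ^ (r - Suc j))" using that by (metis Suc_diff_Suc le_neq_implies_less mult_minus1 power_Suc)
  thus ?thesis by (simp add: c_def algebra_simps)
 qed (simp add: c_def)
 have "seq_diff (Suc r) u i = c (Suc r) 0 * u i + (\<Sum>j\<le>r. c (Suc r) (Suc j) * u (i + Suc j))"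
  unfolding seq_diff_def c_def[symmetric] by (subst sum.atMost_Suc_shift) simp
 also have "(\<Sum>j\<le>r. c (Suc r) (Suc j) * u (i + Suc j)) =
   (\<Sum>j\<le>r. c r j * u (i + Suc j)) - (\<Sum>j\<le>r. c r (Suc j) * u (i + Suc j))"
  unfolding sum_subtractf[symmetric] by (intro sum.cong) (use 1 in \<open>auto simp only: left_diff_distrib atMost_iff\<close>)
 also have "(\<Sum>j\<le>r. c r (Suc j) * u (i + Suc j)) = (\<Sum>j\<le>Suc r. c r j * u (i + j)) - c r 0 * u i" by (subst sum.atMost_Suc_shift) simp
 \<comment> \<open>The additional term carries the binomial coefficient
   \<open>r choose Suc r\<close>, which is 0.\<close>
 also have "(\<Sum>j\<le>Suc r. c r j * u (i + j)) = (\<Sum>j\<le>r. c r j * u (i + j))" by (simp add: c_def)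
 finally have "seq_diff (Suc r) u i = (\<Sum>j\<le>r. c r j * u (i + Suc j)) - (\<Sum>j\<le>r. c r j * u (i + j))" by (simp add: c_def)
 thus ?thesis by (simp add: seq_diff_def c_def right_diff_distrib sum_subtractf)
qed

text \<open>A first difference lowers the degree, because \<open>Q (x + 1)\<close> and
  \<open>Q x\<close> have the same leading coefficient.\<close>

lemma seq_diff_poly_eq_0: "degree Q < r ==> seq_diff r (\<lambda>n. poly Q (real n)) i = 0"
proof (induction r arbitrary: Q)
 case 0
 thus ?case by simp
next
 case (Suc r)
 define R where "R = pcompose Q [:1, 1:] - Q"
 have R: "poly R (real n) = poly Q (real (Suc n)) - poly Q (real n)" for n by (simp add: R_def poly_pcompose add.commute)
 show ?case
 proof (cases "degree Q = 0")
  case True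
  then obtain c where "Q = [:c:]" by (metis degree_0_id degree_eq_zeroE)
  thus ?thesis by (simp add: seq_diff_Suc) (simp add: seq_diff_def)
 next
  case False
  have "degree R < degree Q"
  proof (rule ccontr)
   assume "\<not> degree R < degree Q"
   moreover have "degree R <= degree Q" unfolding R_def by (rule degree_diff_le) (auto intro: order_trans[OF degree_pcompose_le])
   ultimately have eq: "degree R = degree Q" by simp
   have "coeff R (degree Q) = 0" unfolding R_def using lead_coeff_comp[of "[:1, 1 :: real:]" Q] by (simp add: degree_pcompose)
   with eq False show False by (metis degree_0 leading_coeff_0_iff)
  qed
  with Suc.prems have "seq_diff r (\<lambda>n. poly R (real n)) i = 0" by (intro Suc.IH) simp
  thus ?thesis unfolding R seq_diff_Suc .
 qed
qed

lemma seq_diff_diff: "seq_diff r (\<lambda>n. u n - v n) i = seq_diff r u i - seq_diff r v i"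
 by (simp add: seq_diff_def right_diff_distrib sum_subtractf)

text \<open>The highest coefficient of the difference is 1, so each new value is that difference
  minus a combination of the \<open>r + 1\<close> values before it, and the bound is carried forward
  by induction; \<open>K\<close> depends on \<open>r\<close> and \<open>n\<close> alone. The order
  is \<open>Suc r\<close> because the sequences in question are cumulative sums, which raise the
  order by one.\<close>

lemma seq_bound_from_diff:
 "\<exists>K\<ge>0. \<forall>e \<delta>. 0 <= \<delta> --> (\<forall>i\<le>r. e i = 0) -->
   (\<forall>i. i + Suc r <= n --> \<bar>seq_diff (Suc r) e i\<bar> <= \<delta>) --> (\<forall>i\<le>n. \<bar>e i\<bar> <= K * \<delta>)"
proof (induction n)
 case 0
 show ?case by (rule exI[of _ 0]) auto
next
 case (Suc n)
 then obtain K where K: "K \<ge> 0" and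
  IH: "\<And>e \<delta> i. 0 <= \<delta> ==> (\<forall>i\<le>r. e i = 0) ==>
   (\<forall>i. i + Suc r <= n --> \<bar>seq_diff (Suc r) e i\<bar> <= \<delta>) ==> i <= n ==> \<bar>e i\<bar> <= K * \<delta>" by metis
 define L where "L = 1 + (\<Sum>j\<le>r. real (Suc r choose j) * K) + K"
 have Lp: "0 <= (\<Sum>j\<le>r. real (Suc r choose j) * K)" using K by (intro sum_nonneg) auto
 have "\<bar>e i\<bar> <= L * \<delta>" if \<delta>: "0 <= \<delta>" and z: "\<forall>i\<le>r. e i = 0"
  and d: "\<forall>i. i + Suc r <= Suc n --> \<bar>seq_diff (Suc r) e i\<bar> <= \<delta>" and i: "i <= Suc n"
 for e :: "nat => real" and \<delta> i
 proof -
  have le: "\<bar>e i\<bar> <= K * \<delta>" if "i <= n" for i using IH[OF \<delta> z, of i] d that by auto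
  have KL: "K * \<delta> <= L * \<delta>" using \<delta> Lp by (intro mult_right_mono) (auto simp: L_def)
  consider "i <= n" | "i = Suc n" "Suc n <= r" | "i = Suc n" "r <= n" using i by linarith
  thus ?thesis
  proof cases
   case 1 thus ?thesis using le[of i] KL by linarith
  next
   case 2 thus ?thesis using z \<delta> Lp K by (simp add: L_def)
  next
   case 3
   define k where "k = n - r"
   have k: "k + Suc r = Suc n" using 3 by (simp add: k_def)
   have "seq_diff (Suc r) e k = e (Suc n) + (\<Sum>j\<le>r. (- 1) ^ (Suc r - j) * real (Suc r choose j) * e (k + j))"
    unfolding seq_diff_def using k by simp
   moreover have "\<bar>\<Sum>j\<le>r. (- 1) ^ (Suc r - j) * real (Suc r choose j) * e (k + j)\<bar> <=
     (\<Sum>j\<le>r. real (Suc r choose j) * (K * \<delta>))" by (rule order_trans[OF sum_abs], intro sum_mono)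
     (use k in \<open>auto simp: abs_mult power_abs intro!: mult_left_mono le\<close>)
   moreover have "\<bar>seq_diff (Suc r) e k\<bar> <= \<delta>" using d k by auto
   ultimately have "\<bar>e (Suc n)\<bar> <= \<delta> + (\<Sum>j\<le>r. real (Suc r choose j) * (K * \<delta>))" by linarith
   also have "\<dots> <= L * \<delta>" using K \<delta> by (simp add: L_def distrib_right sum_distrib_right mult.assoc)
   finally show ?thesis using 3 by simp
  qed
 qed
 moreover have "L \<ge> 0" using K Lp by (simp add: L_def)
 ultimately show ?case by blast
qed

text \<open>Discrete Whitney estimate. \<open>Q\<close> interpolates the cumulative sums of
  \<open>u\<close> at \<open>0, ..., r\<close>. The error starts with \<open>r + 1\<close> zeros,
  and its differences of order \<open>Suc r\<close> are the differences of order \<open>r\<close> of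
  \<open>u\<close>, since \<open>Q\<close> is annihilated. Working with cumulative sums makes the
  approximants increments of \<open>Q\<close>, that is, cell integrals of
  \<open>pderiv Q\<close>.\<close>

lemma approx_by_poly_increments:
 "\<exists>C\<ge>0. \<forall>u z. 0 <= z --> (\<forall>i. i + r <= N --> \<bar>seq_diff r u i\<bar> <= z) -->
   (\<exists>Q. degree Q <= r \<and> (\<forall>m\<le>N. \<bar>u m - (poly Q (real m + 1) - poly Q (real m))\<bar> <= C * z))"
proof -
 obtain K where K: "K \<ge> 0" and
  bound: "\<And>e z i. 0 <= z ==> (\<forall>i\<le>r. e i = 0) ==>
   (\<forall>i. i + Suc r <= Suc N --> \<bar>seq_diff (Suc r) e i\<bar> <= z) ==> i <= Suc N ==> \<bar>e i\<bar> <= K * z"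
  using seq_bound_from_diff[of r "Suc N"] by metis
 \<comment> \<open>The factor 2 arises because an increment of the error involves two of its
   values.\<close>
 have "\<exists>Q. degree Q <= r \<and> (\<forall>m\<le>N. \<bar>u m - (poly Q (real m + 1) - poly Q (real m))\<bar> <= (2 * K) * z)"
  if z: "0 <= z" and d: "\<forall>i. i + r <= N --> \<bar>seq_diff r u i\<bar> <= z" for u :: "nat => real" and z
 proof -
  define U where "U i = (\<Sum>m<i. u m)" for i
  define Q where "Q = (\<Sum>i\<le>r. smult (U i) (lagrange_poly r i))"
  have deg: "degree Q <= r" by (auto simp: Q_def intro!: degree_sum_le order_trans[OF degree_smult_le] degree_lagrange_poly)
  have QU: "poly Q (real j) = U j" if "j <= r" for j
  proof -
   have "poly Q (real j) = (\<Sum>i\<le>r. if i = j then U j else 0)"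
    unfolding Q_def poly_sum by (intro sum.cong) (auto simp: poly_lagrange_poly that)
   thus ?thesis using that by simp
  qed
  define e where "e i = U i - poly Q (real i)" for i
  have "seq_diff (Suc r) e i = seq_diff r u i" for i
  proof -
   have "seq_diff (Suc r) (\<lambda>n. poly Q (real n)) i = 0" using deg by (intro seq_diff_poly_eq_0) simp
   hence "seq_diff (Suc r) e i = seq_diff (Suc r) U i" unfolding e_def seq_diff_diff by simp
   thus ?thesis by (simp add: seq_diff_Suc U_def)
  qed
  moreover have "e i = 0" if "i <= r" for i using that by (simp add: e_def QU)
  ultimately have e: "\<bar>e i\<bar> <= K * z" if "i <= Suc N" for i using d that by (intro bound[OF z]) auto
  have "\<bar>u m - (poly Q (real m + 1) - poly Q (real m))\<bar> <= 2 * K * z" if "m <= N" for m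
  proof -
   have "u m - (poly Q (real m + 1) - poly Q (real m)) = e (Suc m) - e m" by (simp add: e_def U_def add.commute)
   thus ?thesis using e[of m] e[of "Suc m"] that by linarith
  qed
  with deg show ?thesis by blast
 qed
 with K show ?thesis by (intro exI[of _ "2 * K"]) auto
qed

section \<open>Tensor products of one-dimensional rules\<close>

lemma sum_PiE_insert:
 assumes "b \<notin> B"
 shows "(\<Sum>i\<in>PiE (insert b B) I. g i) = (\<Sum>n\<in>I b. \<Sum>i\<in>PiE B I. g (i(b := n)))"
proof -
 have inj: "inj_on (\<lambda>(y, h). h(b := y)) (I b \<times> PiE B I)" using assms by (rule inj_combinator)
 show ?thesis unfolding PiE_insert_eq sum.reindex[OF inj] by (simp add: sum.cartesian_product split_def comp_def)
qed

lemma sum_PiE_Times: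
 fixes g :: "('a => 'i \<times> 'j) => real"
 assumes "finite B"
 shows "(\<Sum>k\<in>PiE B (\<lambda>_. I \<times> J). g k) =
  (\<Sum>i\<in>PiE B (\<lambda>_. I). \<Sum>j\<in>PiE B (\<lambda>_. J). g (\<lambda>b\<in>B. (i b, j b)))"
proof -
 have "(\<Sum>k\<in>PiE B (\<lambda>_. I \<times> J). g k) =
   (\<Sum>(i, j)\<in>PiE B (\<lambda>_. I) \<times> PiE B (\<lambda>_. J). g (\<lambda>b\<in>B. (i b, j b)))"
  by (rule sum.reindex_bij_witness[of _ "\<lambda>(i, j). \<lambda>b\<in>B. (i b, j b)" "\<lambda>k. (\<lambda>b\<in>B. fst (k b), \<lambda>b\<in>B. snd (k b))"])
   (auto simp: fun_eq_iff PiE_iff extensional_def restrict_def mem_Times_iff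
    intro!: arg_cong[of _ _ g])
 thus ?thesis by (simp add: sum.cartesian_product)
qed

text \<open>A tensor product of functionals \<open>u \<mapsto> \<Sum>i\<in>I. w b i * u (p b i)\<close> on sequences, one for every
 direction \<open>b \<in> B\<close>, applied to the values of \<open>U\<close> on the lattice through \<open>w0\<close>.\<close>

definition tensor_sum ::
 "'a::euclidean_space set => 'i set => ('a => 'i => real) => ('a => 'i => nat) => ('a => real) => 'a => real" where
 "tensor_sum B I w p U w0 =
   (\<Sum>i\<in>PiE B (\<lambda>_. I). (\<Prod>b\<in>B. w b (i b)) * U (w0 + (\<Sum>b\<in>B. real (p b (i b)) *\<^sub>R b)))"

lemma tensor_sum_empty [simp]: "tensor_sum {} I w p U w0 = U w0" by (simp add: tensor_sum_def)

lemma tensor_sum_insert: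
 assumes "finite B" "b \<notin> B"
 shows "tensor_sum (insert b B) I w p U w0 =
  (\<Sum>n\<in>I. w b n * tensor_sum B I w p U (w0 + real (p b n) *\<^sub>R b))"
proof -
 have "(\<Prod>c\<in>B. w c ((i(b := n)) c)) = (\<Prod>c\<in>B. w c (i c))" for i n using assms by (intro prod.cong) auto
 moreover have "(\<Sum>c\<in>B. real (p c ((i(b := n)) c)) *\<^sub>R c) = (\<Sum>c\<in>B. real (p c (i c)) *\<^sub>R c)" for i n
  using assms by (intro sum.cong) auto
 ultimately show ?thesis using assms unfolding tensor_sum_def sum_PiE_insert[OF assms(2)] by (simp add: sum_distrib_left mult.assoc add.assoc)
qed

lemma abs_tensor_sum_le:
 assumes "finite B" and "\<And>i. i \<in> PiE B (\<lambda>_. I) ==> \<bar>U (w0 + (\<Sum>b\<in>B. real (p b (i b)) *\<^sub>R b))\<bar> <= M"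
  and "finite I" and "\<And>b. b \<in> B ==> (\<Sum>i\<in>I. \<bar>w b i\<bar>) <= K" and "0 <= M"
 shows "\<bar>tensor_sum B I w p U w0\<bar> <= K ^ card B * M"
proof -
 have "\<bar>tensor_sum B I w p U w0\<bar> <= (\<Sum>i\<in>PiE B (\<lambda>_. I). (\<Prod>b\<in>B. \<bar>w b (i b)\<bar>) * M)"
  unfolding tensor_sum_def by (rule order_trans[OF sum_abs], intro sum_mono)
   (auto simp: abs_mult abs_prod intro!: mult_left_mono assms prod_nonneg)
 also have "\<dots> = (\<Prod>b\<in>B. \<Sum>i\<in>I. \<bar>w b i\<bar>) * M" using assms by (simp add: prod_sum_PiE sum_distrib_right)
 also have "\<dots> <= (\<Prod>b\<in>B. K) * M" by (intro mult_right_mono prod_mono conjI sum_nonneg assms) auto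
 finally show ?thesis by simp
qed

text \<open>Exactness of a reconstruction rule: \<open>pderiv Q\<close> runs through the polynomials
  of degree less than \<open>r\<close>, the increments of \<open>Q\<close> are their integrals over
  the cells \<open>[p i, p i + 1]\<close>, and the rule has to return the value at
  \<open>x\<close>.\<close>

definition reproduces :: "nat => 'i set => ('i => real) => ('i => nat) => real => bool" where
 "reproduces r I w p x \<longleftrightarrow> (\<forall>Q. degree Q <= r -->
   (\<Sum>i\<in>I. w i * (poly Q (real (p i) + 1) - poly Q (real (p i)))) = poly (pderiv Q) x)"

text \<open>Both rules give the same value on the polynomial part, so their difference sees only the
  deviation of \<open>u\<close> from it.\<close>

lemma reproduces_diff:
 assumes "finite I" "finite J"
  and "reproduces r I w p x" "reproduces r J v q x"
  and "\<And>i. i \<in> I ==> p i <= N" "\<And>j. j \<in> J ==> q j <= N"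
  and "(\<Sum>i\<in>I. \<bar>w i\<bar>) <= K" "(\<Sum>j\<in>J. \<bar>v j\<bar>) <= K"
  and "degree Q <= r" and u: "\<And>m. m <= N ==> \<bar>u m - (poly Q (real m + 1) - poly Q (real m))\<bar> <= d"
  and "0 <= d"
 shows "\<bar>(\<Sum>i\<in>I. w i * u (p i)) - (\<Sum>j\<in>J. v j * u (q j))\<bar> <= 2 * K * d"
proof -
 define e where "e m = u m - (poly Q (real m + 1) - poly Q (real m))" for m
 have 1: "(\<Sum>i\<in>I. w i * u (p i)) = (\<Sum>i\<in>I. w i * e (p i)) + poly (pderiv Q) x"
  if "reproduces r I w p x" for I :: "'k set" and w p
 proof -
  have "poly (pderiv Q) x = (\<Sum>i\<in>I. w i * (poly Q (real (p i) + 1) - poly Q (real (p i))))"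
   using that assms(9) by (simp add: reproduces_def)
  thus ?thesis by (simp add: e_def flip: sum.distrib distrib_left)
 qed
 have 2: "\<bar>\<Sum>i\<in>I. w i * e (p i)\<bar> <= K * d" if "\<And>i. i \<in> I ==> p i <= N" "(\<Sum>i\<in>I. \<bar>w i\<bar>) <= K"
  for I :: "'k set" and w p
 proof -
  have "\<bar>\<Sum>i\<in>I. w i * e (p i)\<bar> <= (\<Sum>i\<in>I. \<bar>w i\<bar> * d)" by (rule order_trans[OF sum_abs], intro sum_mono)
    (auto simp: abs_mult e_def intro!: mult_left_mono u that)
  also have "\<dots> <= K * d" using that assms by (auto simp flip: sum_distrib_right intro!: mult_right_mono)
  finally show ?thesis .
 qed
 have "\<bar>\<Sum>i\<in>I. w i * e (p i)\<bar> <= K * d" "\<bar>\<Sum>j\<in>J. v j * e (q j)\<bar> <= K * d" by (intro 2 assms; assumption)+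
 with 1[OF assms(3)] 1[OF assms(4)] show ?thesis by linarith
qed

lemma seq_diff_eq_fwd_diff:
 "seq_diff r (\<lambda>n. U (w + real n *\<^sub>R b)) i = fwd_diff r b U (w + real i *\<^sub>R b)"
 by (simp add: seq_diff_def fwd_diff_def scaleR_left_distrib add.assoc)

text \<open>Whitney estimate in several variables, by exchanging the rules one direction at a time.
  Each exchange uses the one-dimensional estimate along lines, with the other directions fixed. The
  number of exchanges gives \<open>card B\<close>, the sums of absolute weights give
  \<open>K ^ card B\<close>. As \<open>C\<close> is obtained before all other data, it depends on
  \<open>r\<close> and \<open>N\<close> only.\<close>

lemma tensor_sum_diff:
 fixes r N :: nat
 obtains C where "C \<ge> 0"
  and "\<And>B I J w v p q (x :: 'a::euclidean_space => real) (K :: real) U w0 d.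
   B \<subseteq> Basis ==> finite I ==> finite J ==>
   (\<And>b. b \<in> B ==> reproduces r I (w b) (p b) (x b)) ==>
   (\<And>b. b \<in> B ==> reproduces r J (v b) (q b) (x b)) ==>
   (\<And>b i. b \<in> B ==> i \<in> I ==> p b i <= N) ==> (\<And>b j. b \<in> B ==> j \<in> J ==> q b j <= N) ==>
   (\<And>b. b \<in> B ==> (\<Sum>i\<in>I. \<bar>w b i\<bar>) <= K) ==> (\<And>b. b \<in> B ==> (\<Sum>j\<in>J. \<bar>v b j\<bar>) <= K) ==>
   0 <= d ==>
   (\<And>b z. b \<in> Basis ==> (\<And>c. c \<in> Basis ==> 0 <= z \<bullet> c \<and> z \<bullet> c <= N) ==> z \<bullet> b + r <= N ==>
    \<bar>fwd_diff r b U z\<bar> <= d) ==>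
   (\<And>c. c \<in> Basis ==> 0 <= w0 \<bullet> c \<and> w0 \<bullet> c <= N) ==> (\<And>b. b \<in> B ==> w0 \<bullet> b = 0) ==>
   \<bar>tensor_sum B I w p U w0 - tensor_sum B J v q U w0\<bar> <= card B * K ^ card B * C * d"
proof -
 obtain C where C: "C \<ge> 0" and
  appr: "\<And>u d. 0 <= d ==> (\<forall>i. i + r <= N --> \<bar>seq_diff r u i\<bar> <= d) ==>
   (\<exists>Q. degree Q <= r \<and> (\<forall>m\<le>N. \<bar>u m - (poly Q (real m + 1) - poly Q (real m))\<bar> <= C * d))"
  using approx_by_poly_increments[of r N] by metis
 have main: "\<bar>tensor_sum B I w p U w0 - tensor_sum B J v q U w0\<bar> <= card B * K ^ card B * (2 * C) * d"
  if B: "B \<subseteq> Basis" and fin: "finite I" "finite J"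
   and rI: "\<And>b. b \<in> B ==> reproduces r I (w b) (p b) (x b)"
   and rJ: "\<And>b. b \<in> B ==> reproduces r J (v b) (q b) (x b)"
   and pN: "\<And>b i. b \<in> B ==> i \<in> I ==> p b i <= N" and qN: "\<And>b j. b \<in> B ==> j \<in> J ==> q b j <= N"
   and wK: "\<And>b. b \<in> B ==> (\<Sum>i\<in>I. \<bar>w b i\<bar>) <= K" and vK: "\<And>b. b \<in> B ==> (\<Sum>j\<in>J. \<bar>v b j\<bar>) <= K"
   and d: "0 <= d"
   and U: "\<And>b z. b \<in> Basis ==> (\<And>c. c \<in> Basis ==> 0 <= z \<bullet> c \<and> z \<bullet> c <= N) ==> z \<bullet> b + r <= N ==>
    \<bar>fwd_diff r b U z\<bar> <= d"
   and w0: "\<And>c. c \<in> Basis ==> 0 <= w0 \<bullet> c \<and> w0 \<bullet> c <= N" "\<And>b. b \<in> B ==> w0 \<bullet> b = 0"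
  for B I J w v p q x U d and K :: real and w0 :: 'a
 proof -
  have "finite B" using B finite_Basis by (rule finite_subset)
  thus ?thesis using B rI rJ pN qN wK vK w0
  proof (induction B arbitrary: w0 rule: finite_induct)
   case empty
   show ?case by simp
  next
   case (insert b B)
   have b: "b \<in> Basis" and BB: "B \<subseteq> Basis" using insert.prems(1) by auto
   have "0 <= (\<Sum>i\<in>I. \<bar>w b i\<bar>)" by (intro sum_nonneg) auto
   hence K0: "0 <= K" using insert.prems(6)[of b, OF insertI1] by linarith
   have inner: "(w0 + real n *\<^sub>R b) \<bullet> c = (if c = b then real n else w0 \<bullet> c)" if "c \<in> Basis" for n c
    using b that insert.prems(9)[of b] by (auto simp: inner_simps inner_Basis)
   have dom: "0 <= (w0 + real n *\<^sub>R b) \<bullet> c \<and> (w0 + real n *\<^sub>R b) \<bullet> c <= N" if "c \<in> Basis" "n <= N" for n c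
    using that insert.prems(8)[of c] by (simp add: inner)
   \<comment> \<open>The rules in the directions of \<open>B\<close> are exchanged at base points
     moved along \<open>b\<close>; these still have coordinate 0 in the directions of
     \<open>B\<close>, as the induction hypothesis demands.\<close>
   have IH: "\<bar>tensor_sum B I w p U (w0 + real (p b n) *\<^sub>R b) - tensor_sum B J v q U (w0 + real (p b n) *\<^sub>R b)\<bar>
     <= card B * K ^ card B * (2 * C) * d" if "n \<in> I" for n
   proof (rule insert.IH[OF BB])
    show "(w0 + real (p b n) *\<^sub>R b) \<bullet> c = 0" if "c \<in> B" for c
     using that BB insert.hyps insert.prems(9)[of c] inner[of c "p b n"] by (auto simp: subset_iff)
   qed (use insert.prems dom \<open>n \<in> I\<close> in auto)
   define V where "V n = tensor_sum B J v q U (w0 + real n *\<^sub>R b)" for n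
   \<comment> \<open>The exchange in direction \<open>b\<close>, with the rules \<open>v\<close>
     already in place in the directions of \<open>B\<close>.\<close>
   have 1: "\<bar>(\<Sum>n\<in>I. w b n * V (p b n)) - (\<Sum>n\<in>J. v b n * V (q b n))\<bar> <= K ^ card B * (2 * K * (C * d))"
   proof -
    let ?P = "\<lambda>i. \<Sum>c\<in>B. real (q c (i c)) *\<^sub>R c"
    define D where "D i = (\<Sum>n\<in>I. w b n * U (w0 + real (p b n) *\<^sub>R b + ?P i)) -
      (\<Sum>n\<in>J. v b n * U (w0 + real (q b n) *\<^sub>R b + ?P i))" for i
    \<comment> \<open>The sum over the directions of \<open>B\<close> is pulled out, so that a
      one-dimensional comparison \<open>D i\<close> remains on every line parallel to
      \<open>b\<close>.\<close>
    have eq: "(\<Sum>n\<in>I. w b n * V (p b n)) - (\<Sum>n\<in>J. v b n * V (q b n)) =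
      (\<Sum>i\<in>PiE B (\<lambda>_. J). (\<Prod>c\<in>B. v c (i c)) * D i)"
    proof -
     have sub: "(\<Sum>n\<in>I'. w' n * V (p' n)) =
       (\<Sum>i\<in>PiE B (\<lambda>_. J). (\<Prod>c\<in>B. v c (i c)) * (\<Sum>n\<in>I'. w' n * U (w0 + real (p' n) *\<^sub>R b + ?P i)))"
      for I' :: "'k set" and w' p' unfolding V_def tensor_sum_def sum_distrib_left by (subst sum.swap) (intro sum.cong refl, simp add: mult_ac)
     show ?thesis unfolding sub by (simp add: D_def right_diff_distrib sum_subtractf)
    qed
    have Dle: "\<bar>D i\<bar> <= 2 * K * (C * d)" if i: "i \<in> PiE B (\<lambda>_. J)" for i
    proof -
     define u where "u n = U (w0 + ?P i + real n *\<^sub>R b)" for n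
     have Pi: "?P i \<bullet> c = (if c \<in> B then real (q c (i c)) else 0)" if "c \<in> Basis" for c
     proof -
      have "?P i \<bullet> c = (\<Sum>a\<in>B. real (q a (i a)) * (if a = c then 1 else 0))" unfolding inner_sum_left using BB that
       by (intro sum.cong) (auto simp: inner_Basis)
      thus ?thesis using insert.hyps by (simp add: if_distrib cong: if_cong)
     qed
     have wP: "(w0 + ?P i) \<bullet> c = (if c \<in> B then real (q c (i c)) else w0 \<bullet> c)" if "c \<in> Basis" for c
      using that insert.prems(9)[of c] by (simp add: inner_add_left Pi)
     have "\<bar>seq_diff r u m\<bar> <= d" if "m + r <= N" for m
     proof -
      have "0 <= (w0 + ?P i + real m *\<^sub>R b) \<bullet> c \<and> (w0 + ?P i + real m *\<^sub>R b) \<bullet> c <= N"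
       if c: "c \<in> Basis" for c using c b wP[OF c] insert.hyps i insert.prems(8)[OF c] insert.prems(9)[of b]
        insert.prems(5)[of c "i c"] \<open>m + r <= N\<close> unfolding inner_add_left[of "w0 + ?P i"]
       by (cases "c = b") (auto simp: inner_Basis PiE_iff)
      moreover have "(w0 + ?P i + real m *\<^sub>R b) \<bullet> b = real m" using wP[OF b] b insert.hyps insert.prems(9)[of b]
       unfolding inner_add_left[of "w0 + ?P i"] by auto
      ultimately show ?thesis unfolding u_def seq_diff_eq_fwd_diff using \<open>m + r <= N\<close> by (intro U[OF b]) auto
     qed
     then obtain Q where "degree Q <= r"
      "\<forall>m\<le>N. \<bar>u m - (poly Q (real m + 1) - poly Q (real m))\<bar> <= C * d" using appr[OF d, of u] by auto
     hence "\<bar>(\<Sum>n\<in>I. w b n * u (p b n)) - (\<Sum>n\<in>J. v b n * u (q b n))\<bar> <= 2 * K * (C * d)"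
      using insert.prems C d fin by (intro reproduces_diff[where r = r and N = N and x = "x b" and Q = Q]) auto
     thus ?thesis by (simp add: D_def u_def add_ac)
    qed
    have "\<bar>\<Sum>i\<in>PiE B (\<lambda>_. J). (\<Prod>c\<in>B. v c (i c)) * D i\<bar>
      <= (\<Sum>i\<in>PiE B (\<lambda>_. J). (\<Prod>c\<in>B. \<bar>v c (i c)\<bar>) * (2 * K * (C * d)))"
     by (rule order_trans[OF sum_abs], intro sum_mono)
      (auto simp: abs_mult abs_prod intro!: mult_left_mono Dle prod_nonneg)
    also have "\<dots> = (\<Prod>c\<in>B. \<Sum>j\<in>J. \<bar>v c j\<bar>) * (2 * K * (C * d))"
     using insert.hyps fin by (simp add: prod_sum_PiE flip: sum_distrib_right)
    also have "\<dots> <= (\<Prod>c\<in>B. K) * (2 * K * (C * d))"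
     using insert.prems C d K0 by (intro mult_right_mono prod_mono conjI sum_nonneg) auto
    finally show ?thesis by (simp add: eq)
   qed
   have 2: "\<bar>(\<Sum>n\<in>I. w b n * tensor_sum B I w p U (w0 + real (p b n) *\<^sub>R b)) - (\<Sum>n\<in>I. w b n * V (p b n))\<bar>
     <= K * (card B * K ^ card B * (2 * C) * d)"
   proof -
    have "\<bar>(\<Sum>n\<in>I. w b n * tensor_sum B I w p U (w0 + real (p b n) *\<^sub>R b)) - (\<Sum>n\<in>I. w b n * V (p b n))\<bar>
     <= (\<Sum>n\<in>I. \<bar>w b n\<bar> * (card B * K ^ card B * (2 * C) * d))"
     unfolding sum_subtractf[symmetric] right_diff_distrib[symmetric] by (rule order_trans[OF sum_abs], intro sum_mono)
      (auto simp: abs_mult V_def intro!: mult_left_mono IH)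
    also have "\<dots> <= K * (card B * K ^ card B * (2 * C) * d)"
     unfolding sum_distrib_right[symmetric] using insert.prems C d K0 by (intro mult_right_mono) auto
    finally show ?thesis .
   qed
   have "tensor_sum (insert b B) I w p U w0 = (\<Sum>n\<in>I. w b n * tensor_sum B I w p U (w0 + real (p b n) *\<^sub>R b))"
    "tensor_sum (insert b B) J v q U w0 = (\<Sum>n\<in>J. v b n * V (q b n))" using insert.hyps by (simp_all add: tensor_sum_insert V_def)
   moreover have "K * (card B * K ^ card B * (2 * C) * d) + K ^ card B * (2 * K * (C * d)) =
     card (insert b B) * K ^ card (insert b B) * (2 * C) * d" using insert.hyps by (simp add: algebra_simps)
   ultimately show ?case using 1 2 by linarith
  qed
 qed
 show thesis
 proof (rule that[of "2 * C"])
  show "0 <= 2 * C" using C by simp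
 qed (fact main)
qed

section \<open>Affine changes of variables, cell averages and local polynomials\<close>

lemma nn_integral_lborel_affine:
 fixes f :: "'a::euclidean_space => ennreal"
 assumes [measurable]: "borel_fun f" and c: "c \<noteq> 0"
 shows "(\<integral>\<^sup>+x. f x \<partial>lborel) = ennreal (\<bar>c\<bar> ^ DIM('a)) * (\<integral>\<^sup>+x. f (t + c *\<^sub>R x) \<partial>lborel)"
proof -
 have "(\<integral>\<^sup>+x. f x \<partial>lborel) = (\<integral>\<^sup>+x. f x \<partial>(density (distr lborel borel (\<lambda>x. t + c *\<^sub>R x)) (\<lambda>_. \<bar>c\<bar> ^ DIM('a))))"
  using lborel_affine[OF c, of t] by simp
 also have "\<dots> = (\<integral>\<^sup>+x. ennreal (\<bar>c\<bar> ^ DIM('a)) * f (t + c *\<^sub>R x) \<partial>lborel)"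
  by (subst nn_integral_density) (auto simp: nn_integral_distr ennreal_power)
 finally show ?thesis by (simp add: nn_integral_cmult)
qed

lemma lborel_integral_affine:
 fixes f :: "'a::euclidean_space => real"
 assumes [measurable]: "borel_fun f" and c: "c \<noteq> 0"
 shows "(LINT x|lborel. f x) = \<bar>c\<bar> ^ DIM('a) * (LINT x|lborel. f (t + c *\<^sub>R x))"
proof -
 have "(LINT x|lborel. f x) = (LINT x|(density (distr lborel borel (\<lambda>x. t + c *\<^sub>R x)) (\<lambda>_. \<bar>c\<bar> ^ DIM('a))). f x)"
  using lborel_affine[OF c, of t] by simp
 also have "\<dots> = (LINT x|lborel. \<bar>c\<bar> ^ DIM('a) * f (t + c *\<^sub>R x))" by (subst integral_density) (auto simp: integral_distr)
 finally show ?thesis by simp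
qed

lemma lborel_integrable_affine:
 fixes f :: "'a::euclidean_space => real"
 assumes "integrable lborel f" and c: "c \<noteq> 0"
 shows "integrable lborel (\<lambda>x. f (t + c *\<^sub>R x))"
proof -
 have [measurable]: "borel_fun f" using assms by auto
 have "integrable (density (distr lborel borel (\<lambda>x. t + c *\<^sub>R x)) (\<lambda>_. ennreal (\<bar>c\<bar> ^ DIM('a)))) f"
  using lborel_affine[OF c, of t] assms by simp
 thus ?thesis using c by (subst (asm) integrable_density) (auto simp: integrable_distr_eq)
qed

lemma lborel_integral_translation:
 fixes f :: "'a::euclidean_space => real"
 assumes "borel_fun f"
 shows "(LINT x|lborel. f (x + t)) = (LINT x|lborel. f x)" using lborel_integral_affine[OF assms, of 1 t] by (simp add: add.commute)

lemma nn_integral_lborel_translation: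
 fixes f :: "'a::euclidean_space => ennreal"
 assumes "borel_fun f"
 shows "(\<integral>\<^sup>+x. f (x + t) \<partial>lborel) = (\<integral>\<^sup>+x. f x \<partial>lborel)"
 using nn_integral_lborel_affine[OF assms, of 1 t] by (simp add: add.commute)

text \<open>Half-open, so that smaller cells tile a larger one exactly and the refinement identity
  holds at every point. The side is always 1; other scales enter by rescaling the function.\<close>

definition cell :: "'a::euclidean_space => 'a set" where
 "cell w = {v. \<forall>b\<in>Basis. w \<bullet> b <= v \<bullet> b \<and> v \<bullet> b < w \<bullet> b + 1}"

definition block :: "real => 'a::euclidean_space set" where
 "block M = {v. \<forall>b\<in>Basis. 0 <= v \<bullet> b \<and> v \<bullet> b < M}"

lemma borel_cell [measurable]: "cell (w :: 'a::euclidean_space) \<in> sets borel"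
 and borel_block [measurable]: "block M \<in> sets (borel :: 'a measure)"
proof -
 have eq: "cell w = (\<Inter>b\<in>Basis. {v. w \<bullet> b <= v \<bullet> b \<and> v \<bullet> b < w \<bullet> b + 1})"
  "block M = (\<Inter>b\<in>Basis. {v :: 'a. 0 <= v \<bullet> b \<and> v \<bullet> b < M})" by (auto simp: cell_def block_def)
 show "cell w \<in> sets borel" "block M \<in> sets (borel :: 'a measure)" unfolding eq by (auto intro!: sets.finite_INT)
qed

lemma emeasure_cell [simp]: "emeasure lborel (cell (w :: 'a::euclidean_space)) = 1"
proof (rule antisym)
 have "cell w \<subseteq> cbox w (w + One)" by (fastforce simp: cell_def mem_box inner_simps)
 hence "emeasure lborel (cell w) <= emeasure lborel (cbox w (w + One))" by (intro emeasure_mono) auto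
 also have "\<dots> = 1" by (subst emeasure_lborel_cbox) (auto simp: inner_simps)
 finally show "emeasure lborel (cell w) <= 1" .
 have "1 = emeasure lborel (box w (w + One))" by (subst emeasure_lborel_box) (auto simp: inner_simps)
 also have "box w (w + One) \<subseteq> cell w" by (auto simp: cell_def mem_box inner_simps intro: less_imp_le)
 hence "emeasure lborel (box w (w + One)) <= emeasure lborel (cell w)" by (intro emeasure_mono) auto
 finally show "1 <= emeasure lborel (cell w)" .
qed

text \<open>The product form reduces the tiling of a cell by \<open>2 ^ d\<close> smaller ones to
  the splitting of \<open>[0, 1)\<close> into two halves, by the distributive law.\<close>

lemma indicator_cell:
 "indicator (cell w) v = (\<Prod>b\<in>Basis. indicator {0..<1} (v \<bullet> b - w \<bullet> b) :: real)"
proof (cases "v \<in> cell w")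
 case True
 hence "(\<Prod>b\<in>Basis. indicator {0..<1} (v \<bullet> b - w \<bullet> b)) = (1 :: real)"
  by (intro prod.neutral) (auto simp: cell_def indicator_def algebra_simps)
 with True show ?thesis by simp
next
 case False
 then obtain b where "b \<in> Basis" "\<not> (w \<bullet> b <= v \<bullet> b \<and> v \<bullet> b < w \<bullet> b + 1)" by (auto simp: cell_def)
 hence "\<exists>b\<in>Basis. indicator {0..<1} (v \<bullet> b - w \<bullet> b) = (0::real)" by (auto simp: indicator_def intro!: bexI[of _ b])
 thus ?thesis using False by (simp add: prod_zero_iff)
qed

definition cell_avg :: "('a::euclidean_space => real) => 'a => real" where
 "cell_avg F w = (LINT v|lborel. indicator (cell w) v * F v)"

lemma cell_avg_translation:
 fixes F :: "'a::euclidean_space => real"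
 assumes [measurable]: "borel_fun F"
 shows "cell_avg (\<lambda>v. F (v + a)) w = cell_avg F (w + a)"
proof -
 have "indicator (cell (w + a)) (v + a) = (indicator (cell w) v :: real)" for v by (auto simp: indicator_def cell_def inner_simps)
 thus ?thesis unfolding cell_avg_def by (subst lborel_integral_translation[of _ a, symmetric]) (simp_all add: borel_cell)
qed

text \<open>Jensen's inequality on a set of measure 1: expand the square of \<open>G v - a\<close>,
  with \<open>a\<close> the mean, and integrate.\<close>

lemma integral_square_le:
 fixes G :: "'a::euclidean_space => real"
 assumes [measurable]: "borel_fun G" "A \<in> sets borel"
  and A: "emeasure lborel A = 1" and G: "integrable lborel (\<lambda>v. indicator A v * G v)"
 shows "ennreal ((LINT v|lborel. indicator A v * G v)^2) <= (\<integral>\<^sup>+v. indicator A v * ennreal ((G v)^2) \<partial>lborel)"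
proof (cases "(\<integral>\<^sup>+v. indicator A v * ennreal ((G v)^2) \<partial>lborel) = \<infinity>")
 case True
 thus ?thesis by simp
next
 case False
 have eq: "(\<integral>\<^sup>+v. indicator A v * ennreal ((G v)^2) \<partial>lborel) = (\<integral>\<^sup>+v. ennreal (indicator A v * (G v)^2) \<partial>lborel)"
  by (intro nn_integral_cong) (auto simp: indicator_def)
 have int: "integrable lborel (\<lambda>v. indicator A v * (G v)^2)" using False unfolding eq by (intro integrableI_nonneg) (auto simp: less_top)
 have intA: "integrable lborel (indicator A :: 'a => real)" using A by (simp add: integrable_indicator_iff)
 define a where "a = (LINT v|lborel. indicator A v * G v)"
 have "0 <= (LINT v|lborel. indicator A v * (G v - a)^2)" by (intro integral_nonneg_AE) auto
 also have "(\<lambda>v. indicator A v * (G v - a)^2) =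
   (\<lambda>v. indicator A v * (G v)^2 - 2 * a * (indicator A v * G v) + a^2 * indicator A v)"
  by (auto simp: fun_eq_iff power2_eq_square algebra_simps)
 also have "(LINT v|lborel. indicator A v * (G v)^2 - 2 * a * (indicator A v * G v) + a^2 * indicator A v) =
   (LINT v|lborel. indicator A v * (G v)^2) - 2 * a * a + a^2" using int intA G A by (simp add: a_def measure_def)
 finally have "a^2 <= (LINT v|lborel. indicator A v * (G v)^2)" by (simp add: power2_eq_square)
 thus ?thesis unfolding eq a_def[symmetric] by (subst nn_integral_eq_integral[OF int]) (auto intro!: ennreal_leI)
qed

lemma cell_subset_block:
 assumes "\<And>c. c \<in> Basis ==> 0 <= z \<bullet> c \<and> z \<bullet> c <= M"
 shows "cell z \<subseteq> block (M + 1)" using assms by (fastforce simp: cell_def block_def)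

lemma integrable_cell:
 fixes F :: "'a::euclidean_space => real"
 assumes "integrable lborel (\<lambda>v. indicator A v * F v)" "cell z \<subseteq> A" "A \<in> sets borel"
 shows "integrable lborel (\<lambda>v. indicator (cell z) v * F v)"
proof -
 have "integrable lborel (\<lambda>v. indicator (cell z) v * (indicator A v * F v))"
  using integrable_mult_indicator[of "cell z" lborel, OF _ assms(1)] by simp
 moreover have "(\<lambda>v. indicator (cell z) v * (indicator A v * F v)) = (\<lambda>v. indicator (cell z) v * F v)"
  using assms(2) by (auto simp: indicator_def fun_eq_iff)
 ultimately show ?thesis by simp
qed

text \<open>Averaging commutes with translations, hence with differences. The bound on
  \<open>z \<bullet> b + r\<close> keeps all \<open>r + 1\<close> shifted cells in the block where
  \<open>F\<close> is integrable.\<close>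

lemma fwd_diff_cell_avg:
 fixes F :: "'a::euclidean_space => real"
 assumes [measurable]: "borel_fun F"
  and int: "integrable lborel (\<lambda>v. indicator (block (real N + 1)) v * F v)"
  and b: "b \<in> Basis" and z: "\<And>c. c \<in> Basis ==> 0 <= z \<bullet> c \<and> z \<bullet> c <= N" and zr: "z \<bullet> b + r <= N"
 shows "integrable lborel (\<lambda>v. indicator (cell z) v * fwd_diff r b F v)" (is ?th1)
  and "fwd_diff r b (cell_avg F) z = (LINT v|lborel. indicator (cell z) v * fwd_diff r b F v)" (is ?th2)
proof -
 have int_j: "integrable lborel (\<lambda>v. indicator (cell z) v * F (v + real j *\<^sub>R b))" if "j <= r" for j
 proof -
  have "cell (z + real j *\<^sub>R b) \<subseteq> block (real N + 1)" using z zr b that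
   by (intro cell_subset_block) (fastforce simp: inner_simps inner_Basis)
  from integrable_cell[OF int this]
  have "integrable lborel (\<lambda>v. indicator (cell (z + real j *\<^sub>R b)) v * F v)" by simp
  from lborel_integrable_affine[OF this, of 1 "real j *\<^sub>R b"]
  show ?thesis by (rule Bochner_Integration.integrable_cong[THEN iffD1, rotated -1])
    (auto simp: indicator_def cell_def inner_simps add.commute)
 qed
 have eq: "indicator (cell z) v * fwd_diff r b F v =
   (\<Sum>j\<le>r. (- 1) ^ (r - j) * real (r choose j) * (indicator (cell z) v * F (v + real j *\<^sub>R b)))" for v
  by (simp add: fwd_diff_def sum_distrib_left mult_ac)
 show ?th1 unfolding eq by (intro Bochner_Integration.integrable_sum integrable_mult_right int_j) auto
 show ?th2 unfolding eq by (subst Bochner_Integration.integral_sum)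
   (auto intro!: sum.cong integrable_mult_right int_j
    simp: fwd_diff_def cell_avg_def cell_avg_translation[unfolded cell_avg_def])
qed

lemma fwd_diff_measurable [measurable]:
 assumes [measurable]: "borel_fun f"
 shows "fwd_diff r h f \<in> borel_measurable borel" unfolding fwd_diff_def[abs_def] by measurable

text \<open>The condition \<open>v \<bullet> b < real N + 1 - real r\<close> means that the segment
  from \<open>v\<close> to \<open>v + r b\<close> stays in the block, so only differences available
  inside the block occur on the right.\<close>

lemma fwd_diff_cell_avg_le:
 fixes F :: "'a::euclidean_space => real"
 assumes [measurable]: "borel_fun F"
  and int: "integrable lborel (\<lambda>v. indicator (block (real N + 1)) v * F v)"
  and b: "b \<in> Basis" and z: "\<And>c. c \<in> Basis ==> 0 <= z \<bullet> c \<and> z \<bullet> c <= N" and zr: "z \<bullet> b + r <= N"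
 shows "ennreal ((fwd_diff r b (cell_avg F) z)^2) <=
  (\<integral>\<^sup>+v. indicator {v \<in> block (real N + 1). v \<bullet> b < real N + 1 - real r} v * ennreal ((fwd_diff r b F v)^2) \<partial>lborel)"
proof -
 have "cell z \<subseteq> {v \<in> block (real N + 1). v \<bullet> b < real N + 1 - real r}"
  using z zr cell_subset_block[of z N] b by (fastforce simp: cell_def)
 hence "(\<integral>\<^sup>+v. indicator (cell z) v * ennreal ((fwd_diff r b F v)^2) \<partial>lborel) <=
  (\<integral>\<^sup>+v. indicator {v \<in> block (real N + 1). v \<bullet> b < real N + 1 - real r} v * ennreal ((fwd_diff r b F v)^2) \<partial>lborel)"
  by (intro nn_integral_mono mult_right_mono) (auto simp: indicator_def)
 moreover have "ennreal ((fwd_diff r b (cell_avg F) z)^2) <=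
   (\<integral>\<^sup>+v. indicator (cell z) v * ennreal ((fwd_diff r b F v)^2) \<partial>lborel)"
 proof -
  note * = fwd_diff_cell_avg[OF assms(1,2) b z zr]
  have "ennreal ((LINT v|lborel. indicator (cell z) v * fwd_diff r b F v)^2) <=
   (\<integral>\<^sup>+v. indicator (cell z) v * ennreal ((fwd_diff r b F v)^2) \<partial>lborel)"
   by (rule integral_square_le) (simp_all add: *(1) borel_cell)
  thus ?thesis by (simp only: *(2))
 qed
 ultimately show ?thesis by (rule order_trans[rotated])
qed

lemma cell_avg_refine:
 fixes F :: "'a::euclidean_space => real"
 assumes [measurable]: "borel_fun F"
  and int: "\<And>d. d \<in> PiE Basis (\<lambda>_. {..<2::nat}) ==>
   integrable lborel (\<lambda>v. indicator (cell (o' + 2 *\<^sub>R w + (\<Sum>b\<in>Basis. real (d b) *\<^sub>R b))) v * F v)"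
 shows "cell_avg (\<lambda>v. F (o' + 2 *\<^sub>R v)) w =
   (1/2) ^ DIM('a) * (\<Sum>d\<in>PiE Basis (\<lambda>_. {..<2::nat}). cell_avg F (o' + 2 *\<^sub>R w + (\<Sum>b\<in>Basis. real (d b) *\<^sub>R b)))"
proof -
 let ?E = "PiE Basis (\<lambda>_. {..<2::nat}) :: ('a => nat) set"
 let ?w = "\<lambda>d. o' + 2 *\<^sub>R w + (\<Sum>b\<in>Basis. real (d b) *\<^sub>R b)"
 \<comment> \<open>Under \<open>v \<mapsto> o' + 2 v\<close> the cell at \<open>w\<close> becomes a
   cube of side 2, tiled by the \<open>2 ^ d\<close> unit cells at \<open>?w d\<close>.\<close>
 have ind: "indicator (cell w) v = (\<Sum>d\<in>?E. indicator (cell (?w d)) (o' + 2 *\<^sub>R v) :: real)" for v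
 proof -
  have "(\<Sum>d\<in>?E. indicator (cell (?w d)) (o' + 2 *\<^sub>R v) :: real) =
    (\<Sum>d\<in>?E. \<Prod>b\<in>Basis. indicator {0..<1} (2 * (v \<bullet> b - w \<bullet> b) - real (d b)))" unfolding indicator_cell
   by (intro sum.cong prod.cong refl) (simp add: inner_simps algebra_simps inner_sum_left_Basis)
  also have "\<dots> = (\<Prod>b\<in>Basis. \<Sum>e<2. indicator {0..<1} (2 * (v \<bullet> b - w \<bullet> b) - real e))"
   by (subst prod_sum_PiE) auto
  also have "\<dots> = (\<Prod>b\<in>Basis. indicator {0..<1} (v \<bullet> b - w \<bullet> b))"
   by (intro prod.cong) (auto simp: indicator_def numeral_2_eq_2)
  finally show ?thesis by (simp add: indicator_cell)
 qed
 have "(\<Sum>d\<in>?E. cell_avg F (?w d)) = (LINT v|lborel. (\<Sum>d\<in>?E. indicator (cell (?w d)) v * F v))"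
  unfolding cell_avg_def by (subst Bochner_Integration.integral_sum) (use int in auto)
 also have "\<dots> = 2 ^ DIM('a) * (LINT v|lborel. indicator (cell w) v * F (o' + 2 *\<^sub>R v))"
  by (subst lborel_integral_affine[where c = 2 and t = o']) (simp_all add: ind sum_distrib_right borel_cell)
 finally show ?thesis by (simp add: cell_avg_def power_divide)
qed

text \<open>The cell weights are the basis dual to the cell integrals. So this is the value at
  \<open>x\<close> of the polynomial, of degree less than \<open>r\<close> in each variable, that
  has the same averages as \<open>F\<close> over the \<open>r ^ d\<close> unit cells in
  \<open>[0, r] ^ d\<close>. The estimates below take \<open>x\<close> in
  \<open>[-1, 0] ^ d\<close>, behind the corner of the cells.\<close>

definition local_poly :: "nat => ('a::euclidean_space => real) => 'a => real" where
 "local_poly r F x =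
   tensor_sum Basis {..<r} (\<lambda>b m. poly (cell_weight r m) (x \<bullet> b)) (\<lambda>b m. m) (cell_avg F) 0"

text \<open>Differences along coordinate directions suffice, since the Whitney estimate works line
  by line.\<close>

definition diff_energy :: "nat => nat => ('a::euclidean_space => real) => ennreal" where
 "diff_energy r N F = (\<Sum>b\<in>Basis. \<integral>\<^sup>+v. indicator {v \<in> block (real N + 1). v \<bullet> b < real N + 1 - real r} v *
   ennreal ((fwd_diff r b F v)^2) \<partial>lborel)"

abbreviation cell_avg_diff_bound :: "nat => real => nat => real => 'i set => 'j set => ('a => 'i => real) => ('a => 'i => nat) => ('a => 'j => real) => ('a => 'j => nat) => 'a::euclidean_space => ('a => real) => bool" where
 "cell_avg_diff_bound r K N C I J w p v q x F \<equiv>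
  finite I --> finite J --> (\<forall>b\<in>Basis. reproduces r I (w b) (p b) (x
  \<bullet> b) \<and> reproduces r J (v b) (q b) (x \<bullet> b) \<and> (\<forall>i\<in>I. p b i <= N) \<and>
  (\<forall>j\<in>J. q b j <= N) \<and> (\<Sum>i\<in>I. \<bar>w b i\<bar>) <= K \<and> (\<Sum>j\<in>J.
  \<bar>v b j\<bar>) <= K) --> borel_fun F --> integrable lborel (\<lambda>v.
  indicator (block (real N + 1)) v * F v) --> ennreal ((tensor_sum Basis I w p (cell_avg F) 0 -
  tensor_sum Basis J v q (cell_avg F) 0)^2) <= ennreal C * diff_energy r N F"

text \<open>The Whitney estimate is applied to the averages \<open>cell_avg F\<close>, whose
  differences are controlled by the energy through Jensen's inequality.\<close>

lemma tensor_sum_cell_avg_diff: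
 assumes K: "0 <= K"
 shows "\<exists>C>0. \<forall>(I :: 'i set) (J :: 'j set) w p v q (x :: 'a::euclidean_space) F.
  cell_avg_diff_bound r K N C I J w p v q x F"
proof -
 show ?thesis
 proof (rule tensor_sum_diff[of r N, where 'a='a and 'b='i and 'c='j], goal_cases)
 case (1 C)
 note C = 1(1) and main = 1(2)
 define D where "D = real DIM('a) * K ^ DIM('a) * C"
 have D: "0 <= D" using C K by (simp add: D_def)
 show "?thesis"
 \<comment> \<open>For finite energy the estimate yields \<open>D ^ 2\<close>. Adding 1 makes the
   constant positive, so that for infinite energy the right side is infinite.\<close>
 proof (intro exI[of _ "D^2 + 1"] conjI allI impI)
  show "0 < D^2 + 1" by (simp add: add_nonneg_pos)
  fix I :: "'i set" and J :: "'j set" and w p v q and x :: 'a and F :: "'a => real"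
  assume fin: "finite I" "finite J" and
   rep: "\<forall>b\<in>Basis. reproduces r I (w b) (p b) (x \<bullet> b) \<and> reproduces r J (v b) (q b) (x \<bullet> b) \<and>
   (\<forall>i\<in>I. p b i <= N) \<and> (\<forall>j\<in>J. q b j <= N) \<and> (\<Sum>i\<in>I. \<bar>w b i\<bar>) <= K \<and> (\<Sum>j\<in>J. \<bar>v b j\<bar>) <= K"
   and F: "borel_fun F" "integrable lborel (\<lambda>v. indicator (block (real N + 1)) v * F v)"
  show "ennreal ((tensor_sum Basis I w p (cell_avg F) 0 - tensor_sum Basis J v q (cell_avg F) 0)^2)
   <= ennreal (D^2 + 1) * diff_energy r N F"
  proof (cases "diff_energy r N F = \<infinity>")
   case True
   thus ?thesis by (simp add: ennreal_mult_top add_nonneg_pos)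
  next
   case False
   define d where "d = sqrt (enn2real (diff_energy r N F))"
   have d2: "ennreal (d^2) = diff_energy r N F" using False by (simp add: d_def less_top)
   have fd: "\<bar>fwd_diff r b (cell_avg F) z\<bar> <= d"
    if b: "b \<in> Basis" and z: "\<And>c. c \<in> Basis ==> 0 <= z \<bullet> c \<and> z \<bullet> c <= N" "z \<bullet> b + r <= N" for b z
   proof -
    have "ennreal ((fwd_diff r b (cell_avg F) z)^2) <= (\<integral>\<^sup>+v. indicator {v \<in> block (real N + 1). v \<bullet> b < real N + 1 - real r} v *
      ennreal ((fwd_diff r b F v)^2) \<partial>lborel)" by (rule fwd_diff_cell_avg_le[OF F b z])
    also have "\<dots> <= diff_energy r N F" unfolding diff_energy_def using b by (intro member_le_sum) auto
    finally have "(fwd_diff r b (cell_avg F) z)^2 <= d^2" unfolding d2[symmetric] by (simp add: ennreal_le_iff)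
    thus ?thesis by (rule abs_le_square_iff[THEN iffD2, of _ d, simplified abs_of_nonneg, rotated 0, THEN order_trans])
       (simp add: d_def)
   qed
   have "\<bar>tensor_sum Basis I w p (cell_avg F) 0 - tensor_sum Basis J v q (cell_avg F) 0\<bar> <= D * d"
    unfolding D_def using rep fd by (intro main[of _ I J w p "\<lambda>b. x \<bullet> b" v q] fin) (auto simp: d_def)
   hence "(tensor_sum Basis I w p (cell_avg F) 0 - tensor_sum Basis J v q (cell_avg F) 0)^2 <= (D * d)^2"
    by (rule abs_le_square_iff[THEN iffD1, OF order_trans]) simp
   also have "\<dots> <= (D^2 + 1) * d^2" by (simp add: power_mult_distrib algebra_simps)
   finally show ?thesis unfolding d2[symmetric] by (subst ennreal_mult[symmetric]) (auto intro!: ennreal_leI)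
  qed
 qed
qed
qed

text \<open>Continuity on a compact interval; \<open>[-1, 0]\<close> is the range of the relative
  coordinates of a point behind the corner of its cells.\<close>

lemma cell_weight_bounded:
 "\<exists>K>0. \<forall>x. -1 <= x \<and> x <= 0 --> (\<Sum>m<r. \<bar>poly (cell_weight r m) x\<bar>) <= K"
proof -
 have "compact ((\<lambda>x. \<Sum>m<r. \<bar>poly (cell_weight r m) x\<bar>) ` {-1..0})" by (intro compact_continuous_image continuous_intros) auto
 hence "bounded ((\<lambda>x. \<Sum>m<r. \<bar>poly (cell_weight r m) x\<bar>) ` {-1..0})" by (rule compact_imp_bounded)
 then obtain K where "K > 0" "\<forall>y\<in>(\<lambda>x. \<Sum>m<r. \<bar>poly (cell_weight r m) x\<bar>) ` {-1..0}. norm y <= K"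
  unfolding bounded_pos by blast
 thus ?thesis by (intro exI[of _ K]) fastforce
qed

lemma lagrange_poly_bounded:
 "\<exists>K>0. \<forall>x. -1 <= x \<and> x <= 0 --> (\<Sum>i<r. \<bar>poly (lagrange_poly n i) x\<bar>) <= K"
proof -
 have "compact ((\<lambda>x. \<Sum>i<r. \<bar>poly (lagrange_poly n i) x\<bar>) ` {-1..0})"
  by (intro compact_continuous_image continuous_intros) auto
 hence "bounded ((\<lambda>x. \<Sum>i<r. \<bar>poly (lagrange_poly n i) x\<bar>) ` {-1..0})" by (rule compact_imp_bounded)
 then obtain K where "K > 0" "\<forall>y\<in>(\<lambda>x. \<Sum>i<r. \<bar>poly (lagrange_poly n i) x\<bar>) ` {-1..0}. norm y <= K"
  unfolding bounded_pos by blast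
 thus ?thesis by (intro exI[of _ K]) fastforce
qed

lemma reproduces_cell_weight: "reproduces r {..<r} (\<lambda>m. poly (cell_weight r m) x) (\<lambda>m. m) x"
 unfolding reproduces_def using cell_weight_reproduces by auto

text \<open>The rule of the coarse grid, read on the fine one: coarse cell \<open>j\<close> is the
  union of the fine cells \<open>a + 2 j\<close> and \<open>a + 2 j + 1\<close>, and
  \<open>Q\<close> is pulled back along \<open>y \<mapsto> a + 2 y\<close>. The weights are halved
  because the average over a coarse cell is the mean of two fine ones.\<close>

lemma reproduces_refined:
 assumes x': "x' = 2 * x + real a"
 shows "reproduces r ({..<r} \<times> {..<2::nat}) (\<lambda>(j, e). poly (cell_weight r j) x / 2) (\<lambda>(j, e). a + 2 * j + e) x'"
 unfolding reproduces_def
proof (intro allI impI)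
 fix Q :: "real poly"
 assume Q: "degree Q <= r"
 \<comment> \<open>The factor \<open>1/2\<close> makes \<open>pderiv R\<close> the pullback of
   \<open>pderiv Q\<close>.\<close>
 define R where "R = smult (1/2) (pcompose Q [:real a, 2:])"
 have R: "poly R y = poly Q (real a + 2 * y) / 2" for y by (simp add: R_def poly_pcompose mult.commute)
 have R': "poly (pderiv R) x = poly (pderiv Q) x'"
  by (simp add: R_def pderiv_smult pderiv_pcompose pderiv_pCons poly_pcompose x' add.commute mult.commute)
 have "degree R <= r" unfolding R_def using Q by (intro order_trans[OF degree_smult_le] order_trans[OF degree_pcompose_le]) simp
 from cell_weight_reproduces[OF this, of x]
 have *: "(\<Sum>m<r. poly (cell_weight r m) x * (poly R (real m + 1) - poly R (real m))) = poly (pderiv Q) x'" unfolding R' .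
 have "(\<Sum>i\<in>{..<r} \<times> {..<2}. (case i of (j, e) => poly (cell_weight r j) x / 2) *
   (poly Q (real (case i of (j, e) => a + 2 * j + e) + 1) - poly Q (real (case i of (j, e) => a + 2 * j + e)))) =
   (\<Sum>j<r. \<Sum>e<2. poly (cell_weight r j) x / 2 *
   (poly Q (real (a + 2 * j + e) + 1) - poly Q (real (a + 2 * j + e))))" by (simp add: sum.cartesian_product case_prod_beta)
 also have "\<dots> = (\<Sum>m<r. poly (cell_weight r m) x * (poly R (real m + 1) - poly R (real m)))"
  by (intro sum.cong refl) (simp add: R numeral_2_eq_2 algebra_simps diff_divide_distrib add_divide_distrib)
 finally show "(\<Sum>i\<in>{..<r} \<times> {..<2}. (case i of (j, e) => poly (cell_weight r j) x / 2) *
   (poly Q (real (case i of (j, e) => a + 2 * j + e) + 1) - poly Q (real (case i of (j, e) => a + 2 * j + e)))) = poly (pderiv Q) x'"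
  using * by simp
qed

text \<open>A composition of two exact rules: Lagrange interpolation recovers the value at
  \<open>x\<close> from the values at \<open>0, ..., r - 1\<close>, and each of these is recovered
  from the \<open>r\<close> cells that start at the integer in question.\<close>

lemma reproduces_sampled:
 assumes r: "1 <= r"
 shows "reproduces r ({..<r} \<times> {..<r}) (\<lambda>(i, m). poly (lagrange_poly (r - 1) i) x * poly (cell_weight r m) 0)
  (\<lambda>(i, m). i + m) x" unfolding reproduces_def
proof (intro allI impI)
 fix Q :: "real poly"
 assume Q: "degree Q <= r"
 have shift: "(\<Sum>m<r. poly (cell_weight r m) 0 * (poly Q (real (i + m) + 1) - poly Q (real (i + m)))) = poly (pderiv Q) (real i)"
  for i
 proof -
  define R where "R = pcompose Q [:real i, 1:]"
  have "degree R <= r" unfolding R_def using Q by (intro order_trans[OF degree_pcompose_le]) simp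
  from cell_weight_reproduces[OF this, of 0] show ?thesis by (simp add: R_def poly_pcompose pderiv_pcompose pderiv_pCons add.assoc)
 qed
 have "degree (pderiv Q) <= r - 1" using Q by (simp add: degree_pderiv)
 from lagrange_interpolation[OF this]
 have "poly (pderiv Q) x = (\<Sum>i\<le>r - 1. poly (pderiv Q) (real i) * poly (lagrange_poly (r - 1) i) x)"
  by (metis (no_types, lifting) poly_smult poly_sum sum.cong)
 also have "{..r - 1} = {..<r}" using r by auto
 also have "(\<Sum>i<r. poly (pderiv Q) (real i) * poly (lagrange_poly (r - 1) i) x) =
   (\<Sum>i<r. \<Sum>m<r. poly (lagrange_poly (r - 1) i) x * poly (cell_weight r m) 0 *
    (poly Q (real (i + m) + 1) - poly Q (real (i + m))))" unfolding shift[symmetric] by (simp add: sum_distrib_right sum_distrib_left mult_ac)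
 finally show "(\<Sum>k\<in>{..<r} \<times> {..<r}. (case k of (i, m) => poly (lagrange_poly (r - 1) i) x * poly (cell_weight r m) 0) *
   (poly Q (real (case k of (i, m) => i + m) + 1) - poly Q (real (case k of (i, m) => i + m)))) = poly (pderiv Q) x"
  by (simp add: sum.cartesian_product case_prod_beta)
qed

lemma sum_weights_cell_weight:
 "1 <= r ==> (\<Sum>m<r. poly (cell_weight r m) x) = 1" using cell_weight_reproduces[of "[:0, 1:]" r x] by (simp add: pderiv_pCons)

text \<open>The weights sum to 1, so constants are reproduced and only the deviation from
  \<open>a\<close> is multiplied by the weight bound. It gives the convergence of local polynomials
  at points of continuity.\<close>

lemma local_poly_near_const:
 fixes F :: "'a::euclidean_space => real"
 assumes K: "\<And>x. -1 <= x ==> x <= 0 ==> (\<Sum>m<r. \<bar>poly (cell_weight r m) x\<bar>) <= K" and r: "1 <= r"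
  and F [measurable]: "borel_fun F"
  and x: "\<And>b. b \<in> Basis ==> -1 <= x \<bullet> b \<and> x \<bullet> b <= 0"
  and near: "\<And>v. v \<in> block (real r) ==> \<bar>F v - a\<bar> <= e" and e: "0 <= e"
 shows "\<bar>local_poly r F x - a\<bar> <= K ^ DIM('a) * e"
proof -
 let ?w = "\<lambda>b m. poly (cell_weight r m) (x \<bullet> b)"
 have avg: "\<bar>cell_avg F w - a\<bar> <= e" if w: "\<And>c. c \<in> Basis ==> 0 <= w \<bullet> c \<and> w \<bullet> c <= real r - 1" for w
 proof -
  have sub: "cell w \<subseteq> block (real r)" using cell_subset_block[OF w] by simp
  have ia: "integrable lborel (\<lambda>v. indicator (cell w) v * a)"
   by (intro integrable_mult_left) (simp add: integrable_indicator_iff borel_cell)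
  have ie: "integrable lborel (\<lambda>v. indicator (cell w) v * e)"
   by (intro integrable_mult_left) (simp add: integrable_indicator_iff borel_cell)
  have i1: "integrable lborel (\<lambda>v. indicator (cell w) v * (F v - a))" by (rule Bochner_Integration.integrable_bound[OF ie])
    (use sub near e in \<open>auto simp: indicator_def borel_cell subset_iff intro!: always_eventually\<close>)
  have i2: "integrable lborel (\<lambda>v. indicator (cell w) v * F v)"
   using Bochner_Integration.integrable_add[OF i1 ia] by (simp add: right_diff_distrib)
  have "cell_avg F w - a = (LINT v|lborel. indicator (cell w) v * (F v - a))" using i2 ia by (simp add: cell_avg_def right_diff_distrib measure_def)
  also have "\<bar>\<dots>\<bar> <= (LINT v|lborel. indicator (cell w) v * e)" by (rule order_trans[OF integral_abs_bound])
    (use sub near e in \<open>intro integral_mono i1 ie integrable_abs; auto simp: indicator_def subset_iff\<close>)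
  also have "\<dots> = e" by (simp add: measure_def)
  finally show ?thesis .
 qed
 have "(\<Sum>i\<in>PiE Basis (\<lambda>_. {..<r}). \<Prod>b\<in>Basis. ?w b (i b)) = 1"
  by (subst prod_sum_PiE[symmetric]) (auto simp: sum_weights_cell_weight[OF r])
 hence "local_poly r F x - a = tensor_sum Basis {..<r} ?w (\<lambda>b m. m) (\<lambda>w. cell_avg F w - a) 0" unfolding local_poly_def tensor_sum_def
  by (simp add: right_diff_distrib sum_subtractf flip: sum_distrib_right)
 also have "\<bar>\<dots>\<bar> <= K ^ card (Basis :: 'a set) * e"
 proof (rule abs_tensor_sum_le)
  fix i assume i: "i \<in> PiE (Basis :: 'a set) (\<lambda>_. {..<r})"
  have "real (i c) <= real r - 1" if "c \<in> Basis" for c using PiE_mem[OF i that] by auto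
  thus "\<bar>cell_avg F (0 + (\<Sum>b\<in>Basis. real (i b) *\<^sub>R b)) - a\<bar> <= e" by (intro avg) (auto simp: inner_sum_left_Basis)
 qed (use x K e in auto)
 finally show ?thesis .
qed

lemma integrable_cell_block:
 fixes F :: "'a::euclidean_space => real"
 assumes "integrable lborel (\<lambda>v. indicator (block M) v * F v)"
  and "\<And>c. c \<in> Basis ==> 0 <= z \<bullet> c \<and> z \<bullet> c + 1 <= M"
 shows "integrable lborel (\<lambda>v. indicator (cell z) v * F v)"
proof (rule integrable_cell[OF assms(1)])
 show "cell z \<subseteq> block M" using assms(2) by (fastforce simp: cell_def block_def)
qed (rule borel_block)

abbreviation refine_bound :: "nat => real => ('a::euclidean_space => real) => ('a => nat) => 'a => bool" where
 "refine_bound r C F a x \<equiv>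
  borel_fun F --> integrable lborel (\<lambda>v. indicator (block (real (2 * r) + 1)) v * F v)
  --> (\<forall>b\<in>Basis. a b <= (1 :: nat) \<and> -1 <= x \<bullet> b \<and> x \<bullet>
  b <= 0 \<and> -1 <= 2 * (x \<bullet> b) + a b \<and> 2 * (x \<bullet> b) + a b <= 0) -->
  ennreal ((local_poly r F (2 *\<^sub>R x + (\<Sum>b\<in>Basis. real (a b) *\<^sub>R b)) - local_poly r
  (\<lambda>v. F ((\<Sum>b\<in>Basis. real (a b) *\<^sub>R b) + 2 *\<^sub>R v)) x)^2) <= ennreal C *
  diff_energy r (2 * r) F"

text \<open>The local polynomial on cells of double size is itself an exact rule on the fine cells,
  so the two polynomials differ by at most the difference energy. The offset \<open>a\<close> in
  \<open>{0, 1} ^ d\<close> is the corner of the coarse grid, seen in the fine one.\<close>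

lemma local_poly_refine:
 assumes r: "1 <= r"
 shows "\<exists>C>0. \<forall>(F :: 'a::euclidean_space => real) a x.
  refine_bound r C F a x"
proof -
 obtain K where K: "K > 0" "\<And>x. -1 <= x ==> x <= 0 ==> (\<Sum>m<r. \<bar>poly (cell_weight r m) x\<bar>) <= K"
  using cell_weight_bounded[of r] by blast
 have K0: "0 <= K" using K by simp
 obtain C where C: "C > 0" and main: "\<forall>(I :: nat set) (J :: (nat \<times> nat) set) w p v q (x :: 'a) F.
  cell_avg_diff_bound r K (2 * r) C I J w p v q x F" using tensor_sum_cell_avg_diff[OF K0, of r "2 * r"] by (elim exE conjE) (rule that)
 show ?thesis
 proof (intro exI[of _ C] conjI allI impI C)
  fix F :: "'a => real" and a :: "'a => nat" and x :: 'a
  assume F: "borel_fun F" "integrable lborel (\<lambda>v. indicator (block (real (2 * r) + 1)) v * F v)"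
   and ax: "\<forall>b\<in>Basis. a b <= (1 :: nat) \<and> -1 <= x \<bullet> b \<and> x \<bullet> b <= 0 \<and> -1 <= 2 * (x \<bullet> b) + a b \<and> 2 * (x \<bullet> b) + a b <= 0"
  define o' where "o' = (\<Sum>b\<in>Basis. real (a b) *\<^sub>R b)"
  have o': "o' \<bullet> b = real (a b)" if "b \<in> Basis" for b using that by (simp add: o'_def inner_sum_left_Basis)
  let ?w = "\<lambda>b (m :: nat). poly (cell_weight r m) ((2 *\<^sub>R x + o') \<bullet> b)"
  let ?v = "\<lambda>b. \<lambda>(j, e :: nat). poly (cell_weight r j) (x \<bullet> b) / 2"
  let ?q = "\<lambda>b. \<lambda>(j, e). a b + 2 * j + e"
  have coarse: "local_poly r (\<lambda>v. F (o' + 2 *\<^sub>R v)) x = tensor_sum Basis ({..<r} \<times> {..<2}) ?v ?q (cell_avg F) 0"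
  proof -
   have avg: "cell_avg (\<lambda>v. F (o' + 2 *\<^sub>R v)) (\<Sum>b\<in>Basis. real (i b) *\<^sub>R b) =
    (1/2) ^ DIM('a) * (\<Sum>d\<in>PiE Basis (\<lambda>_. {..<2::nat}). cell_avg F (\<Sum>b\<in>Basis. real (a b + 2 * i b + d b) *\<^sub>R b))"
    if i: "i \<in> PiE Basis (\<lambda>_. {..<r})" for i
   proof -
    have eq: "o' + 2 *\<^sub>R (\<Sum>b\<in>Basis. real (i b) *\<^sub>R b) + (\<Sum>b\<in>Basis. real (d b) *\<^sub>R b) =
      (\<Sum>b\<in>Basis. real (a b + 2 * i b + d b) *\<^sub>R b)" for d :: "'a => nat"
     by (simp add: o'_def scaleR_sum_right scaleR_left_distrib sum.distrib)
    show ?thesis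
    proof (subst cell_avg_refine[OF F(1)])
     fix d assume "d \<in> PiE (Basis :: 'a set) (\<lambda>_. {..<2::nat})"
     \<comment> \<open>\<open>a <= 1\<close>, \<open>i <= r - 1\<close> and \<open>d <= 1\<close>
       add up to at most \<open>2 r\<close>; this explains the block size
       \<open>2 r + 1\<close>.\<close>
     hence "a c + 2 * i c + d c <= 2 * r" if "c \<in> Basis" for c
      using PiE_mem[OF i that] ax that PiE_mem[of d Basis "\<lambda>_. {..<2}" c] by fastforce
     thus "integrable lborel (\<lambda>v. indicator (cell (o' + 2 *\<^sub>R (\<Sum>b\<in>Basis. real (i b) *\<^sub>R b) + (\<Sum>b\<in>Basis. real (d b) *\<^sub>R b))) v * F v)"
      unfolding eq by (intro integrable_cell_block[OF F(2)]) (fastforce simp: inner_sum_left_Basis)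
    qed (simp add: eq)
   qed
   have "tensor_sum Basis ({..<r} \<times> {..<2}) ?v ?q (cell_avg F) 0 =
     (\<Sum>i\<in>PiE Basis (\<lambda>_. {..<r}). \<Sum>d\<in>PiE Basis (\<lambda>_. {..<2}).
      (\<Prod>b\<in>Basis. poly (cell_weight r (i b)) (x \<bullet> b) / 2) * cell_avg F (\<Sum>b\<in>Basis. real (a b + 2 * i b + d b) *\<^sub>R b))"
    unfolding tensor_sum_def by (subst sum_PiE_Times) simp_all
   also have "\<dots> = (\<Sum>i\<in>PiE Basis (\<lambda>_. {..<r}). (\<Prod>b\<in>Basis. poly (cell_weight r (i b)) (x \<bullet> b)) *
     cell_avg (\<lambda>v. F (o' + 2 *\<^sub>R v)) (\<Sum>b\<in>Basis. real (i b) *\<^sub>R b))"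
    by (intro sum.cong refl) (simp add: avg prod_dividef power_divide flip: sum_distrib_left sum_divide_distrib)
   finally show ?thesis by (simp add: local_poly_def tensor_sum_def)
  qed
  have "ennreal ((tensor_sum Basis {..<r} ?w (\<lambda>b m. m) (cell_avg F) 0 -
    tensor_sum Basis ({..<r} \<times> {..<2}) ?v ?q (cell_avg F) 0)^2) <= ennreal C * diff_energy r (2 * r) F"
  proof (rule main[THEN spec, THEN spec, THEN spec, THEN spec, THEN spec, THEN spec,
     THEN spec[where x = "2 *\<^sub>R x + o'"], THEN spec[where x = F], THEN mp, THEN mp, THEN mp, THEN mp, THEN mp])
   show "\<forall>b\<in>Basis. reproduces r {..<r} (?w b) (\<lambda>m. m) ((2 *\<^sub>R x + o') \<bullet> b) \<and>
     reproduces r ({..<r} \<times> {..<2}) (?v b) (?q b) ((2 *\<^sub>R x + o') \<bullet> b) \<and>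
     (\<forall>i\<in>{..<r}. i <= 2 * r) \<and> (\<forall>j\<in>{..<r} \<times> {..<2}. ?q b j <= 2 * r) \<and>
     (\<Sum>i<r. \<bar>?w b i\<bar>) <= K \<and> (\<Sum>j\<in>{..<r} \<times> {..<2}. \<bar>?v b j\<bar>) <= K" (is "\<forall>b\<in>Basis. ?P b")
   proof
    fix b :: 'a assume b: "b \<in> Basis"
    have s: "(\<Sum>j\<in>{..<r} \<times> {..<2}. \<bar>?v b j\<bar>) = (\<Sum>j<r. \<Sum>e<2::nat. \<bar>poly (cell_weight r j) (x \<bullet> b) / 2\<bar>)"
     by (subst sum.cartesian_product) (simp add: case_prod_beta)
    have "(\<Sum>j\<in>{..<r} \<times> {..<2}. \<bar>?v b j\<bar>) <= K"
     unfolding s using K(2)[of "x \<bullet> b"] ax b by (simp add: sum_divide_distrib)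
    moreover have "(\<Sum>i<r. \<bar>?w b i\<bar>) <= K" using ax b by (intro K(2)) (auto simp: inner_simps o')
    moreover have "?q b j <= 2 * r" if "j \<in> {..<r} \<times> {..<2}" for j using that ax b by fastforce
    moreover have "reproduces r ({..<r} \<times> {..<2}) (?v b) (?q b) ((2 *\<^sub>R x + o') \<bullet> b)"
     using b by (intro reproduces_refined) (simp add: inner_simps o')
    ultimately show "?P b" by (auto simp: reproduces_cell_weight)
   qed
  qed (use F in auto)
  thus "ennreal ((local_poly r F (2 *\<^sub>R x + (\<Sum>b\<in>Basis. real (a b) *\<^sub>R b)) -
   local_poly r (\<lambda>v. F ((\<Sum>b\<in>Basis. real (a b) *\<^sub>R b) + 2 *\<^sub>R v)) x)^2) <= ennreal C * diff_energy r (2 * r) F"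
   unfolding o'_def[symmetric] coarse by (simp add: local_poly_def)
 qed
qed

abbreviation sample_bound :: "nat => real => ('a::euclidean_space => real) => 'a => bool" where
 "sample_bound r C F x \<equiv>
  borel_fun F --> integrable lborel (\<lambda>v. indicator (block (real (2 * r) + 1)) v * F v)
  --> (\<forall>b\<in>Basis. -1 <= x \<bullet> b \<and> x \<bullet> b <= 0) -->
  ennreal ((local_poly r F x)^2) <= ennreal C * (diff_energy r (2 * r) F + (\<Sum>i\<in>PiE Basis (\<lambda>_.
  {..<r}). ennreal ((local_poly r (\<lambda>v. F (v + (\<Sum>b\<in>Basis. real (i b) *\<^sub>R b))) 0)^2)))"

text \<open>Turns information at lattice points into a bound for the polynomial elsewhere: the value
  at \<open>x\<close> is compared with the interpolation of the polynomials attached to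
  \<open>r ^ d\<close> lattice points, and the discrepancy is again a difference of two exact
  rules.\<close>

lemma local_poly_sample:
 assumes r: "1 <= r"
 shows "\<exists>C>0. \<forall>(F :: 'a::euclidean_space => real) x.
  sample_bound r C F x"
proof -
 obtain K1 where K1: "K1 > 0" "\<And>x. -1 <= x ==> x <= 0 ==> (\<Sum>m<r. \<bar>poly (cell_weight r m) x\<bar>) <= K1"
  using cell_weight_bounded[of r] by blast
 obtain K2 where K2: "K2 > 0" "\<And>x. -1 <= x ==> x <= 0 ==> (\<Sum>i<r. \<bar>poly (lagrange_poly (r - 1) i) x\<bar>) <= K2"
  using lagrange_poly_bounded[where r = r and n = "r - 1"] by blast
 define K where "K = max K1 (K2 * K1)"
 have K0: "0 <= K" using K1 by (simp add: K_def)
 obtain C where C: "C > 0" and main: "\<forall>(I :: nat set) (J :: (nat \<times> nat) set) w p v q (x :: 'a) F.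
  cell_avg_diff_bound r K (2 * r) C I J w p v q x F" using tensor_sum_cell_avg_diff[OF K0, of r "2 * r"] by (elim exE conjE) (rule that)
 let ?I = "PiE (Basis :: 'a set) (\<lambda>_. {..<r})"
 \<comment> \<open>Cauchy-Schwarz over the \<open>r ^ d\<close> lattice points, with weights at most
   \<open>K2 ^ d\<close>; the 2 comes from splitting the square of a sum.\<close>
 define D where "D = 2 * (K2 ^ (2 * DIM('a)) * real (card ?I))"
 have D: "0 <= D" using K2 by (simp add: D_def)
 show ?thesis
 proof (intro exI[of _ "2 * C + D"] conjI allI impI)
  show "0 < 2 * C + D" using C D by simp
  fix F :: "'a => real" and x :: 'a
  assume F: "borel_fun F" "integrable lborel (\<lambda>v. indicator (block (real (2 * r) + 1)) v * F v)"
   and x: "\<forall>b\<in>Basis. -1 <= x \<bullet> b \<and> x \<bullet> b <= 0"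
  let ?w = "\<lambda>b (m :: nat). poly (cell_weight r m) (x \<bullet> b)"
  let ?v = "\<lambda>b. \<lambda>(i, m). poly (lagrange_poly (r - 1) i) (x \<bullet> b) * poly (cell_weight r m) 0"
  let ?q = "\<lambda>b :: 'a. \<lambda>(i, m). i + m :: nat"
  let ?P = "\<lambda>i. local_poly r (\<lambda>v. F (v + (\<Sum>b\<in>Basis. real (i b) *\<^sub>R b))) 0"
  let ?l = "\<lambda>i. \<Prod>b\<in>Basis. poly (lagrange_poly (r - 1) (i b)) (x \<bullet> b)"
  have "tensor_sum Basis ({..<r} \<times> {..<r}) ?v ?q (cell_avg F) 0 =
    (\<Sum>i\<in>?I. \<Sum>m\<in>?I. ?l i * ((\<Prod>b\<in>Basis. poly (cell_weight r (m b)) 0) *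
      cell_avg F (\<Sum>b\<in>Basis. real (i b + m b) *\<^sub>R b)))"
   unfolding tensor_sum_def by (subst sum_PiE_Times) (simp_all add: prod.distrib mult.assoc)
  also have "\<dots> = (\<Sum>i\<in>?I. ?l i * ?P i)" unfolding local_poly_def tensor_sum_def
   by (simp add: sum_distrib_left cell_avg_translation[OF F(1)] scaleR_left_distrib sum.distrib add.commute)
  finally have fine: "tensor_sum Basis ({..<r} \<times> {..<r}) ?v ?q (cell_avg F) 0 = (\<Sum>i\<in>?I. ?l i * ?P i)" .
  have "ennreal ((tensor_sum Basis {..<r} ?w (\<lambda>b m. m) (cell_avg F) 0 -
    tensor_sum Basis ({..<r} \<times> {..<r}) ?v ?q (cell_avg F) 0)^2) <= ennreal C * diff_energy r (2 * r) F"
  proof (rule main[THEN spec, THEN spec, THEN spec, THEN spec, THEN spec, THEN spec,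
     THEN spec[where x = x], THEN spec[where x = F], THEN mp, THEN mp, THEN mp, THEN mp, THEN mp])
   show "\<forall>b\<in>Basis. reproduces r {..<r} (?w b) (\<lambda>m. m) (x \<bullet> b) \<and>
     reproduces r ({..<r} \<times> {..<r}) (?v b) (?q b) (x \<bullet> b) \<and>
     (\<forall>i\<in>{..<r}. i <= 2 * r) \<and> (\<forall>j\<in>{..<r} \<times> {..<r}. ?q b j <= 2 * r) \<and>
     (\<Sum>i<r. \<bar>?w b i\<bar>) <= K \<and> (\<Sum>j\<in>{..<r} \<times> {..<r}. \<bar>?v b j\<bar>) <= K" (is "\<forall>b\<in>Basis. ?Q b")
   proof
    fix b :: 'a assume b: "b \<in> Basis"
    have "(\<Sum>j\<in>{..<r} \<times> {..<r}. \<bar>?v b j\<bar>) =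
      (\<Sum>i<r. \<Sum>m<r. \<bar>poly (lagrange_poly (r - 1) i) (x \<bullet> b)\<bar> * \<bar>poly (cell_weight r m) 0\<bar>)"
     by (subst sum.cartesian_product) (simp add: case_prod_beta abs_mult)
    also have "\<dots> = (\<Sum>i<r. \<bar>poly (lagrange_poly (r - 1) i) (x \<bullet> b)\<bar>) * (\<Sum>m<r. \<bar>poly (cell_weight r m) 0\<bar>)"
     by (rule sum_product[symmetric])
    also have "\<dots> <= K2 * K1" using x b K1 K2 by (intro mult_mono K1 K2 sum_nonneg) auto
    finally have "(\<Sum>j\<in>{..<r} \<times> {..<r}. \<bar>?v b j\<bar>) <= K" by (simp add: K_def)
    moreover have "(\<Sum>i<r. \<bar>?w b i\<bar>) <= K" using K1(2)[of "x \<bullet> b"] x b by (auto simp: K_def)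
    moreover have "?q b j <= 2 * r" if "j \<in> {..<r} \<times> {..<r}" for j using that by auto
    ultimately show "?Q b" by (intro conjI reproduces_cell_weight reproduces_sampled[OF r]) auto
   qed
  qed (use F in auto)
  hence 1: "ennreal ((local_poly r F x - (\<Sum>i\<in>?I. ?l i * ?P i))^2) <= ennreal C * diff_energy r (2 * r) F"
   unfolding fine by (simp add: local_poly_def)
  have fin: "finite ?I" by (intro finite_PiE) auto
  have l: "(?l i)^2 <= K2 ^ (2 * DIM('a))" if i: "i \<in> ?I" for i
  proof -
   have "\<bar>poly (lagrange_poly (r - 1) (i b)) (x \<bullet> b)\<bar> <= K2" if b: "b \<in> Basis" for b
   proof -
    have "\<bar>poly (lagrange_poly (r - 1) (i b)) (x \<bullet> b)\<bar> <= (\<Sum>i<r. \<bar>poly (lagrange_poly (r - 1) i) (x \<bullet> b)\<bar>)"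
     using PiE_mem[OF i b] by (intro member_le_sum[of _ _ "\<lambda>i. \<bar>poly (lagrange_poly (r - 1) i) (x \<bullet> b)\<bar>"]) auto
    also have "\<dots> <= K2" using x b by (intro K2) auto
    finally show ?thesis .
   qed
   hence "\<bar>?l i\<bar> <= (\<Prod>b\<in>(Basis :: 'a set). K2)" unfolding abs_prod by (intro prod_mono) auto
   hence "(\<bar>?l i\<bar>)^2 <= (K2 ^ DIM('a))^2" by (intro power_mono) auto
   thus ?thesis by (simp add: power_mult[symmetric] mult.commute)
  qed
  have "(\<Sum>i\<in>?I. ?l i * ?P i)^2 <= (\<Sum>i\<in>?I. (?l i)^2) * (\<Sum>i\<in>?I. (?P i)^2)" by (rule Cauchy_Schwarz_ineq_sum)
  also have "\<dots> <= (\<Sum>i\<in>?I. K2 ^ (2 * DIM('a))) * (\<Sum>i\<in>?I. (?P i)^2)" by (intro mult_right_mono sum_mono l sum_nonneg) auto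
  finally have 2: "2 * (\<Sum>i\<in>?I. ?l i * ?P i)^2 <= D * (\<Sum>i\<in>?I. (?P i)^2)" by (simp add: D_def mult_ac)
  have "(local_poly r F x)^2 <= 2 * (local_poly r F x - (\<Sum>i\<in>?I. ?l i * ?P i))^2 + 2 * (\<Sum>i\<in>?I. ?l i * ?P i)^2"
  proof -
   have "u^2 <= 2 * (u - v)^2 + 2 * v^2" for u v :: real using zero_le_power2[of "u - 2 * v"] by (simp add: power2_eq_square algebra_simps)
   thus ?thesis .
  qed
  also have "\<dots> <= 2 * (local_poly r F x - (\<Sum>i\<in>?I. ?l i * ?P i))^2 + D * (\<Sum>i\<in>?I. (?P i)^2)" using 2 by simp
  finally have "ennreal ((local_poly r F x)^2) <=
    ennreal (2 * (local_poly r F x - (\<Sum>i\<in>?I. ?l i * ?P i))^2 + D * (\<Sum>i\<in>?I. (?P i)^2))" by (rule ennreal_leI)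
  also have "\<dots> = 2 * ennreal ((local_poly r F x - (\<Sum>i\<in>?I. ?l i * ?P i))^2) + ennreal D * (\<Sum>i\<in>?I. ennreal ((?P i)^2))"
   using D by (simp add: ennreal_plus ennreal_mult' sum_nonneg sum_ennreal)
  also have "\<dots> <= 2 * (ennreal C * diff_energy r (2 * r) F) + ennreal D * (\<Sum>i\<in>?I. ennreal ((?P i)^2))"
   by (intro add_mono mult_left_mono 1) auto
  also have "\<dots> <= ennreal (2 * C + D) * (diff_energy r (2 * r) F + (\<Sum>i\<in>?I. ennreal ((?P i)^2)))"
  proof -
   have "2 * (ennreal C * diff_energy r (2 * r) F) = ennreal (2 * C) * diff_energy r (2 * r) F" using C by (simp add: ennreal_mult' mult.assoc)
   thus ?thesis using C D by (simp add: distrib_left) (intro add_mono mult_right_mono ennreal_leI, auto)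
  qed
  finally show "ennreal ((local_poly r F x)^2) <= ennreal (2 * C + D) * (diff_energy r (2 * r) F + (\<Sum>i\<in>?I. ennreal ((?P i)^2)))" .
 qed
qed

section \<open>Difference energies in charts, and the telescoping chain over dyadic scales\<close>

definition local_energy ::
 "nat => 'a::euclidean_space set => ('a => 'a) => real => real => ('a => real) => real => 'a => ennreal" where
 "local_energy r W L R h f z y = (\<Sum>b\<in>Basis. \<integral>\<^sup>+v. indicator (block R) v *
   ennreal ((indicator (diff_domain W r (z *\<^sub>R L b)) (y + h *\<^sub>R L v) *
    fwd_diff r (z *\<^sub>R L b) f (y + h *\<^sub>R L v))^2) \<partial>lborel)"

lemma fwd_diff_linear:
 assumes "linear L"
 shows "fwd_diff r b (\<lambda>v. f (c + z *\<^sub>R L v)) v = fwd_diff r (z *\<^sub>R L b) f (c + z *\<^sub>R L v)"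
proof -
 have "c + z *\<^sub>R L (v + real j *\<^sub>R b) = c + z *\<^sub>R L v + real j *\<^sub>R z *\<^sub>R L b" for j
  by (simp add: linear_add[OF assms] linear_cmul[OF assms] scaleR_add_right)
 thus ?thesis unfolding fwd_diff_def by (simp only:)
qed

lemma borel_measurable_linear:
 fixes L :: "'a::euclidean_space => 'a"
 assumes "linear L"
 shows "borel_fun L"
proof (rule borel_measurable_continuous_onI, rule linear_continuous_on)
 show "bounded_linear L" using assms by (simp add: linear_conv_bounded_linear)
qed

text \<open>A compact segment in \<open>W\<close> has positive distance from the complement, and a
  translation by less than that distance keeps it in \<open>W\<close>.\<close>

lemma open_diff_domain:
 assumes "open W"
 shows "open (diff_domain W r h)"
proof (rule openI)
 fix x assume x: "x \<in> diff_domain W r h"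
 have "compact (closed_segment x (x + real r *\<^sub>R h))" by simp
 moreover have "closed_segment x (x + real r *\<^sub>R h) \<subseteq> W" using x by (simp add: diff_domain_def)
 ultimately obtain e where e: "e > 0" "\<And>z. z \<in> closed_segment x (x + real r *\<^sub>R h) ==> ball z e \<subseteq> W"
 proof (cases "- W = {}")
  case True
  thus ?thesis using that[of 1] by auto
 next
  case False
  have "\<exists>d>0. \<forall>u\<in>closed_segment x (x + real r *\<^sub>R h). \<forall>w\<in>- W. d <= dist u w"
   using x assms by (intro separate_compact_closed) (auto simp: diff_domain_def closed_Compl)
  then obtain d where "d > 0" "\<forall>u\<in>closed_segment x (x + real r *\<^sub>R h). \<forall>w\<in>- W. d <= dist u w" by blast
  thus ?thesis by (intro that[of d]) (auto simp: subset_iff not_less[symmetric])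
 qed
 have "ball x e \<subseteq> diff_domain W r h"
 proof
  fix y assume y: "y \<in> ball x e"
  have "z \<in> W" if z: "z \<in> closed_segment y (y + real r *\<^sub>R h)" for z
  proof -
   obtain u where u: "0 <= u" "u <= 1" "z = y + u *\<^sub>R (real r *\<^sub>R h)" using z by (auto simp: closed_segment_def algebra_simps)
   have "x + u *\<^sub>R (real r *\<^sub>R h) \<in> closed_segment x (x + real r *\<^sub>R h)"
    unfolding in_segment using u by (intro exI[of _ u]) (auto simp: algebra_simps)
   from e(2)[OF this] have "ball (x + u *\<^sub>R (real r *\<^sub>R h)) e \<subseteq> W" .
   moreover have "z \<in> ball (x + u *\<^sub>R (real r *\<^sub>R h)) e" using y u by (simp add: dist_norm)
   ultimately show ?thesis by blast
  qed
  moreover have "y \<in> closed_segment y (y + real r *\<^sub>R h)" by simp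
  ultimately show "y \<in> diff_domain W r h" by (auto simp: diff_domain_def)
 qed
 with e(1) show "\<exists>e>0. ball x e \<subseteq> diff_domain W r h" by blast
qed

text \<open>Cells of side \<open>g\<close> at the corner \<open>a\<close> are compared with the
  whole chart block of scale \<open>h\<close>. The factor \<open>(h / g) ^ d\<close> is the
  Jacobian, the price for bounding a small block by the large one. Since \<open>y + h L v\<close>
  stays in \<open>W\<close> over the block, the indicator of \<open>diff_domain\<close> is 1 for all
  differences on the left.\<close>

lemma diff_energy_le_local_energy:
 fixes f :: "'a::euclidean_space => real"
 assumes L: "linear L" and f [measurable]: "borel_fun f" and W: "open W"
  and g: "0 < g" and h: "0 < h"
  and a: "\<And>b. b \<in> Basis ==> 0 <= a \<bullet> b \<and> a \<bullet> b + (g / h) * (real N + 1) <= R"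
  and sub: "\<And>v. v \<in> block R ==> y + h *\<^sub>R L v \<in> W"
 shows "diff_energy r N (\<lambda>v. f (y + h *\<^sub>R L a + g *\<^sub>R L v)) <=
   ennreal ((h / g) ^ DIM('a)) * local_energy r W L R h f g y" unfolding diff_energy_def local_energy_def sum_distrib_left
proof (rule sum_mono)
 fix b :: 'a assume b: "b \<in> Basis"
 have [measurable]: "borel_fun L" by (rule borel_measurable_linear[OF L])
 have [measurable]: "diff_domain W r (g *\<^sub>R L b) \<in> sets borel" using open_diff_domain[OF W] by auto
 define G where "G v = indicator (block R) v *
   ennreal ((indicator (diff_domain W r (g *\<^sub>R L b)) (y + h *\<^sub>R L v) *
    fwd_diff r (g *\<^sub>R L b) f (y + h *\<^sub>R L v))^2)" for v
 have G [measurable]: "borel_fun G" unfolding G_def by measurable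
 let ?B = "{v \<in> block (real N + 1). v \<bullet> b < real N + 1 - real r}"
 have "(\<integral>\<^sup>+v. indicator ?B v * ennreal ((fwd_diff r b (\<lambda>v. f (y + h *\<^sub>R L a + g *\<^sub>R L v)) v)^2) \<partial>lborel)
   <= (\<integral>\<^sup>+v. G (a + (g / h) *\<^sub>R v) \<partial>lborel)"
 proof (rule nn_integral_mono)
  fix v :: 'a
  let ?u = "a + (g / h) *\<^sub>R v"
  let ?z = "y + h *\<^sub>R L a + g *\<^sub>R L v"
  have z: "y + h *\<^sub>R L ?u = ?z" using h by (simp add: linear_add[OF L] linear_cmul[OF L] algebra_simps)
  show "indicator ?B v * ennreal ((fwd_diff r b (\<lambda>v. f (y + h *\<^sub>R L a + g *\<^sub>R L v)) v)^2) <= G ?u"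
  proof (cases "v \<in> ?B")
   case True
   \<comment> \<open>For \<open>v\<close> in \<open>?B\<close> the segment from \<open>v\<close> to
     \<open>v + r b\<close> stays in the block of size \<open>N + 1\<close>, so its image stays in
     \<open>block R\<close>, and the chart takes it into \<open>W\<close>.\<close>
   have blk: "a + (g / h) *\<^sub>R (v + t *\<^sub>R b) \<in> block R" if t: "0 <= t" "t <= real r" for t
   proof -
    have "0 <= (a + (g / h) *\<^sub>R (v + t *\<^sub>R b)) \<bullet> c \<and> (a + (g / h) *\<^sub>R (v + t *\<^sub>R b)) \<bullet> c < R" if c: "c \<in> Basis" for c
    proof -
     have vc: "0 <= (v + t *\<^sub>R b) \<bullet> c" "(v + t *\<^sub>R b) \<bullet> c < real N + 1"
      using True b c t by (auto simp: block_def inner_simps inner_Basis)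
     have "0 <= (g / h) * ((v + t *\<^sub>R b) \<bullet> c)" using vc g h by (intro mult_nonneg_nonneg) auto
     moreover have "(g / h) * ((v + t *\<^sub>R b) \<bullet> c) < (g / h) * (real N + 1)" using vc g h by (intro mult_strict_left_mono) auto
     ultimately show ?thesis using a[OF c] by (simp only: inner_add_left inner_scaleR_left) linarith
    qed
    thus ?thesis by (auto simp: block_def)
   qed
   have "?z \<in> diff_domain W r (g *\<^sub>R L b)"
   proof -
    have "?z + t *\<^sub>R (g *\<^sub>R L b) \<in> W" if t: "0 <= t" "t <= real r" for t
    proof -
     have "y + h *\<^sub>R L (a + (g / h) *\<^sub>R (v + t *\<^sub>R b)) = ?z + t *\<^sub>R (g *\<^sub>R L b)"
      using h by (simp add: linear_add[OF L] linear_cmul[OF L] algebra_simps)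
     with sub[OF blk[OF t]] show ?thesis by simp
    qed
    note * = this
    have "closed_segment ?z (?z + real r *\<^sub>R (g *\<^sub>R L b)) \<subseteq> W"
    proof
     fix p assume "p \<in> closed_segment ?z (?z + real r *\<^sub>R (g *\<^sub>R L b))"
     then obtain u where u: "0 <= u" "u <= 1" "p = ?z + (u * real r) *\<^sub>R (g *\<^sub>R L b)"
      by (auto simp: closed_segment_def algebra_simps)
     have "u * real r <= real r" using u by (simp add: mult_left_le_one_le)
     thus "p \<in> W" using u * by auto
    qed
    with *[of 0] show ?thesis by (simp add: diff_domain_def)
   qed
   moreover have "?u \<in> block R" using blk[of 0] by simp
   ultimately show ?thesis using True by (simp add: G_def z fwd_diff_linear[OF L])
  qed simp
 qed
 also have "\<dots> = ennreal ((h / g) ^ DIM('a)) * (ennreal (\<bar>g / h\<bar> ^ DIM('a)) * (\<integral>\<^sup>+v. G (a + (g / h) *\<^sub>R v) \<partial>lborel))"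
 proof -
  have "ennreal ((h / g) ^ DIM('a)) * ennreal (\<bar>g / h\<bar> ^ DIM('a)) = 1"
   using h g by (subst ennreal_mult[symmetric]) (auto simp flip: power_mult_distrib)
  thus ?thesis by (simp add: mult.assoc[symmetric])
 qed
 also have "ennreal (\<bar>g / h\<bar> ^ DIM('a)) * (\<integral>\<^sup>+v. G (a + (g / h) *\<^sub>R v) \<partial>lborel) = (\<integral>\<^sup>+v. G v \<partial>lborel)"
  using nn_integral_lborel_affine[OF G, of "g / h" a] h g by simp
 finally show "(\<integral>\<^sup>+v. indicator ?B v * ennreal ((fwd_diff r b (\<lambda>v. f (y + h *\<^sub>R L a + g *\<^sub>R L v)) v)^2) \<partial>lborel)
  <= ennreal ((h / g) ^ DIM('a)) * (\<integral>\<^sup>+v. indicator (block R) v *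
   ennreal ((indicator (diff_domain W r (g *\<^sub>R L b)) (y + h *\<^sub>R L v) *
    fwd_diff r (g *\<^sub>R L b) f (y + h *\<^sub>R L v))^2) \<partial>lborel)" by (simp add: G_def)
qed

text \<open>Telescoping, then Cauchy-Schwarz with the weights \<open>q ^ k\<close> and
  \<open>(1 / q) ^ k\<close>; the first sum is at most the geometric series.\<close>

lemma chain_square_le:
 fixes P :: "nat => real"
 assumes P: "P \<longlonglongrightarrow> L" and q: "0 < q" "q < 1"
 shows "ennreal ((L - P 0)^2) <= ennreal (1 / (1 - q)) * (\<Sum>k. ennreal ((1 / q) ^ k * (P (Suc k) - P k)^2))"
proof -
 define T where "T = ennreal (1 / (1 - q)) * (\<Sum>k. ennreal ((1 / q) ^ k * (P (Suc k) - P k)^2))"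
 have part: "ennreal ((P K - P 0)^2) <= T" for K
 proof -
  have sq: "sqrt q ^ k * sqrt (1 / q) ^ k = 1" for k using q by (simp add: power_mult_distrib[symmetric] real_sqrt_mult[symmetric])
  have "P K - P 0 = (\<Sum>k<K. P (Suc k) - P k)" by (rule sum_lessThan_telescope[symmetric])
  also have "\<dots> = (\<Sum>k<K. sqrt q ^ k * (sqrt (1 / q) ^ k * (P (Suc k) - P k)))"
   by (intro sum.cong refl) (simp only: mult.assoc[symmetric] sq mult_1)
  finally have "(P K - P 0)^2 <= (\<Sum>k<K. (sqrt q ^ k)^2) * (\<Sum>k<K. (sqrt (1 / q) ^ k * (P (Suc k) - P k))^2)"
   by (simp only: Cauchy_Schwarz_ineq_sum)
  also have "\<dots> = (\<Sum>k<K. q ^ k) * (\<Sum>k<K. (1 / q) ^ k * (P (Suc k) - P k)^2)"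
   using q by (simp add: power_mult_distrib power_mult[symmetric] mult.commute[of _ 2] power_mult)
  also have "\<dots> <= 1 / (1 - q) * (\<Sum>k<K. (1 / q) ^ k * (P (Suc k) - P k)^2)"
  proof (rule mult_right_mono)
   have "(\<Sum>k<K. q ^ k) = (1 - q ^ K) / (1 - q)" using q by (simp add: sum_gp_strict)
   also have "\<dots> <= 1 / (1 - q)" using q by (intro divide_right_mono) auto
   finally show "(\<Sum>k<K. q ^ k) <= 1 / (1 - q)" .
  qed (use q in \<open>auto intro!: sum_nonneg\<close>)
  finally have "ennreal ((P K - P 0)^2) <= ennreal (1 / (1 - q) * (\<Sum>k<K. (1 / q) ^ k * (P (Suc k) - P k)^2))" by (rule ennreal_leI)
  also have "\<dots> = ennreal (1 / (1 - q)) * (\<Sum>k<K. ennreal ((1 / q) ^ k * (P (Suc k) - P k)^2))"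
   using q by (subst ennreal_mult) (auto intro!: sum_nonneg)
  also have "\<dots> <= T" unfolding T_def by (intro mult_left_mono sum_le_suminf) auto
  finally show ?thesis .
 qed
 have "(\<lambda>K. ennreal ((P K - P 0)^2)) \<longlonglongrightarrow> ennreal ((L - P 0)^2)" by (intro tendsto_ennrealI tendsto_intros P)
 hence "ennreal ((L - P 0)^2) <= T" by (rule LIMSEQ_le_const2) (use part in auto)
 thus ?thesis by (simp add: T_def)
qed

text \<open>\<open>a k\<close> is the corner of the cells of mesh \<open>1 / 2 ^ k\<close>,
  \<open>x k\<close> is the position of a tracked point relative to it in units of the mesh, and
  \<open>d k\<close> are the digits of the refinement. The relations make
  \<open>a k + x k / 2 ^ k\<close> the same point for all \<open>k\<close>.\<close>

abbreviation dyadic_digits :: "(nat => 'a::euclidean_space) => (nat => 'a) => (nat => 'a => nat) => bool" where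
 "dyadic_digits a x d \<equiv>
  \<forall>k. \<forall>b\<in>Basis. d k b <= (1 :: nat) \<and> -1 <= x k \<bullet> b \<and> x k \<bullet> b
  <= 0 \<and> x (Suc k) \<bullet> b = 2 * (x k \<bullet> b) + d k b \<and> a k \<bullet> b = a (Suc k)
  \<bullet> b + d k b / 2 ^ Suc k"

abbreviation chain_step :: "nat => real => ('a::euclidean_space => real) => ('a => 'a) => 'a set => real => real => 'a => (nat => 'a) => (nat => 'a) => (nat => 'a => nat) => bool" where
 "chain_step r C f L W h R y a x d \<equiv>
  linear L --> borel_fun f --> open W --> 0 < h -->
  (\<forall>v\<in>block R. y + h *\<^sub>R L v \<in> W) --> (\<forall>k. integrable lborel
  (\<lambda>v. indicator (block (real (2 * r) + 1)) v * f (y + h *\<^sub>R L (a k) + (h / 2 ^ k) *\<^sub>R L v)))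
  --> (\<forall>k. \<forall>b\<in>Basis. 0 <= a k \<bullet> b \<and> a k \<bullet> b + (1 / 2 ^
  k) * (real (2 * r) + 1) <= R) --> dyadic_digits a x d --> (\<forall>k. ennreal
  ((local_poly r (\<lambda>v. f (y + h *\<^sub>R L (a (Suc k)) + (h / 2 ^ Suc k) *\<^sub>R L v)) (x (Suc k)) -
  local_poly r (\<lambda>v. f (y + h *\<^sub>R L (a k) + (h / 2 ^ k) *\<^sub>R L v)) (x k))^2) <= ennreal (C *
  (2 ^ k) ^ DIM('a)) * local_energy r W L R h f (h / 2 ^ Suc k) y)"

text \<open>One refinement step at scale \<open>h / 2 ^ k\<close>, expressed over the fixed block
  \<open>R\<close>. The Jacobian \<open>(2 ^ Suc k) ^ d\<close> of this localisation is split into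
  the constant \<open>2 ^ d\<close> and the factor \<open>(2 ^ k) ^ d\<close>.\<close>

lemma local_poly_chain:
 assumes r: "1 <= r"
 shows "\<exists>C>0. \<forall>(f :: 'a::euclidean_space => real) L W h R y a x o'.
  chain_step r C f L W h R y a x o'"
proof -
 obtain C where C: "C > 0" and main: "\<forall>(F :: 'a => real) a x.
  refine_bound r C F a x" using local_poly_refine[OF r, where ?'a = 'a] by (elim exE conjE) (rule that)
 show ?thesis
 proof (intro exI[of _ "C * 2 ^ DIM('a)"] conjI allI impI)
  show "0 < C * 2 ^ DIM('a)" using C by simp
  fix f :: "'a => real" and L W h R and y :: 'a and a x :: "nat => 'a" and o' :: "nat => 'a => nat" and k
  assume L: "linear L" and f [measurable]: "borel_fun f" and W: "open W" and h: "0 < h"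
   and sub: "\<forall>v\<in>block R. y + h *\<^sub>R L v \<in> W"
   and int: "\<forall>k. integrable lborel (\<lambda>v. indicator (block (real (2 * r) + 1)) v * f (y + h *\<^sub>R L (a k) + (h / 2 ^ k) *\<^sub>R L v))"
   and a: "\<forall>k. \<forall>b\<in>Basis. 0 <= a k \<bullet> b \<and> a k \<bullet> b + (1 / 2 ^ k) * (real (2 * r) + 1) <= R"
   and x: "dyadic_digits a x o'"
  have [measurable]: "borel_fun L" by (rule borel_measurable_linear[OF L])
  define F where "F v = f (y + h *\<^sub>R L (a (Suc k)) + (h / 2 ^ Suc k) *\<^sub>R L v)" for v
  let ?o = "\<Sum>b\<in>Basis. real (o' k b) *\<^sub>R b"
  have xb: "x (Suc k) \<bullet> b = 2 * (x k \<bullet> b) + real (o' k b)"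
   and ab: "a k \<bullet> b = a (Suc k) \<bullet> b + real (o' k b) / 2 ^ Suc k" if "b \<in> Basis" for b using x that by blast+
  have xk: "2 *\<^sub>R x k + ?o = x (Suc k)" by (rule euclidean_eqI) (simp add: inner_simps inner_sum_left_Basis xb)
  have ak: "a k = a (Suc k) + (1 / 2 ^ Suc k) *\<^sub>R ?o" by (rule euclidean_eqI) (simp add: inner_simps inner_sum_left_Basis ab del: power_Suc)
  \<comment> \<open>The function of level \<open>Suc k\<close>, read on the grid of double mesh with
    offset \<open>?o\<close>, is the function of level \<open>k\<close>.\<close>
  have F_coarse: "F (?o + 2 *\<^sub>R v) = f (y + h *\<^sub>R L (a k) + (h / 2 ^ k) *\<^sub>R L v)" for v
   unfolding F_def ak using h by (simp add: linear_add[OF L] linear_cmul[OF L] scaleR_add_right add.assoc)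
  have "ennreal ((local_poly r F (2 *\<^sub>R x k + ?o) - local_poly r (\<lambda>v. F (?o + 2 *\<^sub>R v)) (x k))^2)
    <= ennreal C * diff_energy r (2 * r) F"
  proof (rule main[rule_format])
   show "borel_fun F" unfolding F_def by measurable
   show "integrable lborel (\<lambda>v. indicator (block (real (2 * r) + 1)) v * F v)" using int[rule_format, of "Suc k"] by (simp add: F_def)
   fix b :: 'a assume b: "b \<in> Basis"
   show "o' k b <= 1 \<and> -1 <= x k \<bullet> b \<and> x k \<bullet> b <= 0 \<and> -1 <= 2 * (x k \<bullet> b) + real (o' k b) \<and> 2 * (x k \<bullet> b) + real (o' k b) <= 0"
    using x b xb[OF b] by metis
  qed
  also have "diff_energy r (2 * r) F <= ennreal ((h / (h / 2 ^ Suc k)) ^ DIM('a)) * local_energy r W L R h f (h / 2 ^ Suc k) y"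
   unfolding F_def using sub a[rule_format, of _ "Suc k"] h by (intro diff_energy_le_local_energy L f W) auto
  also have "(h / (h / 2 ^ Suc k)) ^ DIM('a) = 2 ^ DIM('a) * (2 ^ k) ^ DIM('a)" using h by (simp add: power_mult_distrib)
  finally have "ennreal ((local_poly r F (2 *\<^sub>R x k + ?o) - local_poly r (\<lambda>v. F (?o + 2 *\<^sub>R v)) (x k))^2)
    <= ennreal C * (ennreal (2 ^ DIM('a) * (2 ^ k) ^ DIM('a)) * local_energy r W L R h f (h / 2 ^ Suc k) y)" by (simp add: mult_left_mono)
  thus "ennreal ((local_poly r (\<lambda>v. f (y + h *\<^sub>R L (a (Suc k)) + (h / 2 ^ Suc k) *\<^sub>R L v)) (x (Suc k)) -
    local_poly r (\<lambda>v. f (y + h *\<^sub>R L (a k) + (h / 2 ^ k) *\<^sub>R L v)) (x k))^2) <=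
    ennreal (C * 2 ^ DIM('a) * (2 ^ k) ^ DIM('a)) * local_energy r W L R h f (h / 2 ^ Suc k) y"
   unfolding xk F_coarse using C by (simp add: F_def[abs_def] ennreal_mult' mult.assoc)
 qed
qed

lemma emeasure_block_le: "0 <= R ==> emeasure lborel (block R :: 'a::euclidean_space set) <= ennreal (R ^ DIM('a))"
proof -
 assume R: "0 <= R"
 have "block R \<subseteq> cbox (0 :: 'a) (R *\<^sub>R One)" by (fastforce simp: block_def mem_box)
 hence "emeasure lborel (block R :: 'a set) <= emeasure lborel (cbox (0 :: 'a) (R *\<^sub>R One))" by (intro emeasure_mono) auto
 also have "\<dots> = ennreal (R ^ DIM('a))" using R by (subst emeasure_lborel_cbox) auto
 finally show ?thesis .
qed

lemma borel_measurable_local_energy: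
 fixes f :: "'a::euclidean_space => real"
 assumes L: "linear L" and f [measurable]: "borel_fun f" and W: "open W"
 shows "local_energy r W L R h f z \<in> borel_measurable borel"
proof -
 have [measurable]: "borel_fun L" by (rule borel_measurable_linear[OF L])
 have [measurable]: "diff_domain W r w \<in> sets borel" for w using open_diff_domain[OF W] by auto
 show ?thesis unfolding local_energy_def[abs_def] by measurable
qed

text \<open>Fubini, with the integral over \<open>y\<close> taken first: translation invariance
  removes both \<open>h\<close> and \<open>v\<close>, and the integral over \<open>v\<close>
  contributes only the volume of the block.\<close>

lemma nn_integral_local_energy_le:
 fixes f :: "'a::euclidean_space => real"
 assumes L: "linear L" and f [measurable]: "borel_fun f" and W: "open W" and R: "0 <= R"
 shows "(\<integral>\<^sup>+y. local_energy r W L R h f g y \<partial>lborel) <=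
  ennreal (R ^ DIM('a)) * (\<Sum>b\<in>Basis. sq_int (\<lambda>z. indicator (diff_domain W r (g *\<^sub>R L b)) z *
    fwd_diff r (g *\<^sub>R L b) f z))"
proof -
 have [measurable]: "borel_fun L" by (rule borel_measurable_linear[OF L])
 have [measurable]: "diff_domain W r w \<in> sets borel" for w using open_diff_domain[OF W] by auto
 define G where "G b z = ennreal ((indicator (diff_domain W r (g *\<^sub>R L b)) z * fwd_diff r (g *\<^sub>R L b) f z)^2)" for b z
 have G [measurable]: "G b \<in> borel_measurable borel" for b unfolding G_def[abs_def] by measurable
 have "(\<integral>\<^sup>+y. local_energy r W L R h f g y \<partial>lborel) =
   (\<Sum>b\<in>Basis. \<integral>\<^sup>+y. \<integral>\<^sup>+v. indicator (block R) v * G b (y + h *\<^sub>R L v) \<partial>lborel \<partial>lborel)"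
  unfolding local_energy_def G_def[symmetric] by (rule nn_integral_sum) measurable
 also have "\<dots> = (\<Sum>b\<in>Basis. \<integral>\<^sup>+v. \<integral>\<^sup>+y. indicator (block R) v * G b (y + h *\<^sub>R L v) \<partial>lborel \<partial>lborel)"
  by (intro sum.cong refl lborel_pair.Fubini') measurable
 also have "\<dots> = (\<Sum>b\<in>Basis. \<integral>\<^sup>+v. indicator (block R) (v :: 'a) * (\<integral>\<^sup>+z. G b z \<partial>lborel) \<partial>lborel)"
  by (intro sum.cong refl nn_integral_cong) (simp add: nn_integral_cmult nn_integral_lborel_translation)
 also have "\<dots> = emeasure lborel (block R :: 'a set) * (\<Sum>b\<in>Basis. \<integral>\<^sup>+z. G b z \<partial>lborel)"
  by (simp add: nn_integral_multc sum_distrib_left)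
 also have "\<dots> <= ennreal (R ^ DIM('a)) * (\<Sum>b\<in>Basis. \<integral>\<^sup>+z. G b z \<partial>lborel)"
  by (intro mult_right_mono emeasure_block_le R) simp
 finally show ?thesis by (simp add: G_def)
qed

text \<open>The one property through which the smoothness of \<open>f\<close> enters the sampling
  estimate. It is available on the Sobolev and the Besov scale alike, and a bound by a single power
  of the step can be summed over dyadic steps.\<close>

definition diff_bounded :: "nat => real => 'a::euclidean_space set => real => ('a => real) => bool" where
 "diff_bounded r m W M f \<longleftrightarrow> (\<forall>w. sq_int (\<lambda>z. indicator (diff_domain W r w) z * fwd_diff r w f z)
   <= ennreal ((M * norm w powr m)^2))"

lemma nn_integral_local_energy_diff_bounded:
 fixes f :: "'a::euclidean_space => real"
 assumes L: "linear L" and f: "borel_fun f" and W: "open W" and R: "0 <= R"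
  and M: "diff_bounded r m W M f" and z: "0 < z"
 shows "(\<integral>\<^sup>+y. local_energy r W L R h f z y \<partial>lborel) <=
  ennreal (R ^ DIM('a) * (\<Sum>b\<in>Basis. (norm (L b) powr m)^2) * M^2 * (z powr m)^2)"
proof -
 have "(\<integral>\<^sup>+y. local_energy r W L R h f z y \<partial>lborel) <=
   ennreal (R ^ DIM('a)) * (\<Sum>b\<in>Basis. ennreal ((M * norm (z *\<^sub>R L b) powr m)^2))"
  by (rule order_trans[OF nn_integral_local_energy_le[OF L f W R]])
   (intro mult_left_mono sum_mono M[unfolded diff_bounded_def, rule_format], simp)
 also have "(\<Sum>b\<in>Basis. ennreal ((M * norm (z *\<^sub>R L b) powr m)^2)) =
   ennreal (\<Sum>b\<in>Basis. (M * norm (z *\<^sub>R L b) powr m)^2)" by (simp add: sum_ennreal)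
 also have "(\<Sum>b\<in>Basis. (M * norm (z *\<^sub>R L b) powr m)^2) = (\<Sum>b\<in>Basis. (norm (L b) powr m)^2) * M^2 * (z powr m)^2"
  using z by (simp add: powr_mult power_mult_distrib sum_distrib_left mult_ac)
 finally show ?thesis using R by (simp add: ennreal_mult sum_nonneg mult.assoc)
qed

lemma bounded_block: "bounded (block R :: 'a::euclidean_space set)"
proof -
 have "block R \<subseteq> cbox (0 :: 'a) (R *\<^sub>R One)" by (fastforce simp: block_def mem_box)
 thus ?thesis using bounded_cbox bounded_subset by blast
qed

lemma integrable_block_continuous:
 fixes F :: "'a::euclidean_space => real"
 assumes [measurable]: "borel_fun F" and F: "continuous_on (cbox 0 (M *\<^sub>R One)) F" and M: "0 <= M"
 shows "integrable lborel (\<lambda>v. indicator (block M) v * F v)"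
proof -
 have "bounded (F ` cbox 0 (M *\<^sub>R One))" using F compact_cbox by (intro compact_imp_bounded compact_continuous_image)
 then obtain B where B: "\<And>v. v \<in> cbox 0 (M *\<^sub>R One) ==> \<bar>F v\<bar> <= B" by (auto simp: bounded_iff)
 have sub: "block M \<subseteq> cbox (0 :: 'a) (M *\<^sub>R One)" by (fastforce simp: block_def mem_box)
 have "emeasure lborel (block M :: 'a set) < \<infinity>" using emeasure_block_le[OF M, where 'a = 'a] by (rule le_less_trans) simp
 hence "integrable lborel (\<lambda>v :: 'a. indicator (block M) v * B)"
  by (intro integrable_mult_left) (simp add: integrable_indicator_iff borel_block)
 thus ?thesis by (rule Bochner_Integration.integrable_bound)
   (use B sub in \<open>fastforce simp: indicator_def intro!: always_eventually\<close>)+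
qed

text \<open>The cells have size \<open>h / 2 ^ k\<close> and start within a bounded multiple of it
  from \<open>y\<close>, so they shrink to \<open>y\<close>, and continuity makes \<open>g\<close>
  nearly constant on them.\<close>

lemma local_poly_tendsto:
 fixes g :: "'a::euclidean_space => real" and M :: "'a => 'a"
 assumes r: "1 <= r" and M: "linear M" and g [measurable]: "borel_fun g"
  and cont: "isCont g y"
  and x: "\<And>k b. b \<in> Basis ==> -1 <= x k \<bullet> b \<and> x k \<bullet> b <= 0"
  and u: "\<And>k. c k = y + (h / 2 ^ k) *\<^sub>R M (u k)" "bounded (range u)"
 shows "(\<lambda>k. local_poly r (\<lambda>v. g (c k + (h / 2 ^ k) *\<^sub>R M v)) (x k)) \<longlonglongrightarrow> g y"
proof -
 have [measurable]: "borel_fun M" by (rule borel_measurable_linear[OF M])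
 obtain K where K: "K > 0" "\<And>x. -1 <= x ==> x <= 0 ==> (\<Sum>m<r. \<bar>poly (cell_weight r m) x\<bar>) <= K"
  using cell_weight_bounded[of r] by blast
 obtain A where A: "\<And>k. norm (u k) <= A" using u(2) by (auto simp: bounded_iff)
 obtain B where B: "\<And>v :: 'a. v \<in> block (real r) ==> norm v <= B" using bounded_block[of "real r"] unfolding bounded_iff by blast
 have blin: "bounded_linear M" using M by (simp add: linear_conv_bounded_linear)
 then obtain L where L: "L > 0" "\<And>v. norm (M v) <= norm v * L" using bounded_linear.pos_bounded by blast
 show ?thesis
 proof (rule LIMSEQ_I)
  fix e :: real assume e: "e > 0"
  define d where "d = e / (2 * K ^ DIM('a))"
  have d: "d > 0" using e K by (simp add: d_def)
  obtain \<delta> where \<delta>: "\<delta> > 0" "\<And>z. dist z y < \<delta> ==> dist (g z) (g y) < d"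
   using cont d unfolding continuous_at_eps_delta by (metis dist_norm norm_conv_dist)
  have "(\<lambda>k. \<bar>h\<bar> * ((A + B) * L) * (1 / 2) ^ k) \<longlonglongrightarrow> \<bar>h\<bar> * ((A + B) * L) * 0"
   by (intro tendsto_mult tendsto_const LIMSEQ_realpow_zero) auto
  hence "\<forall>\<^sub>F k in sequentially. \<bar>h\<bar> * ((A + B) * L) * (1 / 2) ^ k < \<delta>"
   using \<delta>(1) by (simp add: order_tendstoD)
  then obtain k0 where k0: "\<And>k. k \<ge> k0 ==> \<bar>h\<bar> * ((A + B) * L) * (1 / 2) ^ k < \<delta>" by (auto simp: eventually_sequentially)
  have "norm (local_poly r (\<lambda>v. g (c k + (h / 2 ^ k) *\<^sub>R M v)) (x k) - g y) < e" if k: "k \<ge> k0" for k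
  proof -
   have near: "\<bar>g (c k + (h / 2 ^ k) *\<^sub>R M v) - g y\<bar> <= d" if v: "v \<in> block (real r)" for v
   proof -
    have eq: "c k + (h / 2 ^ k) *\<^sub>R M v - y = (h / 2 ^ k) *\<^sub>R M (u k + v)" by (simp add: u linear_add[OF M] scaleR_add_right)
    have "dist (c k + (h / 2 ^ k) *\<^sub>R M v) y = \<bar>h / 2 ^ k\<bar> * norm (M (u k + v))" unfolding dist_norm eq by simp
    also have "\<dots> <= \<bar>h / 2 ^ k\<bar> * ((A + B) * L)"
    proof (rule mult_left_mono)
     have "norm (u k + v) <= A + B" using norm_triangle_le A[of k] B[OF v] by (meson add_mono order_trans norm_triangle_ineq)
     thus "norm (M (u k + v)) <= (A + B) * L" using L by (meson mult_right_mono less_imp_le order_trans)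
    qed simp
    also have "\<dots> = \<bar>h\<bar> * ((A + B) * L) * (1 / 2) ^ k" by (simp add: power_divide abs_mult)
    also have "\<dots> < \<delta>" using k0[OF k] .
    finally show ?thesis using \<delta>(2)[of "c k + (h / 2 ^ k) *\<^sub>R M v"] by (simp add: dist_real_def less_imp_le)
   qed
   have "\<bar>local_poly r (\<lambda>v. g (c k + (h / 2 ^ k) *\<^sub>R M v)) (x k) - g y\<bar> <= K ^ DIM('a) * d"
    by (rule local_poly_near_const[OF K(2) r _ x near]) (use d in auto)
   also have "\<dots> = e / 2" using K by (simp add: d_def)
   finally show ?thesis using e by simp
  qed
  thus "\<exists>no. \<forall>k\<ge>no. norm (local_poly r (\<lambda>v. g (c k + (h / 2 ^ k) *\<^sub>R M v)) (x k) - g y) < e" by blast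
 qed
qed

definition scaled_lattice :: "real => 'a::euclidean_space set" where
 "scaled_lattice h = {p. \<forall>b\<in>Basis. \<exists>j :: int. p \<bullet> b = h * of_int j}"

text \<open>The factor \<open>2 ^ d / q\<close> is the price for summing squares over the scales \<open>h / 2 ^ k\<close> by the
 weighted Cauchy--Schwarz inequality.\<close>

definition chain_energy ::
 "nat => 'a::euclidean_space set => ('a => 'a) => real => real => ('a => real) => real => 'a => ennreal" where
 "chain_energy r W L R h f q y =
   (\<Sum>k. ennreal ((2 ^ DIM('a) / q) ^ k) * local_energy r W L R h f (h / 2 ^ Suc k) y)"

text \<open>At level \<open>k\<close> the weight \<open>(2 ^ d / q) ^ k\<close> meets the squared
  difference bound, of order \<open>2 powr (- 2 m k)\<close>. For this \<open>q\<close> the product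
  is \<open>q ^ k\<close>, and \<open>q < 1\<close> because \<open>m > d / 2\<close>.\<close>

lemma nn_integral_chain_energy_le:
 fixes f :: "'a::euclidean_space => real"
 assumes L: "linear L" and f: "borel_fun f" and W: "open W" and R: "0 <= R"
  and M: "diff_bounded r m W M f" and h: "0 < h" and m: "real DIM('a) / 2 < m"
  and q: "q = 2 powr (real DIM('a) / 2 - m)"
 shows "(\<integral>\<^sup>+y. chain_energy r W L R h f q y \<partial>lborel) <=
  ennreal (R ^ DIM('a) * (\<Sum>b\<in>Basis. (norm (L b) powr m)^2) / (1 - q) * M^2 * (h powr m)^2)"
proof -
 have q01: "0 < q" "q < 1" using m unfolding q by (auto simp: powr_less_one)
 define A where "A = R ^ DIM('a) * (\<Sum>b\<in>Basis. (norm (L b) powr m)^2)"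
 have A: "0 <= A" using R by (simp add: A_def sum_nonneg)
 have [measurable]: "local_energy r W L R h f z \<in> borel_measurable borel" for z by (rule borel_measurable_local_energy[OF L f W])
 have term_le: "(\<integral>\<^sup>+y. ennreal ((2 ^ DIM('a) / q) ^ k) * local_energy r W L R h f (h / 2 ^ Suc k) y \<partial>lborel)
   <= ennreal (A * M^2 * (h powr m)^2 * q ^ k)" for k
 proof -
  have "(\<integral>\<^sup>+y. ennreal ((2 ^ DIM('a) / q) ^ k) * local_energy r W L R h f (h / 2 ^ Suc k) y \<partial>lborel)
    = ennreal ((2 ^ DIM('a) / q) ^ k) * (\<integral>\<^sup>+y. local_energy r W L R h f (h / 2 ^ Suc k) y \<partial>lborel)"
   by (rule nn_integral_cmult) measurable
  also have "\<dots> <= ennreal ((2 ^ DIM('a) / q) ^ k) * ennreal (A * M^2 * ((h / 2 ^ Suc k) powr m)^2)"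
   unfolding A_def using h by (intro mult_left_mono nn_integral_local_energy_diff_bounded L f W R M) auto
  also have "\<dots> = ennreal ((2 ^ DIM('a) / q) ^ k * (A * M^2 * ((h / 2 ^ Suc k) powr m)^2))" using A q01 by (intro ennreal_mult[symmetric]) auto
  also have "\<dots> <= ennreal (A * M^2 * (h powr m)^2 * q ^ k)"
  proof (rule ennreal_leI)
   \<comment> \<open>The gain from the additional halving in \<open>Suc k\<close> is given
     away.\<close>
   have "(h / 2 ^ Suc k) powr m <= (h / 2 ^ k) powr m"
    using h m by (intro powr_mono2) (auto simp: field_simps intro: order_trans[OF _ less_imp_le])
   also have "(h / 2 ^ k) powr m = h powr m * (2 powr - m) ^ k"
   proof -
    have "((2 :: real) ^ k) powr m = (2 powr m) ^ k" by (simp add: powr_realpow[symmetric] powr_powr mult.commute)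
    hence "(h / 2 ^ k) powr m = h powr m / (2 powr m) ^ k" using h by (simp add: powr_divide)
    thus ?thesis by (simp add: powr_minus power_inverse divide_inverse)
   qed
   finally have "((h / 2 ^ Suc k) powr m)^2 <= (h powr m * (2 powr - m) ^ k)^2" by (intro power_mono) auto
   also have "\<dots> = (h powr m)^2 * ((2 powr - m)^2) ^ k" by (simp add: power_mult_distrib power_mult[symmetric] mult.commute)
   finally have 1: "((h / 2 ^ Suc k) powr m)^2 <= (h powr m)^2 * ((2 powr - m)^2) ^ k" .
   \<comment> \<open>\<open>q\<close> is the square root of the ratio
     \<open>2 ^ d * 2 powr (- 2 m)\<close> of consecutive terms before weighting.\<close>
   have "q * q = 2 ^ DIM('a) * (2 powr - m)^2" unfolding q power2_eq_square by (simp add: powr_add[symmetric] powr_realpow[symmetric] mult.assoc)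
   hence 2: "(2 ^ DIM('a) / q) * (2 powr - m)^2 = q" using q01 by (simp add: field_simps)
   have "(2 ^ DIM('a) / q) ^ k * (A * M^2 * ((h / 2 ^ Suc k) powr m)^2)
     <= (2 ^ DIM('a) / q) ^ k * (A * M^2 * ((h powr m)^2 * ((2 powr - m)^2) ^ k))" using A q01 by (intro mult_left_mono 1) auto
   also have "\<dots> = A * M^2 * (h powr m)^2 * ((2 ^ DIM('a) / q) * (2 powr - m)^2) ^ k" by (simp only: power_mult_distrib mult_ac)
   finally show "(2 ^ DIM('a) / q) ^ k * (A * M^2 * ((h / 2 ^ Suc k) powr m)^2) <= A * M^2 * (h powr m)^2 * q ^ k" unfolding 2 .
  qed
  finally show ?thesis .
 qed
 have "(\<integral>\<^sup>+y. chain_energy r W L R h f q y \<partial>lborel) =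
   (\<Sum>k. \<integral>\<^sup>+y. ennreal ((2 ^ DIM('a) / q) ^ k) * local_energy r W L R h f (h / 2 ^ Suc k) y \<partial>lborel)"
  unfolding chain_energy_def by (rule nn_integral_suminf) measurable
 also have "\<dots> <= (\<Sum>k. ennreal (A * M^2 * (h powr m)^2 * q ^ k))" by (intro suminf_le term_le summableI)
 also have "\<dots> = ennreal (\<Sum>k. A * M^2 * (h powr m)^2 * q ^ k)" using A q01 by (intro suminf_ennreal2 summable_mult summable_geometric) auto
 also have "(\<Sum>k. A * M^2 * (h powr m)^2 * q ^ k) = A / (1 - q) * M^2 * (h powr m)^2"
  using q01 by (subst suminf_mult) (auto simp: suminf_geometric intro: summable_geometric)
 finally show ?thesis by (simp add: A_def)
qed

text \<open>The strict inequality \<open>a \<bullet> b + s * M < R\<close> keeps the closed cube,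
  and not merely the half-open block, inside the chart, so that \<open>g\<close> is continuous on a
  compact set there.\<close>

lemma integrable_chart_block:
 fixes g :: "'a::euclidean_space => real" and L :: "'a => 'a"
 assumes L: "linear L" and g [measurable]: "borel_fun g" and cont: "continuous_on W g"
  and sub: "\<forall>v\<in>block R. y + h *\<^sub>R L v \<in> W"
  and a: "\<And>b. b \<in> Basis ==> 0 <= a \<bullet> b" "\<And>b. b \<in> Basis ==> a \<bullet> b + s * M < R" and s: "0 <= s" and M: "0 <= M"
 shows "integrable lborel (\<lambda>v. indicator (block M) v * g (y + h *\<^sub>R L a + (h * s) *\<^sub>R L v))"
proof (rule integrable_block_continuous[OF _ _ M])
 have [measurable]: "borel_fun L" by (rule borel_measurable_linear[OF L])
 show "borel_fun (\<lambda>v. g (y + h *\<^sub>R L a + (h * s) *\<^sub>R L v))" by measurable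
 have blin: "bounded_linear L" using L by (simp add: linear_conv_bounded_linear)
 have "y + h *\<^sub>R L a + (h * s) *\<^sub>R L v \<in> W" if v: "v \<in> cbox 0 (M *\<^sub>R One)" for v
 proof -
  have "a + s *\<^sub>R v \<in> block R" unfolding block_def
  proof (intro CollectI ballI)
   fix b :: 'a assume b: "b \<in> Basis"
   have vb: "0 <= v \<bullet> b" "v \<bullet> b <= M" using v b by (auto simp: mem_box)
   have "s * (v \<bullet> b) <= s * M" "0 <= s * (v \<bullet> b)" using vb s by (auto intro!: mult_left_mono)
   thus "0 <= (a + s *\<^sub>R v) \<bullet> b \<and> (a + s *\<^sub>R v) \<bullet> b < R"
    using a[OF b] by (simp only: inner_add_left inner_scaleR_left) linarith
  qed
  hence "y + h *\<^sub>R L (a + s *\<^sub>R v) \<in> W" using sub by blast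
  thus ?thesis by (simp add: linear_add[OF L] linear_cmul[OF L] scaleR_add_right add.assoc)
 qed
 thus "continuous_on (cbox 0 (M *\<^sub>R One)) (\<lambda>v. g (y + h *\<^sub>R L a + (h * s) *\<^sub>R L v))"
  by (intro continuous_on_compose2[OF cont] continuous_intros linear_continuous_on[OF blin]
     continuous_on_compose2[OF linear_continuous_on[OF blin]]) auto
qed

abbreviation chain_limit :: "nat => real => ('a::euclidean_space => real) => ('a => 'a) => 'a set => real => real => 'a => (nat => 'a) => (nat => 'a) => (nat => 'a => nat) => real => 'a => bool" where
 "chain_limit r C g L W h R y a x d q p \<equiv>
  linear L --> borel_fun g --> continuous_on W g --> open W
  --> 0 < h --> 0 < q --> q < 1 --> (\<forall>v\<in>block
  R. y + h *\<^sub>R L v \<in> W) --> (\<forall>k. \<forall>b\<in>Basis. 0 <= a k \<bullet> b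
  \<and> a k \<bullet> b + (1 / 2 ^ k) * (real (2 * r) + 1) < R) --> dyadic_digits a x d
  --> (\<forall>k. a k = p - (1 / 2 ^ k) *\<^sub>R x k) --> ennreal ((g (y + h
  *\<^sub>R L p) - local_poly r (\<lambda>v. g (y + h *\<^sub>R L (a 0) + h *\<^sub>R L v)) (x 0))^2) <=
  ennreal (C / (1 - q)) * chain_energy r W L R h g q y"

text \<open>The local polynomials, evaluated at the tracked point, converge to the value of
  \<open>g\<close> there. Hence the error at scale \<open>h\<close> is the sum of all refinement
  steps, estimated by the weighted Cauchy-Schwarz inequality.\<close>

lemma chain_limit_le:
 assumes r: "1 <= r"
 shows "\<exists>C>0. \<forall>(g :: 'a::euclidean_space => real) (L :: 'a => 'a) W h R y a x o' q p.
  chain_limit r C g L W h R y a x o' q p"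
proof -
 obtain C where C: "C > 0" and main: "\<forall>(f :: 'a::euclidean_space => real) L W h R y a x o'.
  chain_step r C f L W h R y a x o'" using local_poly_chain[OF r, where ?'a = 'a] by (elim exE conjE) (rule that)
 show ?thesis
 proof (intro exI[of _ C] conjI allI impI C)
  fix g :: "'a => real" and L :: "'a => 'a" and W h R and y :: 'a and a x :: "nat => 'a" and o' :: "nat => 'a => nat" and q :: real and p
  assume L: "linear L" and g [measurable]: "borel_fun g" and cont: "continuous_on W g"
   and W: "open W" and h: "0 < h" and q: "0 < q" "q < 1"
   and sub: "\<forall>v\<in>block R. y + h *\<^sub>R L v \<in> W"
   and a: "\<forall>k. \<forall>b\<in>Basis. 0 <= a k \<bullet> b \<and> a k \<bullet> b + (1 / 2 ^ k) * (real (2 * r) + 1) < R"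
   and x: "dyadic_digits a x o'"
   and p: "\<forall>k. a k = p - (1 / 2 ^ k) *\<^sub>R x k"
  have [measurable]: "borel_fun L" by (rule borel_measurable_linear[OF L])
  have blin: "bounded_linear L" using L by (simp add: linear_conv_bounded_linear)
  have a': "0 <= a k \<bullet> b" "a k \<bullet> b + (1 / 2 ^ k) * (real (2 * r) + 1) < R" if "b \<in> Basis" for k b using a that by auto
  have x': "-1 <= x k \<bullet> b" "x k \<bullet> b <= 0" if "b \<in> Basis" for k b using x that by auto
  define P where "P k = local_poly r (\<lambda>v. g (y + h *\<^sub>R L (a k) + (h / 2 ^ k) *\<^sub>R L v)) (x k)" for k
  have int: "integrable lborel (\<lambda>v. indicator (block (real (2 * r) + 1)) v * g (y + h *\<^sub>R L (a k) + (h / 2 ^ k) *\<^sub>R L v))" for k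
   using integrable_chart_block[OF L g cont, of R y h "a k" "1 / 2 ^ k" "real (2 * r) + 1"] sub a' by simp
  have step: "ennreal ((P (Suc k) - P k)^2) <= ennreal (C * (2 ^ k) ^ DIM('a)) * local_energy r W L R h g (h / 2 ^ Suc k) y" for k unfolding P_def
  proof (rule main[rule_format])
   show "0 <= a k \<bullet> b \<and> a k \<bullet> b + 1 / 2 ^ k * (real (2 * r) + 1) <= R" if "b \<in> Basis" for k b
    using a'[OF that, of k] by simp
  qed (use L g W h sub int a' x in blast)+
  have "P \<longlonglongrightarrow> g (y + h *\<^sub>R L p)" unfolding P_def
  proof (rule local_poly_tendsto[OF r L g, where u = "\<lambda>k. - x k"])
   show "y + h *\<^sub>R L (a k) = y + h *\<^sub>R L p + (h / 2 ^ k) *\<^sub>R L (- x k)" for k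
    using p by (simp add: linear_diff[OF L] linear_cmul[OF L] linear_neg[OF L] scaleR_diff_right)
   have "range (\<lambda>k. - x k) \<subseteq> cbox 0 One" using x' by (auto simp: mem_box)
   thus "bounded (range (\<lambda>k. - x k))" using bounded_cbox bounded_subset by blast
   \<comment> \<open>In each coordinate \<open>p\<close> lies at most \<open>1 / 2 ^ k\<close> below
     the corner \<open>a k\<close>, and the corners are nonnegative; letting \<open>k\<close> grow
     shows that \<open>p\<close> is nonnegative.\<close>
   have "p \<in> block R" unfolding block_def
   proof (intro CollectI ballI)
    fix b :: 'a assume b: "b \<in> Basis"
    have "(\<lambda>k. a k \<bullet> b + (1 / 2 ^ k) * (x k \<bullet> b)) = (\<lambda>k. p \<bullet> b)" using p by (simp add: inner_simps)
    have pk: "p \<bullet> b = a k \<bullet> b + (1 / 2 ^ k) * (x k \<bullet> b)" for k using p by (simp add: inner_simps)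
    have "p \<bullet> b < R"
    proof -
     have "0 <= 2 * real r + 1" by simp
     have "(1 / 2 ^ 0) * (x 0 \<bullet> b) <= 0" using x'[OF b, of 0] by simp
     thus ?thesis using pk[of 0] a'[OF b, of 0] by simp
    qed
    moreover have "0 <= p \<bullet> b"
    proof (rule ccontr)
     assume "\<not> 0 <= p \<bullet> b"
     then obtain k where k: "(1 / 2 :: real) ^ k < - (p \<bullet> b)" using real_arch_pow_inv[of "- (p \<bullet> b)" "1 / 2"] by auto
     have "- (1 / 2 ^ k) <= (1 / 2 ^ k) * (x k \<bullet> b)" using mult_left_mono[OF x'(1)[OF b, of k], of "1 / 2 ^ k"] by simp
     hence "- ((1 / 2) ^ k) <= p \<bullet> b" using pk[of k] a'(1)[OF b, of k] by (simp add: power_divide)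
     with k show False by linarith
    qed
    ultimately show "0 <= p \<bullet> b \<and> p \<bullet> b < R" by simp
   qed
   hence "y + h *\<^sub>R L p \<in> W" using sub by blast
   thus "isCont g (y + h *\<^sub>R L p)" using cont W continuous_on_eq_continuous_at by blast
  qed (use x' in auto)
  hence "ennreal ((g (y + h *\<^sub>R L p) - P 0)^2) <= ennreal (1 / (1 - q)) * (\<Sum>k. ennreal ((1 / q) ^ k * (P (Suc k) - P k)^2))"
   by (rule chain_square_le[OF _ q])
  also have "\<dots> <= ennreal (1 / (1 - q)) * (\<Sum>k. ennreal C * (ennreal ((2 ^ DIM('a) / q) ^ k) * local_energy r W L R h g (h / 2 ^ Suc k) y))"
  proof (intro mult_left_mono suminf_le summableI)
   fix k
   have "ennreal ((1 / q) ^ k * (P (Suc k) - P k)^2) = ennreal ((1 / q) ^ k) * ennreal ((P (Suc k) - P k)^2)" using q by (intro ennreal_mult) auto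
   also have "\<dots> <= ennreal ((1 / q) ^ k) * (ennreal (C * (2 ^ k) ^ DIM('a)) * local_energy r W L R h g (h / 2 ^ Suc k) y)"
    by (intro mult_left_mono step) auto
   also have "\<dots> = ennreal ((1 / q) ^ k * (C * (2 ^ k) ^ DIM('a))) * local_energy r W L R h g (h / 2 ^ Suc k) y"
    using q C by (subst ennreal_mult) (auto simp: mult.assoc)
   also have "(1 / q) ^ k * (C * (2 ^ k) ^ DIM('a)) = C * (2 ^ DIM('a) / q) ^ k" by (simp add: power_divide power_mult[symmetric] mult.commute)
   also have "ennreal (C * (2 ^ DIM('a) / q) ^ k) = ennreal C * ennreal ((2 ^ DIM('a) / q) ^ k)" using q C by (intro ennreal_mult) auto
   finally show "ennreal ((1 / q) ^ k * (P (Suc k) - P k)^2) <=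
     ennreal C * (ennreal ((2 ^ DIM('a) / q) ^ k) * local_energy r W L R h g (h / 2 ^ Suc k) y)" by (simp add: mult.assoc)
  qed simp
  also have "\<dots> = ennreal (C / (1 - q)) * chain_energy r W L R h g q y"
  proof -
   have "ennreal (C / (1 - q)) = ennreal (1 / (1 - q)) * ennreal C" using q C by (subst ennreal_mult[symmetric]) auto
   thus ?thesis unfolding chain_energy_def by (simp add: mult.assoc)
  qed
  finally show "ennreal ((g (y + h *\<^sub>R L p) - local_poly r (\<lambda>v. g (y + h *\<^sub>R L (a 0) + h *\<^sub>R L v)) (x 0))^2) <=
    ennreal (C / (1 - q)) * chain_energy r W L R h g q y" by (simp add: P_def)
 qed
qed

section \<open>Functions that vanish on a lattice, seen in one chart\<close>

lemma block_scale: "v \<in> block R ==> 0 < h ==> h * R <= l ==> h *\<^sub>R v \<in> block l"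
proof -
 assume v: "v \<in> block R" and h: "0 < h" "h * R <= l"
 have "0 <= h * (v \<bullet> b) \<and> h * (v \<bullet> b) < l" if "b \<in> Basis" for b
 proof -
  have "h * (v \<bullet> b) < h * R" using v h that by (auto simp: block_def)
  also note h(2)
  finally show ?thesis using v h that by (auto simp: block_def)
 qed
 thus ?thesis by (auto simp: block_def)
qed

text \<open>Two kinds of chains meet at scale \<open>h\<close>. One leads from \<open>y\<close> to
  the polynomial on lattice cells in the cone at \<open>y\<close>; the others lead from lattice
  points, where \<open>g\<close> is zero, to the polynomials based there.
  \<open>local_poly_sample\<close> bounds the first polynomial by the latter.\<close>

lemma pointwise_sampling:
 fixes L :: "'a::euclidean_space => 'a"
 assumes r: "1 <= r" and L: "linear L" "bij L" and W: "open W" and q: "0 < q" "q < 1"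
 shows "\<exists>C>0. \<forall>h (g :: 'a => real) y. 0 < h --> borel_fun g --> continuous_on W g -->
  (\<forall>v\<in>block (real (3 * r + 3)). y + h *\<^sub>R L v \<in> W) --> (\<forall>z\<in>W \<inter> L ` scaled_lattice h. g z = 0) -->
  ennreal ((g y)^2) <= ennreal C * (local_energy r W L (real (3 * r + 3)) h g h y +
   chain_energy r W L (real (3 * r + 3)) h g q y)"
proof -
 \<comment> \<open>Leaves room for rounding up to the lattice by at most 1, a lattice shift of at
   most \<open>r - 1\<close> and a block of size \<open>2 r + 1\<close>.\<close>
 define R where "R = real (3 * r + 3)"
 obtain C1 where C1: "C1 > 0" and chain: "\<forall>(g :: 'a::euclidean_space => real) (L :: 'a => 'a) W h R y a x o' q p.
  chain_limit r C1 g L W h R y a x o' q p" using chain_limit_le[OF r, where ?'a = 'a] by (elim exE conjE) (rule that)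
 obtain C2 where C2: "C2 > 0" and sample: "\<forall>(F :: 'a::euclidean_space => real) x.
  sample_bound r C2 F x" using local_poly_sample[OF r, where ?'a = 'a] by (elim exE conjE) (rule that)
 let ?I = "PiE (Basis :: 'a set) (\<lambda>_. {..<r})"
 define D where "D = C1 / (1 - q)"
 have D: "0 < D" using C1 q by (simp add: D_def)
 define C where "C = 2 * C2 + (2 * D + 2 * C2 * (real (card ?I) * D))"
 have C: "0 < C" using C2 D by (simp add: C_def add_pos_nonneg)
 show ?thesis unfolding R_def[symmetric]
 proof (intro exI[of _ C] conjI allI impI C)
  fix h :: real and g :: "'a => real" and y :: 'a
  assume h: "0 < h" and g [measurable]: "borel_fun g" and cont: "continuous_on W g"
   and sub: "\<forall>v\<in>block R. y + h *\<^sub>R L v \<in> W" and zero: "\<forall>z\<in>W \<inter> L ` scaled_lattice h. g z = 0"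
  have [measurable]: "borel_fun L" by (rule borel_measurable_linear[OF L(1)])
  let ?E = "chain_energy r W L R h g q y"
  define y' where "y' = inv L y"
  have y': "L y' = y" using L(2) by (simp add: y'_def bij_is_surj surj_f_inv_f)
  \<comment> \<open>The coordinates of the preimage of \<open>y\<close> in units of
    \<open>h / 2 ^ k\<close>; their integer parts carry the binary expansion.\<close>
  define T where "T k b = y' \<bullet> b * 2 ^ k / h" for k :: nat and b
  define j where "j k b = \<lfloor>T k b\<rfloor>" for k :: nat and b
  \<comment> \<open>The reference vertex is \<open>j + 1\<close>, rounded up. This makes the corner
    \<open>a k\<close> nonnegative, so that all cells lie in the cone at \<open>y\<close>, and it
    puts \<open>x\<close> into \<open>[-1, 0]\<close>.\<close>
  define x where "x k = (\<Sum>b\<in>Basis. (T k b - of_int (j k b) - 1) *\<^sub>R b)" for k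
  define a where "a k = - (1 / 2 ^ k) *\<^sub>R x k" for k
  \<comment> \<open>The complement of the binary digit \<open>j (k + 1) - 2 j k\<close>, because
    positions are measured downwards from the upper vertex.\<close>
  define o' where "o' k b = nat (2 * j k b + 1 - j (Suc k) b)" for k b
  have xb: "x k \<bullet> b = T k b - of_int (j k b) - 1" if "b \<in> Basis" for k b using that by (simp add: x_def inner_sum_left_Basis)
  have x01: "-1 <= x k \<bullet> b" "x k \<bullet> b <= 0" if "b \<in> Basis" for k b unfolding xb[OF that] j_def by linarith+
  have TS: "T (Suc k) b = 2 * T k b" for k b by (simp add: T_def)
  have jS: "j (Suc k) b = 2 * j k b \<or> j (Suc k) b = 2 * j k b + 1" for k b unfolding j_def TS by linarith
  have o1: "o' k b <= 1" for k b using jS[of k b] by (auto simp: o'_def)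
  have or: "real (o' k b) = 2 * of_int (j k b) + 1 - of_int (j (Suc k) b)" for k b using jS[of k b] by (auto simp: o'_def)
  have xS: "x (Suc k) \<bullet> b = 2 * (x k \<bullet> b) + real (o' k b)" if "b \<in> Basis" for k b unfolding xb[OF that] or TS by simp
  have aS: "a k \<bullet> b = a (Suc k) \<bullet> b + real (o' k b) / 2 ^ Suc k" if b: "b \<in> Basis" for k b
   unfolding a_def inner_scaleR_left xS[OF b] by (simp add: field_simps)
  have a01: "0 <= a k \<bullet> b" "a k \<bullet> b <= 1" if b: "b \<in> Basis" for k b
  proof -
   show "0 <= a k \<bullet> b" using x01[OF b, of k] by (simp add: a_def divide_nonpos_pos)
   have "(1 / 2 ^ k) * (- (x k \<bullet> b)) <= 1 * 1" using x01[OF b, of k] by (intro mult_mono) auto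
   thus "a k \<bullet> b <= 1" by (simp add: a_def)
  qed
  have pow: "(1 / 2 ^ k) * (real (2 * r) + 1) <= real (2 * r) + 1" for k by (intro mult_left_le_one_le) auto
  have "ennreal ((g (y + h *\<^sub>R L 0) - local_poly r (\<lambda>v. g (y + h *\<^sub>R L (a 0) + h *\<^sub>R L v)) (x 0))^2) <= ennreal D * ?E"
   unfolding D_def
  proof (rule chain[rule_format])
   show "0 <= a k \<bullet> b \<and> a k \<bullet> b + 1 / 2 ^ k * (real (2 * r) + 1) < R" if "b \<in> Basis" for k b
    using a01[OF that, of k] pow[of k] r by (simp add: R_def)
   show "o' k b <= 1 \<and> -1 <= x k \<bullet> b \<and> x k \<bullet> b <= 0 \<and>
    x (Suc k) \<bullet> b = 2 * (x k \<bullet> b) + o' k b \<and> a k \<bullet> b = a (Suc k) \<bullet> b + o' k b / 2 ^ Suc k" if "b \<in> Basis" for k b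
    using o1 x01[OF that] xS[OF that] aS[OF that] by blast
   show "a k = 0 - (1 / 2 ^ k) *\<^sub>R x k" for k by (simp add: a_def)
  qed (use L g cont W h q sub in auto)
  hence A: "ennreal ((g y - local_poly r (\<lambda>v. g (y + h *\<^sub>R L (a 0) + h *\<^sub>R L v)) (x 0))^2) <= ennreal D * ?E"
   by (simp add: linear_0[OF L(1)])
  define F where "F v = g (y + h *\<^sub>R L (a 0) + h *\<^sub>R L v)" for v
  have B: "ennreal ((local_poly r (\<lambda>v. F (v + (\<Sum>b\<in>Basis. real (i b) *\<^sub>R b))) 0)^2) <= ennreal D * ?E" if i: "i \<in> ?I" for i
  proof -
   define p where "p = a 0 + (\<Sum>b\<in>Basis. real (i b) *\<^sub>R b)"
   have ib: "real (i b) <= real r - 1" if "b \<in> Basis" for b using PiE_mem[OF i that] by auto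
   have pb: "p \<bullet> b = a 0 \<bullet> b + real (i b)" if "b \<in> Basis" for b
    using that by (simp add: p_def inner_simps inner_sum_left_Basis)
   have pR: "0 <= p \<bullet> b \<and> p \<bullet> b + 1 / 2 ^ k * (real (2 * r) + 1) < R" if "b \<in> Basis" for k :: nat and b
    using a01[OF that, of 0] pow[of k] ib[OF that] r by (simp add: R_def pb[OF that])
   have Fp: "(\<lambda>v. F (v + (\<Sum>b\<in>Basis. real (i b) *\<^sub>R b))) = (\<lambda>v. g (y + h *\<^sub>R L p + h *\<^sub>R L v))"
    by (simp add: F_def p_def linear_add[OF L(1)] scaleR_add_right add_ac)
   have "ennreal ((g (y + h *\<^sub>R L p) - local_poly r (\<lambda>v. g (y + h *\<^sub>R L p + h *\<^sub>R L v)) 0)^2) <= ennreal D * ?E"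
    unfolding D_def
   \<comment> \<open>A lattice point is a vertex of all finer grids: its corner stays fixed, and all
     digits and relative positions are 0.\<close>
   proof (rule chain[rule_format, where a = "\<lambda>_. p" and x = "\<lambda>_. 0" and o' = "\<lambda>_ _. 0"])
    show "0 <= p \<bullet> b \<and> p \<bullet> b + 1 / 2 ^ k * (real (2 * r) + 1) < R" if "b \<in> Basis" for k :: nat and b
     by (rule pR[OF that])
   qed (use L g cont W h q sub in auto)
   moreover have "g (y + h *\<^sub>R L p) = 0"
   proof -
    have "p \<in> block R" unfolding block_def
    proof (intro CollectI ballI)
     fix b :: 'a assume b: "b \<in> Basis"
     show "0 <= p \<bullet> b \<and> p \<bullet> b < R" using a01[OF b, of 0] ib[OF b] by (simp add: R_def pb[OF b])
    qed
    hence "y + h *\<^sub>R L p \<in> W" using sub by blast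
    moreover have "y + h *\<^sub>R L p = L (y' + h *\<^sub>R p)" using y' by (simp add: linear_add[OF L(1)] linear_cmul[OF L(1)])
    \<comment> \<open>\<open>a 0\<close> completes \<open>y' / h\<close> to the next vertex
      \<open>j 0 + 1\<close>, and the shift by \<open>i\<close> preserves integrality.\<close>
    moreover have "y' + h *\<^sub>R p \<in> scaled_lattice h" unfolding scaled_lattice_def
    proof (intro CollectI ballI exI)
     fix b :: 'a assume b: "b \<in> Basis"
     have "h * T 0 b = y' \<bullet> b" using h by (simp add: T_def)
     thus "(y' + h *\<^sub>R p) \<bullet> b = h * of_int (j 0 b + 1 + int (i b))" using b by (simp add: inner_simps pb a_def xb algebra_simps)
    qed
    ultimately show ?thesis using zero by auto
   qed
   ultimately show ?thesis unfolding Fp by simp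
  qed
  have S: "ennreal ((local_poly r F (x 0))^2) <= ennreal C2 * (diff_energy r (2 * r) F +
   (\<Sum>i\<in>?I. ennreal ((local_poly r (\<lambda>v. F (v + (\<Sum>b\<in>Basis. real (i b) *\<^sub>R b))) 0)^2)))"
  proof (rule sample[rule_format])
   show "borel_fun F" unfolding F_def by measurable
   have "a 0 \<bullet> b + 1 * (real (2 * r) + 1) < R" if "b \<in> Basis" for b using a01[OF that, of 0] r by (simp add: R_def)
   thus "integrable lborel (\<lambda>v. indicator (block (real (2 * r) + 1)) v * F v)"
    unfolding F_def using integrable_chart_block[OF L(1) g cont sub, of "a 0" 1 "real (2 * r) + 1"] a01 by simp
  qed (use x01 in auto)
  also have "diff_energy r (2 * r) F <= local_energy r W L R h g h y"
  proof -
   have "diff_energy r (2 * r) F <= ennreal ((h / h) ^ DIM('a)) * local_energy r W L R h g h y" unfolding F_def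
   proof (rule diff_energy_le_local_energy[OF L(1) g W h h])
    show "0 <= a 0 \<bullet> b \<and> a 0 \<bullet> b + h / h * (real (2 * r) + 1) <= R" if "b \<in> Basis" for b
     using a01[OF that, of 0] h r by (simp add: R_def)
   qed (use sub in blast)
   thus ?thesis using h by simp
  qed
  also have "(\<Sum>i\<in>?I. ennreal ((local_poly r (\<lambda>v. F (v + (\<Sum>b\<in>Basis. real (i b) *\<^sub>R b))) 0)^2)) <= (\<Sum>i\<in>?I. ennreal D * ?E)"
   by (intro sum_mono B)
  also have "\<dots> = ennreal (real (card ?I) * D) * ?E" using D by (simp add: ennreal_mult ennreal_of_nat_eq_real_of_nat mult.assoc)
  finally have S': "ennreal ((local_poly r F (x 0))^2) <= ennreal C2 * (local_energy r W L R h g h y + ennreal (real (card ?I) * D) * ?E)"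
   by (simp add: add_mono mult_left_mono)
  have "(g y)^2 <= 2 * (g y - local_poly r F (x 0))^2 + 2 * (local_poly r F (x 0))^2"
   using zero_le_power2[of "g y - 2 * local_poly r F (x 0)"] by (simp add: power2_eq_square algebra_simps)
  hence "ennreal ((g y)^2) <= ennreal (2 * (g y - local_poly r F (x 0))^2 + 2 * (local_poly r F (x 0))^2)" by (rule ennreal_leI)
  also have "\<dots> = 2 * ennreal ((g y - local_poly r F (x 0))^2) + 2 * ennreal ((local_poly r F (x 0))^2)"
   by (simp add: ennreal_plus ennreal_mult')
  also have "\<dots> <= 2 * (ennreal D * ?E) + 2 * (ennreal C2 * (local_energy r W L R h g h y + ennreal (real (card ?I) * D) * ?E))"
   using A S' by (intro add_mono mult_left_mono) (auto simp: F_def[abs_def])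
  also have "\<dots> = ennreal (2 * C2) * local_energy r W L R h g h y + ennreal (2 * D + 2 * C2 * (real (card ?I) * D)) * ?E"
   using C2 D by (simp add: ennreal_plus ennreal_mult distrib_left distrib_right mult.assoc ac_simps)
  also have "\<dots> <= ennreal C * local_energy r W L R h g h y + ennreal C * ?E"
   using C2 D by (intro add_mono mult_right_mono ennreal_leI) (auto simp: C_def)
  finally show "ennreal ((g y)^2) <= ennreal C * (local_energy r W L R h g h y + ?E)" by (simp add: distrib_left)
 qed
qed

text \<open>The pointwise bound is integrated over \<open>U\<close>; both energies integrate to a
  multiple of \<open>(h powr m) ^ 2\<close>. The condition on \<open>h\<close> and \<open>l\<close>
  supplies the chart block at every point of \<open>U\<close>.\<close>

lemma chart_sampling:
 fixes L :: "'a::euclidean_space => 'a"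
 assumes r: "1 <= r" and m: "real DIM('a) / 2 < m" and L: "linear L" "bij L" and W: "open W"
  and U [measurable]: "U \<in> sets borel" and cone: "\<And>y v. y \<in> U ==> v \<in> block l ==> y + L v \<in> W"
 shows "\<exists>C\<ge>0. \<forall>h M (g :: 'a => real). 0 < h --> h * real (3 * r + 3) <= l --> borel_fun g -->
  continuous_on W g --> diff_bounded r m W M g --> (\<forall>z\<in>W \<inter> L ` scaled_lattice h. g z = 0) -->
  (\<integral>\<^sup>+y. indicator U y * ennreal ((g y)^2) \<partial>lborel) <= ennreal (C * M^2 * (h powr m)^2)"
proof -
 define q where "q = (2 :: real) powr (real DIM('a) / 2 - m)"
 have q: "0 < q" "q < 1" using m unfolding q_def by (auto simp: powr_less_one)
 define R where "R = real (3 * r + 3)"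
 have R: "0 <= R" by (simp add: R_def)
 obtain C where C: "C > 0" and main: "\<forall>h (g :: 'a => real) y. 0 < h --> borel_fun g --> continuous_on W g -->
  (\<forall>v\<in>block R. y + h *\<^sub>R L v \<in> W) --> (\<forall>z\<in>W \<inter> L ` scaled_lattice h. g z = 0) -->
  ennreal ((g y)^2) <= ennreal C * (local_energy r W L R h g h y + chain_energy r W L R h g q y)"
  using pointwise_sampling[OF r L W q, folded R_def] by (elim exE conjE) (rule that)
 define A where "A = R ^ DIM('a) * (\<Sum>b\<in>(Basis :: 'a set). (norm (L b) powr m)^2)"
 have A: "0 <= A" using R by (simp add: A_def sum_nonneg)
 show ?thesis
 proof (intro exI[of _ "C * (A + A / (1 - q))"] conjI allI impI)
  show "0 <= C * (A + A / (1 - q))" using C A q by simp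
  fix h M :: real and g :: "'a => real"
  assume h: "0 < h" "h * real (3 * r + 3) <= l" and g [measurable]: "borel_fun g" and cont: "continuous_on W g"
   and M: "diff_bounded r m W M g" and zero: "\<forall>z\<in>W \<inter> L ` scaled_lattice h. g z = 0"
  have [measurable]: "local_energy r W L R h g w \<in> borel_measurable borel" for w by (rule borel_measurable_local_energy[OF L(1) g W])
  have [measurable]: "chain_energy r W L R h g q \<in> borel_measurable borel" unfolding chain_energy_def[abs_def] by measurable
  have "(\<integral>\<^sup>+y. indicator U y * ennreal ((g y)^2) \<partial>lborel) <=
    (\<integral>\<^sup>+y. ennreal C * (local_energy r W L R h g h y + chain_energy r W L R h g q y) \<partial>lborel)"
  proof (rule nn_integral_mono)
   fix y
   show "indicator U y * ennreal ((g y)^2) <= ennreal C * (local_energy r W L R h g h y + chain_energy r W L R h g q y)"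
   proof (cases "y \<in> U")
    case True
    have "y + h *\<^sub>R L v \<in> W" if "v \<in> block R" for v
     using cone[OF True block_scale[OF that h(1)]] h(2) by (simp add: R_def linear_cmul[OF L(1)])
    thus ?thesis using main h(1) g cont zero True by simp
   qed simp
  qed
  also have "\<dots> = ennreal C * ((\<integral>\<^sup>+y. local_energy r W L R h g h y \<partial>lborel) + (\<integral>\<^sup>+y. chain_energy r W L R h g q y \<partial>lborel))"
   by (simp add: nn_integral_cmult nn_integral_add)
  also have "\<dots> <= ennreal C * (ennreal (A * M^2 * (h powr m)^2) + ennreal (A / (1 - q) * M^2 * (h powr m)^2))" unfolding A_def
   by (intro mult_left_mono add_mono nn_integral_local_energy_diff_bounded nn_integral_chain_energy_le L(1) g W R M h(1) m q_def) simp
  also have "\<dots> = ennreal (C * (A + A / (1 - q)) * M^2 * (h powr m)^2)"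
   using A C q by (simp add: ennreal_plus[symmetric] ennreal_mult[symmetric] algebra_simps del: ennreal_plus)
  finally show "(\<integral>\<^sup>+y. indicator U y * ennreal ((g y)^2) \<partial>lborel) <= ennreal (C * (A + A / (1 - q)) * M^2 * (h powr m)^2)" .
 qed
qed

section \<open>Charts of a Lipschitz domain, counting of lattice points, and the sampling
  inequality\<close>

lemma inner_One_ge_norm:
 fixes a :: "'a::euclidean_space"
 assumes "\<And>b. b \<in> Basis ==> 0 <= a \<bullet> b"
 shows "norm a <= a \<bullet> One"
proof -
 have "norm a <= (\<Sum>b\<in>Basis. \<bar>a \<bullet> b\<bar>)" by (rule norm_le_l1)
 also have "\<dots> = a \<bullet> One" using assms by (simp add: inner_sum_right)
 finally show ?thesis .
qed

lemma block_inner_One_le: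
 fixes v :: "'a::euclidean_space"
 assumes "v \<in> block l"
 shows "0 <= v \<bullet> One" "v \<bullet> One <= l * real DIM('a)" "norm v <= l * real DIM('a)"
proof -
 have v: "0 <= v \<bullet> b" "v \<bullet> b <= l" if "b \<in> Basis" for b using assms that by (auto simp: block_def less_imp_le)
 show "0 <= v \<bullet> One" using v by (simp add: inner_sum_right sum_nonneg)
 have "(\<Sum>b\<in>Basis. v \<bullet> b) <= (\<Sum>b\<in>(Basis :: 'a set). l)" by (intro sum_mono v)
 thus 1: "v \<bullet> One <= l * real DIM('a)" by (simp add: inner_sum_right mult.commute)
 show "norm v <= l * real DIM('a)" using inner_One_ge_norm[of v, OF v(1)] 1 by linarith
qed

text \<open>Near a boundary point the columns \<open>z b + e\<close> of the chart matrix lie in the cone above the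
 Lipschitz graph; the two candidates for \<open>z\<close> are there to avoid the single singular value.\<close>

lemma Lipschitz_chart:
 fixes W :: "'a::euclidean_space set"
 assumes "bounded_Lipschitz_domain W" "p \<in> closure W"
 shows "\<exists>d>0. \<exists>l>0. \<exists>M :: 'a => 'a. linear M \<and> bij M \<and> (\<forall>y\<in>W \<inter> ball p d. \<forall>v\<in>block l. y + M v \<in> W)"
proof (cases "p \<in> W")
 case True
 have "open W" using assms by (simp add: bounded_Lipschitz_domain_def)
 then obtain d where d: "d > 0" "ball p d \<subseteq> W" using True by (meson openE)
 let ?l = "d / (2 * real DIM('a))"
 have "y + v \<in> W" if y: "y \<in> W \<inter> ball p (d / 2)" and v: "v \<in> block ?l" for y v
 proof -
  have "norm v <= d / 2" using block_inner_One_le(3)[OF v] by (simp add: field_simps)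
  moreover have "dist p y < d / 2" using y by simp
  moreover have "dist p (y + v) <= dist p y + norm v" using dist_triangle[of p "y + v" y] by (simp add: dist_norm)
  ultimately have "y + v \<in> ball p d" by simp
  thus ?thesis using d by blast
 qed
 hence "linear (id :: 'a => 'a) \<and> bij (id :: 'a => 'a) \<and> (\<forall>y\<in>W \<inter> ball p (d / 2). \<forall>v\<in>block ?l. y + id v \<in> W)"
  by (auto simp: linear_id)
 moreover have "0 < d / 2" "0 < ?l" using d by auto
 ultimately show ?thesis by blast
next
 case False
 hence "p \<in> frontier W" using assms by (auto simp: bounded_Lipschitz_domain_def frontier_def interior_open)
 hence "\<exists>r>0. \<exists>e L. \<exists>\<gamma> :: 'a => real.
    norm e = 1 \<and> L-lipschitz_on {y. y \<bullet> e = 0} \<gamma> \<and>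
    W \<inter> ball p r = {x \<in> ball p r. \<gamma> (x - (x \<bullet> e) *\<^sub>R e) < x \<bullet> e}"
  using assms(1) unfolding bounded_Lipschitz_domain_def by (elim conjE) (rule bspec)
 then obtain d e L \<gamma> where d: "d > 0" and e: "norm e = 1" and \<gamma>: "L-lipschitz_on {y. y \<bullet> e = 0} \<gamma>"
  and eq: "W \<inter> ball p d = {x \<in> ball p d. \<gamma> (x - (x \<bullet> e) *\<^sub>R e) < x \<bullet> e}" by (elim exE conjE) (rule that)
 have L: "0 <= L" using \<gamma> by (rule lipschitz_on_nonneg)
 \<comment> \<open>The inequality keeps the image of the block in the cone above the graph;
   \<open>z \<noteq> - (e \<bullet> One)\<close> makes the matrix invertible.\<close>
 have "\<exists>z>0. z * (1 + 2 * L) < 1 \<and> z \<noteq> - (e \<bullet> One)"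
 proof (cases "1 / (2 * (1 + 2 * L)) = - (e \<bullet> One)")
  case True
  hence "1 / (3 * (1 + 2 * L)) \<noteq> - (e \<bullet> One)" using L by (auto simp: field_simps)
  thus ?thesis using L by (intro exI[of _ "1 / (3 * (1 + 2 * L))"]) (auto simp: field_simps)
 next
  case False
  thus ?thesis using L by (intro exI[of _ "1 / (2 * (1 + 2 * L))"]) (auto simp: field_simps)
 qed
 then obtain z where z: "z > 0" "z * (1 + 2 * L) < 1" "z \<noteq> - (e \<bullet> One)" by blast
 have "z * 1 <= z * (1 + 2 * L)" using z L by (intro mult_left_mono) auto
 hence z1: "z < 1" using z by linarith
 define M where "M a = z *\<^sub>R a + (a \<bullet> One) *\<^sub>R e" for a :: 'a
 have lin: "linear M" by (rule linearI) (simp_all add: M_def inner_add_left scaleR_add_right scaleR_add_left)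
 have "inj M"
 proof (rule linear_injective_0[THEN iffD2, OF lin], intro allI impI)
  fix a assume a: "M a = 0"
  \<comment> \<open>Pairing with \<open>One\<close> gives a scalar equation for
    \<open>a \<bullet> One\<close>, whose factor \<open>z + e \<bullet> One\<close> is nonzero by
    the choice of \<open>z\<close>.\<close>
  hence "M a \<bullet> One = 0" by simp
  hence "(a \<bullet> One) * (z + e \<bullet> One) = 0" by (simp add: M_def inner_add_left algebra_simps)
  hence "a \<bullet> One = 0" using z(3) by auto
  thus "a = 0" using a z(1) by (simp add: M_def)
 qed
 hence bij: "bij M" using linear_injective_imp_surjective[OF lin] by (simp add: bij_def)
 let ?l = "d / (4 * real DIM('a))"
 have "y + M v \<in> W" if y: "y \<in> W \<inter> ball p (d / 2)" and v: "v \<in> block ?l" for y v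
 proof -
  have v0: "0 <= v \<bullet> One" "v \<bullet> One <= d / 4" "norm v <= v \<bullet> One"
   using block_inner_One_le[OF v] v by (auto simp: field_simps block_def intro!: inner_One_ge_norm)
  have "norm (M v) <= z * norm v + (v \<bullet> One)"
   unfolding M_def using norm_triangle_ineq[of "z *\<^sub>R v" "(v \<bullet> One) *\<^sub>R e"] z e v0 by simp
  also have "\<dots> <= 1 * (v \<bullet> One) + (v \<bullet> One)" using z z1 v0 by (intro add_mono mult_mono) auto
  also have "\<dots> <= d / 2" using v0 by simp
  finally have "norm (M v) <= d / 2" .
  moreover have "dist p y < d / 2" using y by simp
  moreover have "dist p (y + M v) <= dist p y + norm (M v)" using dist_triangle[of p "y + M v" y] by (simp add: dist_norm)
  ultimately have ball: "y + M v \<in> ball p d" by simp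
  let ?P = "\<lambda>x. x - (x \<bullet> e) *\<^sub>R e"
  have ee: "e \<bullet> e = 1" using e by (simp add: dot_square_norm)
  have Pe: "?P x \<in> {y. y \<bullet> e = 0}" for x by (simp add: inner_diff_left ee)
  have "y \<in> W \<inter> ball p d" using y d by auto
  hence ye: "\<gamma> (?P y) < y \<bullet> e" using eq by blast
  have "norm (?P v) <= norm v + \<bar>v \<bullet> e\<bar>" using norm_triangle_ineq4[of v "(v \<bullet> e) *\<^sub>R e"] e by simp
  moreover have ve: "\<bar>v \<bullet> e\<bar> <= norm v" using Cauchy_Schwarz_ineq2[of v e] e by simp
  ultimately have Pv: "norm (?P v) <= 2 * (v \<bullet> One)" using v0 by linarith
  have PP: "?P (y + M v) = ?P y + z *\<^sub>R ?P v" by (simp add: M_def inner_add_left ee algebra_simps)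
  have "\<gamma> (?P (y + M v)) - \<gamma> (?P y) <= L * dist (?P (y + M v)) (?P y)"
   using lipschitz_onD[OF \<gamma> Pe Pe, of "y + M v" y] by (simp add: dist_real_def)
  also have "dist (?P (y + M v)) (?P y) = z * norm (?P v)" unfolding PP dist_norm using z by simp
  also have "L * (z * norm (?P v)) <= L * (z * (2 * (v \<bullet> One)))" using L z Pv by (intro mult_left_mono) auto
  \<comment> \<open>The graph rises by at most \<open>2 L z\<close> times
    \<open>v \<bullet> One\<close>, the point by at least \<open>1 - z\<close> times it;
    \<open>z (1 + 2 L) < 1\<close> compares the two.\<close>
  also have "\<dots> <= (1 - z) * (v \<bullet> One)"
  proof -
   have "L * z * 2 <= 1 - z" using z(2) by (simp add: algebra_simps)
   hence "(L * z * 2) * (v \<bullet> One) <= (1 - z) * (v \<bullet> One)" using v0 by (intro mult_right_mono) auto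
   thus ?thesis by (simp add: mult_ac)
  qed
  also have "\<dots> <= M v \<bullet> e"
  proof -
   have "z * (v \<bullet> e) \<ge> - (z * (v \<bullet> One))" using mult_left_mono[of "- (v \<bullet> One)" "v \<bullet> e" z] ve v0 z by auto
   thus ?thesis by (simp add: M_def inner_add_left ee algebra_simps)
  qed
  finally have "\<gamma> (?P (y + M v)) < (y + M v) \<bullet> e" using ye by (simp add: inner_add_left)
  thus ?thesis using ball eq by blast
 qed
 moreover have "0 < d / 2" "0 < ?l" using d by auto
 ultimately show ?thesis using lin bij by blast
qed

text \<open>The inverse of \<open>M\<close> is bounded, so the integer coordinates of the lattice
  points in \<open>W\<close> are at most \<open>B / h\<close> in absolute value.
  \<open>h <= 1\<close> absorbs the summand 1 of the count into \<open>1 / h\<close>.\<close>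

lemma card_lattice_points:
 fixes W :: "'a::euclidean_space set" and M :: "'a => 'a"
 assumes W: "bounded W" and M: "linear M" "bij M"
 shows "\<exists>A>0. \<forall>h. 0 < h \<and> h <= 1 --> finite (W \<inter> M ` scaled_lattice h) \<and>
  real (card (W \<inter> M ` scaled_lattice h)) <= (A / h) ^ DIM('a)"
proof -
 obtain B0 where B0: "\<And>z. z \<in> W ==> norm z <= B0" using W by (auto simp: bounded_iff)
 obtain P where P: "linear P" "\<And>x. P (M x) = x" using linear_injective_left_inverse[OF M(1) bij_is_inj[OF M(2)]] by (auto simp: fun_eq_iff)
 have "bounded_linear P" using P(1) by (simp add: linear_conv_bounded_linear)
 then obtain L where L: "L > 0" "\<And>v. norm (P v) <= norm v * L" using bounded_linear.pos_bounded by blast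
 define B where "B = max 0 (B0 * L)"
 have pB: "\<bar>p \<bullet> b\<bar> <= B" if "M p \<in> W" "b \<in> Basis" for p b
 proof -
  have "norm p <= norm (M p) * L" using L(2)[of "M p"] by (simp add: P)
  also have "\<dots> <= B0 * L" using B0[OF that(1)] L(1) by (intro mult_right_mono) auto
  finally show ?thesis using Basis_le_norm[OF that(2), of p] by (simp add: B_def)
 qed
 show ?thesis
 proof (intro exI[of _ "2 * B + 1"] conjI allI impI)
  show "0 < 2 * B + 1" by (simp add: B_def add_nonneg_pos)
  fix h :: real assume h: "0 < h \<and> h <= 1"
  define m where "m = \<lfloor>B / h\<rfloor>"
  have m: "0 <= m" using h by (simp add: m_def B_def)
  let ?J = "PiE (Basis :: 'a set) (\<lambda>_. {-m..m})"
  let ?f = "\<lambda>j :: 'a => int. M (\<Sum>b\<in>Basis. (h * of_int (j b)) *\<^sub>R b)"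
  have fin: "finite ?J" by (intro finite_PiE) auto
  have sub: "W \<inter> M ` scaled_lattice h \<subseteq> ?f ` ?J"
  proof
   fix z assume "z \<in> W \<inter> M ` scaled_lattice h"
   then obtain p where p: "M p \<in> W" "z = M p" "p \<in> scaled_lattice h" by auto
   then obtain j where j: "\<And>b. b \<in> Basis ==> p \<bullet> b = h * of_int (j b)" unfolding scaled_lattice_def by (auto dest!: bchoice)
   have "j b \<in> {-m..m}" if b: "b \<in> Basis" for b
   proof -
    have "\<bar>h * of_int (j b)\<bar> <= B" using pB[OF p(1) b] j[OF b] by simp
    hence "\<bar>of_int (j b)\<bar> <= B / h" using h by (simp add: abs_mult field_simps)
    hence "\<bar>j b\<bar> <= m" unfolding m_def by (simp add: le_floor_iff)
    thus ?thesis by auto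
   qed
   hence "restrict j Basis \<in> ?J" by auto
   moreover have "z = ?f (restrict j Basis)"
   proof -
    have "p = (\<Sum>b\<in>Basis. (h * of_int (restrict j Basis b)) *\<^sub>R b)" by (rule euclidean_eqI) (simp add: inner_sum_left_Basis j)
    thus ?thesis using p by simp
   qed
   ultimately show "z \<in> ?f ` ?J" by blast
  qed
  show "finite (W \<inter> M ` scaled_lattice h)" using finite_subset[OF sub] fin by simp
  have "card (W \<inter> M ` scaled_lattice h) <= card ?J" using card_mono[OF finite_imageI[OF fin] sub] card_image_le[OF fin] by (rule order_trans)
  also have "card ?J = nat (2 * m + 1) ^ DIM('a)" by (simp add: card_PiE)
  finally have "real (card (W \<inter> M ` scaled_lattice h)) <= real (nat (2 * m + 1)) ^ DIM('a)" by (metis of_nat_le_iff of_nat_power)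
  also have "\<dots> <= ((2 * B + 1) / h) ^ DIM('a)"
  proof (rule power_mono)
   have "of_int m <= B / h" by (simp add: m_def)
   moreover have "1 <= 1 / h" using h by simp
   ultimately have "2 * of_int m + 1 <= 2 * (B / h) + 1 / h" by linarith
   thus "real (nat (2 * m + 1)) <= (2 * B + 1) / h" using m by (simp add: add_divide_distrib)
  qed simp
  finally show "real (card (W \<inter> M ` scaled_lattice h)) <= ((2 * B + 1) / h) ^ DIM('a)" .
 qed
qed

abbreviation good_samples :: "nat => real => 'a::euclidean_space set => real => nat => (nat => 'a) => bool" where
 "good_samples r s W C n x \<equiv>
  (\<forall>i<n. x i \<in> W) \<and> (\<forall>g M. borel_fun g --> continuous_on W g
  --> diff_bounded r s W M g --> (\<forall>i<n. g (x i) = 0) -->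
  (\<integral>\<^sup>+y. indicator W y * ennreal ((g y)^2) \<partial>lborel) <= ennreal (M^2)
  --> (\<integral>\<^sup>+y. indicator W y * ennreal ((g y)^2) \<partial>lborel) <= ennreal (C *
  M^2 * (real n powr (- s / real DIM('a)))^2))"

text \<open>Compactness of the closure gives finitely many charts, and the samples are the points of
  all chart lattices with one mesh \<open>h\<close>, of order \<open>n powr (- 1 / d)\<close>. For
  small \<open>n\<close> the mesh is too large for the charts; there the a priori bound by
  \<open>M\<close> in \<open>good_samples\<close> suffices, with a larger constant.\<close>

theorem sampling_inequality:
 fixes W :: "'a::euclidean_space set"
 assumes dom: "bounded_Lipschitz_domain W" and r: "1 <= r" and \<sigma>: "real DIM('a) / 2 < \<sigma>"
 shows "\<exists>C>0. \<forall>n\<ge>1. \<exists>x :: nat => 'a. good_samples r \<sigma> W C n x"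
proof -
 have W: "open W" "bounded W" "W \<noteq> {}" using dom by (auto simp: bounded_Lipschitz_domain_def)
 have Wm [measurable]: "W \<in> sets borel" using W by auto
 have "\<forall>p\<in>closure W. \<exists>d l (L :: 'a => 'a). d > 0 \<and> l > 0 \<and> linear L \<and> bij L \<and> (\<forall>y\<in>W \<inter> ball p d. \<forall>v\<in>block l. y + L v \<in> W)"
  using Lipschitz_chart[OF dom] by blast
 from bchoice[OF this] obtain d where "\<forall>p\<in>closure W. \<exists>l (L :: 'a => 'a). d p > 0 \<and> l > 0 \<and> linear L \<and> bij L \<and>
   (\<forall>y\<in>W \<inter> ball p (d p). \<forall>v\<in>block l. y + L v \<in> W)" by (elim exE) (rule that)
 from bchoice[OF this] obtain l where "\<forall>p\<in>closure W. \<exists>L :: 'a => 'a. d p > 0 \<and> l p > 0 \<and> linear L \<and> bij L \<and>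
   (\<forall>y\<in>W \<inter> ball p (d p). \<forall>v\<in>block (l p). y + L v \<in> W)" by (elim exE) (rule that)
 from bchoice[OF this] obtain L :: "'a => 'a => 'a" where chart': "\<forall>p\<in>closure W. d p > 0 \<and> l p > 0 \<and> linear (L p) \<and> bij (L p) \<and>
   (\<forall>y\<in>W \<inter> ball p (d p). \<forall>v\<in>block (l p). y + L p v \<in> W)" by (elim exE) (rule that)
 have chart: "d p > 0" "l p > 0" "linear (L p)" "bij (L p)"
  "\<And>y v. y \<in> W \<inter> ball p (d p) ==> v \<in> block (l p) ==> y + L p v \<in> W" if "p \<in> closure W" for p using chart' that by auto
 have "compact (closure W)" using W(2) by (simp add: compact_closure)
 then obtain Q where Q: "Q \<subseteq> closure W" "finite Q" "closure W \<subseteq> (\<Union>p\<in>Q. ball p (d p))"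
  by (rule compactE_image[of _ "closure W" "\<lambda>p. ball p (d p)"]) (use chart(1) in auto)
 have cl: "p \<in> closure W" if "p \<in> Q" for p using Q that by auto
 have Qne: "Q \<noteq> {}" using Q(3) W(3) closure_subset by fastforce
 have "\<forall>p\<in>Q. \<exists>C\<ge>0. \<forall>h M (g :: 'a => real). 0 < h --> h * real (3 * r + 3) <= l p --> borel_fun g -->
  continuous_on W g --> diff_bounded r \<sigma> W M g --> (\<forall>z\<in>W \<inter> L p ` scaled_lattice h. g z = 0) -->
  (\<integral>\<^sup>+y. indicator (W \<inter> ball p (d p)) y * ennreal ((g y)^2) \<partial>lborel) <= ennreal (C * M^2 * (h powr \<sigma>)^2)"
  using cl chart by (intro ballI chart_sampling[OF r \<sigma>] W) auto
 then obtain C where C: "\<And>p. p \<in> Q ==> 0 <= C p" and main: "\<And>p h M (g :: 'a => real). p \<in> Q ==> 0 < h ==> h * real (3 * r + 3) <= l p ==>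
  borel_fun g ==> continuous_on W g ==> diff_bounded r \<sigma> W M g ==> (\<forall>z\<in>W \<inter> L p ` scaled_lattice h. g z = 0) ==>
  (\<integral>\<^sup>+y. indicator (W \<inter> ball p (d p)) y * ennreal ((g y)^2) \<partial>lborel) <= ennreal (C p * M^2 * (h powr \<sigma>)^2)"
  by (subst (asm) bchoice_iff) blast
 have "\<forall>p\<in>Q. \<exists>A>0. \<forall>h. 0 < h \<and> h <= 1 --> finite (W \<inter> L p ` scaled_lattice h) \<and>
  real (card (W \<inter> L p ` scaled_lattice h)) <= (A / h) ^ DIM('a)" using cl chart by (intro ballI card_lattice_points W) auto
 then obtain A where A: "\<And>p. p \<in> Q ==> 0 < A p" and card: "\<And>p h. p \<in> Q ==> 0 < h ==> h <= 1 ==>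
   finite (W \<inter> L p ` scaled_lattice h)" "\<And>p h. p \<in> Q ==> 0 < h ==> h <= 1 ==>
  real (card (W \<inter> L p ` scaled_lattice h)) <= (A p / h) ^ DIM('a)" by (subst (asm) bchoice_iff) blast
 define h0 where "h0 = Min (insert 1 ((\<lambda>p. l p / real (3 * r + 3)) ` Q))"
 have h0: "h0 <= 1" "\<And>p. p \<in> Q ==> h0 <= l p / real (3 * r + 3)" "0 < h0" using Q(2) chart(2)[OF cl] by (auto simp: h0_def)
 define A0 where "A0 = Max (A ` Q)"
 have A0: "A p <= A0" if "p \<in> Q" for p using Q(2) that by (simp add: A0_def)
 have A0p: "0 < A0" using A A0 Qne by (meson all_not_in_conv less_le_trans)
 define N where "N = card Q"
 have N: "1 <= N" using Q(2) Qne by (simp add: N_def Suc_le_eq card_gt_0_iff)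
 \<comment> \<open>With \<open>h = G * n powr (- 1 / d)\<close> each of the \<open>N\<close>
   lattices has at most \<open>n / N ^ d\<close> points in \<open>W\<close>, so together there are
   at most \<open>n\<close>.\<close>
 define G where "G = A0 * real N"
 have G: "0 < G" using A0p N by (simp add: G_def)
 \<comment> \<open>The second summand serves the case \<open>h > h0\<close>.\<close>
 define C' where "C' = (\<Sum>p\<in>Q. C p) * (G powr \<sigma>)^2 + ((G / h0) powr \<sigma>)^2"
 have \<sigma>0: "0 < \<sigma>" using \<sigma> by (rule le_less_trans[rotated]) simp
 have C'0: "0 <= (\<Sum>p\<in>Q. C p) * (G powr \<sigma>)^2" using C by (simp add: sum_nonneg)
 have C'pos: "0 < C'" using C'0 G h0 by (simp add: C'_def add_nonneg_pos)
 show ?thesis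
 proof (intro exI[of _ C'] conjI allI impI C'pos)
  fix n :: nat assume n: "1 <= n"
  define t where "t = real n powr (- 1 / real DIM('a))"
  have t0: "0 < t" using n by (simp add: t_def)
  have t\<sigma>: "t powr \<sigma> = real n powr (- \<sigma> / real DIM('a))" by (simp add: t_def powr_powr)
  have tD: "t ^ DIM('a) = 1 / real n"
  proof -
   have "t ^ DIM('a) = t powr real DIM('a)" using t0 by (simp add: powr_realpow)
   also have "\<dots> = real n powr - 1" unfolding t_def powr_powr by simp
   finally show ?thesis using n by (simp add: powr_minus divide_inverse)
  qed
  define h where "h = G * t"
  have h: "0 < h" using G t0 by (simp add: h_def)
  have h\<sigma>: "h powr \<sigma> = G powr \<sigma> * t powr \<sigma>" using G t0 by (simp add: h_def powr_mult)
  show "\<exists>x :: nat => 'a. good_samples r \<sigma> W C' n x"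
  proof (cases "h <= h0")
   case True
   define X where "X = (\<Union>p\<in>Q. W \<inter> L p ` scaled_lattice h)"
   have h1: "h <= 1" using True h0 by simp
   have finX: "finite X" unfolding X_def using Q(2) card(1)[OF _ h h1] by (intro finite_UN_I) auto
   have "real (card X) <= (\<Sum>p\<in>Q. real (card (W \<inter> L p ` scaled_lattice h)))"
    unfolding X_def using card_UN_le[OF Q(2), of "\<lambda>p. W \<inter> L p ` scaled_lattice h"]
    by (simp only: of_nat_sum[symmetric] of_nat_le_iff)
   also have "\<dots> <= (\<Sum>p\<in>Q. (A0 / h) ^ DIM('a))"
    using A A0 h by (intro sum_mono order_trans[OF card(2)] h1 power_mono divide_right_mono) (auto simp: less_imp_le)
   also have "\<dots> = real N * (real n / real N ^ DIM('a))"
    using A0p t0 n by (simp add: N_def[symmetric] h_def G_def power_divide power_mult_distrib tD)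
   also have "\<dots> <= real n"
   proof -
    have "real N ^ 1 <= real N ^ DIM('a)" using N by (intro power_increasing) auto
    hence "real N * real n <= real N ^ DIM('a) * real n" by (intro mult_right_mono) auto
    thus ?thesis using N by (simp add: field_simps)
   qed
   finally have cardX: "card X <= n" by simp
   obtain w where w: "w \<in> W" using W(3) by blast
   obtain f where f: "bij_betw f {..<card X} X" using ex_bij_betw_nat_finite[OF finX] by (auto simp: atLeast0LessThan)
   \<comment> \<open>The sample is filled up to length \<open>n\<close> by repeating one point
     \<open>w\<close> of \<open>W\<close>.\<close>
   define x where "x i = (if i < card X then f i else w)" for i
   have xW: "x i \<in> W" for i using bij_betwE[OF f] w by (auto simp: x_def X_def)
   have Xx: "\<exists>i<n. x i = z" if "z \<in> X" for z
   proof -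
    have "z \<in> f ` {..<card X}" using f that by (simp only: bij_betw_imp_surj_on)
    then obtain i where "i < card X" "f i = z" by blast
    thus ?thesis using cardX by (intro exI[of _ i]) (auto simp: x_def)
   qed
   show ?thesis
   proof (intro exI[of _ x] conjI allI impI)
    fix g :: "'a => real" and M :: real
    assume g [measurable]: "borel_fun g" and cont: "continuous_on W g" and M: "diff_bounded r \<sigma> W M g"
     and gx: "\<forall>i<n. g (x i) = 0"
    have [measurable]: "ball p e \<in> sets borel" for p :: 'a and e by (rule borel_open) simp
    have gX: "g z = 0" if "z \<in> X" for z using Xx[OF that] gx by blast
    have "(\<integral>\<^sup>+y. indicator W y * ennreal ((g y)^2) \<partial>lborel) <=
      (\<integral>\<^sup>+y. (\<Sum>p\<in>Q. indicator (W \<inter> ball p (d p)) y * ennreal ((g y)^2)) \<partial>lborel)"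
    proof (rule nn_integral_mono)
     fix y
     show "indicator W y * ennreal ((g y)^2) <= (\<Sum>p\<in>Q. indicator (W \<inter> ball p (d p)) y * ennreal ((g y)^2))"
     proof (cases "y \<in> W")
      case True
      then obtain p where p: "p \<in> Q" "y \<in> ball p (d p)" using Q(3) closure_subset[of W] by blast
      have "indicator W y * ennreal ((g y)^2) = indicator (W \<inter> ball p (d p)) y * ennreal ((g y)^2)"
       using True p by (simp add: indicator_def)
      also have "\<dots> <= (\<Sum>p\<in>Q. indicator (W \<inter> ball p (d p)) y * ennreal ((g y)^2))"
       using p Q(2) by (intro member_le_sum) auto
      finally show ?thesis .
     qed simp
    qed
    also have "\<dots> = (\<Sum>p\<in>Q. \<integral>\<^sup>+y. indicator (W \<inter> ball p (d p)) y * ennreal ((g y)^2) \<partial>lborel)"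
     by (rule nn_integral_sum) measurable
    also have "\<dots> <= (\<Sum>p\<in>Q. ennreal (C p * M^2 * (h powr \<sigma>)^2))"
    proof (intro sum_mono main h g cont M)
     fix p assume p: "p \<in> Q"
     have "h <= l p / real (3 * r + 3)" using h0(2)[OF p] True by linarith
     thus "h * real (3 * r + 3) <= l p" by (simp add: pos_le_divide_eq)
     show "\<forall>z\<in>W \<inter> L p ` scaled_lattice h. g z = 0" using gX p by (auto simp: X_def)
    qed
    also have "\<dots> = ennreal (\<Sum>p\<in>Q. C p * M^2 * (h powr \<sigma>)^2)" using C by (intro sum_ennreal) auto
    also have "\<dots> <= ennreal (C' * M^2 * (real n powr (- \<sigma> / real DIM('a)))^2)"
    proof (rule ennreal_leI)
     have "(\<Sum>p\<in>Q. C p * M^2 * (h powr \<sigma>)^2) = (\<Sum>p\<in>Q. C p) * (G powr \<sigma>)^2 * (M^2 * (t powr \<sigma>)^2)"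
      unfolding h\<sigma> sum_distrib_right by (intro sum.cong refl) (simp add: power_mult_distrib mult_ac)
     also have "\<dots> <= C' * (M^2 * (t powr \<sigma>)^2)" by (intro mult_right_mono) (auto simp: C'_def)
     finally show "(\<Sum>p\<in>Q. C p * M^2 * (h powr \<sigma>)^2) <= C' * M^2 * (real n powr (- \<sigma> / real DIM('a)))^2"
      unfolding t\<sigma> by (simp only: mult.assoc)
    qed
    finally show "(\<integral>\<^sup>+y. indicator W y * ennreal ((g y)^2) \<partial>lborel) <= ennreal (C' * M^2 * (real n powr (- \<sigma> / real DIM('a)))^2)" .
   qed (rule xW)
  next
   case False
   obtain w where w: "w \<in> W" using W(3) by blast
   \<comment> \<open>A mesh above \<open>h0\<close> means that \<open>n\<close> is bounded, so a
     constant times the rate exceeds 1 and the bound by \<open>M\<close> is good enough.\<close>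
   have "1 <= (h / h0) powr \<sigma>" using False h0 \<sigma>0 by (intro ge_one_powr_ge_zero) auto
   also have "(h / h0) powr \<sigma> = (G / h0) powr \<sigma> * t powr \<sigma>" using G h0 t0 by (simp add: h_def powr_mult powr_divide)
   finally have "1 <= ((G / h0) powr \<sigma> * t powr \<sigma>)^2" by simp
   also have "\<dots> = ((G / h0) powr \<sigma>)^2 * (t powr \<sigma>)^2" by (rule power_mult_distrib)
   also have "\<dots> <= C' * (t powr \<sigma>)^2" using C'0 by (intro mult_right_mono) (auto simp: C'_def)
   finally have "1 <= C' * (t powr \<sigma>)^2" .
   hence "M^2 <= C' * M^2 * (t powr \<sigma>)^2" for M using mult_left_mono[of 1 "C' * (t powr \<sigma>)^2" "M^2"] by (simp add: mult_ac)
   thus ?thesis unfolding t\<sigma>[symmetric] by (intro exI[of _ "\<lambda>_. w"]) (use w in \<open>blast intro: order_trans ennreal_leI\<close>)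
  qed
 qed
qed

section \<open>Smooth functions and their partial derivatives\<close>

abbreviation (input) pderiv_dir :: "'a::euclidean_space => ('a => real) => 'a => real" where
 "pderiv_dir b f \<equiv> (\<lambda>x. frechet_derivative f (at x) b)"

lemma partial_derivs_append: "partial_derivs (bs @ cs) f = partial_derivs bs (partial_derivs cs f)" by (induction bs) auto

text \<open>Grading by the order makes closure under products accessible to induction: the
  derivative of a product is a sum of products with one order of smoothness less.\<close>

definition smooth_upto :: "nat => ('a::euclidean_space => real) => bool" where
 "smooth_upto n f \<longleftrightarrow> (\<forall>bs. set bs \<subseteq> Basis --> length bs <= n --> (\<forall>x. partial_derivs bs f differentiable (at x)))"

lemma smooth_iff: "smooth f \<longleftrightarrow> (\<forall>n. smooth_upto n f)" by (auto simp: smooth_def smooth_upto_def differentiable_on_def)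

lemma smooth_upto_0: "smooth_upto 0 f \<longleftrightarrow> (\<forall>x. f differentiable (at x))" by (auto simp: smooth_upto_def)

text \<open>\<open>partial_derivs\<close> applies the last direction of its list first, so the list
  is split at its end.\<close>

lemma smooth_upto_Suc:
 "smooth_upto (Suc n) f \<longleftrightarrow> (\<forall>x. f differentiable (at x)) \<and> (\<forall>b\<in>Basis. smooth_upto n (pderiv_dir b f))"
proof
 assume f: "smooth_upto (Suc n) f"
 have "\<forall>x. f differentiable (at x)" using f unfolding smooth_upto_def by (auto dest: spec[of _ "[]"])
 moreover have "smooth_upto n (pderiv_dir b f)" if "b \<in> Basis" for b unfolding smooth_upto_def
 proof (intro allI impI)
  fix bs :: "'a list" and x assume "set bs \<subseteq> Basis" "length bs <= n"
  hence "partial_derivs (bs @ [b]) f differentiable (at x)" using f that unfolding smooth_upto_def by (auto dest!: spec[of _ "bs @ [b]"])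
  thus "partial_derivs bs (pderiv_dir b f) differentiable (at x)" by (simp add: partial_derivs_append)
 qed
 ultimately show "(\<forall>x. f differentiable (at x)) \<and> (\<forall>b\<in>Basis. smooth_upto n (pderiv_dir b f))" by blast
next
 assume f: "(\<forall>x. f differentiable (at x)) \<and> (\<forall>b\<in>Basis. smooth_upto n (pderiv_dir b f))"
 show "smooth_upto (Suc n) f" unfolding smooth_upto_def
 proof (intro allI impI)
  fix bs :: "'a list" and x assume bs: "set bs \<subseteq> Basis" "length bs <= Suc n"
  show "partial_derivs bs f differentiable (at x)"
  proof (cases bs rule: rev_cases)
   case Nil
   thus ?thesis using f by simp
  next
   case (snoc cs b)
   thus ?thesis using f bs by (auto simp: partial_derivs_append smooth_upto_def)
  qed
 qed
qed

lemma smooth_upto_imp_differentiable: "smooth_upto n f ==> f differentiable (at x)" by (cases n) (auto simp: smooth_upto_0 smooth_upto_Suc)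

lemma smooth_upto_mono: "smooth_upto (Suc n) f ==> smooth_upto n f" by (auto simp: smooth_upto_def)

lemma frechet_derivative_eqI:
 assumes "(f has_derivative D) (at x)"
 shows "frechet_derivative f (at x) = D" using frechet_derivative_at[OF assms] by simp

lemma smooth_upto_const: "smooth_upto n (\<lambda>x. c)"
proof (induction n arbitrary: c)
 case (Suc n)
 have "pderiv_dir b (\<lambda>x. c) = (\<lambda>x. 0)" for b :: 'a by (simp add: frechet_derivative_const)
 thus ?case using Suc by (simp add: smooth_upto_Suc)
qed (simp add: smooth_upto_0)

lemma frechet_derivative_add:
 assumes "f differentiable (at x)" "g differentiable (at x)"
 shows "frechet_derivative (\<lambda>x. f x + g x) (at x) b = frechet_derivative f (at x) b + frechet_derivative g (at x) b"
 using assms by (subst frechet_derivative_eqI[OF has_derivative_add]) (auto simp: frechet_derivative_works)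

lemma frechet_derivative_mult:
 fixes f g :: "'a::real_normed_vector => real"
 assumes "f differentiable (at x)" "g differentiable (at x)"
 shows "frechet_derivative (\<lambda>x. f x * g x) (at x) b = f x * frechet_derivative g (at x) b + frechet_derivative f (at x) b * g x"
 using assms by (subst frechet_derivative_eqI[OF has_derivative_mult]) (auto simp: frechet_derivative_works)

lemma smooth_upto_add: "smooth_upto n f ==> smooth_upto n g ==> smooth_upto n (\<lambda>x. f x + g x)"
proof (induction n arbitrary: f g)
 case (Suc n)
 have d: "f differentiable (at x)" "g differentiable (at x)" for x using Suc.prems by (auto simp: smooth_upto_Suc)
 have "pderiv_dir b (\<lambda>x. f x + g x) = (\<lambda>x. pderiv_dir b f x + pderiv_dir b g x)" for b using d by (simp add: frechet_derivative_add)
 thus ?case using Suc d by (simp add: smooth_upto_Suc)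
qed (auto simp: smooth_upto_0)

lemma smooth_upto_mult: "smooth_upto n f ==> smooth_upto n g ==> smooth_upto n (\<lambda>x. f x * g x)"
proof (induction n arbitrary: f g)
 case (Suc n)
 have d: "f differentiable (at x)" "g differentiable (at x)" for x using Suc.prems by (auto simp: smooth_upto_Suc)
 have "pderiv_dir b (\<lambda>x. f x * g x) = (\<lambda>x. f x * pderiv_dir b g x + pderiv_dir b f x * g x)" for b
  using d by (simp add: frechet_derivative_mult)
 moreover have "smooth_upto n f" "smooth_upto n g" using Suc.prems by (auto intro: smooth_upto_mono)
 ultimately show ?case using Suc d by (auto simp: smooth_upto_Suc intro!: smooth_upto_add)
qed (auto simp: smooth_upto_0)

lemma smooth_const: "smooth (\<lambda>x. c)"
 and smooth_add: "smooth f ==> smooth g ==> smooth (\<lambda>x. f x + g x)"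
 and smooth_mult: "smooth f ==> smooth g ==> smooth (\<lambda>x. f x * g x)"
 by (auto simp: smooth_iff intro: smooth_upto_const smooth_upto_add smooth_upto_mult)

lemma smooth_sum: "(\<And>i. i \<in> I ==> smooth (f i)) ==> smooth (\<lambda>x. \<Sum>i\<in>I. f i x)"
 by (induction I rule: infinite_finite_induct) (auto intro: smooth_const smooth_add)

lemma smooth_prod: "(\<And>i. i \<in> I ==> smooth (f i)) ==> smooth (\<lambda>x. \<Prod>i\<in>I. f i x)"
 by (induction I rule: infinite_finite_induct) (auto intro: smooth_const smooth_mult)

lemma smooth_power: "smooth f ==> smooth (\<lambda>x. f x ^ n)" by (induction n) (auto intro: smooth_const smooth_mult)

lemma smooth_diff: "smooth f ==> smooth g ==> smooth (\<lambda>x. f x - g x)"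
 using smooth_add[of f "\<lambda>x. -1 * g x"] smooth_mult[OF smooth_const[of "-1"], of g] by simp

lemma smooth_imp_differentiable: "smooth f ==> f differentiable (at x)" by (auto simp: smooth_iff intro: smooth_upto_imp_differentiable[of 0])

lemma smooth_imp_continuous: "smooth f ==> continuous_on A f"
 by (intro continuous_at_imp_continuous_on ballI differentiable_imp_continuous_within smooth_imp_differentiable)

lemma smooth_partial_derivs: "smooth f ==> set bs \<subseteq> Basis ==> smooth (partial_derivs bs f)" unfolding smooth_def
proof (intro allI impI)
 fix cs :: "'a list"
 assume f: "\<forall>bs. set bs \<subseteq> Basis --> partial_derivs bs f differentiable_on UNIV" and s: "set bs \<subseteq> Basis" "set cs \<subseteq> Basis"
 hence "partial_derivs (cs @ bs) f differentiable_on UNIV" by (intro f[rule_format]) auto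
 thus "partial_derivs cs (partial_derivs bs f) differentiable_on UNIV" by (simp add: partial_derivs_append)
qed

text \<open>The functions \<open>a * G k (x \<bullet> w + c)\<close>, for all \<open>a\<close> and
  \<open>k\<close>, form a class that is closed under partial differentiation.\<close>

lemma smooth_compose_inner:
 fixes G :: "nat => real => real"
 assumes G: "\<And>k t. (G k has_real_derivative G (Suc k) t) (at t)"
 shows "smooth (\<lambda>x. G k (x \<bullet> w + c))"
proof -
 have "smooth_upto n (\<lambda>x. a * G k (x \<bullet> w + c))" for n a k
 proof (induction n arbitrary: a k)
  case 0
  have "(\<lambda>x. G k (x \<bullet> w + c)) differentiable (at x)" for x
   by (rule differentiableI, rule DERIV_compose_FDERIV[OF G]) (auto intro!: derivative_eq_intros)
  thus ?case by (auto simp: smooth_upto_0)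
 next
  case (Suc n)
  have D: "((\<lambda>x. a * G k (x \<bullet> w + c)) has_derivative (\<lambda>h. a * ((h \<bullet> w) * G (Suc k) (x \<bullet> w + c)))) (at x)" for x
   by (intro has_derivative_mult_right DERIV_compose_FDERIV[OF G]) (auto intro!: derivative_eq_intros)
  have "pderiv_dir b (\<lambda>x. a * G k (x \<bullet> w + c)) = (\<lambda>x. (a * (b \<bullet> w)) * G (Suc k) (x \<bullet> w + c))" for b
   by (simp add: frechet_derivative_eqI[OF D] mult.assoc)
  thus ?case using Suc differentiableI[OF D] by (auto simp: smooth_upto_Suc)
 qed
 from this[of _ 1] show ?thesis by (simp add: smooth_iff)
qed

lemma has_derivative_affine_compose:
 fixes g :: "'a::euclidean_space => real"
 assumes "smooth g"
 shows "((\<lambda>x. k * g (a *\<^sub>R x + c)) has_derivative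
  (\<lambda>h. k * frechet_derivative g (at (a *\<^sub>R x + c)) (a *\<^sub>R h))) (at x)"
proof (rule has_derivative_mult_right)
 have "(g has_derivative frechet_derivative g (at (a *\<^sub>R x + c))) (at (a *\<^sub>R x + c))"
  using smooth_imp_differentiable[OF assms] by (simp add: frechet_derivative_works)
 moreover have "((\<lambda>x. a *\<^sub>R x + c) has_derivative (\<lambda>h. a *\<^sub>R h)) (at x)" by (auto intro!: derivative_eq_intros)
 ultimately show "((\<lambda>x. g (a *\<^sub>R x + c)) has_derivative (\<lambda>h. frechet_derivative g (at (a *\<^sub>R x + c)) (a *\<^sub>R h))) (at x)"
  using diff_chain_at[of "\<lambda>x. a *\<^sub>R x + c" _ x g] by (simp add: comp_def)
qed

lemma partial_derivs_affine:
 fixes f :: "'a::euclidean_space => real"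
 assumes f: "smooth f" and bs: "set bs \<subseteq> Basis"
 shows "partial_derivs bs (\<lambda>x. f (a *\<^sub>R x + c)) = (\<lambda>x. a ^ length bs * partial_derivs bs f (a *\<^sub>R x + c))" using bs
proof (induction bs)
 case (Cons b bs)
 let ?g = "partial_derivs bs f"
 have g: "smooth ?g" using smooth_partial_derivs[OF f] Cons.prems by simp
 have lin: "linear (frechet_derivative ?g (at y))" for y using smooth_imp_differentiable[OF g] by (simp add: linear_frechet_derivative)
 show ?case using Cons by (simp add: frechet_derivative_eqI[OF has_derivative_affine_compose[OF g]] linear_cmul[OF lin] mult_ac)
qed simp

lemma smooth_affine:
 assumes "smooth f"
 shows "smooth (\<lambda>x. f (a *\<^sub>R x + c))" unfolding smooth_def
proof (intro allI impI)
 fix bs :: "'a list" assume bs: "set bs \<subseteq> Basis"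
 show "partial_derivs bs (\<lambda>x. f (a *\<^sub>R x + c)) differentiable_on UNIV"
  unfolding partial_derivs_affine[OF assms bs] differentiable_on_def
  by (intro ballI differentiableI[OF has_derivative_affine_compose[OF smooth_partial_derivs[OF assms bs]]])
qed

lemma partial_derivs_sum:
 assumes "\<And>i. i \<in> I ==> smooth (f i)" "set bs \<subseteq> Basis"
 shows "partial_derivs bs (\<lambda>x. \<Sum>i\<in>I. f i x) = (\<lambda>x. \<Sum>i\<in>I. partial_derivs bs (f i) x)" using assms(2)
proof (induction bs)
 case (Cons b bs)
 have "((\<lambda>x. \<Sum>i\<in>I. partial_derivs bs (f i) x) has_derivative
   (\<lambda>h. \<Sum>i\<in>I. frechet_derivative (partial_derivs bs (f i)) (at x) h)) (at x)" for x
  using smooth_imp_differentiable[OF smooth_partial_derivs[OF assms(1), of _ bs]] Cons.prems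
  by (intro has_derivative_sum) (simp add: frechet_derivative_works)
 from frechet_derivative_eqI[OF this] show ?case using Cons by simp
qed simp

lemma smooth_scale: "smooth f ==> smooth (\<lambda>x. c * f x)" by (intro smooth_mult smooth_const)

subsection \<open>Bump functions\<close>

text \<open>Differentiating \<open>p (1 / x) * exp (- (1 / x))\<close> produces the factor
  \<open>1 / x ^ 2\<close> and the polynomial \<open>p - p'\<close>; the recursion records
  this.\<close>

fun flat_poly :: "nat => real poly" where
 "flat_poly 0 = 1"
| "flat_poly (Suc k) = [:0, 0, 1:] * (flat_poly k - pderiv (flat_poly k))"

definition flat_deriv :: "nat => real => real" where
 "flat_deriv k x = (if 0 < x then poly (flat_poly k) (1 / x) * exp (- (1 / x)) else 0)"

lemma poly_exp_tendsto_0: "((\<lambda>y. poly p y * exp (- y)) \<longlongrightarrow> 0) at_top" for p :: "real poly"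
proof -
 have "((\<lambda>y. \<Sum>i\<le>degree p. coeff p i * (y ^ i / exp y)) \<longlongrightarrow> (\<Sum>i\<le>degree p. coeff p i * 0)) at_top"
  by (intro tendsto_sum tendsto_mult tendsto_const tendsto_power_div_exp_0)
 moreover have "(\<Sum>i\<le>degree p. coeff p i * (y ^ i / exp y)) = poly p y * exp (- y)" for y :: real
  by (simp add: poly_altdef exp_minus divide_inverse sum_distrib_right mult.assoc)
 ultimately show ?thesis by simp
qed

text \<open>For \<open>x > 0\<close> this is the recursion of \<open>flat_poly\<close>. At 0 the
  difference quotient from the right is a polynomial in \<open>1 / h\<close> times
  \<open>exp (- (1 / h))\<close>, which tends to 0.\<close>

lemma flat_deriv_has_derivative: "(flat_deriv k has_real_derivative flat_deriv (Suc k) x) (at x)"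
proof (cases "x = 0")
 case False
 show ?thesis
 proof (cases "0 < x")
  case True
  have "((\<lambda>x. poly (flat_poly k) (1 / x) * exp (- (1 / x))) has_real_derivative flat_deriv (Suc k) x) (at x)"
   using True by (auto intro!: derivative_eq_intros DERIV_chain2[OF poly_DERIV] simp: flat_deriv_def power2_eq_square field_simps)
  thus ?thesis by (rule DERIV_cong_ev[THEN iffD1, rotated -1])
    (use True eventually_nhds_in_open[of "{0<..}" x] in \<open>auto simp: flat_deriv_def elim!: eventually_mono\<close>)
 next
  case n: False
  have "((\<lambda>x. 0 :: real) has_real_derivative flat_deriv (Suc k) x) (at x)" using n by (simp add: flat_deriv_def)
  thus ?thesis by (rule DERIV_cong_ev[THEN iffD1, rotated -1])
    (use n False eventually_nhds_in_open[of "{..<0}" x] in \<open>auto simp: flat_deriv_def elim!: eventually_mono\<close>)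
 qed
next
 case True
 have "((\<lambda>h. (flat_deriv k h - flat_deriv k 0) / h) \<longlongrightarrow> 0) (at 0)"
 proof (rule filterlim_split_at)
  have "\<forall>\<^sub>F h in at_left (0 :: real). 0 = (flat_deriv k h - flat_deriv k 0) / h" by (auto simp: eventually_at_filter flat_deriv_def)
  thus "((\<lambda>h. (flat_deriv k h - flat_deriv k 0) / h) \<longlongrightarrow> 0) (at_left 0)"
   by (rule Lim_transform_eventually[OF tendsto_const])
  have "((\<lambda>h. poly ([:0, 1:] * flat_poly k) (inverse h) * exp (- inverse h)) \<longlongrightarrow> 0) (at_right 0)"
   by (rule filterlim_compose[OF poly_exp_tendsto_0 filterlim_inverse_at_top_right])
  moreover have "\<forall>\<^sub>F h in at_right (0 :: real). poly ([:0, 1:] * flat_poly k) (inverse h) * exp (- inverse h) = (flat_deriv k h - flat_deriv k 0) / h"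
   by (auto simp: eventually_at_filter flat_deriv_def divide_inverse)
  ultimately show "((\<lambda>h. (flat_deriv k h - flat_deriv k 0) / h) \<longlongrightarrow> 0) (at_right 0)" by (rule Lim_transform_eventually)
 qed
 thus ?thesis using True by (simp add: has_field_derivative_iff flat_deriv_def)
qed

definition flat :: "real => real" where "flat = flat_deriv 0"

lemma flat_pos_iff: "0 < flat x \<longleftrightarrow> 0 < x" and flat_nonneg: "0 <= flat x" and flat_le_1: "flat x <= 1"
 and flat_eq_0: "x <= 0 ==> flat x = 0" by (auto simp: flat_def flat_deriv_def)

definition box_bump :: "'a::euclidean_space => 'a => 'a => real" where
 "box_bump p q x = (\<Prod>b\<in>Basis. flat (x \<bullet> b - p \<bullet> b) * flat (q \<bullet> b - x \<bullet> b))"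

lemma smooth_box_bump: "smooth (box_bump p q)"
proof -
 have "smooth (\<lambda>x. flat_deriv 0 (x \<bullet> b + - (p \<bullet> b)))" "smooth (\<lambda>x. flat_deriv 0 (x \<bullet> (- b) + q \<bullet> b))" for b
  by (intro smooth_compose_inner flat_deriv_has_derivative)+
 thus ?thesis unfolding box_bump_def[abs_def] flat_def by (intro smooth_prod smooth_mult) (simp_all add: algebra_simps)
qed

lemma box_bump_nonneg: "0 <= box_bump p q x"
 and box_bump_le_1: "box_bump p q x <= 1" by (auto simp: box_bump_def flat_nonneg flat_le_1 intro!: prod_nonneg prod_le_1 mult_le_one)

lemma box_bump_pos_iff: "0 < box_bump p q x \<longleftrightarrow> x \<in> box p q"
proof
 assume x: "0 < box_bump p q x"
 show "x \<in> box p q"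
 proof (rule ccontr)
  assume "x \<notin> box p q"
  then obtain b where "b \<in> Basis" "x \<bullet> b <= p \<bullet> b \<or> q \<bullet> b <= x \<bullet> b" by (auto simp: mem_box not_less)
  hence "box_bump p q x = 0" unfolding box_bump_def by (intro prod_zero) (auto intro!: bexI[of _ b] simp: flat_eq_0)
  with x show False by simp
 qed
next
 assume "x \<in> box p q"
 thus "0 < box_bump p q x" unfolding box_bump_def by (intro prod_pos) (auto simp: flat_pos_iff mem_box)
qed

lemma box_bump_eq_0: "x \<notin> box p q ==> box_bump p q x = 0" using box_bump_pos_iff[of p q x] box_bump_nonneg[of p q x] by linarith

lemma test_functionsI:
 assumes "smooth \<phi>" "\<And>x. \<phi> x \<noteq> 0 ==> x \<in> K" "compact K" "K \<subseteq> U"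
 shows "\<phi> \<in> test_functions U"
proof -
 have "closure {x. \<phi> x \<noteq> 0} \<subseteq> K" using assms by (intro closure_minimal compact_imp_closed) auto
 moreover from this have "compact (closure {x. \<phi> x \<noteq> 0})"
  using assms(3) by (meson closed_closure compact_Int_closed inf.absorb_iff2 compact_imp_bounded bounded_subset compact_eq_bounded_closed)
 ultimately show ?thesis using assms by (auto simp: test_functions_def)
qed

lemma test_functionsE:
 assumes "\<phi> \<in> test_functions U"
 obtains K where "compact K" "K \<subseteq> U" "\<And>x. x \<notin> K ==> \<phi> x = 0"
proof (rule that[of "closure {x. \<phi> x \<noteq> 0}"])
 show "\<phi> x = 0" if "x \<notin> closure {x. \<phi> x \<noteq> 0}" for x using that closure_subset[of "{x. \<phi> x \<noteq> 0}"] by blast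
qed (use assms in \<open>auto simp: test_functions_def\<close>)

lemma test_functions_smooth: "\<phi> \<in> test_functions U ==> smooth \<phi>" by (simp add: test_functions_def)

lemma test_functions_zero: "(\<lambda>x. 0) \<in> test_functions U" by (rule test_functionsI[of _ "{}"]) (auto intro: smooth_const)

lemma test_functions_add:
 assumes "\<phi> \<in> test_functions U" "g \<in> test_functions U"
 shows "(\<lambda>x. \<phi> x + g x) \<in> test_functions U"
proof -
 obtain K where K: "compact K" "K \<subseteq> U" "\<And>x. x \<notin> K ==> \<phi> x = 0" using test_functionsE[OF assms(1)] by metis
 obtain L where L: "compact L" "L \<subseteq> U" "\<And>x. x \<notin> L ==> g x = 0" using test_functionsE[OF assms(2)] by metis
 show ?thesis
 proof (rule test_functionsI[of _ "K \<union> L"])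
  show "x \<in> K \<union> L" if "\<phi> x + g x \<noteq> 0" for x using K(3)[of x] L(3)[of x] that by (cases "x \<in> K"; cases "x \<in> L") auto
 qed (use K L assms in \<open>auto intro: smooth_add test_functions_smooth\<close>)
qed

lemma test_functions_mult_smooth:
 assumes "\<phi> \<in> test_functions U" "smooth f"
 shows "(\<lambda>x. f x * \<phi> x) \<in> test_functions U"
proof -
 obtain K where K: "compact K" "K \<subseteq> U" "\<And>x. x \<notin> K ==> \<phi> x = 0" using test_functionsE[OF assms(1)] by metis
 show ?thesis by (rule test_functionsI[of _ "K"])
   (use K assms in \<open>auto intro: smooth_mult test_functions_smooth\<close>)
qed

lemma test_functions_scale: "\<phi> \<in> test_functions U ==> (\<lambda>x. c * \<phi> x) \<in> test_functions U"
 by (intro test_functions_mult_smooth smooth_const)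

lemma test_functions_mono: "U \<subseteq> V ==> test_functions U \<subseteq> test_functions V" by (auto simp: test_functions_def)

lemma test_functions_partial_derivs:
 assumes "\<phi> \<in> test_functions U" "set bs \<subseteq> Basis"
 shows "partial_derivs bs \<phi> \<in> test_functions U"
proof -
 let ?K = "closure {x. \<phi> x \<noteq> 0}"
 have K: "compact ?K" "?K \<subseteq> U" using assms by (auto simp: test_functions_def)
 have "partial_derivs bs \<phi> x = 0" if "x \<in> - ?K" for x using that
 proof (induction bs arbitrary: x)
  case Nil
  thus ?case using closure_subset[of "{x. \<phi> x \<noteq> 0}"] by auto
 next
  case (Cons b bs)
  have "((\<lambda>x. 0 :: real) has_derivative (\<lambda>h. 0)) (at x)" by simp
  hence "(partial_derivs bs \<phi> has_derivative (\<lambda>h. 0)) (at x)"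
   by (rule has_derivative_transform_within_open[of _ _ _ _ "- ?K"]) (use Cons in auto)
  thus ?case by (simp add: frechet_derivative_eqI)
 qed
 thus ?thesis using smooth_partial_derivs[OF test_functions_smooth[OF assms(1)] assms(2)] K by (intro test_functionsI[of _ ?K]) auto
qed

lemma test_functions_borel: "\<phi> \<in> test_functions U ==> borel_fun \<phi>"
 by (intro borel_measurable_continuous_onI smooth_imp_continuous test_functions_smooth)

lemma test_functions_bounded:
 assumes "\<phi> \<in> test_functions U"
 obtains B where "B > 0" "\<And>x. \<bar>\<phi> x\<bar> <= B"
proof -
 obtain K where K: "compact K" "K \<subseteq> U" "\<And>x. x \<notin> K ==> \<phi> x = 0" using test_functionsE[OF assms] by metis
 have "bounded (\<phi> ` K)" by (intro compact_imp_bounded compact_continuous_image K smooth_imp_continuous test_functions_smooth[OF assms])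
 then obtain B where "B > 0" "\<And>x. x \<in> K ==> \<bar>\<phi> x\<bar> <= B" by (auto simp: bounded_pos)
 thus thesis using K by (intro that[of B]) (metis abs_zero less_imp_le)+
qed

section \<open>Density of the test functions among square integrable functions\<close>

lemma test_functions_nn_integral_finite:
 fixes \<phi> :: "'a::euclidean_space => real"
 assumes "\<phi> \<in> test_functions U"
 shows "sq_int \<phi> < \<infinity>"
proof -
 obtain K where K: "compact K" "K \<subseteq> U" "\<And>x. x \<notin> K ==> \<phi> x = 0" using test_functionsE[OF assms] by metis
 obtain B where B: "B > 0" "\<And>x. \<bar>\<phi> x\<bar> <= B" using test_functions_bounded[OF assms] by metis
 have "sq_int \<phi> <= (\<integral>\<^sup>+x. ennreal (B^2) * indicator K x \<partial>lborel)"
 proof (rule nn_integral_mono)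
  fix x
  have "(\<phi> x)^2 <= B^2" using B(2)[of x] by (metis abs_ge_zero power2_abs power_mono)
  thus "ennreal ((\<phi> x)^2) <= ennreal (B^2) * indicator K x" using K(3)[of x] by (cases "x \<in> K") (auto intro: ennreal_leI)
 qed
 also have "\<dots> = ennreal (B^2) * emeasure lborel K" using borel_compact[OF K(1)] by (subst nn_integral_cmult) auto
 also have "\<dots> < \<infinity>" using emeasure_compact_finite[OF K(1)] by (simp add: ennreal_mult_less_top)
 finally show ?thesis .
qed

text \<open>Borel functions and integrals in \<open>ennreal\<close> spare integrability conditions
  when limits are taken. Density follows by measure-theoretic induction over boxes, Borel sets in a
  box, Borel sets of finite measure and simple functions.\<close>

definition l2_approx :: "'a::euclidean_space set => ('a => real) => bool" where
 "l2_approx U f \<longleftrightarrow> f \<in> borel_measurable borel \<and>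
   (\<forall>e>0. \<exists>\<phi>\<in>test_functions U. sq_int (\<lambda>x. f x - \<phi> x) < ennreal e)"

lemma l2_approx_test: "\<phi> \<in> test_functions U ==> l2_approx U \<phi>"
 unfolding l2_approx_def using test_functions_borel[of \<phi> U] by (intro conjI allI impI bexI[of _ \<phi>]) auto

lemma nn_integral_square_add_le:
 fixes f g :: "'a::euclidean_space => real"
 assumes [measurable]: "borel_fun f" "borel_fun g"
 shows "sq_int (\<lambda>x. f x + g x) <=
  2 * sq_int f + 2 * sq_int g"
proof -
 have "sq_int (\<lambda>x. f x + g x) <= (\<integral>\<^sup>+x. 2 * ennreal ((f x)^2) + 2 * ennreal ((g x)^2) \<partial>lborel)"
 proof (rule nn_integral_mono)
  fix x
  have "(f x + g x)^2 <= 2 * (f x)^2 + 2 * (g x)^2" using zero_le_power2[of "f x - g x"] by (simp add: power2_eq_square algebra_simps)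
  hence "ennreal ((f x + g x)^2) <= ennreal (2 * (f x)^2 + 2 * (g x)^2)" by (rule ennreal_leI)
  also have "\<dots> = 2 * ennreal ((f x)^2) + 2 * ennreal ((g x)^2)" by (simp add: ennreal_plus ennreal_mult')
  finally show "ennreal ((f x + g x)^2) <= 2 * ennreal ((f x)^2) + 2 * ennreal ((g x)^2)" .
 qed
 also have "\<dots> = 2 * sq_int f + 2 * sq_int g" by (simp add: nn_integral_add nn_integral_cmult)
 finally show ?thesis .
qed

lemma l2_approx_near:
 assumes f [measurable]: "borel_fun f"
  and near: "\<And>e. 0 < e ==> \<exists>g. l2_approx U g \<and> sq_int (\<lambda>x. f x - g x) < ennreal e"
 shows "l2_approx U f" unfolding l2_approx_def
proof (intro conjI f allI impI)
 fix e :: real assume e: "0 < e"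
 hence e4: "0 < e / 4" by simp
 obtain g where g: "l2_approx U g" "sq_int (\<lambda>x. f x - g x) < ennreal (e / 4)" using near[OF e4] by blast
 then obtain \<phi> where \<phi>: "\<phi> \<in> test_functions U" "sq_int (\<lambda>x. g x - \<phi> x) < ennreal (e / 4)"
  using e4 unfolding l2_approx_def by blast
 have [measurable]: "borel_fun g" "borel_fun \<phi>" using g(1) test_functions_borel[OF \<phi>(1)] by (auto simp: l2_approx_def)
 have "sq_int (\<lambda>x. f x - \<phi> x) <=
   2 * sq_int (\<lambda>x. f x - g x) + 2 * sq_int (\<lambda>x. g x - \<phi> x)"
  using nn_integral_square_add_le[of "\<lambda>x. f x - g x" "\<lambda>x. g x - \<phi> x"] by simp
 also have "\<dots> < 2 * ennreal (e / 4) + 2 * ennreal (e / 4)" using g(2) \<phi>(2) by (intro add_strict_mono ennreal_mult_strict_left_mono) auto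
 also have "\<dots> = ennreal e"
  using e by (simp add: ennreal_plus[symmetric] ennreal_mult'[symmetric] ennreal_numeral[symmetric] del: ennreal_plus ennreal_numeral)
 finally show "\<exists>\<phi>\<in>test_functions U. sq_int (\<lambda>x. f x - \<phi> x) < ennreal e" using \<phi>(1) by blast
qed

lemma l2_approx_add:
 assumes "l2_approx U f" "l2_approx U g"
 shows "l2_approx U (\<lambda>x. f x + g x)" unfolding l2_approx_def
proof (intro conjI allI impI)
 have fg [measurable]: "borel_fun f" "borel_fun g" using assms by (auto simp: l2_approx_def)
 show "borel_fun (\<lambda>x. f x + g x)" by measurable
 fix e :: real assume "0 < e"
 hence e4: "0 < e / 4" by simp
 obtain \<phi> where \<phi>: "\<phi> \<in> test_functions U" "sq_int (\<lambda>x. f x - \<phi> x) < ennreal (e / 4)"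
  using assms(1) e4 unfolding l2_approx_def by blast
 obtain q where q: "q \<in> test_functions U" "sq_int (\<lambda>x. g x - q x) < ennreal (e / 4)" using assms(2) e4 unfolding l2_approx_def by blast
 have [measurable]: "borel_fun \<phi>" "borel_fun q" using \<phi>(1) q(1) by (auto intro: test_functions_borel)
 have "sq_int (\<lambda>x. f x + g x - (\<phi> x + q x)) <=
   2 * sq_int (\<lambda>x. f x - \<phi> x) + 2 * sq_int (\<lambda>x. g x - q x)"
  using nn_integral_square_add_le[of "\<lambda>x. f x - \<phi> x" "\<lambda>x. g x - q x"] by (simp add: algebra_simps)
 also have "\<dots> < 2 * ennreal (e / 4) + 2 * ennreal (e / 4)" using \<phi>(2) q(2) by (intro add_strict_mono ennreal_mult_strict_left_mono) auto
 also have "\<dots> = ennreal e"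
  using \<open>0 < e\<close> by (simp add: ennreal_plus[symmetric] ennreal_mult'[symmetric] ennreal_numeral[symmetric] del: ennreal_plus ennreal_numeral)
 finally show "\<exists>\<phi>\<in>test_functions U. sq_int (\<lambda>x. f x + g x - \<phi> x) < ennreal e"
  by (intro bexI[OF _ test_functions_add[OF \<phi>(1) q(1)]])
qed

lemma l2_approx_scale:
 assumes "l2_approx U f"
 shows "l2_approx U (\<lambda>x. c * f x)" unfolding l2_approx_def
proof (intro conjI allI impI)
 have f [measurable]: "borel_fun f" using assms by (auto simp: l2_approx_def)
 show "borel_fun (\<lambda>x. c * f x)" by measurable
 fix d :: real assume "0 < d"
 hence e: "0 < d / (c^2 + 1)" by (simp add: add_nonneg_pos)
 obtain \<phi> where \<phi>: "\<phi> \<in> test_functions U" "sq_int (\<lambda>x. f x - \<phi> x) < ennreal (d / (c^2 + 1))"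
  using assms e unfolding l2_approx_def by blast
 have [measurable]: "borel_fun \<phi>" using \<phi>(1) by (rule test_functions_borel)
 have "sq_int (\<lambda>x. c * f x - c * \<phi> x) = ennreal (c^2) * sq_int (\<lambda>x. f x - \<phi> x)"
  by (subst nn_integral_cmult[symmetric]) (auto simp: ennreal_mult[symmetric] power_mult_distrib right_diff_distrib[symmetric])
 also have "\<dots> <= ennreal (c^2) * ennreal (d / (c^2 + 1))" using \<phi>(2) by (intro mult_left_mono) auto
 also have "\<dots> = ennreal (c^2 * (d / (c^2 + 1)))" using e by (intro ennreal_mult[symmetric]) auto
 also have "\<dots> < ennreal d"
 proof (rule ennreal_lessI)
  have "c^2 / (c^2 + 1) < 1" by (simp add: add_nonneg_pos)
  hence "d * (c^2 / (c^2 + 1)) < d * 1" using \<open>0 < d\<close> by (intro mult_strict_left_mono)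
  thus "c^2 * (d / (c^2 + 1)) < d" by (simp add: mult.commute)
 qed (rule \<open>0 < d\<close>)
 finally show "\<exists>\<phi>\<in>test_functions U. sq_int (\<lambda>x. c * f x - \<phi> x) < ennreal d"
  by (intro bexI[OF _ test_functions_scale[OF \<phi>(1), of c]])
qed

lemma l2_approx_sum: "(\<And>i. i \<in> I ==> l2_approx U (f i)) ==> l2_approx U (\<lambda>x. \<Sum>i\<in>I. f i x)"
 by (induction I rule: infinite_finite_induct) (auto intro: l2_approx_add l2_approx_test test_functions_zero)

lemma l2_approx_diff: "l2_approx U f ==> l2_approx U g ==> l2_approx U (\<lambda>x. f x - g x)"
 using l2_approx_add[of U f "\<lambda>x. -1 * g x"] l2_approx_scale[of U g "-1"] by simp

lemma l2_approx_dominated: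
 fixes f :: "'a::euclidean_space => real"
 assumes F: "\<And>n. l2_approx U (F n)" and f [measurable]: "borel_fun f" and g [measurable]: "borel_fun g"
  and lim: "AE x in lborel. (\<lambda>n. F n x) \<longlonglongrightarrow> f x" and dom: "\<And>n x. \<bar>F n x\<bar> <= g x"
  and fin: "sq_int g < \<infinity>"
 shows "l2_approx U f"
proof (rule l2_approx_near[OF f])
 have [measurable]: "F n \<in> borel_measurable borel" for n using F by (auto simp: l2_approx_def)
 have "(\<lambda>n. sq_int (\<lambda>x. f x - F n x)) \<longlonglongrightarrow> (\<integral>\<^sup>+x. 0 \<partial>(lborel :: 'a measure))"
 proof (rule nn_integral_dominated_convergence[where w = "\<lambda>x. 4 * ennreal ((g x)^2)"])
  show "(\<integral>\<^sup>+x. 4 * ennreal ((g x)^2) \<partial>lborel) < \<infinity>"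
   using fin by (simp add: nn_integral_cmult ennreal_mult_less_top)
  show "AE x in lborel. ennreal ((f x - F n x)^2) <= 4 * ennreal ((g x)^2)" for n using lim
  proof eventually_elim
   case (elim x)
   have "\<bar>f x\<bar> <= g x" using tendsto_rabs[OF elim] dom by (intro LIMSEQ_le_const2) auto
   hence "\<bar>f x - F n x\<bar> <= 2 * g x" using dom[of n x] by linarith
   hence "(f x - F n x)^2 <= (2 * g x)^2" by (metis abs_ge_zero power2_abs power_mono)
   hence "ennreal ((f x - F n x)^2) <= ennreal (4 * (g x)^2)" by (intro ennreal_leI) simp
   thus ?case by (simp add: ennreal_mult')
  qed
  show "AE x in lborel. (\<lambda>n. ennreal ((f x - F n x)^2)) \<longlonglongrightarrow> 0" using lim
  proof eventually_elim
   case (elim x)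
   have "(\<lambda>n. ennreal ((f x - F n x)^2)) \<longlonglongrightarrow> ennreal ((f x - f x)^2)" by (intro tendsto_ennrealI tendsto_intros elim)
   thus ?case by simp
  qed
 qed measurable
 hence lim0: "(\<lambda>n. sq_int (\<lambda>x. f x - F n x)) \<longlonglongrightarrow> 0" by simp
 fix e :: real assume "0 < e"
 hence "\<forall>\<^sub>F n in sequentially. sq_int (\<lambda>x. f x - F n x) < ennreal e" using order_tendstoD(2)[OF lim0, of "ennreal e"] by simp
 then obtain n where "sq_int (\<lambda>x. f x - F n x) < ennreal e" by (auto simp: eventually_sequentially)
 thus "\<exists>g. l2_approx U g \<and> sq_int (\<lambda>x. f x - g x) < ennreal e" using F by blast
qed

lemma nn_integral_square_indicator:
 "(\<integral>\<^sup>+x. ennreal ((indicator A x)^2) \<partial>M) = (\<integral>\<^sup>+x. indicator A x \<partial>M)"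
 by (intro nn_integral_cong) (auto simp: indicator_def)

text \<open>\<open>1 - (1 - b) ^ n\<close> turns a bump \<open>b\<close> with values in \<open>[0, 1]\<close> into the indicator function of
 its support.\<close>

lemma l2_approx_box:
 fixes p q :: "'a::euclidean_space"
 assumes U: "cbox p q \<subseteq> U"
 shows "l2_approx U (indicator (box p q))"
proof (rule l2_approx_dominated[where F = "\<lambda>n x. 1 - (1 - box_bump p q x) ^ n" and g = "indicator (box p q)"])
 have b01: "0 <= 1 - box_bump p q x" "1 - box_bump p q x <= 1" for x using box_bump_le_1[of p q x] box_bump_nonneg[of p q x] by auto
 show "l2_approx U (\<lambda>x. 1 - (1 - box_bump p q x) ^ n)" for n
 proof (rule l2_approx_test, rule test_functionsI[of _ "cbox p q"])
  show "smooth (\<lambda>x. 1 - (1 - box_bump p q x) ^ n)" by (intro smooth_diff smooth_const smooth_power smooth_box_bump)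
  show "x \<in> cbox p q" if "1 - (1 - box_bump p q x) ^ n \<noteq> 0" for x
   using that box_bump_eq_0[of x p q] box_subset_cbox[of p q] by (cases "x \<in> box p q") auto
 qed (use U in auto)
 show "AE x in lborel. (\<lambda>n. 1 - (1 - box_bump p q x) ^ n) \<longlonglongrightarrow> indicator (box p q) x"
 proof (rule AE_I2)
  fix x
  show "(\<lambda>n. 1 - (1 - box_bump p q x) ^ n) \<longlonglongrightarrow> indicator (box p q) x"
  proof (cases "x \<in> box p q")
   case True
   hence "\<bar>1 - box_bump p q x\<bar> < 1" using box_bump_pos_iff[of p q x] b01[of x] by simp
   hence "(\<lambda>n. 1 - (1 - box_bump p q x) ^ n) \<longlonglongrightarrow> 1 - 0" by (intro tendsto_intros LIMSEQ_power_zero) simp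
   thus ?thesis using True by simp
  qed (simp add: box_bump_eq_0)
 qed
 show "\<bar>1 - (1 - box_bump p q x) ^ n\<bar> <= indicator (box p q) x" for n x
  using b01[of x] power_le_one[OF b01(1)[of x] b01(2)[of x], of n] zero_le_power[OF b01(1)[of x], of n]
  by (cases "x \<in> box p q") (auto simp: box_bump_eq_0)
 show "sq_int (indicator (box p q)) < \<infinity>" using emeasure_lborel_box_finite[of p q] by (simp add: nn_integral_square_indicator less_top)
qed auto

text \<open>Dynkin's argument: boxes form an intersection-stable generator, and the property passes
  to complements and to countable disjoint unions. Intersecting with a fixed box keeps all measures
  finite.\<close>

lemma l2_approx_borel_box:
 fixes p q :: "'a::euclidean_space"
 assumes U: "cbox p q \<subseteq> U" and A: "A \<in> sets borel"
 shows "l2_approx U (indicator (A \<inter> box p q))"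
proof -
 let ?G = "range (\<lambda>(a, b). box a b :: 'a set)"
 have A': "A \<in> sigma_sets UNIV ?G" using A by (simp add: borel_eq_box sets_measure_of)
 have stable: "Int_stable ?G"
 proof (rule Int_stableI)
  fix a b assume "a \<in> ?G" "b \<in> ?G"
  then obtain c d c' d' where "a = box c d" "b = box c' d'" by auto
  hence "a \<inter> b = (\<lambda>(a, b). box a b) (\<Sum>i\<in>Basis. max (c \<bullet> i) (c' \<bullet> i) *\<^sub>R i, \<Sum>i\<in>Basis. min (d \<bullet> i) (d' \<bullet> i) *\<^sub>R i)"
   by (simp add: box_Int_box)
  thus "a \<inter> b \<in> ?G" by (rule range_eqI)
 qed
 have "?G \<subseteq> Pow UNIV" by simp
 with stable show ?thesis using A'
 proof (induction rule: sigma_sets_induct_disjoint)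
  case (basic A)
  then obtain a b where A: "A = box a b" by auto
  let ?c = "\<Sum>i\<in>Basis. max (a \<bullet> i) (p \<bullet> i) *\<^sub>R i" and ?d = "\<Sum>i\<in>Basis. min (b \<bullet> i) (q \<bullet> i) *\<^sub>R i"
  have "cbox ?c ?d \<subseteq> U" using U by (auto simp: mem_box subset_iff)
  thus ?case unfolding A box_Int_box by (rule l2_approx_box)
 next
  case empty
  show ?case using l2_approx_test[OF test_functions_zero] by simp
 next
  case (compl A)
  have "(indicator ((UNIV - A) \<inter> box p q) :: 'a => real) = (\<lambda>x. indicator (box p q) x - indicator (A \<inter> box p q) x)"
   by (auto simp: indicator_def fun_eq_iff)
  thus ?case using l2_approx_diff[OF l2_approx_box[OF U] compl(2)] by simp
 next
  case (union A)
  have [measurable]: "A i \<in> sets borel" for i using union(2) by (auto simp: borel_eq_box sets_measure_of)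
  show ?case
  proof (rule l2_approx_dominated[where F = "\<lambda>n x. \<Sum>i<n. indicator (A i \<inter> box p q) x" and g = "indicator (box p q)"])
   show "l2_approx U (\<lambda>x. \<Sum>i<n. indicator (A i \<inter> box p q) x)" for n by (intro l2_approx_sum union)
   have eq: "(\<Sum>i<n. indicator (A i \<inter> box p q) x :: real) = indicator ((\<Union>i<n. A i) \<inter> box p q) x" for n x
   proof -
    have "(\<Sum>i<n. indicator (A i) x :: real) = indicator (\<Union>i<n. A i) x"
     using union(1) by (intro indicator_UN_disjoint[symmetric]) (auto simp: disjoint_family_on_def)
    thus ?thesis by (simp add: indicator_inter_arith flip: sum_distrib_right)
   qed
   show "AE x in lborel. (\<lambda>n. \<Sum>i<n. indicator (A i \<inter> box p q) x) \<longlonglongrightarrow> (indicator ((\<Union>i. A i) \<inter> box p q) x :: real)"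
   proof (rule AE_I2)
    fix x
    have "(\<lambda>n. indicator (\<Union>i<n. A i) x * indicator (box p q) x :: real) \<longlonglongrightarrow> indicator (\<Union>i. A i) x * indicator (box p q) x"
     by (intro tendsto_mult LIMSEQ_indicator_UN tendsto_const)
    thus "(\<lambda>n. \<Sum>i<n. indicator (A i \<inter> box p q) x) \<longlonglongrightarrow> (indicator ((\<Union>i. A i) \<inter> box p q) x :: real)"
     unfolding eq by (simp only: indicator_inter_arith)
   qed
   show "\<bar>\<Sum>i<n. indicator (A i \<inter> box p q) x\<bar> <= (indicator (box p q) x :: real)" for n x
    unfolding eq by (auto simp: indicator_def)
   show "sq_int (indicator (box p q)) < \<infinity>" using emeasure_lborel_box_finite[of p q] by (simp add: nn_integral_square_indicator less_top)
  qed auto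
 qed
qed

text \<open>\<open>U\<close> is a countable union of closed boxes. Their interiors are made
  disjoint, so that each piece of \<open>A\<close> lies in one box; the faces lost in this way are
  null sets, which is why convergence holds almost everywhere.\<close>

lemma l2_approx_indicator:
 fixes A :: "'a::euclidean_space set"
 assumes U: "open U" and A: "A \<in> sets borel" "A \<subseteq> U" "emeasure lborel A < \<infinity>"
 shows "l2_approx U (indicator A)"
proof -
 obtain \<D> where \<D>: "countable \<D>" "\<D> \<subseteq> Pow U" "\<And>X. X \<in> \<D> ==> \<exists>a b. X = cbox a b" "\<Union>\<D> = U"
  using open_countable_Union_open_cbox[OF U] by metis
 define K where "K = from_nat_into (insert {} \<D>)"
 have K: "range K = insert {} \<D>" unfolding K_def using \<D>(1) by (intro range_from_nat_into) auto
 have UK: "(\<Union>i. K i) = U" using K \<D>(4) by auto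
 have "\<exists>a b. K i = cbox a b \<and> cbox a b \<subseteq> U" for i
 proof (cases "K i = {}")
  case True
  have "cbox (One :: 'a) 0 = {}" by (simp add: box_eq_empty ex_in_conv)
  with True show ?thesis by (metis empty_subsetI)
 next
  case False
  hence "K i \<in> \<D>" using K by blast
  thus ?thesis using \<D>(2,3) by (metis PowD subsetD)
 qed
 then obtain a b where ab: "\<And>i. K i = cbox (a i) (b i)" "\<And>i. cbox (a i) (b i) \<subseteq> U" by metis
 define B where "B i = box (a i) (b i)" for i
 have [measurable]: "B i \<in> sets borel" for i by (simp add: B_def)
 have [measurable]: "A \<in> sets borel" by (rule A)
 have dis: "disjointed B i = B i - (\<Union>j<i. B j)" for i by (simp add: disjointed_def atLeast0LessThan)
 show ?thesis
 proof (rule l2_approx_dominated[where F = "\<lambda>n x. \<Sum>i<n. indicator (A \<inter> disjointed B i) x" and g = "indicator A"])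
  show "l2_approx U (\<lambda>x. \<Sum>i<n. indicator (A \<inter> disjointed B i) x)" for n
  proof (rule l2_approx_sum)
   fix i
   have "A \<inter> disjointed B i = (A - (\<Union>j<i. B j)) \<inter> box (a i) (b i)" by (auto simp: dis B_def)
   thus "l2_approx U (indicator (A \<inter> disjointed B i))" using l2_approx_borel_box[OF ab(2), of "A - (\<Union>j<i. B j)" i] by simp
  qed
  have eq: "(\<Sum>i<n. indicator (A \<inter> disjointed B i) x :: real) = indicator A x * indicator (\<Union>i<n. B i) x" for n x
  proof -
   have "(\<Sum>i<n. indicator (disjointed B i) x :: real) = indicator (\<Union>i<n. disjointed B i) x"
    using disjoint_family_disjointed[of B] by (intro indicator_UN_disjoint[symmetric]) (auto simp: disjoint_family_on_def)
   also have "(\<Union>i<n. disjointed B i) = (\<Union>i<n. B i)" using finite_UN_disjointed_eq[of B n] by (simp add: atLeast0LessThan)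
   finally show ?thesis by (simp add: indicator_inter_arith flip: sum_distrib_left)
  qed
  have "(\<Union>i. cbox (a i) (b i) - B i) \<in> null_sets lborel"
  proof (rule null_sets_UN)
   show "cbox (a i) (b i) - B i \<in> null_sets lborel" for i unfolding B_def by (rule null_sets_cbox_Diff_box)
  qed
  hence "AE x in lborel. x \<notin> (\<Union>i. cbox (a i) (b i) - B i)" by (rule AE_not_in)
  thus "AE x in lborel. (\<lambda>n. \<Sum>i<n. indicator (A \<inter> disjointed B i) x) \<longlonglongrightarrow> (indicator A x :: real)"
  proof eventually_elim
   case (elim x)
   have "(\<lambda>n. indicator A x * indicator (\<Union>i<n. B i) x :: real) \<longlonglongrightarrow> indicator A x * indicator (\<Union>i. B i) x"
    by (intro tendsto_mult LIMSEQ_indicator_UN tendsto_const)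
   also have "indicator A x * indicator (\<Union>i. B i) x = (indicator A x :: real)"
   proof (cases "x \<in> A")
    case True
    then obtain i where "x \<in> K i" using A(2) UK by blast
    hence "x \<in> B i" using elim ab(1) by auto
    thus ?thesis by (auto simp: indicator_def)
   qed simp
   finally show ?case unfolding eq .
  qed
  show "\<bar>\<Sum>i<n. indicator (A \<inter> disjointed B i) x\<bar> <= (indicator A x :: real)" for n x
   unfolding eq by (auto simp: indicator_def)
  show "sq_int (indicator A) < \<infinity>" using A(3) by (simp add: nn_integral_square_indicator less_top)
 qed auto
qed

text \<open>Approximation by simple functions bounded by \<open>2 * \<bar>f\<bar>\<close>. A level
  set of a nonzero value lies in \<open>U\<close>, because \<open>f\<close> is zero elsewhere, and
  has finite measure by Chebyshev's inequality.\<close>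

theorem l2_dense:
 fixes f :: "'a::euclidean_space => real"
 assumes U: "open U" and f [measurable]: "borel_fun f"
  and fin: "sq_int f < \<infinity>" and zero: "\<And>x. x \<notin> U ==> f x = 0"
 shows "l2_approx U f"
proof -
 obtain s where s: "\<And>i. simple_function borel (s i)" "\<And>x. (\<lambda>i. s i x) \<longlonglongrightarrow> f x" "\<And>i x. \<bar>s i x\<bar> <= 2 * \<bar>f x\<bar>"
  using borel_measurable_implies_sequence_metric[OF f, of 0] by (auto simp: dist_real_def)
 have fin4: "sq_int (\<lambda>x. 2 * \<bar>f x\<bar>) < \<infinity>"
 proof -
  have "sq_int (\<lambda>x. 2 * \<bar>f x\<bar>) = 4 * sq_int f"
   by (subst nn_integral_cmult[symmetric]) (auto simp: power_mult_distrib ennreal_mult')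
  thus ?thesis using fin by (simp add: ennreal_mult_less_top)
 qed
 show ?thesis
 proof (rule l2_approx_dominated[where F = s and g = "\<lambda>x. 2 * \<bar>f x\<bar>"])
  show "l2_approx U (s i)" for i
  proof -
   have sm [measurable]: "s i \<in> borel_measurable borel" using s(1) by (rule borel_measurable_simple_function)
   have finr: "finite (range (s i))" using simple_functionD(1)[OF s(1), of i] by simp
   have rep: "s i = (\<lambda>x. \<Sum>y\<in>range (s i). y * indicator (s i -` {y}) x)"
   proof
    fix x
    have "(\<Sum>y\<in>range (s i). y * indicator (s i -` {y}) x) = (\<Sum>y\<in>range (s i). if y = s i x then y else 0)"
     by (intro sum.cong) (auto simp: indicator_def)
    thus "s i x = (\<Sum>y\<in>range (s i). y * indicator (s i -` {y}) x)" using finr by simp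
   qed
   have "l2_approx U (\<lambda>x. y * indicator (s i -` {y}) x)" for y
   proof (cases "y = 0")
    case True
    thus ?thesis using l2_approx_test[OF test_functions_zero] by simp
   next
    case False
    let ?A = "s i -` {y}"
    have A [measurable]: "?A \<in> sets borel" using measurable_sets[OF sm, of "{y}"] by simp
    have "?A \<subseteq> U"
    proof
     fix x assume "x \<in> ?A"
     thus "x \<in> U" using s(3)[of i x] zero[of x] False by (cases "x \<in> U") auto
    qed
    moreover have "emeasure lborel ?A < \<infinity>"
    proof -
     have "ennreal (y^2) * emeasure lborel ?A = (\<integral>\<^sup>+x. ennreal (y^2) * indicator ?A x \<partial>lborel)"
      by (subst nn_integral_cmult) auto
     also have "\<dots> <= sq_int (\<lambda>x. 2 * \<bar>f x\<bar>)"
     proof (rule nn_integral_mono)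
      fix x
      show "ennreal (y^2) * indicator ?A x <= ennreal ((2 * \<bar>f x\<bar>)^2)"
      proof (cases "x \<in> ?A")
       case True
       hence "y^2 <= (2 * \<bar>f x\<bar>)^2" using s(3)[of i x] by (metis abs_ge_zero power2_abs power_mono singletonD vimageE)
       thus ?thesis using True by (simp add: ennreal_leI)
      qed simp
     qed
     also note fin4
     finally show ?thesis using False by (auto simp: ennreal_mult_less_top ennreal_eq_0_iff)
    qed
    ultimately show ?thesis by (intro l2_approx_scale l2_approx_indicator U A)
   qed
   thus ?thesis by (subst rep) (intro l2_approx_sum)
  qed
 qed (use s fin4 in auto)
qed

subsection \<open>Differentiation under the integral sign\<close>

definition dir_deriv :: "'a::euclidean_space => ('a => real) => 'a => real" where
 "dir_deriv w f x = frechet_derivative f (at x) w"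

lemma dir_deriv_eq_sum:
 assumes "smooth f"
 shows "dir_deriv w f = (\<lambda>x. \<Sum>b\<in>Basis. (w \<bullet> b) * partial_derivs [b] f x)"
proof
 fix x
 have lin: "linear (frechet_derivative f (at x))" by (rule linear_frechet_derivative[OF smooth_imp_differentiable[OF assms]])
 have "frechet_derivative f (at x) w = frechet_derivative f (at x) (\<Sum>b\<in>Basis. (w \<bullet> b) *\<^sub>R b)"
  by (simp add: euclidean_representation)
 also have "\<dots> = (\<Sum>b\<in>Basis. (w \<bullet> b) * frechet_derivative f (at x) b)" by (simp add: linear_sum[OF lin] linear_cmul[OF lin])
 finally show "dir_deriv w f x = (\<Sum>b\<in>Basis. (w \<bullet> b) * partial_derivs [b] f x)" by (simp add: dir_deriv_def)
qed

lemma test_functions_sum: "(\<And>i. i \<in> I ==> f i \<in> test_functions U) ==> (\<lambda>x. \<Sum>i\<in>I. f i x) \<in> test_functions U"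
 by (induction I rule: infinite_finite_induct) (auto intro: test_functions_zero test_functions_add)

lemma test_functions_dir_deriv:
 assumes "\<phi> \<in> test_functions U"
 shows "dir_deriv w \<phi> \<in> test_functions U" unfolding dir_deriv_eq_sum[OF test_functions_smooth[OF assms]]
 by (intro test_functions_sum test_functions_scale test_functions_partial_derivs assms) auto

lemma has_real_derivative_line:
 assumes "smooth g"
 shows "((\<lambda>t. g (y - t *\<^sub>R w)) has_real_derivative - dir_deriv w g (y - t *\<^sub>R w)) (at t)"
proof -
 have D: "(g has_derivative frechet_derivative g (at (y - t *\<^sub>R w))) (at (y - t *\<^sub>R w))"
  using smooth_imp_differentiable[OF assms] by (simp add: frechet_derivative_works)
 have "((\<lambda>t. y - t *\<^sub>R w) has_derivative (\<lambda>h. - (h *\<^sub>R w))) (at t)" by (auto intro!: derivative_eq_intros)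
 from diff_chain_at[OF this D]
 have "((\<lambda>t. g (y - t *\<^sub>R w)) has_derivative (\<lambda>h. frechet_derivative g (at (y - t *\<^sub>R w)) (- (h *\<^sub>R w)))) (at t)"
  by (simp add: comp_def)
 moreover have lin: "linear (frechet_derivative g (at (y - t *\<^sub>R w)))"
  by (rule linear_frechet_derivative[OF smooth_imp_differentiable[OF assms]])
 ultimately show ?thesis unfolding has_field_derivative_def
  by (elim has_derivative_eq_rhs) (simp add: dir_deriv_def linear_neg[OF lin] linear_cmul[OF lin] fun_eq_iff)
qed

lemma integrable_mult_test:
 fixes f :: "'a::euclidean_space => real"
 assumes f [measurable]: "borel_fun f"
  and loc: "\<And>K. compact K ==> integrable lborel (\<lambda>y. indicator K y * f y)"
  and g: "g \<in> test_functions U"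
 shows "integrable lborel (\<lambda>y. f y * g (y - c))"
proof -
 obtain K where K: "compact K" "\<And>x. x \<notin> K ==> g x = 0" using test_functionsE[OF g] by metis
 obtain B where B: "B > 0" "\<And>x. \<bar>g x\<bar> <= B" using test_functions_bounded[OF g] by metis
 have [measurable]: "borel_fun g" by (rule test_functions_borel[OF g])
 let ?K = "(\<lambda>x. c + x) ` K"
 have "integrable lborel (\<lambda>y. B * (indicator ?K y * f y))" by (intro integrable_mult_right loc compact_translation K)
 thus ?thesis
 proof (rule Bochner_Integration.integrable_bound)
  show "AE y in lborel. norm (f y * g (y - c)) <= norm (B * (indicator ?K y * f y))"
  proof (rule AE_I2)
   fix y
   show "norm (f y * g (y - c)) <= norm (B * (indicator ?K y * f y))"
   proof (cases "y - c \<in> K")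
    case True
    hence "y \<in> ?K" by (auto intro!: image_eqI[of _ _ "y - c"])
    moreover have "\<bar>f y\<bar> * \<bar>g (y - c)\<bar> <= \<bar>f y\<bar> * B" using B by (intro mult_left_mono) auto
    ultimately show ?thesis using B by (simp add: abs_mult mult.commute)
   qed (simp add: K)
  qed
 qed measurable
qed

text \<open>Dominated convergence for the difference quotients of \<open>\<psi>\<close>: they are
  bounded by the supremum of the directional derivative and vanish outside the compact set swept by
  the translates with \<open>\<bar>s - t\<bar> <= 1\<close>, where \<open>f\<close> is
  integrable.\<close>

lemma deriv_under_integral:
 fixes f :: "'a::euclidean_space => real"
 assumes f [measurable]: "borel_fun f"
  and loc: "\<And>K. compact K ==> integrable lborel (\<lambda>y. indicator K y * f y)"
  and \<psi>: "\<psi> \<in> test_functions U"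
 shows "((\<lambda>t. LINT y|lborel. f y * \<psi> (y - t *\<^sub>R w)) has_real_derivative
   - (LINT y|lborel. f y * dir_deriv w \<psi> (y - t *\<^sub>R w))) (at t)"
proof -
 have D\<psi>: "dir_deriv w \<psi> \<in> test_functions U" by (rule test_functions_dir_deriv[OF \<psi>])
 have sm: "smooth \<psi>" by (rule test_functions_smooth[OF \<psi>])
 obtain K where K: "compact K" "\<And>x. x \<notin> K ==> \<psi> x = 0" using test_functionsE[OF \<psi>] by metis
 obtain B where B: "B > 0" "\<And>x. \<bar>dir_deriv w \<psi> x\<bar> <= B" using test_functions_bounded[OF D\<psi>] by metis
 have m [measurable]: "borel_fun \<psi>" "dir_deriv w \<psi> \<in> borel_measurable borel" using test_functions_borel \<psi> D\<psi> by blast+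
 have int: "integrable lborel (\<lambda>y. f y * \<psi> (y - c))" for c by (rule integrable_mult_test[OF f loc \<psi>])
 let ?q = "\<lambda>s y. f y * ((\<psi> (y - s *\<^sub>R w) - \<psi> (y - t *\<^sub>R w)) / (s - t))"
 have Lip: "\<bar>\<psi> (y - s *\<^sub>R w) - \<psi> (y - t *\<^sub>R w)\<bar> <= B * \<bar>s - t\<bar>" for y s
 proof -
  have "norm (\<psi> (y - s *\<^sub>R w) - \<psi> (y - t *\<^sub>R w)) <= B * norm (s - t)"
  proof (rule field_differentiable_bound[of UNIV])
   show "((\<lambda>t. \<psi> (y - t *\<^sub>R w)) has_field_derivative - dir_deriv w \<psi> (y - z *\<^sub>R w)) (at z within UNIV)" for z
    using has_real_derivative_line[OF sm] by simp
  qed (use B in auto)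
  thus ?thesis by simp
 qed
 let ?L = "(\<lambda>(s, k). s *\<^sub>R w + k) ` ({t - 1..t + 1} \<times> K)"
 have L: "compact ?L" by (intro compact_continuous_image compact_Times K) (auto simp: split_def intro!: continuous_intros)
 have "((\<lambda>s. LINT y|lborel. ?q s y) \<longlongrightarrow> (LINT y|lborel. - (f y * dir_deriv w \<psi> (y - t *\<^sub>R w)))) (at t)"
  unfolding tendsto_at_iff_sequentially
 proof (intro allI impI)
  fix X :: "nat => real" assume X: "\<forall>i. X i \<in> UNIV - {t}" "X \<longlonglongrightarrow> t"
  then obtain n0 where n0: "\<And>n. n \<ge> n0 ==> \<bar>X n - t\<bar> < 1" by (metis LIMSEQ_iff zero_less_one real_norm_def)
  have "(\<lambda>n. LINT y|lborel. ?q (X (n + n0)) y) \<longlonglongrightarrow> (LINT y|lborel. - (f y * dir_deriv w \<psi> (y - t *\<^sub>R w)))"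
  proof (rule integral_dominated_convergence[where w = "\<lambda>y. B * \<bar>indicator ?L y * f y\<bar>"])
   show "integrable lborel (\<lambda>y. B * \<bar>indicator ?L y * f y\<bar>)" by (intro integrable_mult_right integrable_abs loc L)
   show "AE y in lborel. (\<lambda>n. ?q (X (n + n0)) y) \<longlonglongrightarrow> - (f y * dir_deriv w \<psi> (y - t *\<^sub>R w))"
   proof (rule AE_I2)
    fix y
    have "((\<lambda>s. (\<psi> (y - s *\<^sub>R w) - \<psi> (y - t *\<^sub>R w)) / (s - t)) \<longlongrightarrow> - dir_deriv w \<psi> (y - t *\<^sub>R w)) (at t)"
     using has_real_derivative_line[OF sm, of y w t] by (simp add: has_field_derivative_iff)
    hence "(\<lambda>n. (\<psi> (y - X (n + n0) *\<^sub>R w) - \<psi> (y - t *\<^sub>R w)) / (X (n + n0) - t)) \<longlonglongrightarrow> - dir_deriv w \<psi> (y - t *\<^sub>R w)"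
     by (rule tendsto_at_iff_sequentially[THEN iffD1, rule_format, unfolded comp_def])
      (use X LIMSEQ_ignore_initial_segment[OF X(2)] in auto)
    from tendsto_mult[OF tendsto_const[of "f y"] this]
    show "(\<lambda>n. ?q (X (n + n0)) y) \<longlonglongrightarrow> - (f y * dir_deriv w \<psi> (y - t *\<^sub>R w))" by simp
   qed
   show "AE y in lborel. norm (?q (X (n + n0)) y) <= B * \<bar>indicator ?L y * f y\<bar>" for n
   proof (rule AE_I2)
    fix y
    let ?s = "X (n + n0)"
    have s: "?s \<noteq> t" "\<bar>?s - t\<bar> < 1" using X(1) n0[of "n + n0"] by auto
    show "norm (?q ?s y) <= B * \<bar>indicator ?L y * f y\<bar>"
    proof (cases "y \<in> ?L")
     case True
     have "\<bar>(\<psi> (y - ?s *\<^sub>R w) - \<psi> (y - t *\<^sub>R w)) / (?s - t)\<bar> <= B"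
      using Lip[of y ?s] s by (simp add: divide_le_eq)
     hence "\<bar>f y\<bar> * \<bar>(\<psi> (y - ?s *\<^sub>R w) - \<psi> (y - t *\<^sub>R w)) / (?s - t)\<bar> <= \<bar>f y\<bar> * B"
      by (rule mult_left_mono) simp
     thus ?thesis using True by (simp add: abs_mult mult.commute)
    next
     case False
     have "y - u *\<^sub>R w \<notin> K" if "\<bar>u - t\<bar> <= 1" for u
     proof
      assume "y - u *\<^sub>R w \<in> K"
      hence "(u, y - u *\<^sub>R w) \<in> {t - 1..t + 1} \<times> K" using that by auto
      hence "y \<in> ?L" by (rule image_eqI[rotated]) simp
      with False show False by blast
     qed
     from this[of ?s] this[of t] s have "\<psi> (y - ?s *\<^sub>R w) = 0" "\<psi> (y - t *\<^sub>R w) = 0" by (auto intro: K)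
     thus ?thesis using B by simp
    qed
   qed
  qed measurable
  thus "((\<lambda>s. LINT y|lborel. ?q s y) \<circ> X) \<longlonglongrightarrow> (LINT y|lborel. - (f y * dir_deriv w \<psi> (y - t *\<^sub>R w)))"
   unfolding comp_def by (rule LIMSEQ_offset)
 qed
 moreover have "(LINT y|lborel. ?q s y) = ((LINT y|lborel. f y * \<psi> (y - s *\<^sub>R w)) - (LINT y|lborel. f y * \<psi> (y - t *\<^sub>R w))) / (s - t)" for s
  using int by (simp add: right_diff_distrib diff_divide_distrib)
 moreover have "(LINT y|lborel. - (f y * dir_deriv w \<psi> (y - t *\<^sub>R w))) = - (LINT y|lborel. f y * dir_deriv w \<psi> (y - t *\<^sub>R w))"
  by simp
 ultimately show ?thesis unfolding has_field_derivative_iff by (simp only:)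
qed

text \<open>The mean value theorem trades one difference for one derivative at an intermediate
  point, at the cost of an interval longer by 1.\<close>

lemma seq_diff_le_deriv:
 fixes G :: "nat => real => real"
 assumes "\<And>k t. (G k has_real_derivative G (Suc k) t) (at t)"
  and "\<And>t. 0 <= t ==> t <= real m ==> \<bar>G m t\<bar> <= K"
 shows "\<bar>seq_diff m (\<lambda>n. G 0 (real n)) 0\<bar> <= K" using assms
proof (induction m arbitrary: G)
 case 0
 thus ?case by (simp add: seq_diff_def)
next
 case (Suc m)
 define H where "H k t = G k (t + 1) - G k t" for k t
 have "\<bar>seq_diff m (\<lambda>n. H 0 (real n)) 0\<bar> <= K"
 proof (rule Suc.IH)
  show "(H k has_real_derivative H (Suc k) t) (at t)" for k t
  proof -
   have "((\<lambda>t. G k (t + 1)) has_real_derivative G (Suc k) (t + 1)) (at t)" using Suc.prems(1)[of k "t + 1"] by (simp add: DERIV_shift)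
   thus ?thesis unfolding H_def[abs_def] using Suc.prems(1) by (intro DERIV_diff)
  qed
  show "\<bar>H m t\<bar> <= K" if t: "0 <= t" "t <= real m" for t
  proof -
   obtain z where z: "t < z" "z < t + 1" "G m (t + 1) - G m t = (t + 1 - t) * G (Suc m) z"
    using MVT2[of t "t + 1" "G m" "G (Suc m)"] Suc.prems(1) by auto
   thus ?thesis using Suc.prems(2)[of z] t by (simp add: H_def)
  qed
 qed
 thus ?case by (simp add: seq_diff_Suc H_def add.commute)
qed

text \<open>The integral of a translate does not depend on the translation; differentiate under the
  integral at 0.\<close>

lemma integral_dir_deriv_eq_0:
 fixes g :: "'a::euclidean_space => real"
 assumes "g \<in> test_functions U"
 shows "(LINT y|lborel. dir_deriv w g y) = 0"
proof -
 have [measurable]: "borel_fun g" by (rule test_functions_borel[OF assms])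
 have loc: "integrable lborel (\<lambda>y :: 'a. indicator K y * 1 :: real)" if "compact K" for K
  using emeasure_compact_finite[OF that] borel_compact[OF that] by (simp add: integrable_indicator_iff less_top)
 have "((\<lambda>t. LINT y|lborel. 1 * g (y - t *\<^sub>R w)) has_real_derivative
   - (LINT y|lborel. 1 * dir_deriv w g (y - 0 *\<^sub>R w))) (at 0)" by (rule deriv_under_integral[OF _ loc assms]) auto
 moreover have "(\<lambda>t. LINT y|lborel. 1 * g (y - t *\<^sub>R w)) = (\<lambda>t. LINT y|lborel. g y)"
 proof
  fix t
  show "(LINT y|lborel. 1 * g (y - t *\<^sub>R w)) = (LINT y|lborel. g y)" using lborel_integral_translation[of g "- (t *\<^sub>R w)"] by simp
 qed
 ultimately have "((\<lambda>t :: real. LINT y|lborel. g y) has_real_derivative - (LINT y|lborel. dir_deriv w g y)) (at 0)" by simp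
 moreover have "((\<lambda>t :: real. LINT y|lborel. g y) has_real_derivative 0) (at 0)" by simp
 ultimately show ?thesis using DERIV_unique by fastforce
qed

lemma integrable_test: "g \<in> test_functions U ==> integrable lborel (g :: 'a::euclidean_space => real)"
proof -
 assume g: "g \<in> test_functions U"
 have "integrable lborel (\<lambda>y :: 'a. indicator K y * 1 :: real)" if "compact K" for K
  using emeasure_compact_finite[OF that] borel_compact[OF that] by (simp add: integrable_indicator_iff less_top)
 from integrable_mult_test[OF _ this g, of 0] show ?thesis by simp
qed

lemma test_functions_mult: "\<phi> \<in> test_functions U ==> g \<in> test_functions V ==> (\<lambda>x. \<phi> x * g x) \<in> test_functions V"
 by (intro test_functions_mult_smooth) (auto intro: test_functions_smooth)

text \<open>Derivatives are moved across one at a time, the outermost first, so they arrive in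
  reversed order. Keeping \<open>rev bs\<close> avoids an appeal to the symmetry of mixed
  derivatives.\<close>

lemma integration_by_parts:
 fixes \<phi> g :: "'a::euclidean_space => real"
 assumes \<phi>: "\<phi> \<in> test_functions U" and g: "g \<in> test_functions V" and bs: "set bs \<subseteq> Basis"
 shows "(LINT y|lborel. \<phi> y * partial_derivs bs g y) = (- 1) ^ length bs * (LINT y|lborel. partial_derivs (rev bs) \<phi> y * g y)"
 using \<phi> bs
proof (induction bs arbitrary: \<phi>)
 case (Cons b bs)
 let ?X = "partial_derivs bs g"
 have X: "?X \<in> test_functions V" using Cons.prems by (intro test_functions_partial_derivs g) auto
 have d: "partial_derivs [b] \<phi> \<in> test_functions U" using Cons.prems by (intro test_functions_partial_derivs) auto
 have Xb: "partial_derivs (b # bs) g \<in> test_functions V" using Cons.prems by (intro test_functions_partial_derivs g) auto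
 have prod: "dir_deriv b (\<lambda>x. \<phi> x * ?X x) = (\<lambda>x. \<phi> x * partial_derivs (b # bs) g x + partial_derivs [b] \<phi> x * ?X x)"
  by (auto simp: dir_deriv_def fun_eq_iff smooth_imp_differentiable test_functions_smooth[OF X] test_functions_smooth[OF Cons.prems(1)]
    intro!: frechet_derivative_mult)
 have "(LINT y|lborel. \<phi> y * partial_derivs (b # bs) g y + partial_derivs [b] \<phi> y * ?X y) = 0"
  using integral_dir_deriv_eq_0[OF test_functions_mult[OF Cons.prems(1) X], of b] by (simp only: prod)
 hence "(LINT y|lborel. \<phi> y * partial_derivs (b # bs) g y) = - (LINT y|lborel. partial_derivs [b] \<phi> y * ?X y)"
  using integrable_test[OF test_functions_mult[OF Cons.prems(1) Xb]] integrable_test[OF test_functions_mult[OF d X]]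
  by (subst (asm) Bochner_Integration.integral_add) auto
 also have "(LINT y|lborel. partial_derivs [b] \<phi> y * ?X y) =
   (- 1) ^ length bs * (LINT y|lborel. partial_derivs (rev bs) (partial_derivs [b] \<phi>) y * g y)" using Cons.prems by (intro Cons.IH d) auto
 finally show ?case by (simp add: partial_derivs_append)
qed simp

subsection \<open>Borel representatives of square integrable functions\<close>

lemma rep_L2_square_integrable: "square_integrable (rep_L2 u)" using Quotient_rep_reflp[OF Quotient_L2, of u] by (simp add: ae_equal_def)

lemma rep_abs_L2:
 assumes "square_integrable f"
 shows "AE x in lebesgue. rep_L2 (abs_L2 f) x = f x"
proof -
 have "ae_equal f f" using assms by (simp add: ae_equal_def)
 hence "ae_equal (rep_L2 (abs_L2 f)) f" by (rule Quotient_rep_abs[OF Quotient_L2])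
 thus ?thesis by (simp add: ae_equal_def)
qed

lemma L2_eqI:
 assumes "AE x in lebesgue. rep_L2 u x = rep_L2 v x"
 shows "u = v"
proof -
 have "ae_equal (rep_L2 u) (rep_L2 v)" using assms by (simp add: ae_equal_def rep_L2_square_integrable)
 hence "abs_L2 (rep_L2 u) = abs_L2 (rep_L2 v)" using Quotient_rel[OF Quotient_L2, of "rep_L2 u" "rep_L2 v"] by simp
 thus ?thesis by (simp add: Quotient_abs_rep[OF Quotient_L2])
qed

text \<open>\<open>rep_L2 u\<close> is known to be Lebesgue measurable only; a Borel representative
  can be composed with affine maps and used in Fubini's theorem.\<close>

definition L2_rep :: "'a::euclidean_space L2 => ('a => real) => bool" where
 "L2_rep u f \<longleftrightarrow> f \<in> borel_measurable borel \<and> (AE x in lborel. rep_L2 u x = f x)"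

lemma AE_lebesgue_iff: "(AE x in lebesgue. P x) \<longleftrightarrow> (AE x in lborel. P x)" by (rule AE_completion_iff)

lemma L2_rep_ex: "\<exists>f. L2_rep u f"
proof -
 have "rep_L2 u \<in> borel_measurable lebesgue" using rep_L2_square_integrable[of u] by (simp add: square_integrable_def)
 from completion_ex_borel_measurable_real[OF this] show ?thesis by (auto simp: L2_rep_def)
qed

lemma square_integrable_AE_cong:
 fixes f g :: "'a::euclidean_space => real"
 assumes "square_integrable f" "AE x in lborel. f x = g x" and g: "borel_fun g"
 shows "square_integrable g"
proof -
 have g': "g \<in> borel_measurable lebesgue" using g by (simp add: measurable_completion)
 have "integrable lebesgue (\<lambda>x. (g x)^2)"
 proof (rule integrable_cong_AE_imp)
  show "integrable lebesgue (\<lambda>x. (f x)^2)" using assms(1) by (simp add: square_integrable_def)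
  show "AE x in lebesgue. (f x)^2 = (g x)^2" using assms(2) by (auto simp: AE_lebesgue_iff elim: eventually_mono)
 qed (use g' in simp)
 with g' show ?thesis by (simp add: square_integrable_def)
qed

lemma square_integrable_borel_iff:
 fixes f :: "'a::euclidean_space => real"
 assumes [measurable]: "borel_fun f"
 shows "square_integrable f \<longleftrightarrow> sq_int f < \<infinity>"
proof -
 have "square_integrable f \<longleftrightarrow> integrable lebesgue (\<lambda>x. (f x)^2)"
  by (simp add: square_integrable_def measurable_completion)
 also have "\<dots> \<longleftrightarrow> integrable lborel (\<lambda>x. (f x)^2)" by (rule integrable_completion) measurable
 also have "\<dots> \<longleftrightarrow> sq_int f < \<infinity>" by (simp add: integrable_iff_bounded)
 finally show ?thesis .
qed

lemma L2_rep_borel: "L2_rep u f ==> borel_fun f" by (simp add: L2_rep_def)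

lemma L2_rep_square_integrable: "L2_rep u f ==> square_integrable f"
 using square_integrable_AE_cong[OF rep_L2_square_integrable] by (auto simp: L2_rep_def)

lemma L2_rep_finite: "L2_rep u f ==> sq_int f < \<infinity>"
 using L2_rep_square_integrable[of u f] square_integrable_borel_iff[of f] by (simp add: L2_rep_def)

lemma integrable_mult_lborel:
 fixes f g :: "'a::euclidean_space => real"
 assumes "square_integrable f" "square_integrable g" and [measurable]: "borel_fun f" "borel_fun g"
 shows "integrable lborel (\<lambda>x. f x * g x)"
proof -
 have "integrable lebesgue (\<lambda>x. f x * g x)" using assms(1,2) by (rule square_integrable_mult)
 moreover have "(\<lambda>x. f x * g x) \<in> borel_measurable lborel" by measurable
 ultimately show ?thesis using integrable_completion by blast
qed

lemma L2_rep_integrable: "L2_rep u f ==> L2_rep v g ==> integrable lborel (\<lambda>x. f x * g x)"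
 by (intro integrable_mult_lborel L2_rep_square_integrable) (auto intro: L2_rep_borel)

lemma L2_rep_inner:
 assumes u: "L2_rep u f" and v: "L2_rep v g"
 shows "inner u v = (LINT x|lborel. f x * g x)"
proof -
 have [measurable]: "borel_fun f" "borel_fun g" using u v by (auto simp: L2_rep_def)
 have m: "rep_L2 u \<in> borel_measurable lebesgue" "rep_L2 v \<in> borel_measurable lebesgue"
  using rep_L2_square_integrable by (auto simp: square_integrable_def)
 have "inner u v = (LINT x|lebesgue. rep_L2 u x * rep_L2 v x)" by (simp add: inner_L2.rep_eq)
 also have "\<dots> = (LINT x|lebesgue. f x * g x)"
  using u v m by (intro integral_cong_AE) (auto simp: L2_rep_def AE_lebesgue_iff measurable_completion)
 also have "\<dots> = (LINT x|lborel. f x * g x)" by (rule integral_completion) measurable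
 finally show ?thesis .
qed

lemma L2_rep_norm:
 assumes u: "L2_rep u f"
 shows "sq_int f = ennreal ((norm u)^2)"
proof -
 have "(norm u)^2 = (LINT x|lborel. (f x)^2)" unfolding power2_norm_eq_inner using L2_rep_inner[OF u u] by (simp add: power2_eq_square)
 moreover have "integrable lborel (\<lambda>x. (f x)^2)" using L2_rep_integrable[OF u u] by (simp add: power2_eq_square)
 ultimately show ?thesis by (simp add: nn_integral_eq_integral)
qed

lemma L2_rep_AE_cong: "L2_rep u f ==> AE x in lborel. f x = g x ==> borel_fun g ==> L2_rep u g" by (auto simp: L2_rep_def elim: eventually_elim2)

lemma L2_rep_eqI:
 assumes "L2_rep u f" "L2_rep v g" "AE x in lborel. f x = g x"
 shows "u = v"
proof (rule L2_eqI)
 have "AE x in lborel. rep_L2 u x = f x" "AE x in lborel. rep_L2 v x = g x" using assms by (auto simp: L2_rep_def)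
 thus "AE x in lebesgue. rep_L2 u x = rep_L2 v x" unfolding AE_lebesgue_iff using assms(3) by eventually_elim simp
qed

lemma L2_rep_abs:
 assumes "borel_fun f" "sq_int f < \<infinity>"
 shows "L2_rep (abs_L2 f) f" using assms rep_abs_L2[of f] by (simp add: L2_rep_def square_integrable_borel_iff AE_lebesgue_iff)

lemma L2_rep_zero: "L2_rep 0 (\<lambda>x. 0)" unfolding zero_L2_def by (rule L2_rep_abs) auto

lemma rep_L2_add: "AE x in lborel. rep_L2 (u + v) x = rep_L2 u x + rep_L2 v x"
proof -
 have "u + v = abs_L2 (\<lambda>x. rep_L2 u x + rep_L2 v x)" by (simp add: plus_L2_def)
 thus ?thesis using rep_abs_L2[OF square_integrable_add[OF rep_L2_square_integrable[of u] rep_L2_square_integrable[of v]]]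
  by (simp add: AE_lebesgue_iff)
qed

lemma rep_L2_scaleR: "AE x in lborel. rep_L2 (c *\<^sub>R u) x = c * rep_L2 u x"
proof -
 have "c *\<^sub>R u = abs_L2 (\<lambda>x. c * rep_L2 u x)" by (simp add: scaleR_L2_def)
 thus ?thesis using rep_abs_L2[OF square_integrable_scale[OF rep_L2_square_integrable[of u], of c]] by (simp add: AE_lebesgue_iff)
qed

lemma L2_rep_add:
 assumes "L2_rep u f" "L2_rep v g"
 shows "L2_rep (u + v) (\<lambda>x. f x + g x)"
proof -
 have "AE x in lborel. rep_L2 u x = f x" "AE x in lborel. rep_L2 v x = g x" using assms by (auto simp: L2_rep_def)
 hence "AE x in lborel. rep_L2 (u + v) x = f x + g x" using rep_L2_add[of u v] by eventually_elim simp
 thus ?thesis using assms by (auto simp: L2_rep_def)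
qed

lemma L2_rep_scaleR:
 assumes "L2_rep u f"
 shows "L2_rep (c *\<^sub>R u) (\<lambda>x. c * f x)"
proof -
 have "AE x in lborel. rep_L2 u x = f x" using assms by (auto simp: L2_rep_def)
 hence "AE x in lborel. rep_L2 (c *\<^sub>R u) x = c * f x" using rep_L2_scaleR[of c u] by eventually_elim simp
 thus ?thesis using assms by (auto simp: L2_rep_def)
qed

lemma L2_rep_diff:
 assumes "L2_rep u f" "L2_rep v g"
 shows "L2_rep (u - v) (\<lambda>x. f x - g x)" using L2_rep_add[OF assms(1) L2_rep_scaleR[OF assms(2), of "-1"]] by simp

lemma L2_on_rep:
 assumes W [measurable]: "W \<in> sets borel" and u: "u \<in> L2_on W"
 obtains f where "L2_rep u f" "\<And>x. x \<notin> W ==> f x = 0"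
proof -
 obtain g where g: "L2_rep u g" using L2_rep_ex by blast
 hence [measurable]: "borel_fun g" by (rule L2_rep_borel)
 have "AE x in lborel. rep_L2 u x = g x" using g by (simp add: L2_rep_def)
 moreover have "AE x in lborel. x \<notin> W --> rep_L2 u x = 0" using u by (simp add: L2_on_def AE_lebesgue_iff)
 ultimately have "AE x in lborel. g x = indicator W x * g x" by eventually_elim (auto simp: indicator_def)
 hence "L2_rep u (\<lambda>x. indicator W x * g x)" by (rule L2_rep_AE_cong[OF g]) measurable
 thus thesis by (rule that) simp
qed

lemma L2_onI: "L2_rep u f ==> (\<And>x. x \<notin> W ==> f x = 0) ==> u \<in> L2_on W"
 by (auto simp: L2_rep_def L2_on_def AE_lebesgue_iff elim!: eventually_mono)

lemma L2_on_add:
 assumes "u \<in> L2_on W" "v \<in> L2_on W"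
 shows "u + v \<in> L2_on W"
proof -
 have "AE x in lborel. x \<notin> W --> rep_L2 u x = 0" "AE x in lborel. x \<notin> W --> rep_L2 v x = 0"
  using assms by (auto simp: L2_on_def AE_lebesgue_iff)
 thus ?thesis unfolding L2_on_def AE_lebesgue_iff mem_Collect_eq using rep_L2_add[of u v] by eventually_elim simp
qed

lemma L2_on_scaleR:
 assumes "u \<in> L2_on W"
 shows "c *\<^sub>R u \<in> L2_on W"
proof -
 have "AE x in lborel. x \<notin> W --> rep_L2 u x = 0" using assms by (auto simp: L2_on_def AE_lebesgue_iff)
 thus ?thesis unfolding L2_on_def AE_lebesgue_iff mem_Collect_eq using rep_L2_scaleR[of c u] by eventually_elim simp
qed

lemma L2_on_zero: "0 \<in> L2_on W" by (rule L2_onI[OF L2_rep_zero]) simp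

lemma L2_on_diff: "u \<in> L2_on W ==> v \<in> L2_on W ==> u - v \<in> L2_on W"
 using L2_on_add[of u W "-1 *\<^sub>R v"] L2_on_scaleR[of v W "-1"] by simp

lemma L2_rep_test: "\<phi> \<in> test_functions U ==> L2_rep (abs_L2 \<phi>) \<phi>"
 by (intro L2_rep_abs test_functions_borel test_functions_nn_integral_finite)

lemma test_functions_zero_outside: "\<phi> \<in> test_functions U ==> x \<notin> U ==> \<phi> x = 0" by (metis test_functionsE subsetD)

lemma test_in_L2_on: "\<phi> \<in> test_functions U ==> abs_L2 \<phi> \<in> L2_on U"
 by (rule L2_onI[OF L2_rep_test]) (auto intro: test_functions_zero_outside)

lemma L2_on_dense:
 assumes U: "open U" and u: "u \<in> L2_on U" and e: "0 < e"
 shows "\<exists>\<phi>\<in>test_functions U. norm (u - abs_L2 \<phi>) < e"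
proof -
 have "U \<in> sets borel" using U by simp
 then obtain f where f: "L2_rep u f" "\<And>x. x \<notin> U ==> f x = 0" using L2_on_rep u by metis
 have "l2_approx U f" using f by (intro l2_dense U L2_rep_finite L2_rep_borel) auto
 moreover have "0 < e^2" using e by simp
 ultimately obtain \<phi> where \<phi>: "\<phi> \<in> test_functions U" "sq_int (\<lambda>x. f x - \<phi> x) < ennreal (e^2)"
  unfolding l2_approx_def by blast
 have "ennreal ((norm (u - abs_L2 \<phi>))^2) < ennreal (e^2)" using \<phi>(2) L2_rep_norm[OF L2_rep_diff[OF f(1) L2_rep_test[OF \<phi>(1)]]] by simp
 hence "(norm (u - abs_L2 \<phi>))^2 < e^2" by (simp add: ennreal_less_iff)
 hence "norm (u - abs_L2 \<phi>) < e" using e by (simp add: power_less_imp_less_base)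
 with \<phi>(1) show ?thesis by blast
qed

text \<open>By density the norm is determined by pairings with test functions. It reduces norm
  estimates for differences to estimates in which all derivatives fall on smooth functions.\<close>

lemma L2_on_dual_bound:
 assumes U: "open U" and u: "u \<in> L2_on U" and K: "0 <= K"
  and dual: "\<And>\<phi>. \<phi> \<in> test_functions U ==> \<bar>inner u (abs_L2 \<phi>)\<bar> <= K * norm (abs_L2 \<phi>)"
 shows "norm u <= K"
proof (rule ccontr)
 assume n: "\<not> norm u <= K"
 define e where "e = (norm u - K) / 3"
 have e: "0 < e" using n by (simp add: e_def)
 have nu: "0 < norm u" using n K by linarith
 \<comment> \<open>Chosen so that \<open>(K + norm u) * d <= e * norm u\<close>, which is the error
   allowed in the final estimate.\<close>
 define d where "d = min 1 (e * norm u / (K + norm u + 1))"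
 have Kn: "0 < K + norm u + 1" using nu K by linarith
 have d: "0 < d" unfolding d_def using e nu Kn by (simp add: divide_pos_pos)
 obtain \<phi> where \<phi>: "\<phi> \<in> test_functions U" "norm (u - abs_L2 \<phi>) < d" using L2_on_dense[OF U u d] by blast
 let ?v = "abs_L2 \<phi>"
 have "(norm u)^2 = inner u ?v + inner u (u - ?v)" by (simp add: power2_norm_eq_inner inner_diff_right)
 also have "\<dots> <= K * norm ?v + norm u * norm (u - ?v)" using dual[OF \<phi>(1)] norm_cauchy_schwarz[of u "u - ?v"] by linarith
 also have "norm ?v <= norm u + norm (u - ?v)" using norm_triangle_ineq2[of ?v u] by (simp add: norm_minus_commute)
 hence "K * norm ?v + norm u * norm (u - ?v) <= K * (norm u + norm (u - ?v)) + norm u * norm (u - ?v)"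
  using K by (intro add_right_mono mult_left_mono) auto
 also have "\<dots> = K * norm u + (K + norm u) * norm (u - ?v)" by (simp add: algebra_simps)
 also have "\<dots> <= K * norm u + e * norm u"
 proof -
  have "(K + norm u) * norm (u - ?v) <= (K + norm u + 1) * (e * norm u / (K + norm u + 1))"
   using \<phi>(2) K by (intro mult_mono) (auto simp: d_def)
  also have "\<dots> = e * norm u" using Kn by simp
  finally show ?thesis by simp
 qed
 finally have "norm u * norm u <= (K + e) * norm u" by (simp add: power2_eq_square algebra_simps)
 hence "norm u <= K + e" using nu by simp
 thus False using e by (simp add: e_def field_simps)
qed

lemma L2_on_eq_0:
 assumes U: "open U" and u: "u \<in> L2_on U" and "\<And>\<phi>. \<phi> \<in> test_functions U ==> inner u (abs_L2 \<phi>) = 0"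
 shows "u = 0" using L2_on_dual_bound[OF U u, of 0] assms(3) by simp

subsection \<open>Weak derivatives\<close>

lemma set_lint_eq_inner:
 assumes W [measurable]: "W \<in> sets borel" and u: "u \<in> L2_on W" and \<phi>: "\<phi> \<in> test_functions U"
 shows "(LINT x:W|lebesgue. rep_L2 u x * \<phi> x) = inner u (abs_L2 \<phi>)"
proof -
 obtain f where f: "L2_rep u f" "\<And>x. x \<notin> W ==> f x = 0" using L2_on_rep[OF W u] by metis
 have [measurable]: "borel_fun f" "borel_fun \<phi>" using L2_rep_borel[OF f(1)] test_functions_borel[OF \<phi>] by auto
 have m: "rep_L2 u \<in> borel_measurable lebesgue" using rep_L2_square_integrable by (auto simp: square_integrable_def)
 have Wl [measurable]: "W \<in> sets lebesgue" using W by simp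
 have \<phi>l: "\<phi> \<in> borel_measurable lebesgue" by (simp add: measurable_completion)
 have "(LINT x:W|lebesgue. rep_L2 u x * \<phi> x) = (LINT x|lebesgue. f x * \<phi> x)" unfolding set_lebesgue_integral_def
 proof (rule integral_cong_AE)
  show "AE x in lebesgue. indicator W x *\<^sub>R (rep_L2 u x * \<phi> x) = f x * \<phi> x" using f(1) unfolding AE_lebesgue_iff L2_rep_def
   by (auto elim!: eventually_mono simp: f(2) indicator_def)
  show "(\<lambda>x. indicator W x *\<^sub>R (rep_L2 u x * \<phi> x)) \<in> borel_measurable lebesgue"
   by (intro borel_measurable_scaleR borel_measurable_indicator borel_measurable_times m \<phi>l Wl)
  show "(\<lambda>x. f x * \<phi> x) \<in> borel_measurable lebesgue" by (simp add: measurable_completion)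
 qed
 also have "\<dots> = (LINT x|lborel. f x * \<phi> x)" by (rule integral_completion) measurable
 also have "\<dots> = inner u (abs_L2 \<phi>)" by (rule L2_rep_inner[OF f(1) L2_rep_test[OF \<phi>], symmetric])
 finally show ?thesis .
qed

text \<open>In terms of inner products the condition is visibly linear in \<open>u\<close> and
  \<open>v\<close>, and density of test functions yields uniqueness.\<close>

lemma is_weak_deriv_iff:
 assumes W: "W \<in> sets borel" and u: "u \<in> L2_on W" and v: "v \<in> L2_on W" and bs: "set bs \<subseteq> Basis"
 shows "is_weak_deriv W bs u v \<longleftrightarrow> (\<forall>\<phi>\<in>test_functions W.
  inner u (abs_L2 (partial_derivs bs \<phi>)) = (- 1) ^ length bs * inner v (abs_L2 \<phi>))" unfolding is_weak_deriv_def
 by (intro ball_cong refl) (simp add: set_lint_eq_inner[OF W u test_functions_partial_derivs[OF _ bs]] set_lint_eq_inner[OF W v])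

lemma weak_deriv_unique:
 assumes W: "open W" and u: "u \<in> L2_on W" and v: "v \<in> L2_on W" "v' \<in> L2_on W" and bs: "set bs \<subseteq> Basis"
  and wd: "is_weak_deriv W bs u v" "is_weak_deriv W bs u v'"
 shows "v = v'"
proof -
 have Wb: "W \<in> sets borel" using W by simp
 have "v - v' = 0"
 proof (rule L2_on_eq_0[OF W L2_on_diff[OF v]])
  fix \<phi> assume "\<phi> \<in> test_functions W"
  hence "(- 1) ^ length bs * inner v (abs_L2 \<phi>) = (- 1) ^ length bs * inner v' (abs_L2 \<phi>)"
   using wd by (auto simp: is_weak_deriv_iff[OF Wb u _ bs] v)
  thus "inner (v - v') (abs_L2 \<phi>) = 0" by (simp add: inner_diff_left)
 qed
 thus ?thesis by simp
qed

lemma weak_deriv_eqI: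
 assumes W: "open W" and u: "u \<in> L2_on W" and v: "v \<in> L2_on W" and bs: "set bs \<subseteq> Basis" and wd: "is_weak_deriv W bs u v"
 shows "weak_deriv W bs u = v" unfolding weak_deriv_def by (rule the_equality) (use weak_deriv_unique[OF W u _ _ bs] v wd in auto)

lemma is_weak_deriv_Nil: "is_weak_deriv W [] u u" by (simp add: is_weak_deriv_def)

lemma weak_deriv_Nil: "open W ==> u \<in> L2_on W ==> weak_deriv W [] u = u" by (rule weak_deriv_eqI) (auto simp: is_weak_deriv_Nil)

lemma Sobolev_weak_deriv:
 assumes W: "open W" and u: "u \<in> Sobolev m W" and bs: "set bs \<subseteq> Basis" "length bs <= m"
 shows "weak_deriv W bs u \<in> L2_on W" "is_weak_deriv W bs u (weak_deriv W bs u)"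
proof -
 obtain v where v: "v \<in> L2_on W" "is_weak_deriv W bs u v" using u bs by (auto simp: Sobolev_def)
 moreover have "u \<in> L2_on W" using u by (simp add: Sobolev_def)
 ultimately have "weak_deriv W bs u = v" by (intro weak_deriv_eqI W bs)
 with v show "weak_deriv W bs u \<in> L2_on W" "is_weak_deriv W bs u (weak_deriv W bs u)" by auto
qed

lemma finite_derivs: "finite {bs :: 'a::euclidean_space list. set bs \<subseteq> Basis \<and> length bs <= m}" by (rule finite_lists_length_le) simp

lemma norm_weak_deriv_le_Sobolev_norm:
 fixes W :: "'a::euclidean_space set"
 assumes bs: "set bs \<subseteq> Basis" "length bs <= m"
 shows "norm (weak_deriv W bs u) <= Sobolev_norm m W u"
proof -
 have "(norm (weak_deriv W bs u))^2 <= (\<Sum>bs\<in>{bs. set bs \<subseteq> Basis \<and> length bs <= m}. (norm (weak_deriv W bs u))^2)"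
  using bs by (intro member_le_sum finite_derivs) auto
 hence "sqrt ((norm (weak_deriv W bs u))^2) <= Sobolev_norm m W u" unfolding Sobolev_norm_def by (rule real_sqrt_le_mono)
 thus ?thesis by simp
qed

lemma norm_le_Sobolev_norm: "open W ==> u \<in> Sobolev m W ==> norm u <= Sobolev_norm m W u"
 using norm_weak_deriv_le_Sobolev_norm[of "[]" m W u] by (simp add: weak_deriv_Nil Sobolev_def)

lemma Sobolev_add:
 assumes W: "open W" and u: "u \<in> Sobolev m W" and v: "v \<in> Sobolev m W"
 shows "u + v \<in> Sobolev m W"
proof -
 have uv: "u \<in> L2_on W" "v \<in> L2_on W" using u v by (auto simp: Sobolev_def)
 have Wb: "W \<in> sets borel" using W by simp
 have "\<exists>w\<in>L2_on W. is_weak_deriv W bs (u + v) w" if bs: "set bs \<subseteq> Basis" "length bs <= m" for bs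
 proof (intro bexI[of _ "weak_deriv W bs u + weak_deriv W bs v"])
  note d = Sobolev_weak_deriv[OF W u bs] Sobolev_weak_deriv[OF W v bs]
  show mem: "weak_deriv W bs u + weak_deriv W bs v \<in> L2_on W" using d by (intro L2_on_add)
  show "is_weak_deriv W bs (u + v) (weak_deriv W bs u + weak_deriv W bs v)"
   using d by (simp add: is_weak_deriv_iff[OF Wb _ _ bs(1)] uv mem L2_on_add[OF uv] inner_add_left distrib_left)
 qed
 thus ?thesis using L2_on_add[OF uv] by (simp add: Sobolev_def)
qed

lemma Sobolev_scaleR:
 assumes W: "open W" and u: "u \<in> Sobolev m W"
 shows "c *\<^sub>R u \<in> Sobolev m W"
proof -
 have uv: "u \<in> L2_on W" using u by (auto simp: Sobolev_def)
 have Wb: "W \<in> sets borel" using W by simp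
 have "\<exists>w\<in>L2_on W. is_weak_deriv W bs (c *\<^sub>R u) w" if bs: "set bs \<subseteq> Basis" "length bs <= m" for bs
 proof (intro bexI[of _ "c *\<^sub>R weak_deriv W bs u"])
  note d = Sobolev_weak_deriv[OF W u bs]
  show mem: "c *\<^sub>R weak_deriv W bs u \<in> L2_on W" using d by (intro L2_on_scaleR)
  show "is_weak_deriv W bs (c *\<^sub>R u) (c *\<^sub>R weak_deriv W bs u)"
   using d by (simp add: is_weak_deriv_iff[OF Wb _ _ bs(1)] uv mem L2_on_scaleR[OF uv] mult.left_commute)
 qed
 thus ?thesis using L2_on_scaleR[OF uv] by (simp add: Sobolev_def)
qed

lemma test_weak_deriv:
 assumes W: "open W" and \<phi>: "\<phi> \<in> test_functions W" and bs: "set bs \<subseteq> Basis"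
 shows "is_weak_deriv W bs (abs_L2 \<phi>) (abs_L2 (partial_derivs (rev bs) \<phi>))"
  "weak_deriv W bs (abs_L2 \<phi>) = abs_L2 (partial_derivs (rev bs) \<phi>)"
proof -
 have Wb: "W \<in> sets borel" using W by simp
 have d: "partial_derivs (rev bs) \<phi> \<in> test_functions W" using bs by (intro test_functions_partial_derivs \<phi>) simp
 have "inner (abs_L2 \<phi>) (abs_L2 (partial_derivs bs g)) = (- 1) ^ length bs * inner (abs_L2 (partial_derivs (rev bs) \<phi>)) (abs_L2 g)"
  if g: "g \<in> test_functions W" for g using integration_by_parts[OF \<phi> g bs]
   L2_rep_inner[OF L2_rep_test[OF \<phi>] L2_rep_test[OF test_functions_partial_derivs[OF g bs]]]
   L2_rep_inner[OF L2_rep_test[OF d] L2_rep_test[OF g]] by simp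
 thus *: "is_weak_deriv W bs (abs_L2 \<phi>) (abs_L2 (partial_derivs (rev bs) \<phi>))"
  by (simp add: is_weak_deriv_iff[OF Wb test_in_L2_on[OF \<phi>] test_in_L2_on[OF d] bs])
 show "weak_deriv W bs (abs_L2 \<phi>) = abs_L2 (partial_derivs (rev bs) \<phi>)"
  by (rule weak_deriv_eqI[OF W test_in_L2_on[OF \<phi>] test_in_L2_on[OF d] bs *])
qed

lemma test_in_Sobolev:
 assumes W: "open W" and \<phi>: "\<phi> \<in> test_functions W"
 shows "abs_L2 \<phi> \<in> Sobolev m W"
proof -
 have "\<exists>v\<in>L2_on W. is_weak_deriv W bs (abs_L2 \<phi>) v" if bs: "set bs \<subseteq> Basis" for bs
 proof (rule bexI[of _ "abs_L2 (partial_derivs (rev bs) \<phi>)"])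
  show "is_weak_deriv W bs (abs_L2 \<phi>) (abs_L2 (partial_derivs (rev bs) \<phi>))" by (rule test_weak_deriv(1)[OF W \<phi> bs])
  have "partial_derivs (rev bs) \<phi> \<in> test_functions W" using bs by (intro test_functions_partial_derivs \<phi>) simp
  thus "abs_L2 (partial_derivs (rev bs) \<phi>) \<in> L2_on W" by (rule test_in_L2_on)
 qed
 thus ?thesis using test_in_L2_on[OF \<phi>] by (simp add: Sobolev_def)
qed

subsection \<open>Finite differences in \<open>L\<^sub>2\<close>\<close>

definition fwd_diff_const :: "nat => real" where
 "fwd_diff_const r = (\<Sum>j\<le>r. ((- 1) ^ (r - j) * real (r choose j))^2) * real (Suc r)"

lemma fwd_diff_const_nonneg: "0 <= fwd_diff_const r" by (simp add: fwd_diff_const_def sum_nonneg)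

lemma nn_integral_fwd_diff_le:
 fixes f :: "'a::euclidean_space => real"
 assumes f [measurable]: "borel_fun f"
 shows "sq_int (fwd_diff r h f) <= ennreal (fwd_diff_const r) * sq_int f"
proof -
 let ?c = "\<lambda>j. (- 1) ^ (r - j) * real (r choose j)"
 let ?S = "\<Sum>j\<le>r. (?c j)^2"
 have "(fwd_diff r h f x)^2 <= ?S * (\<Sum>j\<le>r. (f (x + real j *\<^sub>R h))^2)" for x unfolding fwd_diff_def by (rule Cauchy_Schwarz_ineq_sum)
 hence "sq_int (fwd_diff r h f) <= (\<integral>\<^sup>+x. ennreal ?S * (\<Sum>j\<le>r. ennreal ((f (x + real j *\<^sub>R h))^2)) \<partial>lborel)"
  by (intro nn_integral_mono) (auto simp: ennreal_mult[symmetric] sum_nonneg sum_ennreal intro!: ennreal_leI)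
 also have "\<dots> = ennreal ?S * (\<Sum>j\<le>r. sq_int (\<lambda>x. f (x + real j *\<^sub>R h)))"
  by (subst nn_integral_cmult, simp, subst nn_integral_sum, simp, rule refl)
 also have "(\<Sum>j\<le>r. sq_int (\<lambda>x. f (x + real j *\<^sub>R h))) = (\<Sum>j\<le>r. sq_int f)"
  by (intro sum.cong refl nn_integral_lborel_translation[where f = "\<lambda>x. ennreal ((f x)^2)"]) simp
 also have "ennreal ?S * \<dots> = ennreal (fwd_diff_const r) * sq_int f" unfolding fwd_diff_const_def
  by (subst ennreal_mult) (auto simp: sum_nonneg mult.assoc ennreal_of_nat_eq_real_of_nat algebra_simps)
 finally show ?thesis .
qed

text \<open>Makes the integral in the modulus of smoothness the squared norm of an element depending
  linearly on \<open>u\<close>; the indicator extends the difference by zero.\<close>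

definition diff_L2 :: "nat => 'a::euclidean_space set => 'a => 'a L2 => 'a L2" where
 "diff_L2 r W h u = abs_L2 (\<lambda>z. indicator (diff_domain W r h) z * fwd_diff r h (rep_L2 u) z)"

text \<open>Translates of null sets are null sets, and a difference involves finitely many
  translates.\<close>

lemma fwd_diff_AE_cong:
 fixes f g :: "'a::euclidean_space => real"
 assumes "AE x in lborel. f x = g x"
 shows "AE x in lborel. fwd_diff r h f x = fwd_diff r h g x"
proof -
 have "AE x in lborel. f (x + real j *\<^sub>R h) = g (x + real j *\<^sub>R h)" for j
 proof -
  have "AE x in distr lborel (borel :: 'a measure) ((+) (real j *\<^sub>R h)). f x = g x" unfolding lborel_distr_plus by (rule assms)
  hence "AE x in lborel. f (real j *\<^sub>R h + x) = g (real j *\<^sub>R h + x)" by (rule AE_distrD[rotated]) simp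
  thus ?thesis by (simp add: add.commute)
 qed
 hence "AE x in lborel. \<forall>j\<in>{..r}. f (x + real j *\<^sub>R h) = g (x + real j *\<^sub>R h)" by (intro AE_finite_allI) auto
 thus ?thesis by eventually_elim (auto simp: fwd_diff_def intro!: sum.cong)
qed

lemma nn_integral_indicator_fwd_diff:
 fixes f :: "'a::euclidean_space => real"
 assumes f [measurable]: "borel_fun f"
 shows "sq_int (\<lambda>z. indicator A z * fwd_diff r h f z) <= ennreal (fwd_diff_const r) * sq_int f"
 by (rule order_trans[OF _ nn_integral_fwd_diff_le[OF f, of r h]])
  (intro nn_integral_mono ennreal_leI, simp add: indicator_def)

text \<open>The difference of \<open>rep_L2 u\<close> agrees almost everywhere with that of a Borel
  representative, which settles its measurability and reduces both claims to Borel
  functions.\<close>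

lemma
 fixes W :: "'a::euclidean_space set"
 assumes W: "open W" and f: "L2_rep u f"
 shows L2_rep_diff_L2: "L2_rep (diff_L2 r W h u) (\<lambda>z. indicator (diff_domain W r h) z * fwd_diff r h f z)" (is "L2_rep _ ?g")
  and set_lint_fwd_diff: "(LINT x:diff_domain W r h|lebesgue. (fwd_diff r h (rep_L2 u) x)^2) = (norm (diff_L2 r W h u))^2"
proof -
 have [measurable]: "borel_fun f" by (rule L2_rep_borel[OF f])
 have D [measurable]: "diff_domain W r h \<in> sets borel" using open_diff_domain[OF W] by simp
 let ?g' = "\<lambda>z. indicator (diff_domain W r h) z * fwd_diff r h (rep_L2 u) z"
 have fin: "sq_int f < \<infinity>" by (rule L2_rep_finite[OF f])
 have gm: "borel_fun ?g" by measurable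
 have gfin: "sq_int ?g < \<infinity>"
  by (rule order_le_less_trans[OF nn_integral_indicator_fwd_diff]) (use fin in \<open>auto simp: ennreal_mult_less_top\<close>)
 have rg: "L2_rep (abs_L2 ?g) ?g" by (rule L2_rep_abs[OF gm gfin])
 have "AE z in lborel. fwd_diff r h (rep_L2 u) z = fwd_diff r h f z" using f by (intro fwd_diff_AE_cong) (simp add: L2_rep_def)
 hence ae: "AE z in lborel. ?g z = ?g' z" by eventually_elim simp
 have g'm: "?g' \<in> borel_measurable lebesgue"
  by (rule borel_measurable_AE[of ?g]) (use ae gm in \<open>auto simp: AE_lebesgue_iff measurable_completion\<close>)
 have sg: "square_integrable ?g" using square_integrable_borel_iff[OF gm] gfin by simp
 have sg': "square_integrable ?g'" unfolding square_integrable_def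
 proof (intro conjI g'm)
  show "integrable lebesgue (\<lambda>x. (?g' x)^2)"
  proof (rule integrable_cong_AE_imp)
   show "integrable lebesgue (\<lambda>x. (?g x)^2)" using sg unfolding square_integrable_def by blast
   show "(\<lambda>x. (?g' x)^2) \<in> borel_measurable lebesgue" by (rule borel_measurable_power[OF g'm])
   show "AE x in lebesgue. (?g x)^2 = (?g' x)^2" unfolding AE_lebesgue_iff using ae by eventually_elim (simp only:)
  qed
 qed
 have "ae_equal ?g ?g'" using sg sg' ae by (simp add: ae_equal_def AE_lebesgue_iff)
 hence eq: "diff_L2 r W h u = abs_L2 ?g" unfolding diff_L2_def using Quotient_rel[OF Quotient_L2, of ?g ?g'] by simp
 show R: "L2_rep (diff_L2 r W h u) ?g" using rg eq by simp
 have "(LINT x:diff_domain W r h|lebesgue. (fwd_diff r h (rep_L2 u) x)^2) = (LINT x|lebesgue. (?g' x)^2)"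
  unfolding set_lebesgue_integral_def by (intro Bochner_Integration.integral_cong) (auto simp: indicator_def)
 also have "\<dots> = (LINT x|lebesgue. ?g x * ?g x)"
 proof (rule integral_cong_AE)
  show "(\<lambda>x. (?g' x)^2) \<in> borel_measurable lebesgue" using g'm by simp
  show "(\<lambda>x. ?g x * ?g x) \<in> borel_measurable lebesgue" using gm by (simp add: measurable_completion)
  show "AE x in lebesgue. (?g' x)^2 = ?g x * ?g x" unfolding AE_lebesgue_iff using ae by eventually_elim (simp only: power2_eq_square)
 qed
 also have "\<dots> = (LINT x|lborel. ?g x * ?g x)" by (rule integral_completion) (use gm in simp)
 also have "\<dots> = (norm (diff_L2 r W h u))^2" unfolding power2_norm_eq_inner by (rule L2_rep_inner[OF R R, symmetric])
 finally show "(LINT x:diff_domain W r h|lebesgue. (fwd_diff r h (rep_L2 u) x)^2) = (norm (diff_L2 r W h u))^2" .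
qed

lemma diff_L2_add:
 assumes W: "open W"
 shows "diff_L2 r W h (u + v) = diff_L2 r W h u + diff_L2 r W h v"
proof -
 obtain f g where f: "L2_rep u f" "L2_rep v g" using L2_rep_ex by metis
 show ?thesis by (rule L2_rep_eqI[OF L2_rep_diff_L2[OF W L2_rep_add[OF f]] L2_rep_add[OF L2_rep_diff_L2[OF W f(1)] L2_rep_diff_L2[OF W f(2)]]])
   (auto simp: fwd_diff_def sum.distrib distrib_left)
qed

lemma diff_L2_scaleR:
 assumes W: "open W"
 shows "diff_L2 r W h (c *\<^sub>R u) = c *\<^sub>R diff_L2 r W h u"
proof -
 obtain f where f: "L2_rep u f" using L2_rep_ex by blast
 show ?thesis by (rule L2_rep_eqI[OF L2_rep_diff_L2[OF W L2_rep_scaleR[OF f]] L2_rep_scaleR[OF L2_rep_diff_L2[OF W f]]])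
   (auto simp: fwd_diff_def sum_distrib_left mult_ac intro!: AE_I2 sum.cong)
qed

lemma norm_diff_L2_le:
 assumes W: "open W"
 shows "norm (diff_L2 r W h u) <= sqrt (fwd_diff_const r) * norm u"
proof -
 obtain f where f: "L2_rep u f" using L2_rep_ex by blast
 have "ennreal ((norm (diff_L2 r W h u))^2) <= ennreal (fwd_diff_const r) * ennreal ((norm u)^2)"
  using nn_integral_indicator_fwd_diff[OF L2_rep_borel[OF f], of "diff_domain W r h" r h]
  unfolding L2_rep_norm[OF f] L2_rep_norm[OF L2_rep_diff_L2[OF W f]] .
 also have "\<dots> = ennreal ((sqrt (fwd_diff_const r) * norm u)^2)" by (simp add: ennreal_mult fwd_diff_const_nonneg power_mult_distrib)
 finally have "(norm (diff_L2 r W h u))^2 <= (sqrt (fwd_diff_const r) * norm u)^2" by (subst (asm) ennreal_le_iff) auto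
 thus ?thesis by (rule power2_le_imp_le) (simp add: fwd_diff_const_nonneg)
qed

lemma modulus_eq: "open W ==> modulus_of_smoothness r W u t = (SUP h\<in>cball 0 t. norm (diff_L2 r W h u))"
 using L2_rep_ex[of u] unfolding modulus_of_smoothness_def by (elim exE) (simp add: set_lint_fwd_diff)

lemma bdd_above_diff_L2: "open W ==> bdd_above ((\<lambda>h. norm (diff_L2 r W h u)) ` A)"
 by (intro bdd_aboveI2[of _ _ "sqrt (fwd_diff_const r) * norm u"] norm_diff_L2_le)

lemma norm_diff_L2_le_modulus: "open W ==> norm h <= t ==> norm (diff_L2 r W h u) <= modulus_of_smoothness r W u t"
 unfolding modulus_eq by (intro cSUP_upper bdd_above_diff_L2) auto

lemma modulus_nonneg: "open W ==> 0 <= t ==> 0 <= modulus_of_smoothness r W u t"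
 by (rule order_trans[OF norm_ge_zero norm_diff_L2_le_modulus[of _ 0]]) auto

lemma modulus_le: "open W ==> 0 <= t ==> (\<And>h. norm h <= t ==> norm (diff_L2 r W h u) <= K) ==> modulus_of_smoothness r W u t <= K"
 unfolding modulus_eq by (intro cSUP_least) auto

lemma modulus_mono:
 assumes "open W" "0 <= t" "t <= t'"
 shows "modulus_of_smoothness r W u t <= modulus_of_smoothness r W u t'" using assms by (intro modulus_le norm_diff_L2_le_modulus) auto

lemma modulus_le_norm: "open W ==> 0 <= t ==> modulus_of_smoothness r W u t <= sqrt (fwd_diff_const r) * norm u" by (intro modulus_le norm_diff_L2_le)

lemma modulus_add_le:
 assumes "open W" "0 <= t"
 shows "modulus_of_smoothness r W (u + v) t <= modulus_of_smoothness r W u t + modulus_of_smoothness r W v t"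
proof (intro modulus_le assms)
 fix h :: 'a assume "norm h <= t"
 thus "norm (diff_L2 r W h (u + v)) <= modulus_of_smoothness r W u t + modulus_of_smoothness r W v t" unfolding diff_L2_add[OF assms(1)] using assms
  by (intro order_trans[OF norm_triangle_ineq] add_mono norm_diff_L2_le_modulus)
qed

lemma modulus_scaleR_le:
 assumes "open W" "0 <= t"
 shows "modulus_of_smoothness r W (c *\<^sub>R u) t <= \<bar>c\<bar> * modulus_of_smoothness r W u t"
 using assms by (intro modulus_le) (auto simp: diff_L2_scaleR intro!: mult_left_mono norm_diff_L2_le_modulus)

text \<open>The sum runs over all words of \<open>m\<close> directions without collecting equal
  mixed derivatives, in accordance with the way \<open>Sobolev_norm\<close> counts them.\<close>

lemma dir_deriv_iterate:
 fixes \<phi> :: "'a::euclidean_space => real"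
 assumes \<phi>: "smooth \<phi>"
 shows "(dir_deriv w ^^ m) \<phi> = (\<lambda>x. \<Sum>bs\<in>{bs. set bs \<subseteq> Basis \<and> length bs = m}. (\<Prod>b\<leftarrow>bs. w \<bullet> b) * partial_derivs bs \<phi> x)"
proof (induction m)
 case 0
 have "{bs :: 'a list. set bs \<subseteq> Basis \<and> bs = []} = {[]}" by auto
 thus ?case by simp
next
 case (Suc m)
 let ?L = "{bs :: 'a list. set bs \<subseteq> Basis \<and> length bs = m}"
 let ?t = "\<lambda>bs x. (\<Prod>b\<leftarrow>bs. w \<bullet> b) * partial_derivs bs \<phi> x"
 have sm: "smooth (?t bs)" if "bs \<in> ?L" for bs using that by (intro smooth_scale smooth_partial_derivs[OF \<phi>]) blast
 have der: "partial_derivs [b] (?t bs) x = (\<Prod>b\<leftarrow>bs. w \<bullet> b) * partial_derivs (b # bs) \<phi> x" if "bs \<in> ?L" for b bs x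
 proof -
  have "smooth (partial_derivs bs \<phi>)" using that by (intro smooth_partial_derivs[OF \<phi>]) blast
  from has_derivative_mult_right[OF frechet_derivative_works[THEN iffD1, OF smooth_imp_differentiable[OF this]]]
  have "(?t bs has_derivative (\<lambda>h. (\<Prod>b\<leftarrow>bs. w \<bullet> b) * frechet_derivative (partial_derivs bs \<phi>) (at x) h)) (at x)" .
  from frechet_derivative_eqI[OF this] show ?thesis by simp
 qed
 have "(dir_deriv w ^^ Suc m) \<phi> = dir_deriv w (\<lambda>x. \<Sum>bs\<in>?L. ?t bs x)" using Suc.IH by simp
 also have "\<dots> = (\<lambda>x. \<Sum>b\<in>Basis. (w \<bullet> b) * (\<Sum>bs\<in>?L. partial_derivs [b] (?t bs) x))"
 proof -
  have S: "smooth (\<lambda>x. \<Sum>bs\<in>?L. ?t bs x)" by (intro smooth_sum sm)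
  have D: "partial_derivs [b] (\<lambda>x. \<Sum>bs\<in>?L. ?t bs x) = (\<lambda>x. \<Sum>bs\<in>?L. partial_derivs [b] (?t bs) x)" if "b \<in> Basis" for b
   by (rule partial_derivs_sum[of ?L "?t" "[b]"]) (use sm that in auto)
  show ?thesis unfolding dir_deriv_eq_sum[OF S] by (rule ext, rule sum.cong[OF refl], simp only: D)
 qed
 also have "\<dots> = (\<lambda>x. \<Sum>bs\<in>?L. \<Sum>b\<in>Basis. ?t (b # bs) x)"
 proof
  fix x
  have "(\<Sum>b\<in>Basis. (w \<bullet> b) * (\<Sum>bs\<in>?L. partial_derivs [b] (?t bs) x)) = (\<Sum>b\<in>Basis. \<Sum>bs\<in>?L. ?t (b # bs) x)"
   unfolding sum_distrib_left by (intro sum.cong refl) (simp only: der list.map prod_list.Cons mult.assoc)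
  thus "(\<Sum>b\<in>Basis. (w \<bullet> b) * (\<Sum>bs\<in>?L. partial_derivs [b] (?t bs) x)) = (\<Sum>bs\<in>?L. \<Sum>b\<in>Basis. ?t (b # bs) x)"
   by (rule trans) (rule sum.swap)
 qed
 also have "\<dots> = (\<lambda>x. \<Sum>(bs, b)\<in>?L \<times> Basis. ?t (b # bs) x)" by (simp add: sum.cartesian_product)
 also have "\<dots> = (\<lambda>x. \<Sum>bs\<in>{bs. set bs \<subseteq> Basis \<and> length bs = Suc m}. ?t bs x)" unfolding lists_length_Suc_eq
  by (subst sum.reindex) (auto simp: inj_on_def split_def)
 finally show ?case .
qed

lemma abs_prod_list_inner_le: "set bs \<subseteq> Basis ==> \<bar>\<Prod>b\<leftarrow>bs. w \<bullet> b\<bar> <= norm (w :: 'a::euclidean_space) ^ length bs"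
proof (induction bs)
 case (Cons b bs)
 thus ?case by (auto simp: abs_mult intro!: mult_mono Basis_le_norm)
qed simp

lemma L2_rep_locally_integrable:
 fixes f :: "'a::euclidean_space => real"
 assumes f: "L2_rep u f" and K: "compact K"
 shows "integrable lborel (\<lambda>y. indicator K y * f y)"
proof -
 have Kb [measurable]: "K \<in> sets borel" using K by (rule borel_compact)
 have "sq_int (\<lambda>x. indicator K x :: real) = emeasure lborel K" by (simp add: nn_integral_square_indicator)
 also have "\<dots> < \<infinity>" by (rule emeasure_compact_finite[OF K])
 finally have "L2_rep (abs_L2 (indicator K)) (indicator K :: 'a => real)" by (intro L2_rep_abs) auto
 from L2_rep_integrable[OF this f] show ?thesis .
qed

lemma norm_test_translate:
 fixes \<phi> :: "'a::euclidean_space => real"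
 assumes "\<phi> \<in> test_functions U" and t: "(\<lambda>y. \<phi> (y - c)) \<in> test_functions V"
 shows "norm (abs_L2 (\<lambda>y. \<phi> (y - c))) = norm (abs_L2 \<phi>)"
proof -
 have [measurable]: "borel_fun \<phi>" by (rule test_functions_borel[OF assms(1)])
 have "ennreal ((norm (abs_L2 (\<lambda>y. \<phi> (y - c))))^2) = sq_int (\<lambda>x. \<phi> (x - c))"
  by (rule L2_rep_norm[OF L2_rep_test[OF t], symmetric])
 also have "\<dots> = sq_int \<phi>" using nn_integral_lborel_translation[of "\<lambda>x. ennreal ((\<phi> x)^2)" "- c"] by simp
 also have "\<dots> = ennreal ((norm (abs_L2 \<phi>))^2)" by (rule L2_rep_norm[OF L2_rep_test[OF assms(1)]])
 finally show ?thesis by simp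
qed

text \<open>By duality the difference is paired with a test function \<open>\<phi>\<close> supported
  in \<open>diff_domain\<close>. The pairing is the \<open>m\<close>-th difference at 0 of
  \<open>t \<mapsto> \<integral> f y * \<phi> (y - t w)\<close>, hence bounded by the
  \<open>m\<close>-th derivative in \<open>t\<close>. These derivatives fall on
  \<open>\<phi>\<close> and are passed to \<open>u\<close> as weak derivatives.\<close>

lemma norm_diff_L2_le_Sobolev_norm:
 fixes W :: "'a::euclidean_space set"
 assumes W: "open W" and u: "u \<in> Sobolev m W"
 shows "norm (diff_L2 m W w u) <= real (DIM('a) ^ m) * norm w ^ m * Sobolev_norm m W u"
proof -
 let ?D = "diff_domain W m w" and ?v = "diff_L2 m W w u"
 have D: "open ?D" by (rule open_diff_domain[OF W])
 have Wb: "W \<in> sets borel" using W by simp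
 have uO: "u \<in> L2_on W" using u by (simp add: Sobolev_def)
 obtain f where f: "L2_rep u f" using L2_rep_ex by blast
 note fm [measurable] = L2_rep_borel[OF f]
 have v: "L2_rep ?v (\<lambda>z. indicator ?D z * fwd_diff m w f z)" by (rule L2_rep_diff_L2[OF W f])
 have Sn: "0 <= Sobolev_norm m W u" by (simp add: Sobolev_norm_def sum_nonneg)
 note loc = L2_rep_locally_integrable[OF f]
 show ?thesis
 proof (rule L2_on_dual_bound[OF D])
  show "?v \<in> L2_on ?D" by (rule L2_onI[OF v]) simp
  fix \<phi> assume \<phi>: "\<phi> \<in> test_functions ?D"
  have [measurable]: "borel_fun \<phi>" by (rule test_functions_borel[OF \<phi>])
  have sm: "smooth \<phi>" by (rule test_functions_smooth[OF \<phi>])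
  obtain K where K: "compact K" "K \<subseteq> ?D" "\<And>x. x \<notin> K ==> \<phi> x = 0" using test_functionsE[OF \<phi>] by metis
  have it: "(dir_deriv w ^^ k) \<phi> \<in> test_functions ?D" for k by (induction k) (auto intro: \<phi> test_functions_dir_deriv)
  define G where "G k t = (- 1) ^ k * (LINT y|lborel. f y * ((dir_deriv w ^^ k) \<phi>) (y - t *\<^sub>R w))" for k t
  have dG: "(G k has_real_derivative G (Suc k) t) (at t)" for k t
  proof -
   from DERIV_cmult[OF deriv_under_integral[OF fm loc it[of k], where w = w and t = t], where c = "(- 1) ^ k"]
   show ?thesis by (simp add: G_def[abs_def])
  qed
  have "\<bar>seq_diff m (\<lambda>n. G 0 (real n)) 0\<bar> <= real (DIM('a) ^ m) * norm w ^ m * Sobolev_norm m W u * norm (abs_L2 \<phi>)"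
  proof (rule seq_diff_le_deriv[where G = G, OF dG])
   fix t :: real assume t: "0 <= t" "t <= real m"
   define \<phi>t where "\<phi>t y = \<phi> (1 *\<^sub>R y + - (t *\<^sub>R w))" for y
   have \<phi>t_eq: "\<phi>t = (\<lambda>y. \<phi> (y - t *\<^sub>R w))" by (auto simp: \<phi>t_def)
   \<comment> \<open>The purpose of \<open>diff_domain\<close>: a point of the support, moved by
     \<open>t w\<close> with \<open>0 <= t <= m\<close>, stays on a segment contained in
     \<open>W\<close>.\<close>
   have \<phi>t: "\<phi>t \<in> test_functions W"
   proof (rule test_functionsI)
    show "smooth \<phi>t" unfolding \<phi>t_def[abs_def] by (rule smooth_affine[OF sm])
    show "compact ((\<lambda>y. t *\<^sub>R w + y) ` K)" by (intro compact_translation K)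
    show "y \<in> (\<lambda>y. t *\<^sub>R w + y) ` K" if "\<phi>t y \<noteq> 0" for y
    proof (rule image_eqI)
     show "y - t *\<^sub>R w \<in> K" using that K(3) unfolding \<phi>t_eq by blast
    qed simp
    show "(\<lambda>y. t *\<^sub>R w + y) ` K \<subseteq> W"
    proof clarify
     fix y assume "y \<in> K"
     hence sub: "closed_segment y (y + real m *\<^sub>R w) \<subseteq> W" using K(2) by (auto simp: diff_domain_def)
     have "t *\<^sub>R w + y \<in> closed_segment y (y + real m *\<^sub>R w)"
     proof (cases "m = 0")
      case False
      thus ?thesis unfolding in_segment using t by (intro exI[of _ "t / m"]) (auto simp: algebra_simps)
     qed (use t in auto)
     with sub show "t *\<^sub>R w + y \<in> W" by blast
    qed
   qed
   have n: "norm (abs_L2 \<phi>t) = norm (abs_L2 \<phi>)" using \<phi>t unfolding \<phi>t_eq by (rule norm_test_translate[OF \<phi>])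
   let ?L = "{bs :: 'a list. set bs \<subseteq> Basis \<and> length bs = m}"
   have dt: "partial_derivs bs \<phi> (y - t *\<^sub>R w) = partial_derivs bs \<phi>t y" if "bs \<in> ?L" for bs y
    using partial_derivs_affine[OF sm, of bs 1 "- (t *\<^sub>R w)"] that by (simp add: \<phi>t_eq)
   have pt: "partial_derivs bs \<phi>t \<in> test_functions W" if "bs \<in> ?L" for bs
    using that by (intro test_functions_partial_derivs[OF \<phi>t]) blast
   have "(LINT y|lborel. f y * ((dir_deriv w ^^ m) \<phi>) (y - t *\<^sub>R w))
     = (LINT y|lborel. (\<Sum>bs\<in>?L. (\<Prod>b\<leftarrow>bs. w \<bullet> b) * (f y * partial_derivs bs \<phi>t y)))"
    unfolding dir_deriv_iterate[OF sm] sum_distrib_left by (intro Bochner_Integration.integral_cong sum.cong refl) (simp only: dt mult_ac)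
   also have "\<dots> = (\<Sum>bs\<in>?L. (\<Prod>b\<leftarrow>bs. w \<bullet> b) * inner u (abs_L2 (partial_derivs bs \<phi>t)))"
    using L2_rep_integrable[OF f L2_rep_test[OF pt]]
    by (subst Bochner_Integration.integral_sum) (auto simp: L2_rep_inner[OF f L2_rep_test[OF pt]])
   also have "\<bar>\<dots>\<bar> <= (\<Sum>bs\<in>?L. norm w ^ m * (Sobolev_norm m W u * norm (abs_L2 \<phi>)))"
   proof (rule order_trans[OF sum_abs sum_mono])
    fix bs assume bs: "bs \<in> ?L"
    note wd = Sobolev_weak_deriv[OF W u, of bs]
    have "inner u (abs_L2 (partial_derivs bs \<phi>t)) = (- 1) ^ length bs * inner (weak_deriv W bs u) (abs_L2 \<phi>t)"
     using wd is_weak_deriv_iff[OF Wb uO, of "weak_deriv W bs u" bs] bs \<phi>t by simp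
    hence "\<bar>inner u (abs_L2 (partial_derivs bs \<phi>t))\<bar> = \<bar>inner (weak_deriv W bs u) (abs_L2 \<phi>t)\<bar>"
     by (simp add: abs_mult)
    also have "\<dots> <= norm (weak_deriv W bs u) * norm (abs_L2 \<phi>t)" by (rule Cauchy_Schwarz_ineq2)
    also have "\<dots> <= Sobolev_norm m W u * norm (abs_L2 \<phi>t)" using bs by (intro mult_right_mono norm_weak_deriv_le_Sobolev_norm) auto
    finally have "\<bar>inner u (abs_L2 (partial_derivs bs \<phi>t))\<bar> <= Sobolev_norm m W u * norm (abs_L2 \<phi>)" unfolding n .
    thus "\<bar>(\<Prod>b\<leftarrow>bs. w \<bullet> b) * inner u (abs_L2 (partial_derivs bs \<phi>t))\<bar> <= norm w ^ m * (Sobolev_norm m W u * norm (abs_L2 \<phi>))"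
     unfolding abs_mult using abs_prod_list_inner_le[of bs w] bs by (intro mult_mono) auto
   qed
   also have "\<dots> = real (DIM('a) ^ m) * norm w ^ m * Sobolev_norm m W u * norm (abs_L2 \<phi>)" by (simp add: card_lists_length_eq)
   finally show "\<bar>G m t\<bar> <= real (DIM('a) ^ m) * norm w ^ m * Sobolev_norm m W u * norm (abs_L2 \<phi>)" by (simp add: G_def abs_mult)
  qed
  moreover have "inner ?v (abs_L2 \<phi>) = seq_diff m (\<lambda>n. G 0 (real n)) 0"
  proof -
   have int: "integrable lborel (\<lambda>z. f (z + real j *\<^sub>R w) * \<phi> z)" for j
    using lborel_integrable_affine[OF integrable_mult_test[OF fm loc \<phi>, of "real j *\<^sub>R w"], of 1 "real j *\<^sub>R w"]
    by (simp add: add.commute)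
   have eq: "(LINT z|lborel. f (z + real j *\<^sub>R w) * \<phi> z) = G 0 (real j)" for j
    using lborel_integral_translation[of "\<lambda>y. f y * \<phi> (y - real j *\<^sub>R w)" "real j *\<^sub>R w"] by (simp add: G_def)
   have "inner ?v (abs_L2 \<phi>) = (LINT z|lborel. indicator ?D z * fwd_diff m w f z * \<phi> z)"
    by (rule L2_rep_inner[OF v L2_rep_test[OF \<phi>]])
   also have "\<dots> = (LINT z|lborel. (\<Sum>j\<le>m. (- 1) ^ (m - j) * real (m choose j) * (f (z + real j *\<^sub>R w) * \<phi> z)))"
   proof (rule Bochner_Integration.integral_cong[OF refl])
    fix z
    show "indicator ?D z * fwd_diff m w f z * \<phi> z = (\<Sum>j\<le>m. (- 1) ^ (m - j) * real (m choose j) * (f (z + real j *\<^sub>R w) * \<phi> z))"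
     using test_functions_zero_outside[OF \<phi>, of z] by (cases "z \<in> ?D") (simp_all add: fwd_diff_def sum_distrib_right mult.assoc)
   qed
   also have "\<dots> = (\<Sum>j\<le>m. (- 1) ^ (m - j) * real (m choose j) * G 0 (real j))"
    using int by (subst Bochner_Integration.integral_sum) (auto simp: eq)
   finally show ?thesis by (simp add: seq_diff_def)
  qed
  ultimately show "\<bar>inner ?v (abs_L2 \<phi>)\<bar> <= real (DIM('a) ^ m) * norm w ^ m * Sobolev_norm m W u * norm (abs_L2 \<phi>)"
   by (simp only:)
 qed (simp add: Sn)
qed

subsection \<open>The scale of spaces \<open>H\<^sup>s\<close>\<close>

definition Besov_integrand :: "real => 'a::euclidean_space set => 'a L2 => real => ennreal" where
 "Besov_integrand s W u l = ennreal ((l powr (- s) * modulus_of_smoothness (nat \<lfloor>s\<rfloor> + 1) W u l)^2 / l) * indicator {0<..} l"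

lemma Besov_integral_eq: "Besov_integral s W u = (\<integral>\<^sup>+t. Besov_integrand s W u t \<partial>lborel)"
 by (simp only: Besov_integral_def Besov_integrand_def)

text \<open>The modulus increases for nonnegative arguments, and monotone functions are Borel;
  \<open>max 0\<close> extends the monotonicity to the whole line.\<close>

lemma borel_measurable_Besov_integrand:
 assumes W: "open W"
 shows "Besov_integrand s W u \<in> borel_measurable borel"
proof -
 let ?z = "\<lambda>t. modulus_of_smoothness (nat \<lfloor>s\<rfloor> + 1) W u (max 0 t)"
 have "mono ?z" by (intro monoI modulus_mono W) auto
 hence [measurable]: "borel_fun ?z" by (rule borel_measurable_mono)
 have "(\<lambda>t. ennreal ((t powr (- s) * ?z t)^2 / t) * indicator {0<..} t) \<in> borel_measurable borel" by measurable
 also have "(\<lambda>t. ennreal ((t powr (- s) * ?z t)^2 / t) * indicator {0<..} t) = Besov_integrand s W u"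
  by (auto simp: fun_eq_iff Besov_integrand_def indicator_def max_def)
 finally show ?thesis .
qed

lemma Besov_integral_add_le:
 assumes W: "open W"
 shows "Besov_integral s W (u + v) <= 2 * Besov_integral s W u + 2 * Besov_integral s W v"
proof -
 let ?r = "nat \<lfloor>s\<rfloor> + 1"
 let ?z = "modulus_of_smoothness ?r W"
 note [measurable] = borel_measurable_Besov_integrand[OF W]
 have "Besov_integral s W (u + v) <= (\<integral>\<^sup>+t. 2 * Besov_integrand s W u t + 2 * Besov_integrand s W v t \<partial>lborel)"
  unfolding Besov_integral_eq
 proof (rule nn_integral_mono)
  fix t :: real
  show "Besov_integrand s W (u + v) t <= 2 * Besov_integrand s W u t + 2 * Besov_integrand s W v t"
  proof (cases "0 < t")
   case True
   let ?p = "t powr (- s)"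
   have "(?p * ?z (u + v) t)^2 <= (?p * ?z u t + ?p * ?z v t)^2" unfolding distrib_left[symmetric] using True
    by (intro power_mono mult_left_mono modulus_add_le mult_nonneg_nonneg modulus_nonneg W) auto
   also have "\<dots> <= 2 * (?p * ?z u t)^2 + 2 * (?p * ?z v t)^2"
    using sum_squares_bound[of "?p * ?z u t" "?p * ?z v t"] by (simp add: power2_sum)
   finally have "(?p * ?z (u + v) t)^2 / t <= (2 * (?p * ?z u t)^2 + 2 * (?p * ?z v t)^2) / t" using True by (intro divide_right_mono) auto
   also have "\<dots> = 2 * ((?p * ?z u t)^2 / t) + 2 * ((?p * ?z v t)^2 / t)" by (simp add: add_divide_distrib)
   finally have "ennreal ((?p * ?z (u + v) t)^2 / t) <= ennreal (2 * ((?p * ?z u t)^2 / t) + 2 * ((?p * ?z v t)^2 / t))" by (rule ennreal_leI)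
   also have "\<dots> = 2 * ennreal ((?p * ?z u t)^2 / t) + 2 * ennreal ((?p * ?z v t)^2 / t)"
    using True by (simp only: ennreal_plus ennreal_mult zero_le_divide_iff zero_le_power2 mult_nonneg_nonneg zero_le_numeral less_imp_le simp_thms ennreal_numeral)
   finally show ?thesis using True by (simp add: Besov_integrand_def)
  qed (simp add: Besov_integrand_def)
 qed
 also have "\<dots> = 2 * Besov_integral s W u + 2 * Besov_integral s W v"
  unfolding Besov_integral_eq by (subst nn_integral_add) (auto simp: nn_integral_cmult)
 finally show ?thesis .
qed

lemma Besov_integral_scaleR_le:
 assumes W: "open W"
 shows "Besov_integral s W (c *\<^sub>R u) <= ennreal (c^2) * Besov_integral s W u"
proof -
 let ?z = "modulus_of_smoothness (nat \<lfloor>s\<rfloor> + 1) W"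
 note [measurable] = borel_measurable_Besov_integrand[OF W]
 have "Besov_integral s W (c *\<^sub>R u) <= (\<integral>\<^sup>+t. ennreal (c^2) * Besov_integrand s W u t \<partial>lborel)"
  unfolding Besov_integral_eq
 proof (rule nn_integral_mono)
  fix t :: real
  show "Besov_integrand s W (c *\<^sub>R u) t <= ennreal (c^2) * Besov_integrand s W u t"
  proof (cases "0 < t")
   case True
   have "(t powr (- s) * ?z (c *\<^sub>R u) t)^2 <= (t powr (- s) * (\<bar>c\<bar> * ?z u t))^2"
    using True by (intro power_mono mult_left_mono modulus_scaleR_le mult_nonneg_nonneg modulus_nonneg W) auto
   hence "(t powr (- s) * ?z (c *\<^sub>R u) t)^2 / t <= c^2 * ((t powr (- s) * ?z u t)^2 / t)"
    using True by (simp add: power_mult_distrib mult_ac divide_right_mono)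
   thus ?thesis using True by (simp add: Besov_integrand_def ennreal_mult[symmetric] ennreal_leI)
  qed (simp add: Besov_integrand_def)
 qed
 also have "\<dots> = ennreal (c^2) * Besov_integral s W u" unfolding Besov_integral_eq by (rule nn_integral_cmult) simp
 finally show ?thesis .
qed

lemma diff_L2_zero:
 assumes W: "open W" and r: "1 <= r"
 shows "diff_L2 r W 0 u = 0"
proof -
 obtain f where f: "L2_rep u f" using L2_rep_ex by blast
 have "(\<Sum>j\<le>r. (- 1) ^ (r - j) * real (r choose j)) = (\<Sum>j\<le>r. (- 1) ^ r * ((- 1) ^ j * real (r choose j)))"
  by (intro sum.cong refl) (simp add: minus_one_power_iff)
 also have "\<dots> = 0" using choose_alternating_sum[of r, where ?'a = real] r by (simp flip: sum_distrib_left)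
 finally have "fwd_diff r 0 f z = 0" for z by (simp add: fwd_diff_def flip: sum_distrib_right)
 thus ?thesis by (intro L2_rep_eqI[OF L2_rep_diff_L2[OF W f] L2_rep_zero]) auto
qed

text \<open>As the modulus of smoothness increases, its value at \<open>l\<close> is controlled by the part of
 the Besov integral over \<open>[l, 2 l]\<close>.\<close>

lemma norm_diff_L2_le_Besov_norm:
 assumes W: "open W" and s: "0 < s" and u: "u \<in> Besov s W"
 shows "norm (diff_L2 (nat \<lfloor>s\<rfloor> + 1) W w u) <= 2 * 2 powr s * norm w powr s * Besov_norm s W u"
proof (cases "w = 0")
 case True
 thus ?thesis by (simp add: diff_L2_zero[OF W])
next
 case False
 let ?r = "nat \<lfloor>s\<rfloor> + 1" and ?l = "norm w"
 let ?N = "norm (diff_L2 ?r W w u)" and ?I = "Besov_integral s W u"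
 have l: "0 < ?l" using False by simp
 \<comment> \<open>A lower bound for the Besov integrand on \<open>[l, 2 l]\<close>, where
   \<open>l = norm w\<close>: the power and the quotient are smallest at \<open>2 l\<close>, the
   modulus at \<open>l\<close>.\<close>
 define e where "e = ((2 * ?l) powr (- s) * ?N)^2 / (2 * ?l)"
 have e: "0 <= e" by (simp add: e_def)
 have "ennreal (e * ?l) = (\<integral>\<^sup>+t. ennreal e * indicator {?l..2 * ?l} t \<partial>lborel)"
  using l e by (subst nn_integral_cmult_indicator) (auto simp: ennreal_mult)
 also have "\<dots> <= ?I" unfolding Besov_integral_eq
 proof (rule nn_integral_mono)
  fix t :: real
  show "ennreal e * indicator {?l..2 * ?l} t <= Besov_integrand s W u t"
  proof (cases "?l <= t \<and> t <= 2 * ?l")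
   case True
   have t0: "0 < t" using conjunct1[OF True] l by linarith
   have "(2 * ?l) powr (- s) <= t powr (- s)" using conjunct2[OF True] t0 s by (intro powr_mono2') auto
   moreover have "?N <= modulus_of_smoothness ?r W u t" using True by (intro norm_diff_L2_le_modulus W) auto
   ultimately have "((2 * ?l) powr (- s) * ?N)^2 <= (t powr (- s) * modulus_of_smoothness ?r W u t)^2" by (intro power_mono mult_mono) auto
   hence "e <= (t powr (- s) * modulus_of_smoothness ?r W u t)^2 / t" unfolding e_def using conjunct2[OF True] t0 by (intro frac_le) auto
   thus ?thesis using True t0 by (simp add: Besov_integrand_def ennreal_leI)
  qed (auto simp: indicator_def)
 qed
 finally have "ennreal (e * ?l) <= ?I" .
 moreover have "?I < \<infinity>" using u by (simp add: Besov_def)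
 ultimately have le: "e * ?l <= enn2real ?I" using enn2real_mono[of "ennreal (e * ?l)" ?I] e by simp
 have "((2 * ?l) powr (- s) * ?N)^2 = 2 * (e * ?l)" using l by (simp add: e_def)
 also have "\<dots> <= 2 * enn2real ?I" using le by simp
 also have "\<dots> <= (2 * sqrt (enn2real ?I))^2" by (simp add: power_mult_distrib)
 finally have "(2 * ?l) powr (- s) * ?N <= 2 * sqrt (enn2real ?I)" by (rule power2_le_imp_le) simp
 hence "(2 * ?l) powr s * ((2 * ?l) powr (- s) * ?N) <= (2 * ?l) powr s * (2 * sqrt (enn2real ?I))" by (rule mult_left_mono) simp
 also have "(2 * ?l) powr s * ((2 * ?l) powr (- s) * ?N) = ?N" using l by (simp add: powr_minus)
 also have "(2 * ?l) powr s * (2 * sqrt (enn2real ?I)) <= (2 * ?l) powr s * (2 * Besov_norm s W u)"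
  by (intro mult_left_mono) (auto simp: Besov_norm_def)
 finally show ?thesis using l by (simp add: powr_mult mult_ac)
qed

text \<open>The integral is split at \<open>T\<close>. Below \<open>T\<close> the modulus is bounded
  by \<open>t ^ r\<close> times the Sobolev norm of order \<open>r\<close>, above by a multiple of
  the \<open>L\<^sub>2\<close> norm; both powers are integrable since
  \<open>0 < s < r\<close>.\<close>

lemma Besov_integral_le:
 fixes W :: "'a::euclidean_space set"
 assumes W: "open W" and s: "0 < s" "s \<notin> \<nat>" and r: "r = nat \<lfloor>s\<rfloor> + 1" and u: "u \<in> Sobolev r W" and T: "0 < T"
 shows "Besov_integral s W u <=
  ennreal ((real (DIM('a) ^ r) * Sobolev_norm r W u)^2 * (T powr (2 * (r - s)) / (2 * (r - s))) +
   (sqrt (fwd_diff_const r) * norm u)^2 * (T powr (- (2 * s)) / (2 * s)))"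
proof -
 let ?A = "real (DIM('a) ^ r) * Sobolev_norm r W u" and ?B = "sqrt (fwd_diff_const r) * norm u"
 have Sn: "0 <= Sobolev_norm r W u" by (simp add: Sobolev_norm_def sum_nonneg)
 have rs: "0 < real r - s" using s r by linarith
 have i1: "((\<lambda>t. t powr (2 * (r - s) - 1)) has_integral T powr (2 * (r - s)) / (2 * (r - s))) {0..T}"
  using has_integral_powr_from_0[of "2 * (r - s) - 1" T] rs T by simp
 have i2: "((\<lambda>t. t powr (- (2 * s) - 1)) has_integral T powr (- (2 * s)) / (2 * s)) {T..}"
  using has_integral_powr_to_inf[of "- (2 * s) - 1" T] s T by simp
 have "Besov_integral s W u <= (\<integral>\<^sup>+t. ennreal (?A^2) * (ennreal (t powr (2 * (r - s) - 1)) * indicator {0..T} t) +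
   ennreal (?B^2) * (ennreal (t powr (- (2 * s) - 1)) * indicator {T..} t) \<partial>lborel)" unfolding Besov_integral_eq
 proof (rule nn_integral_mono)
  fix t :: real
  let ?z = "modulus_of_smoothness r W u t"
  show "Besov_integrand s W u t <= ennreal (?A^2) * (ennreal (t powr (2 * (r - s) - 1)) * indicator {0..T} t) +
   ennreal (?B^2) * (ennreal (t powr (- (2 * s) - 1)) * indicator {T..} t)"
  proof (cases "0 < t")
   case True
   have p: "(t powr a)^2 = t powr (2 * a)" for a using True by (simp add: power2_eq_square flip: powr_add)
   have pr: "t ^ r = t powr real r" using True by (simp add: powr_realpow)
   show ?thesis
   proof (cases "t <= T")
    case le: True
    have "?z <= ?A * t ^ r"
    proof (rule modulus_le[OF W])
     fix h :: 'a assume "norm h <= t"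
     hence "real (DIM('a) ^ r) * norm h ^ r * Sobolev_norm r W u <= real (DIM('a) ^ r) * t ^ r * Sobolev_norm r W u"
      by (intro mult_right_mono mult_left_mono power_mono Sn) auto
     thus "norm (diff_L2 r W h u) <= ?A * t ^ r" using norm_diff_L2_le_Sobolev_norm[OF W u, of h] by (simp add: mult_ac)
    qed (use True in simp)
    hence "(t powr (- s) * ?z)^2 / t <= (t powr (- s) * (?A * t ^ r))^2 / t"
     using True by (intro divide_right_mono power_mono mult_left_mono mult_nonneg_nonneg modulus_nonneg W) auto
    also have "\<dots> = ?A^2 * (t powr (2 * (- s)) * t powr (2 * real r) / t powr 1)" using True by (simp add: power_mult_distrib p pr)
    also have "t powr (2 * (- s)) * t powr (2 * real r) / t powr 1 = t powr (2 * (r - s) - 1)"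
     by (simp only: powr_add[symmetric] powr_diff[symmetric]) (simp add: algebra_simps)
    finally have "Besov_integrand s W u t <= ennreal (?A^2) * (ennreal (t powr (2 * (r - s) - 1)) * indicator {0..T} t)"
     using True le r by (simp add: Besov_integrand_def ennreal_mult[symmetric] ennreal_leI)
    thus ?thesis by (rule order_trans) simp
   next
    case gt: False
    have "?z <= ?B" using True by (intro modulus_le_norm W) auto
    hence "(t powr (- s) * ?z)^2 / t <= (t powr (- s) * ?B)^2 / t"
     using True by (intro divide_right_mono power_mono mult_left_mono mult_nonneg_nonneg modulus_nonneg W) auto
    also have "\<dots> = ?B^2 * (t powr (2 * (- s)) / t powr 1)" using True by (simp add: power_mult_distrib p)
    also have "t powr (2 * (- s)) / t powr 1 = t powr (- (2 * s) - 1)" by (simp only: powr_diff[symmetric]) simp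
    finally have "Besov_integrand s W u t <= ennreal (?B^2) * (ennreal (t powr (- (2 * s) - 1)) * indicator {T..} t)"
     using True gt r by (simp add: Besov_integrand_def ennreal_mult[symmetric] ennreal_leI)
    thus ?thesis by (rule order_trans) simp
   qed
  qed (simp add: Besov_integrand_def)
 qed
 also have "\<dots> = ennreal (?A^2) * ennreal (T powr (2 * (r - s)) / (2 * (r - s))) + ennreal (?B^2) * ennreal (T powr (- (2 * s)) / (2 * s))"
  using nn_integral_has_integral_lebesgue'[OF _ i1] nn_integral_has_integral_lebesgue'[OF _ i2]
  by (subst nn_integral_add) (auto simp: nn_integral_cmult)
 also have "\<dots> = ennreal (?A^2 * (T powr (2 * (r - s)) / (2 * (r - s))) + ?B^2 * (T powr (- (2 * s)) / (2 * s)))"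
 proof -
  have nn: "0 <= T powr (2 * (r - s)) / (2 * (r - s))" "0 <= T powr (- (2 * s)) / (2 * s)" using rs s by auto
  note m = mult_nonneg_nonneg[OF zero_le_power2 nn(1)] mult_nonneg_nonneg[OF zero_le_power2 nn(2)]
  show ?thesis by (simp only: ennreal_plus[OF m] ennreal_mult[OF zero_le_power2 nn(1)] ennreal_mult[OF zero_le_power2 nn(2)])
 qed
 finally show ?thesis .
qed

text \<open>For integer \<open>s\<close> the differences of order \<open>s\<close> are bounded
  through weak derivatives of that order; for other \<open>s\<close> the order is the one in the
  definition of the Besov space.\<close>

definition diff_order :: "real => nat" where
 "diff_order s = (if s \<in> \<nat> then nat \<lfloor>s\<rfloor> else nat \<lfloor>s\<rfloor> + 1)"

lemma diff_order_pos: "0 < s ==> 1 <= diff_order s" by (auto simp: diff_order_def Nats_def)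

lemma H_space_subset_L2_on: "H_space s W \<subseteq> L2_on W" by (auto simp: H_space_def Sobolev_def Besov_def)

lemma norm_le_H_norm: "open W ==> u \<in> H_space s W ==> norm u <= H_norm s W u"
 by (auto simp: H_space_def H_norm_def norm_le_Sobolev_norm Besov_norm_def split: if_splits)

lemma H_norm_nonneg: "0 <= H_norm s W u" by (auto simp: H_norm_def Sobolev_norm_def Besov_norm_def sum_nonneg)

lemma H_space_add:
 assumes W: "open W" and "u \<in> H_space s W" "v \<in> H_space s W"
 shows "u + v \<in> H_space s W"
proof (cases "s \<in> \<nat>")
 case False
 hence "u \<in> L2_on W" "v \<in> L2_on W" "Besov_integral s W u < \<infinity>" "Besov_integral s W v < \<infinity>"
  using assms by (auto simp: H_space_def Besov_def)
 hence "Besov_integral s W (u + v) < \<infinity>" "u + v \<in> L2_on W"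
  by (auto intro!: le_less_trans[OF Besov_integral_add_le[OF W]] L2_on_add simp: ennreal_mult_less_top)
 thus ?thesis using False by (simp add: H_space_def Besov_def)
qed (use assms in \<open>auto simp: H_space_def intro: Sobolev_add\<close>)

lemma H_space_scaleR:
 assumes W: "open W" and "u \<in> H_space s W"
 shows "c *\<^sub>R u \<in> H_space s W"
proof (cases "s \<in> \<nat>")
 case False
 hence "u \<in> L2_on W" "Besov_integral s W u < \<infinity>" using assms by (auto simp: H_space_def Besov_def)
 hence "Besov_integral s W (c *\<^sub>R u) < \<infinity>" "c *\<^sub>R u \<in> L2_on W"
  by (auto intro!: le_less_trans[OF Besov_integral_scaleR_le[OF W]] L2_on_scaleR simp: ennreal_mult_less_top)
 thus ?thesis using False by (simp add: H_space_def Besov_def)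
qed (use assms in \<open>auto simp: H_space_def intro: Sobolev_scaleR\<close>)

lemma diff_bounded_H:
 fixes W :: "'a::euclidean_space set"
 assumes W: "open W" and s: "0 < s"
 shows "\<exists>C>0. \<forall>u\<in>H_space s W. \<forall>f. L2_rep u f --> diff_bounded (diff_order s) s W (C * H_norm s W u) f"
proof (intro exI conjI ballI allI impI)
 define C where "C = max (real (DIM('a) ^ diff_order s)) (2 * 2 powr s)"
 show "0 < C" by (simp add: C_def less_max_iff_disj)
 fix u f assume u: "u \<in> H_space s W" and f: "L2_rep u f"
 have "norm (diff_L2 (diff_order s) W w u) <= C * H_norm s W u * norm w powr s" for w
 proof (cases "s \<in> \<nat>")
  case True
  then obtain m where m: "s = real m" by (auto simp: Nats_def)
  have "norm w ^ m = norm w powr s" using s m by (cases "w = 0") (auto simp: powr_realpow)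
  hence "norm (diff_L2 m W w u) <= real (DIM('a) ^ m) * (norm w powr s * Sobolev_norm m W u)"
   using norm_diff_L2_le_Sobolev_norm[OF W, of u m w] u True m by (simp add: H_space_def mult_ac)
  also have "\<dots> <= C * (norm w powr s * Sobolev_norm m W u)"
   using True m by (intro mult_right_mono) (auto simp: C_def diff_order_def Sobolev_norm_def sum_nonneg)
  finally show ?thesis using True m by (simp add: diff_order_def H_norm_def mult_ac)
 next
  case False
  have "norm (diff_L2 (diff_order s) W w u) <= 2 * 2 powr s * (norm w powr s * Besov_norm s W u)"
   using norm_diff_L2_le_Besov_norm[OF W s, of u w] u False by (simp add: H_space_def diff_order_def mult_ac)
  also have "\<dots> <= C * (norm w powr s * Besov_norm s W u)" by (intro mult_right_mono) (auto simp: C_def Besov_norm_def)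
  finally show ?thesis using False by (simp add: H_norm_def mult_ac)
 qed
 thus "diff_bounded (diff_order s) s W (C * H_norm s W u) f" unfolding diff_bounded_def L2_rep_norm[OF L2_rep_diff_L2[OF W f]]
  by (intro allI ennreal_leI power_mono) auto
qed

text \<open>An interpolation inequality, phrased for functions that vary at frequency
  \<open>N\<close>. In the noninteger case the Besov integral is split at \<open>1 / N\<close>,
  where both parts are of order \<open>(K * N powr s) ^ 2\<close>. It serves for sums of bumps of
  width about \<open>1 / N\<close>.\<close>

lemma H_norm_le:
 fixes W :: "'a::euclidean_space set"
 assumes W: "open W" and s: "0 < s"
 shows "\<exists>C>0. \<forall>u K N. u \<in> Sobolev (diff_order s) W --> 0 <= K --> 1 <= N --> norm u <= K -->
  Sobolev_norm (diff_order s) W u <= K * N ^ diff_order s --> u \<in> H_space s W \<and> H_norm s W u <= C * (K * N powr s)"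
proof (cases "s \<in> \<nat>")
 case True
 then obtain m where m: "s = real m" by (auto simp: Nats_def)
 show ?thesis using True m by (intro exI[of _ 1]) (auto simp: diff_order_def H_space_def H_norm_def powr_realpow)
next
 case False
 let ?r = "diff_order s"
 have r: "?r = nat \<lfloor>s\<rfloor> + 1" using False by (simp add: diff_order_def)
 have rs: "0 < real ?r - s" using s r by linarith
 define c where "c = (real (DIM('a) ^ ?r))^2 / (2 * (?r - s)) + fwd_diff_const ?r / (2 * s)"
 have c: "0 <= c" unfolding c_def using rs s by (intro add_nonneg_nonneg divide_nonneg_nonneg fwd_diff_const_nonneg) auto
 show ?thesis
 proof (intro exI[of _ "1 + sqrt c"] conjI allI impI)
  fix u :: "'a L2" and K N :: real
  assume u: "u \<in> Sobolev ?r W" and K: "0 <= K" and N: "1 <= N" and le: "norm u <= K" "Sobolev_norm ?r W u <= K * N ^ ?r"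
  have Sn: "0 <= Sobolev_norm ?r W u" by (simp add: Sobolev_norm_def sum_nonneg)
  have p: "(N powr a)^2 = N powr (2 * a)" for a by (simp add: power2_eq_square flip: powr_add)
  have pr: "N ^ ?r = N powr real ?r" using N by (simp add: powr_realpow)
  have q: "(1 / N) powr a = N powr (- a)" for a using N by (simp add: powr_divide powr_minus_divide)
  have "(real (DIM('a) ^ ?r) * Sobolev_norm ?r W u)^2 * ((1 / N) powr (2 * (?r - s)) / (2 * (?r - s)))
   <= (real (DIM('a) ^ ?r) * (K * N ^ ?r))^2 * ((1 / N) powr (2 * (?r - s)) / (2 * (?r - s)))"
   using rs Sn le by (intro mult_right_mono power_mono mult_left_mono) auto
  also have "\<dots> = (real (DIM('a) ^ ?r))^2 / (2 * (?r - s)) * K^2 * (N powr (2 * real ?r) * N powr (- (2 * (?r - s))))"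
   using N by (simp add: power_mult_distrib p q pr)
  also have "N powr (2 * real ?r) * N powr (- (2 * (?r - s))) = (N powr s)^2" unfolding p powr_add[symmetric] by (simp add: algebra_simps)
  finally have 1: "(real (DIM('a) ^ ?r) * Sobolev_norm ?r W u)^2 * ((1 / N) powr (2 * (?r - s)) / (2 * (?r - s)))
   <= (real (DIM('a) ^ ?r))^2 / (2 * (?r - s)) * (K * N powr s)^2" by (simp add: power_mult_distrib)
  have "(sqrt (fwd_diff_const ?r) * norm u)^2 * ((1 / N) powr (- (2 * s)) / (2 * s))
   <= (sqrt (fwd_diff_const ?r) * K)^2 * ((1 / N) powr (- (2 * s)) / (2 * s))"
   using s le by (intro mult_right_mono power_mono mult_left_mono) (auto simp: fwd_diff_const_nonneg)
  also have "\<dots> = fwd_diff_const ?r / (2 * s) * (K * N powr s)^2" by (simp add: power_mult_distrib p q fwd_diff_const_nonneg)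
  finally have "(real (DIM('a) ^ ?r) * Sobolev_norm ?r W u)^2 * ((1 / N) powr (2 * (?r - s)) / (2 * (?r - s))) +
    (sqrt (fwd_diff_const ?r) * norm u)^2 * ((1 / N) powr (- (2 * s)) / (2 * s)) <= c * (K * N powr s)^2"
   using 1 by (simp add: c_def distrib_right)
  moreover have "0 < 1 / N" using N by simp
  ultimately have I: "Besov_integral s W u <= ennreal (c * (K * N powr s)^2)"
   using Besov_integral_le[OF W s False r u, of "1 / N"] by (meson ennreal_leI order_trans)
  have uO: "u \<in> L2_on W" using u by (simp add: Sobolev_def)
  show "u \<in> H_space s W" using I uO False by (auto simp: H_space_def Besov_def intro: le_less_trans)
  have "enn2real (Besov_integral s W u) <= c * (K * N powr s)^2" using I c by (intro enn2real_leI) auto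
  hence "sqrt (enn2real (Besov_integral s W u)) <= sqrt c * (K * N powr s)"
   using K c by (metis real_sqrt_le_mono real_sqrt_mult real_sqrt_abs abs_of_nonneg mult_nonneg_nonneg powr_ge_zero)
  moreover have "norm u <= K * N powr s" using le(1) N s K mult_left_mono[of 1 "N powr s" K] by (simp add: ge_one_powr_ge_zero)
  ultimately show "H_norm s W u <= (1 + sqrt c) * (K * N powr s)" using False by (simp add: H_norm_def Besov_norm_def distrib_right)
 qed (use c in \<open>simp add: add_pos_nonneg\<close>)
qed

lemma test_in_H_space:
 assumes W: "open W" and s: "0 < s" and \<phi>: "\<phi> \<in> test_functions W"
 shows "abs_L2 \<phi> \<in> H_space s W"
proof -
 let ?u = "abs_L2 \<phi>"
 have "?u \<in> Sobolev (diff_order s) W" by (rule test_in_Sobolev[OF W \<phi>])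
 moreover have "norm ?u <= Sobolev_norm (diff_order s) W ?u" by (intro norm_le_Sobolev_norm W calculation)
 moreover have "0 <= Sobolev_norm (diff_order s) W ?u" by (simp add: Sobolev_norm_def sum_nonneg)
 ultimately show ?thesis
  using H_norm_le[OF W s] by (elim exE conjE) (drule spec[of _ ?u], drule spec[of _ "Sobolev_norm (diff_order s) W ?u"], drule spec[of _ 1], simp)
qed

subsection \<open>Continuous representatives\<close>

lemma integrable_indicator_square_integrable:
 fixes F :: "'a::euclidean_space => real"
 assumes F: "borel_fun F" "sq_int F < \<infinity>"
  and A [measurable]: "A \<in> sets borel" "emeasure lborel A < \<infinity>"
 shows "integrable lborel (\<lambda>v. indicator A v * F v)"
proof (rule integrable_mult_lborel)
 show "square_integrable F" using F square_integrable_borel_iff[OF F(1)] by simp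
 have "borel_fun (\<lambda>x. indicator A x :: real)" by measurable
 from square_integrable_borel_iff[OF this]
 show "square_integrable (indicator A :: 'a => real)" using A by (simp add: nn_integral_square_indicator)
qed (use F in auto)

lemma local_poly_square_le:
 assumes r: "1 <= r"
 shows "\<exists>K>0. \<forall>F :: 'a::euclidean_space => real. borel_fun F --> sq_int F < \<infinity> -->
  ennreal ((local_poly r F 0)^2) <= ennreal K * (\<integral>\<^sup>+v. indicator (block (real r)) v * ennreal ((F v)^2) \<partial>lborel)"
proof -
 obtain K where K: "K > 0" "\<And>x. -1 <= x ==> x <= 0 ==> (\<Sum>m<r. \<bar>poly (cell_weight r m) x\<bar>) <= K"
  using cell_weight_bounded[of r] by blast
 show ?thesis
 proof (intro exI[of _ "(K ^ DIM('a))^2"] conjI allI impI)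
  fix F :: "'a => real"
  assume F [measurable]: "borel_fun F" and fin: "sq_int F < \<infinity>"
  let ?I = "\<integral>\<^sup>+v. indicator (block (real r)) v * ennreal ((F v)^2) \<partial>lborel"
  have "?I <= sq_int F" by (intro nn_integral_mono) (auto simp: indicator_def)
  hence I: "?I < \<infinity>" using fin by (rule le_less_trans)
  have avg: "\<bar>cell_avg F w\<bar> <= sqrt (enn2real ?I)" if w: "\<And>c. c \<in> Basis ==> 0 <= w \<bullet> c \<and> w \<bullet> c <= real r - 1" for w
  proof -
   have sub: "cell w \<subseteq> block (real r)" using cell_subset_block[OF w] by simp
   have "ennreal ((cell_avg F w)^2) <= (\<integral>\<^sup>+v. indicator (cell w) v * ennreal ((F v)^2) \<partial>lborel)" unfolding cell_avg_def
    by (intro integral_square_le integrable_indicator_square_integrable F fin borel_cell) auto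
   also have "\<dots> <= ?I" using sub by (intro nn_integral_mono) (auto simp: indicator_def)
   finally have "(cell_avg F w)^2 <= enn2real ?I" using I enn2real_mono[of "ennreal ((cell_avg F w)^2)" ?I] by simp
   thus ?thesis by (metis real_sqrt_abs real_sqrt_le_mono)
  qed
  have "\<bar>local_poly r F 0\<bar> <= K ^ card (Basis :: 'a set) * sqrt (enn2real ?I)" unfolding local_poly_def
  proof (rule abs_tensor_sum_le)
   fix i assume i: "i \<in> PiE (Basis :: 'a set) (\<lambda>_. {..<r})"
   have "real (i c) <= real r - 1" if "c \<in> Basis" for c using PiE_mem[OF i that] by auto
   thus "\<bar>cell_avg F (0 + (\<Sum>b\<in>Basis. real (i b) *\<^sub>R b))\<bar> <= sqrt (enn2real ?I)"
    by (intro avg) (auto simp: inner_sum_left_Basis)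
  qed (use K in auto)
  hence "(local_poly r F 0)^2 <= (K ^ DIM('a) * sqrt (enn2real ?I))^2" using K by (intro abs_le_square_iff[THEN iffD1]) simp
  also have "\<dots> = (K ^ DIM('a))^2 * enn2real ?I" by (simp add: power_mult_distrib)
  finally have "ennreal ((local_poly r F 0)^2) <= ennreal ((K ^ DIM('a))^2 * enn2real ?I)" by (rule ennreal_leI)
  also have "\<dots> = ennreal ((K ^ DIM('a))^2) * ?I" using I by (simp add: ennreal_mult)
  finally show "ennreal ((local_poly r F 0)^2) <= ennreal ((K ^ DIM('a))^2) * ?I" .
 qed (use K in simp)
qed

text \<open>The cells of side \<open>1 / 2 ^ k\<close> have \<open>y\<close> itself as their lower
  corner, so the relative position is 0 on every level and the polynomial becomes a function of
  \<open>y\<close>.\<close>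

definition dyadic_poly :: "nat => ('a::euclidean_space => real) => nat => 'a => real" where
 "dyadic_poly r f k y = local_poly r (\<lambda>v. f (y + (1 / 2 ^ k) *\<^sub>R v)) 0"

lemma nn_integral_dyadic:
 fixes f :: "'a::euclidean_space => real"
 assumes [measurable]: "borel_fun f"
 shows "sq_int (\<lambda>v. f (y + (1 / 2 ^ k) *\<^sub>R v)) = ennreal ((2 ^ k) ^ DIM('a)) * sq_int f"
proof -
 have "sq_int (\<lambda>v. f (y + (1 / 2 ^ k) *\<^sub>R v)) =
  ennreal (\<bar>2 ^ k\<bar> ^ DIM('a)) * sq_int (\<lambda>x. f (y + (1 / 2 ^ k) *\<^sub>R (- ((2 ^ k) *\<^sub>R y) + (2 ^ k) *\<^sub>R x)))"
  by (rule nn_integral_lborel_affine) auto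
 thus ?thesis by (simp add: scaleR_right_distrib scaleR_diff_right)
qed

lemma cell_avg_diff:
 fixes F G :: "'a::euclidean_space => real"
 assumes "borel_fun F" "sq_int F < \<infinity>"
  and "borel_fun G" "sq_int G < \<infinity>"
 shows "cell_avg (\<lambda>v. F v - G v) w = cell_avg F w - cell_avg G w"
 using integrable_indicator_square_integrable[OF assms(1,2) borel_cell[of w]] integrable_indicator_square_integrable[OF assms(3,4) borel_cell[of w]]
 by (simp add: cell_avg_def right_diff_distrib)

lemma dyadic_poly_diff:
 fixes f g :: "'a::euclidean_space => real"
 assumes f [measurable]: "borel_fun f" "sq_int f < \<infinity>"
  and g [measurable]: "borel_fun g" "sq_int g < \<infinity>"
 shows "dyadic_poly r (\<lambda>x. f x - g x) k y = dyadic_poly r f k y - dyadic_poly r g k y"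
proof -
 have "sq_int (\<lambda>v. f (y + (1 / 2 ^ k) *\<^sub>R v)) < \<infinity>"
  "sq_int (\<lambda>v. g (y + (1 / 2 ^ k) *\<^sub>R v)) < \<infinity>" using f g by (auto simp: nn_integral_dyadic ennreal_mult_less_top)
 from cell_avg_diff[OF _ this(1) _ this(2)]
 show ?thesis by (simp add: dyadic_poly_def local_poly_def tensor_sum_def sum_subtractf right_diff_distrib)
qed

text \<open>Pointwise the small cells cost \<open>2 ^ (k d)\<close>; integrated over
  \<open>y\<close>, Fubini removes this loss. The first bound serves for continuity in
  \<open>y\<close>, the second for the identification of the limit.\<close>

lemma dyadic_poly_square_le:
 assumes r: "1 <= r"
 shows "\<exists>K>0. \<forall>(f :: 'a::euclidean_space => real) k y. borel_fun f --> sq_int f < \<infinity> -->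
  ennreal ((dyadic_poly r f k y)^2) <= ennreal (K * (2 ^ k) ^ DIM('a)) * sq_int f \<and>
  (dyadic_poly r f k \<in> borel_measurable borel -->
   sq_int (dyadic_poly r f k) <= ennreal K * sq_int f)"
proof -
 obtain K where K: "K > 0" "\<And>F :: 'a => real. borel_fun F ==> sq_int F < \<infinity> ==>
  ennreal ((local_poly r F 0)^2) <= ennreal K * (\<integral>\<^sup>+v. indicator (block (real r)) v * ennreal ((F v)^2) \<partial>lborel)"
  using local_poly_square_le[OF r, where 'a = 'a] by (elim exE conjE) (rule that, assumption, blast)
 show ?thesis
 proof (intro exI[of _ "K * real r ^ DIM('a)"] conjI allI impI)
  fix f :: "'a => real" and k y
  assume f [measurable]: "borel_fun f" and fin: "sq_int f < \<infinity>"
  let ?S = "sq_int f"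
  have le: "ennreal ((dyadic_poly r f k y)^2) <= ennreal K * (\<integral>\<^sup>+v. indicator (block (real r)) v * ennreal ((f (y + (1 / 2 ^ k) *\<^sub>R v))^2) \<partial>lborel)" for y
   unfolding dyadic_poly_def by (rule K(2)) (use fin in \<open>auto simp: nn_integral_dyadic ennreal_mult_less_top\<close>)
  have "ennreal ((dyadic_poly r f k y)^2) <= ennreal K * sq_int (\<lambda>v. f (y + (1 / 2 ^ k) *\<^sub>R v))"
   by (rule order_trans[OF le]) (intro mult_left_mono nn_integral_mono, auto simp: indicator_def)
  also have "\<dots> = ennreal (K * (2 ^ k) ^ DIM('a)) * ?S" using K(1) by (simp add: nn_integral_dyadic ennreal_mult mult.assoc)
  also have "\<dots> <= ennreal (K * real r ^ DIM('a) * (2 ^ k) ^ DIM('a)) * ?S"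
   using K(1) r by (intro mult_right_mono ennreal_leI) (simp_all add: mult_le_cancel_left1 one_le_power)
  finally show "ennreal ((dyadic_poly r f k y)^2) <= ennreal (K * real r ^ DIM('a) * (2 ^ k) ^ DIM('a)) * ?S" .
  have "sq_int (dyadic_poly r f k) <=
    (\<integral>\<^sup>+y. ennreal K * (\<integral>\<^sup>+v. indicator (block (real r)) v * ennreal ((f (y + (1 / 2 ^ k) *\<^sub>R v))^2) \<partial>lborel) \<partial>lborel)"
   by (intro nn_integral_mono le)
  also have "\<dots> = ennreal K * (\<integral>\<^sup>+y. \<integral>\<^sup>+v. indicator (block (real r)) v * ennreal ((f (y + (1 / 2 ^ k) *\<^sub>R v))^2) \<partial>lborel \<partial>lborel)"
   by (rule nn_integral_cmult) measurable
  also have "(\<integral>\<^sup>+y. \<integral>\<^sup>+v. indicator (block (real r)) v * ennreal ((f (y + (1 / 2 ^ k) *\<^sub>R v))^2) \<partial>lborel \<partial>lborel) =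
    (\<integral>\<^sup>+v. \<integral>\<^sup>+y. indicator (block (real r)) v * ennreal ((f (y + (1 / 2 ^ k) *\<^sub>R v))^2) \<partial>lborel \<partial>lborel)"
   by (rule lborel_pair.Fubini') measurable
  also have "\<dots> = (\<integral>\<^sup>+v. indicator (block (real r)) (v :: 'a) * ?S \<partial>lborel)"
   by (intro nn_integral_cong) (simp add: nn_integral_cmult nn_integral_lborel_translation[where f = "\<lambda>x. ennreal ((f x)^2)"])
  also have "\<dots> = emeasure lborel (block (real r) :: 'a set) * ?S" by (simp add: nn_integral_multc)
  also have "ennreal K * (emeasure lborel (block (real r) :: 'a set) * ?S) <= ennreal K * (ennreal (real r ^ DIM('a)) * ?S)"
   by (intro mult_left_mono mult_right_mono emeasure_block_le) auto
  also have "\<dots> = ennreal (K * real r ^ DIM('a)) * ?S" using K(1) by (simp add: ennreal_mult mult.assoc)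
  finally show "sq_int (dyadic_poly r f k) <= ennreal (K * real r ^ DIM('a)) * ?S" .
 qed (use K r in simp)
qed

lemma dyadic_poly_test:
 fixes \<phi> :: "'a::euclidean_space => real"
 assumes \<phi>: "\<phi> \<in> test_functions U" and r: "1 <= r"
 shows "continuous_on UNIV (dyadic_poly r \<phi> k)" "(\<lambda>k. dyadic_poly r \<phi> k y) \<longlonglongrightarrow> \<phi> y"
proof -
 obtain B where B: "B > 0" "\<And>x. \<bar>\<phi> x\<bar> <= B" using test_functions_bounded[OF \<phi>] by metis
 have m [measurable]: "borel_fun \<phi>" by (rule test_functions_borel[OF \<phi>])
 have cont: "isCont \<phi> x" for x
  using smooth_imp_continuous[OF test_functions_smooth[OF \<phi>], of UNIV] by (simp add: continuous_on_eq_continuous_at)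
 have "continuous_on UNIV (\<lambda>y. cell_avg (\<lambda>v. \<phi> (y + (1 / 2 ^ k) *\<^sub>R v)) w)" for w
  unfolding continuous_on_sequentially comp_def
 proof (intro allI ballI impI)
  fix X :: "nat => 'a" and y assume X: "(\<forall>n. X n \<in> UNIV) \<and> X \<longlonglongrightarrow> y"
  show "(\<lambda>n. cell_avg (\<lambda>v. \<phi> (X n + (1 / 2 ^ k) *\<^sub>R v)) w) \<longlonglongrightarrow> cell_avg (\<lambda>v. \<phi> (y + (1 / 2 ^ k) *\<^sub>R v)) w"
   unfolding cell_avg_def
  proof (rule integral_dominated_convergence[where w = "\<lambda>v. indicator (cell w) v * B"])
   show "integrable lborel (\<lambda>v. indicator (cell w) v * B)" by (intro integrable_mult_left) (simp add: integrable_indicator_iff borel_cell)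
   show "AE v in lborel. (\<lambda>n. indicator (cell w) v * \<phi> (X n + (1 / 2 ^ k) *\<^sub>R v)) \<longlonglongrightarrow> indicator (cell w) v * \<phi> (y + (1 / 2 ^ k) *\<^sub>R v)"
    using X by (intro AE_I2 tendsto_mult tendsto_const isCont_tendsto_compose[OF cont] tendsto_add) auto
   show "AE v in lborel. norm (indicator (cell w) v * \<phi> (X n + (1 / 2 ^ k) *\<^sub>R v)) <= indicator (cell w) v * B" for n
    using B by (intro AE_I2) (auto simp: indicator_def)
  qed measurable
 qed
 thus "continuous_on UNIV (dyadic_poly r \<phi> k)" unfolding dyadic_poly_def[abs_def] local_poly_def tensor_sum_def by (intro continuous_intros)
 show "(\<lambda>k. dyadic_poly r \<phi> k y) \<longlonglongrightarrow> \<phi> y" unfolding dyadic_poly_def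
  by (rule local_poly_tendsto[where M = "\<lambda>x. x" and c = "\<lambda>_. y" and h = 1 and u = "\<lambda>_. 0" and x = "\<lambda>_. 0"])
   (use r in \<open>auto simp: cont linear_iff\<close>)
qed

text \<open>At a fixed level the pointwise bound by the \<open>L\<^sub>2\<close> norm exhibits the
  polynomial of \<open>f\<close> as a uniform limit of those of test functions.\<close>

lemma continuous_dyadic_poly:
 fixes f :: "'a::euclidean_space => real"
 assumes r: "1 <= r" and f [measurable]: "borel_fun f" and fin: "sq_int f < \<infinity>"
 shows "continuous_on UNIV (dyadic_poly r f k)"
proof -
 obtain K where K: "K > 0" "\<And>(f :: 'a => real) k y. borel_fun f ==> sq_int f < \<infinity> ==>
  ennreal ((dyadic_poly r f k y)^2) <= ennreal (K * (2 ^ k) ^ DIM('a)) * sq_int f" using dyadic_poly_square_le[OF r] by metis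
 define A where "A = K * (2 ^ k) ^ DIM('a)"
 have A: "0 < A" using K by (simp add: A_def)
 have dense: "l2_approx UNIV f" by (rule l2_dense) (use fin in auto)
 have "\<exists>\<phi>\<in>test_functions UNIV. sq_int (\<lambda>x. f x - \<phi> x) < ennreal ((1 / Suc n)^2 / A)" for n
  using dense A unfolding l2_approx_def by (metis divide_pos_pos of_nat_0_less_iff zero_less_Suc zero_less_one zero_less_power)
 hence "\<exists>\<phi>. \<forall>n. \<phi> n \<in> test_functions UNIV \<and> sq_int (\<lambda>x. f x - \<phi> n x) < ennreal ((1 / Suc n)^2 / A)"
  by (intro choice allI) blast
 then obtain \<phi> where \<phi>: "\<And>n. \<phi> n \<in> test_functions UNIV" "\<And>n. sq_int (\<lambda>x. f x - \<phi> n x) < ennreal ((1 / Suc n)^2 / A)"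
  by blast
 have [measurable]: "\<phi> n \<in> borel_measurable borel" for n by (rule test_functions_borel[OF \<phi>(1)])
 have bd: "\<bar>dyadic_poly r f k y - dyadic_poly r (\<phi> n) k y\<bar> <= 1 / Suc n" for n y
 proof -
  have fin': "sq_int (\<lambda>x. f x - \<phi> n x) < \<infinity>" using \<phi>(2)[of n] by (simp add: order.strict_trans)
  have "ennreal ((dyadic_poly r f k y - dyadic_poly r (\<phi> n) k y)^2) = ennreal ((dyadic_poly r (\<lambda>x. f x - \<phi> n x) k y)^2)"
   using test_functions_nn_integral_finite[OF \<phi>(1)] by (subst dyadic_poly_diff) (use fin in auto)
  also have "\<dots> <= ennreal A * sq_int (\<lambda>x. f x - \<phi> n x)" unfolding A_def by (rule K(2)) (use fin' in auto)
  also have "\<dots> <= ennreal A * ennreal ((1 / Suc n)^2 / A)" using \<phi>(2)[of n] by (intro mult_left_mono) auto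
  also have "\<dots> = ennreal ((1 / Suc n)^2)" using A by (simp flip: ennreal_mult)
  finally have "(dyadic_poly r f k y - dyadic_poly r (\<phi> n) k y)^2 <= (1 / Suc n)^2" by simp
  thus ?thesis using abs_le_square_iff[of _ "1 / real (Suc n)"] by (metis abs_of_nonneg of_nat_0_le_iff zero_le_divide_1_iff)
 qed
 have "uniform_limit UNIV (\<lambda>n. dyadic_poly r (\<phi> n) k) (dyadic_poly r f k) sequentially"
 proof (rule uniform_limitI)
  fix e :: real assume e: "0 < e"
  obtain N where N: "inverse (real (Suc N)) < e" using reals_Archimedean[OF e] by blast
  have "dist (dyadic_poly r (\<phi> n) k y) (dyadic_poly r f k y) < e" if "N <= n" for n y
  proof -
   have "1 / real (Suc n) <= inverse (real (Suc N))" using that by (simp add: field_simps)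
   thus ?thesis using bd[of y n] N by (simp add: dist_real_def abs_minus_commute)
  qed
  thus "\<forall>\<^sub>F n in sequentially. \<forall>y\<in>UNIV. dist (dyadic_poly r (\<phi> n) k y) (dyadic_poly r f k y) < e"
   unfolding eventually_sequentially by blast
 qed
 thus ?thesis by (rule uniform_limit_theorem[rotated]) (auto intro!: always_eventually dyadic_poly_test(1)[OF \<phi>(1) r])
qed

abbreviation dyadic_chain_bound :: "nat => 'a::euclidean_space set => real => nat => ('a => real) => 'a => bool" where
 "dyadic_chain_bound r W C k0 f y \<equiv>
  borel_fun f --> sq_int f < \<infinity> --> (\<forall>v\<in>block (real (2 * r) +
  1). y + (1 / 2 ^ k0) *\<^sub>R v \<in> W) --> (\<forall>k. ennreal ((dyadic_poly r f (Suc (k0 +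
  k)) y - dyadic_poly r f (k0 + k) y)^2) <= ennreal (C * (2 ^ k) ^ DIM('a)) * local_energy r W (\<lambda>v. v)
  (real (2 * r) + 1) (1 / 2 ^ k0) f (1 / 2 ^ k0 / 2 ^ Suc k) y)"

text \<open>The refinement chain with constant corner and all digits 0. Here the local energy is
  bounded by an integral over the whole space, at the price of \<open>2 ^ (k0 d)\<close>; this makes
  the estimate pointwise, with steps decaying like powers of
  \<open>2 powr (d / 2 - m)\<close>.\<close>

lemma dyadic_poly_chain:
 fixes W :: "'a::euclidean_space set" and m :: real
 assumes r: "1 <= r" and W: "open W" and m: "0 <= m"
 shows "\<exists>C>0. \<forall>(f :: 'a => real) M y k. borel_fun f --> sq_int f < \<infinity> -->
  diff_bounded r m W M f --> 0 <= M --> (\<forall>v\<in>block (real (2 * r) + 1). y + (1 / 2 ^ k0) *\<^sub>R v \<in> W) -->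
  \<bar>dyadic_poly r f (Suc (k0 + k)) y - dyadic_poly r f (k0 + k) y\<bar> <= C * M * (2 powr (real DIM('a) / 2 - m)) ^ k"
proof -
 have "\<exists>C>0. \<forall>(f :: 'a => real) M y. dyadic_chain_bound r W C k0 f y" using local_poly_chain[OF r, where 'a = 'a]
 proof (elim exE conjE, intro exI conjI allI impI)
  fix C :: real and f :: "'a => real" and M :: real and y k
  assume f: "borel_fun f" and fin: "sq_int f < \<infinity>"
   and sub: "\<forall>v\<in>block (real (2 * r) + 1). y + (1 / 2 ^ k0) *\<^sub>R v \<in> W"
  let ?R = "real (2 * r) + 1" and ?h = "1 / 2 ^ k0 :: real"
  have h: "?h / 2 ^ k = 1 / 2 ^ (k0 + k)" for k :: nat by (simp add: power_add)
  have hS: "?h / 2 ^ Suc k = 1 / 2 ^ (Suc (k0 + k))" for k :: nat by (simp add: power_add)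
  have int: "integrable lborel (\<lambda>v. indicator (block ?R) v * f (y + ?h *\<^sub>R 0 + (?h / 2 ^ k) *\<^sub>R v))" for k
  proof (rule integrable_indicator_square_integrable)
   show "sq_int (\<lambda>x. f (y + ?h *\<^sub>R 0 + (?h / 2 ^ k) *\<^sub>R x)) < \<infinity>"
    unfolding h using f fin by (simp add: nn_integral_dyadic ennreal_mult_less_top)
   show "emeasure lborel (block ?R :: 'a set) < \<infinity>" by (rule le_less_trans[OF emeasure_block_le]) auto
  qed (use f in auto)
  assume "\<forall>(f :: 'a => real) L W h R y a x o'.
  chain_step r C f L W h R y a x o'"
  note this[rule_format, of "\<lambda>v. v" f W ?h ?R y "\<lambda>_. 0" "\<lambda>_ _. 0" "\<lambda>_. 0" k]
  moreover have "1 / 2 ^ k' * ?R <= ?R" for k' :: nat using mult_right_mono[of "1 / 2 ^ k'" 1 ?R] by simp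
  ultimately have "ennreal ((local_poly r (\<lambda>v. f (y + ?h *\<^sub>R 0 + (?h / 2 ^ Suc k) *\<^sub>R v)) 0 -
    local_poly r (\<lambda>v. f (y + ?h *\<^sub>R 0 + (?h / 2 ^ k) *\<^sub>R v)) 0)^2) <=
    ennreal (C * (2 ^ k) ^ DIM('a)) * local_energy r W (\<lambda>v. v) ?R ?h f (?h / 2 ^ Suc k) y" using f W sub int by (simp add: linear_iff)
  thus "ennreal ((dyadic_poly r f (Suc (k0 + k)) y - dyadic_poly r f (k0 + k) y)^2) <=
    ennreal (C * (2 ^ k) ^ DIM('a)) * local_energy r W (\<lambda>v. v) ?R ?h f (?h / 2 ^ Suc k) y"
   unfolding dyadic_poly_def h[symmetric] hS[symmetric] by simp
 qed
 then obtain C where C: "0 < C" and chain: "\<forall>(f :: 'a => real) M y. dyadic_chain_bound r W C k0 f y" by (elim exE conjE) (rule that)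
 let ?d = "DIM('a)"
 define A where "A = real ?d * (2 ^ k0) ^ ?d"
 have A: "0 < A" by (simp add: A_def)
 show ?thesis
 proof (intro exI[of _ "sqrt (C * A)"] conjI allI impI)
  fix f :: "'a => real" and M :: real and y k
  assume f [measurable]: "borel_fun f" and fin: "sq_int f < \<infinity>"
   and M: "diff_bounded r m W M f" "0 <= M"
   and sub: "\<forall>v\<in>block (real (2 * r) + 1). y + (1 / 2 ^ k0) *\<^sub>R v \<in> W"
  let ?g = "1 / 2 ^ k0 / 2 ^ Suc k :: real"
  have g: "0 < ?g" by simp
  have [measurable]: "diff_domain W r w \<in> sets borel" for w using open_diff_domain[OF W] by auto
  have "local_energy r W (\<lambda>v. v) (real (2 * r) + 1) (1 / 2 ^ k0) f ?g y <=
   (\<Sum>b\<in>Basis. sq_int (\<lambda>v. indicator (diff_domain W r (?g *\<^sub>R b)) (y + (1 / 2 ^ k0) *\<^sub>R v) *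
    fwd_diff r (?g *\<^sub>R b) f (y + (1 / 2 ^ k0) *\<^sub>R v)))" unfolding local_energy_def
  proof (intro sum_mono nn_integral_mono)
   fix b v :: 'a and c :: ennreal
   show "indicator (block (real (2 * r) + 1)) v * ennreal ((indicator (diff_domain W r (?g *\<^sub>R b)) (y + (1 / 2 ^ k0) *\<^sub>R v) *
     fwd_diff r (?g *\<^sub>R b) f (y + (1 / 2 ^ k0) *\<^sub>R v))^2) <= ennreal ((indicator (diff_domain W r (?g *\<^sub>R b)) (y + (1 / 2 ^ k0) *\<^sub>R v) *
     fwd_diff r (?g *\<^sub>R b) f (y + (1 / 2 ^ k0) *\<^sub>R v))^2)" by (cases "v \<in> block (real (2 * r) + 1)") auto
  qed
  also have "\<dots> = (\<Sum>b\<in>(Basis :: 'a set). ennreal ((2 ^ k0) ^ ?d) * sq_int (\<lambda>z. indicator (diff_domain W r (?g *\<^sub>R b)) z *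
    fwd_diff r (?g *\<^sub>R b) f z))" by (intro sum.cong refl nn_integral_dyadic) measurable
  also have "\<dots> <= (\<Sum>b\<in>(Basis :: 'a set). ennreal ((2 ^ k0) ^ ?d) * ennreal ((M * norm (?g *\<^sub>R b) powr m)^2))"
   by (intro sum_mono mult_left_mono M(1)[unfolded diff_bounded_def, rule_format]) simp
  also have "\<dots> = (\<Sum>b\<in>(Basis :: 'a set). ennreal ((2 ^ k0) ^ ?d) * ennreal ((M * ?g powr m)^2))" using g by (intro sum.cong refl) simp
  also have "\<dots> = ennreal (A * (M * ?g powr m)^2)" by (simp add: A_def ennreal_mult ennreal_of_nat_eq_real_of_nat mult.assoc)
  also have "\<dots> <= ennreal (A * (M * (2 powr - m) ^ k)^2)"
  proof (intro ennreal_leI mult_left_mono power_mono)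
   have "?g <= 1 / 2 ^ k"
   proof -
    have "(1 :: real) <= 2 ^ k0" by (rule one_le_power) simp
    hence "(2 :: real) ^ k * 1 <= 2 ^ k * (2 * 2 ^ k0)" by (intro mult_left_mono) (linarith, simp)
    thus ?thesis by (simp add: field_simps)
   qed
   hence "?g powr m <= (1 / 2 ^ k) powr m" using m by (intro powr_mono2) auto
   also have "(1 / 2 ^ k) powr m = (2 powr - m) ^ k" by (simp add: powr_divide powr_minus_divide power_one_over powr_power flip: powr_realpow)
     (simp add: powr_powr mult.commute)
   finally show "?g powr m <= (2 powr - m) ^ k" .
  qed (use A M in auto)
  finally have le: "local_energy r W (\<lambda>v. v) (real (2 * r) + 1) (1 / 2 ^ k0) f ?g y <= ennreal (A * (M * (2 powr - m) ^ k)^2)" .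
  have q: "(2 powr (real ?d / 2)) ^ k * (2 powr (real ?d / 2)) ^ k = ((2 :: real) ^ k) ^ ?d"
  proof -
   have "(2 powr (real ?d / 2)) ^ k * (2 powr (real ?d / 2)) ^ k = (2 powr (real ?d / 2) * 2 powr (real ?d / 2)) ^ k"
    by (simp add: power_mult_distrib)
   also have "2 powr (real ?d / 2) * 2 powr (real ?d / 2) = (2 :: real) ^ ?d" by (simp flip: powr_add add: powr_realpow)
   finally show ?thesis by (simp add: power_mult[symmetric] mult.commute)
  qed
  have "ennreal ((dyadic_poly r f (Suc (k0 + k)) y - dyadic_poly r f (k0 + k) y)^2) <=
    ennreal (C * (2 ^ k) ^ ?d) * ennreal (A * (M * (2 powr - m) ^ k)^2)"
   using f fin sub by (intro order_trans[OF chain[rule_format] mult_left_mono[OF le]]) auto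
  also have "\<dots> = ennreal (C * (2 ^ k) ^ ?d * (A * (M * (2 powr - m) ^ k)^2))" using C A by (intro ennreal_mult[symmetric]) auto
  also have "C * (2 ^ k) ^ ?d * (A * (M * (2 powr - m) ^ k)^2) = (sqrt (C * A) * M * ((2 powr (real ?d / 2)) ^ k * (2 powr - m) ^ k))^2"
   using C A by (simp add: power_mult_distrib flip: q) (simp add: power2_eq_square)
  also have "(2 powr (real ?d / 2)) ^ k * (2 powr - m) ^ k = (2 powr (real ?d / 2 - m)) ^ k"
   by (simp add: powr_add[symmetric] flip: power_mult_distrib)
  finally have "(dyadic_poly r f (Suc (k0 + k)) y - dyadic_poly r f (k0 + k) y)^2 <= (sqrt (C * A) * M * (2 powr (real ?d / 2 - m)) ^ k)^2" by simp
  hence "\<bar>dyadic_poly r f (Suc (k0 + k)) y - dyadic_poly r f (k0 + k) y\<bar> <= \<bar>sqrt (C * A) * M * (2 powr (real ?d / 2 - m)) ^ k\<bar>"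
   by (simp only: abs_le_square_iff)
  thus "\<bar>dyadic_poly r f (Suc (k0 + k)) y - dyadic_poly r f (k0 + k) y\<bar> <= sqrt (C * A) * M * (2 powr (real ?d / 2 - m)) ^ k"
   using C A M(2) by (simp add: abs_mult)
 qed (use C A in simp)
qed

lemma dyadic_neighbourhood:
 fixes W :: "'a::euclidean_space set"
 assumes "open W" "x \<in> W"
 shows "\<exists>l>0. \<exists>k. ball x l \<subseteq> W \<and> (\<forall>y\<in>ball x l. \<forall>v\<in>block R. y + (1 / 2 ^ k) *\<^sub>R v \<in> W)"
proof -
 obtain e where e: "0 < e" "ball x e \<subseteq> W" using assms by (metis open_contains_ball)
 obtain B where B: "0 < B" "\<And>v :: 'a. v \<in> block R ==> norm v <= B" using bounded_block[of R] by (auto simp: bounded_pos)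
 obtain k where k: "2 * B / e < 2 ^ k" using real_arch_pow[of 2 "2 * B / e"] by auto
 have "y + (1 / 2 ^ k) *\<^sub>R v \<in> W" if "y \<in> ball x (e / 2)" "v \<in> block R" for y v
 proof -
  have "norm ((1 / 2 ^ k) *\<^sub>R v) = norm v / 2 ^ k" by simp
  also have "\<dots> <= B / 2 ^ k" using B(2)[OF that(2)] by (intro divide_right_mono) auto
  also have "\<dots> < e / 2" using k e by (simp add: field_simps)
  finally have "dist y (y + (1 / 2 ^ k) *\<^sub>R v) < e / 2" by (simp add: dist_norm)
  hence "dist x (y + (1 / 2 ^ k) *\<^sub>R v) < e" using that(1) dist_triangle[of x "y + (1 / 2 ^ k) *\<^sub>R v" y] by simp
  thus ?thesis using e(2) by auto
 qed
 moreover have "ball x (e / 2) \<subseteq> W" using e by (auto simp: subset_iff)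
 ultimately show ?thesis using e(1) by (intro exI[of _ "e / 2"] conjI exI[of _ k] ballI) simp_all
qed

text \<open>A Sobolev embedding for \<open>m > d / 2\<close>. Near each point the dyadic polynomials
  converge uniformly, their steps being geometric. The constant \<open>c x\<close> varies with the
  point because the starting level depends on the room around it; this is enough for evaluation at
  \<open>x\<close> to be a bounded functional.\<close>

theorem continuous_representative:
 fixes W :: "'a::euclidean_space set" and m :: real
 assumes r: "1 <= r" and W: "open W" and m: "real DIM('a) / 2 < m"
 shows "\<exists>c :: 'a => real. \<forall>(f :: 'a => real) A M. borel_fun f --> sq_int f <= ennreal (A^2) -->
  0 <= A --> diff_bounded r m W M f --> 0 <= M -->
  (\<exists>g. continuous_on W g \<and> (AE x in lborel. x \<in> W --> g x = f x) \<and> (\<forall>x\<in>W. \<bar>g x\<bar> <= c x * (A + M)))"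
proof -
 let ?R = "real (2 * r) + 1" and ?d = "DIM('a)"
 define q where "q = 2 powr (real ?d / 2 - m)"
 have q: "0 < q" "q < 1" using m by (auto simp: q_def powr_less_one)
 have sq: "summable (\<lambda>k. q ^ k)" using q by (intro summable_geometric) simp
 have m0: "0 <= m" using m by (meson less_imp_le le_less_trans divide_nonneg_pos of_nat_0_le_iff zero_less_numeral)
 obtain K where K: "0 < K" "\<And>(f :: 'a => real) k y. borel_fun f ==> sq_int f < \<infinity> ==>
   ennreal ((dyadic_poly r f k y)^2) <= ennreal (K * (2 ^ k) ^ ?d) * sq_int f"
  and K2: "\<And>(f :: 'a => real) k. borel_fun f ==> sq_int f < \<infinity> ==>
   dyadic_poly r f k \<in> borel_measurable borel ==>
   sq_int (dyadic_poly r f k) <= ennreal K * sq_int f"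
  using dyadic_poly_square_le[OF r, where 'a = 'a] by (elim exE conjE) (rule that, assumption, blast, blast)
 have "\<forall>k0. \<exists>C>0. \<forall>(f :: 'a => real) M y k. borel_fun f --> sq_int f < \<infinity> -->
  diff_bounded r m W M f --> 0 <= M --> (\<forall>v\<in>block ?R. y + (1 / 2 ^ k0) *\<^sub>R v \<in> W) -->
  \<bar>dyadic_poly r f (Suc (k0 + k)) y - dyadic_poly r f (k0 + k) y\<bar> <= C * M * q ^ k"
  unfolding q_def by (rule allI) (rule dyadic_poly_chain[OF r W m0])
 then obtain C where C: "\<And>k0 (f :: 'a => real) M y k. borel_fun f ==> sq_int f < \<infinity> ==>
  diff_bounded r m W M f ==> 0 <= M ==> (\<forall>v\<in>block ?R. y + (1 / 2 ^ k0) *\<^sub>R v \<in> W) ==>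
  \<bar>dyadic_poly r f (Suc (k0 + k)) y - dyadic_poly r f (k0 + k) y\<bar> <= C k0 * M * q ^ k" and C0: "\<And>k0. 0 < C k0"
  by (drule_tac choice) (elim exE, rule that, blast, blast)
 have "\<forall>x. \<exists>p :: real \<times> nat. x \<in> W --> 0 < fst p \<and> ball x (fst p) \<subseteq> W \<and> (\<forall>y\<in>ball x (fst p). \<forall>v\<in>block ?R. y + (1 / 2 ^ snd p) *\<^sub>R v \<in> W)"
  using dyadic_neighbourhood[OF W, where R = ?R] by (metis fst_conv snd_conv)
 then obtain p :: "'a => real \<times> nat" where p: "\<And>x. x \<in> W ==> 0 < fst (p x)" "\<And>x. x \<in> W ==> ball x (fst (p x)) \<subseteq> W"
  "\<And>x y v. x \<in> W ==> y \<in> ball x (fst (p x)) ==> v \<in> block ?R ==> y + (1 / 2 ^ snd (p x)) *\<^sub>R v \<in> W"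
  by (drule_tac choice) (elim exE, rule that, blast, blast, blast)
 define c where "c x = max (sqrt (K * (2 ^ snd (p x)) ^ ?d)) (C (snd (p x)) * (\<Sum>k. q ^ k))" for x
 show ?thesis
 proof (rule exI[of _ c], intro allI impI)
  fix f :: "'a => real" and A M :: real
  assume f [measurable]: "borel_fun f" and fA: "sq_int f <= ennreal (A^2)"
   and A: "0 <= A" and M: "diff_bounded r m W M f" "0 <= M"
  have fin: "sq_int f < \<infinity>" using fA by (rule le_less_trans) simp
  let ?T = "dyadic_poly r f"
  define D where "D x n y = ?T (Suc (snd (p x) + n)) y - ?T (snd (p x) + n) y" for x n y
  define G where "G x y = ?T (snd (p x)) y + (\<Sum>n. D x n y)" for x y
  have D: "norm (D x n y) <= C (snd (p x)) * M * q ^ n" if "x \<in> W" "y \<in> ball x (fst (p x))" for x n y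
   using p(3)[OF that] by (simp add: D_def C[OF f fin M])
  have sM: "summable (\<lambda>n. C (snd (p x)) * M * q ^ n)" for x by (intro summable_mult sq)
  have tel: "(\<Sum>i<n. D x i y) = ?T (snd (p x) + n) y - ?T (snd (p x)) y" for x n y
   using sum_lessThan_telescope[of "\<lambda>n. ?T (snd (p x) + n) y" n] by (simp add: D_def)
  have ul: "uniform_limit (ball x (fst (p x))) (\<lambda>n. ?T (snd (p x) + n)) (G x) sequentially" if x: "x \<in> W" for x
  proof -
   have "uniform_limit (ball x (fst (p x))) (\<lambda>n y. \<Sum>i<n. D x i y) (\<lambda>y. \<Sum>n. D x n y) sequentially"
    by (rule Weierstrass_m_test[OF D[OF x] sM])
   from uniform_limit_add[OF uniform_limit_const[where c = "?T (snd (p x))"] this]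
   show ?thesis by (simp add: tel G_def[abs_def])
  qed
  have contT: "continuous_on B (?T k)" for k B using continuous_dyadic_poly[OF r f fin] continuous_on_subset by blast
  define g where "g y = lim (\<lambda>k. ?T k y)" for y
  have lim: "(\<lambda>k. ?T k y) \<longlonglongrightarrow> G x y" if x: "x \<in> W" and y: "y \<in> ball x (fst (p x))" for x y
  proof (rule LIMSEQ_offset)
   show "(\<lambda>n. ?T (n + snd (p x)) y) \<longlonglongrightarrow> G x y" using tendsto_uniform_limitI[OF ul[OF x] y] by (simp add: add.commute)
  qed
  have g_eq: "g y = G x y" if "x \<in> W" "y \<in> ball x (fst (p x))" for x y unfolding g_def using lim[OF that] by (rule limI)
  have g_lim: "(\<lambda>k. ?T k x) \<longlonglongrightarrow> g x" if "x \<in> W" for x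
   using lim[OF that, of x] g_eq[OF that, of x] p(1)[OF that] by simp
  have cont: "continuous_on W g"
  proof (intro continuous_at_imp_continuous_on ballI)
   fix x assume x: "x \<in> W"
   have "continuous_on (ball x (fst (p x))) (G x)" by (rule uniform_limit_theorem[OF _ ul[OF x]]) (auto intro!: always_eventually contT)
   hence "continuous_on (ball x (fst (p x))) g" by (rule continuous_on_eq) (simp only: g_eq[OF x])
   thus "isCont g x" using p(1)[OF x] continuous_on_eq_continuous_at[OF open_ball] centre_in_ball by blast
  qed
  have Wb [measurable]: "W \<in> sets borel" using W by simp
  have gb [measurable]: "borel_fun (\<lambda>x. indicator W x * g x)" using borel_measurable_continuous_on_indicator[OF Wb cont] by simp
  have Tb: "dyadic_poly r h k \<in> borel_measurable borel"
   if "borel_fun h" "sq_int h < \<infinity>" for h :: "'a => real" and k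
   by (rule borel_measurable_continuous_onI[OF continuous_dyadic_poly[OF r that]])
  \<comment> \<open>The polynomials of \<open>\<phi>\<close> converge to \<open>\<phi>\<close>, so
    Fatou's lemma carries the \<open>L\<^sub>2\<close> bound, uniform in the level, from the
    polynomials of \<open>f - \<phi>\<close> over to \<open>g - \<phi>\<close>.\<close>
  have near: "sq_int (\<lambda>x. indicator W x * g x - indicator W x * \<phi> x) <= ennreal K * sq_int (\<lambda>x. f x - \<phi> x)"
   if \<phi>: "\<phi> \<in> test_functions UNIV" and df: "sq_int (\<lambda>x. f x - \<phi> x) < \<infinity>" for \<phi>
  proof -
   have \<phi>b [measurable]: "borel_fun \<phi>" by (rule test_functions_borel[OF \<phi>])
   note \<phi>f = test_functions_nn_integral_finite[OF \<phi>]
   have [measurable]: "?T k \<in> borel_measurable borel" "dyadic_poly r \<phi> k \<in> borel_measurable borel" for k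
    using Tb f fin \<phi>b \<phi>f by blast+
   let ?u = "\<lambda>k x. ennreal ((indicator W x * (?T k x - dyadic_poly r \<phi> k x))^2)"
   have "sq_int (\<lambda>x. indicator W x * g x - indicator W x * \<phi> x) = (\<integral>\<^sup>+x. liminf (\<lambda>k. ?u k x) \<partial>lborel)"
   proof (rule nn_integral_cong)
    fix x
    have "(\<lambda>k. ?u k x) \<longlonglongrightarrow> ennreal ((indicator W x * (g x - \<phi> x))^2)"
    proof (cases "x \<in> W")
     case True
     show ?thesis
      by (intro tendsto_ennrealI tendsto_power tendsto_mult tendsto_const tendsto_diff g_lim[OF True] dyadic_poly_test(2)[OF \<phi> r])
    qed simp
    hence "liminf (\<lambda>k. ?u k x) = ennreal ((indicator W x * (g x - \<phi> x))^2)" by (intro lim_imp_Liminf) auto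
    thus "ennreal ((indicator W x * g x - indicator W x * \<phi> x)^2) = liminf (\<lambda>k. ?u k x)" by (simp add: right_diff_distrib)
   qed
   also have "\<dots> <= liminf (\<lambda>k. \<integral>\<^sup>+x. ?u k x \<partial>lborel)" by (rule nn_integral_liminf) measurable
   also have "\<dots> <= ennreal K * sq_int (\<lambda>x. f x - \<phi> x)"
   proof (rule Liminf_le[OF sequentially_bot always_eventually], rule allI)
    fix k
    have "(\<integral>\<^sup>+x. ?u k x \<partial>lborel) <= sq_int (\<lambda>x. dyadic_poly r (\<lambda>x. f x - \<phi> x) k x)"
    proof (rule nn_integral_mono)
     fix x
     show "?u k x <= ennreal ((dyadic_poly r (\<lambda>x. f x - \<phi> x) k x)^2)"
      unfolding dyadic_poly_diff[OF f fin \<phi>b \<phi>f] by (cases "x \<in> W") auto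
    qed
    also have "\<dots> <= ennreal K * sq_int (\<lambda>x. f x - \<phi> x)" using df by (intro K2 Tb) auto
    finally show "(\<integral>\<^sup>+x. ?u k x \<partial>lborel) <= ennreal K * sq_int (\<lambda>x. f x - \<phi> x)" .
   qed
   finally show ?thesis .
  qed
  \<comment> \<open>On \<open>W\<close> both \<open>g\<close> and \<open>f\<close> are close to one
    test function, which may be chosen as near to \<open>f\<close> as desired.\<close>
  have "sq_int (\<lambda>x. indicator W x * g x - indicator W x * f x) <= 0"
  proof (rule ennreal_le_epsilon)
   fix e :: real assume e: "0 < e"
   define e' where "e' = e / (2 * K + 2)"
   have e': "0 < e'" using e K(1) by (simp add: e'_def add_pos_pos)
   have "l2_approx UNIV f" by (rule l2_dense) (use fin in auto)
   then obtain \<phi> where \<phi>: "\<phi> \<in> test_functions UNIV" "sq_int (\<lambda>x. f x - \<phi> x) < ennreal e'"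
    using e' unfolding l2_approx_def by blast
   have \<phi>b [measurable]: "borel_fun \<phi>" by (rule test_functions_borel[OF \<phi>(1)])
   have "sq_int (\<lambda>x. indicator W x * g x - indicator W x * f x) =
     sq_int (\<lambda>x. (indicator W x * g x - indicator W x * \<phi> x) + (indicator W x * \<phi> x - indicator W x * f x))" by simp
   also have "\<dots> <= 2 * sq_int (\<lambda>x. indicator W x * g x - indicator W x * \<phi> x) +
     2 * sq_int (\<lambda>x. indicator W x * \<phi> x - indicator W x * f x)" by (rule nn_integral_square_add_le) measurable
   also have "\<dots> <= 2 * (ennreal K * ennreal e') + 2 * ennreal e'"
   proof (intro add_mono mult_left_mono)
    show "sq_int (\<lambda>x. indicator W x * g x - indicator W x * \<phi> x) <= ennreal K * ennreal e'"
     using \<phi>(2) by (intro order_trans[OF near[OF \<phi>(1)]] mult_left_mono) (auto intro: less_trans)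
    have "sq_int (\<lambda>x. indicator W x * \<phi> x - indicator W x * f x) <= sq_int (\<lambda>x. f x - \<phi> x)"
     by (intro nn_integral_mono) (auto simp: indicator_def power2_commute)
    also have "\<dots> <= ennreal e'" using \<phi>(2) by simp
    finally show "sq_int (\<lambda>x. indicator W x * \<phi> x - indicator W x * f x) <= ennreal e'" .
   qed auto
   also have "\<dots> = ennreal (2 * (K * e') + 2 * e')" using K(1) e' by (simp add: ennreal_plus ennreal_mult)
   also have "2 * (K * e') + 2 * e' = (2 * K + 2) * e'" by (simp add: algebra_simps)
   also have "(2 * K + 2) * e' = e" using K(1) by (simp add: e'_def)
   finally show "sq_int (\<lambda>x. indicator W x * g x - indicator W x * f x) <= 0 + ennreal e" by simp
  qed
  hence "AE x in lborel. ennreal ((indicator W x * g x - indicator W x * f x)^2) = 0"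
   by (subst (asm) le_zero_eq, subst (asm) nn_integral_0_iff_AE) measurable
  hence ae: "AE x in lborel. x \<in> W --> g x = f x" by eventually_elim (auto simp: indicator_def)
  have "\<bar>g x\<bar> <= c x * (A + M)" if x: "x \<in> W" for x
  proof -
   let ?k = "snd (p x)"
   have xb: "x \<in> ball x (fst (p x))" using p(1)[OF x] by simp
   have "ennreal ((?T ?k x)^2) <= ennreal (K * (2 ^ ?k) ^ ?d) * ennreal (A^2)" by (rule order_trans[OF K(2)[OF f fin] mult_left_mono[OF fA]]) simp
   also have "\<dots> = ennreal ((sqrt (K * (2 ^ ?k) ^ ?d) * A)^2)" using K(1) by (simp add: ennreal_mult[symmetric] power_mult_distrib)
   finally have "(?T ?k x)^2 <= (sqrt (K * (2 ^ ?k) ^ ?d) * A)^2" by simp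
   hence "\<bar>?T ?k x\<bar> <= \<bar>sqrt (K * (2 ^ ?k) ^ ?d) * A\<bar>" by (simp only: abs_le_square_iff)
   hence "\<bar>?T ?k x\<bar> <= sqrt (K * (2 ^ ?k) ^ ?d) * A" using K(1) A by (simp add: abs_mult)
   also have "\<dots> <= c x * A" unfolding c_def using A by (intro mult_right_mono) auto
   finally have 1: "\<bar>?T ?k x\<bar> <= c x * A" .
   have "norm (\<Sum>n. D x n x) <= (\<Sum>n. C ?k * M * q ^ n)" by (rule norm_suminf_le[OF D[OF x xb] sM])
   also have "\<dots> = C ?k * M * (\<Sum>n. q ^ n)" by (rule suminf_mult[OF sq])
   also have "\<dots> = C ?k * (\<Sum>n. q ^ n) * M" by simp
   also have "\<dots> <= c x * M" unfolding c_def using M(2) by (intro mult_right_mono) auto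
   finally have 2: "\<bar>\<Sum>n. D x n x\<bar> <= c x * M" by simp
   have "\<bar>g x\<bar> <= \<bar>?T ?k x\<bar> + \<bar>\<Sum>n. D x n x\<bar>" unfolding g_eq[OF x xb] G_def by (rule abs_triangle_ineq)
   with 1 2 show ?thesis by (simp add: distrib_left)
  qed
  with cont ae show "\<exists>g. continuous_on W g \<and> (AE x in lborel. x \<in> W --> g x = f x) \<and> (\<forall>x\<in>W. \<bar>g x\<bar> <= c x * (A + M))"
   by blast
 qed
qed

text \<open>The set where the functions differ is open, and a nonempty open set is not negligible.
  It makes the continuous representative, hence \<open>point_eval\<close>, unique.\<close>

lemma continuous_AE_eq:
 fixes g h :: "'a::euclidean_space => real"
 assumes W: "open W" and g: "continuous_on W g" and h: "continuous_on W h"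
  and ae: "AE x in lebesgue. x \<in> W --> g x = h x" and x: "x \<in> W"
 shows "g x = h x"
proof (rule ccontr)
 assume ne: "g x \<noteq> h x"
 let ?S = "{x \<in> W. g x - h x \<in> - {0}}"
 have "open (W \<inter> (\<lambda>x. g x - h x) -` (- {0}))"
  by (rule continuous_open_preimage[OF continuous_on_diff[OF g h] W]) (simp add: open_Compl)
 hence "open ?S" by (simp add: Int_def vimage_def)
 moreover have "?S \<noteq> {}" using x ne by auto
 moreover have "negligible ?S"
 proof -
  obtain N where N: "{x \<in> space lebesgue. \<not> (x \<in> W --> g x = h x)} \<subseteq> N" "emeasure lebesgue N = 0" "N \<in> sets lebesgue"
   using ae by (rule AE_E)
  hence "negligible N" by (simp add: negligible_iff_null_sets null_setsI)
  thus ?thesis by (rule negligible_subset) (use N(1) in auto)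
 qed
 ultimately show False using open_not_negligible by blast
qed

lemma point_eval_eqI:
 fixes W :: "'a::euclidean_space set"
 assumes W: "open W" and g: "continuous_on W g" "AE z in lebesgue. z \<in> W --> g z = rep_L2 u z" and x: "x \<in> W"
 shows "point_eval W u x = g x" unfolding point_eval_def
proof (rule the_equality)
 show "\<exists>h. continuous_on W h \<and> (AE z in lebesgue. z \<in> W --> h z = rep_L2 u z) \<and> g x = h x" using g by blast
next
 fix y assume "\<exists>h. continuous_on W h \<and> (AE z in lebesgue. z \<in> W --> h z = rep_L2 u z) \<and> y = h x"
 then obtain h where h: "continuous_on W h" "AE z in lebesgue. z \<in> W --> h z = rep_L2 u z" "y = h x" by blast
 have "AE z in lebesgue. z \<in> W --> h z = g z" using h(2) g(2) by eventually_elim simp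
 from continuous_AE_eq[OF W h(1) g(1) this x] h(3) show "y = g x" by simp
qed

abbreviation good_representative :: "real => 'a::euclidean_space set => ('a => real) => 'a L2 => bool" where
 "good_representative s W c u \<equiv>
  continuous_on W (point_eval W u) \<and> (AE x in lebesgue. x \<in> W --> point_eval W u x =
  rep_L2 u x) \<and> (\<forall>x\<in>W. \<bar>point_eval W u x\<bar> <= c x * H_norm s W u)"

lemma point_eval_H:
 fixes W :: "'a::euclidean_space set"
 assumes W: "open W" and m: "real DIM('a) / 2 < m"
 shows "\<exists>c. \<forall>u\<in>H_space m W. good_representative m W c u"
proof -
 have m0: "0 < m" using m by (meson le_less_trans divide_nonneg_pos of_nat_0_le_iff zero_less_numeral)
 obtain C where C: "0 < C" "\<And>u f. u \<in> H_space m W ==> L2_rep u f ==> diff_bounded (diff_order m) m W (C * H_norm m W u) f"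
  using diff_bounded_H[OF W m0] by blast
 obtain c :: "'a => real" where c: "\<forall>(f :: 'a => real) A M. borel_fun f --> sq_int f <= ennreal (A^2) -->
  0 <= A --> diff_bounded (diff_order m) m W M f --> 0 <= M -->
  (\<exists>g. continuous_on W g \<and> (AE x in lborel. x \<in> W --> g x = f x) \<and> (\<forall>x\<in>W. \<bar>g x\<bar> <= c x * (A + M)))"
  using continuous_representative[OF diff_order_pos[OF m0] W m] by (elim exE) (rule that)
 show ?thesis
 proof (rule exI[of _ "\<lambda>x. \<bar>c x\<bar> * (1 + C)"], intro ballI)
  fix u assume u: "u \<in> H_space m W"
  obtain f where f: "L2_rep u f" using L2_rep_ex by blast
  have H: "0 <= H_norm m W u" by (rule H_norm_nonneg)
  obtain g where g: "continuous_on W g" "AE x in lborel. x \<in> W --> g x = f x"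
   "\<And>x. x \<in> W ==> \<bar>g x\<bar> <= c x * (norm u + C * H_norm m W u)"
  proof -
   have "sq_int f <= ennreal ((norm u)^2)" by (simp add: L2_rep_norm[OF f])
   moreover have "0 <= C * H_norm m W u" using C(1) H by simp
   ultimately show thesis using c[rule_format, OF L2_rep_borel[OF f] _ norm_ge_zero C(2)[OF u f]] that by blast
  qed
  have gr: "AE x in lebesgue. x \<in> W --> g x = rep_L2 u x" using g(2) f unfolding AE_lebesgue_iff L2_rep_def by (auto elim: eventually_elim2)
  have eq: "point_eval W u x = g x" if "x \<in> W" for x by (rule point_eval_eqI[OF W g(1) gr that])
  have "\<bar>point_eval W u x\<bar> <= \<bar>c x\<bar> * (1 + C) * H_norm m W u" if x: "x \<in> W" for x
  proof -
   have "\<bar>point_eval W u x\<bar> <= c x * (norm u + C * H_norm m W u)" using g(3)[OF x] eq[OF x] by simp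
   also have "\<dots> <= \<bar>c x\<bar> * (H_norm m W u + C * H_norm m W u)" using C(1) H norm_le_H_norm[OF W u] by (intro mult_mono) auto
   finally show ?thesis by (simp add: algebra_simps)
  qed
  moreover have "continuous_on W (point_eval W u)" using g(1) by (rule continuous_on_eq) (simp add: eq)
  moreover have "AE x in lebesgue. x \<in> W --> point_eval W u x = rep_L2 u x" using gr by eventually_elim (simp add: eq)
  ultimately show "continuous_on W (point_eval W u) \<and> (AE x in lebesgue. x \<in> W --> point_eval W u x = rep_L2 u x) \<and>
   (\<forall>x\<in>W. \<bar>point_eval W u x\<bar> <= \<bar>c x\<bar> * (1 + C) * H_norm m W u)" by blast
 qed
qed

lemma
 fixes W :: "'a::euclidean_space set"
 assumes W: "open W" and m: "real DIM('a) / 2 < m" and u: "u \<in> H_space m W" and x: "x \<in> W"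
 shows point_eval_scaleR: "point_eval W (a *\<^sub>R u) x = a * point_eval W u x"
  and point_eval_add: "v \<in> H_space m W ==> point_eval W (u + v) x = point_eval W u x + point_eval W v x"
proof -
 obtain c where c: "\<forall>u\<in>H_space m W. good_representative m W c u" using point_eval_H[OF W m] by blast
 have pe: "continuous_on W (point_eval W v)" "AE x in lborel. x \<in> W --> point_eval W v x = rep_L2 v x" if "v \<in> H_space m W" for v
  using c that unfolding AE_lebesgue_iff by auto
 show "point_eval W (a *\<^sub>R u) x = a * point_eval W u x"
 proof (rule point_eval_eqI[OF W _ _ x])
  show "continuous_on W (\<lambda>x. a * point_eval W u x)" by (intro continuous_intros pe u)
  show "AE x in lebesgue. x \<in> W --> a * point_eval W u x = rep_L2 (a *\<^sub>R u) x"
   unfolding AE_lebesgue_iff using pe(2)[OF u] rep_L2_scaleR[of a u] by eventually_elim simp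
 qed
 assume v: "v \<in> H_space m W"
 show "point_eval W (u + v) x = point_eval W u x + point_eval W v x"
 proof (rule point_eval_eqI[OF W _ _ x])
  show "continuous_on W (\<lambda>x. point_eval W u x + point_eval W v x)" by (intro continuous_intros pe u v)
  show "AE x in lebesgue. x \<in> W --> point_eval W u x + point_eval W v x = rep_L2 (u + v) x"
   unfolding AE_lebesgue_iff using pe(2)[OF u] pe(2)[OF v] rep_L2_add[of u v] by eventually_elim simp
 qed
qed

lemma point_eval_test:
 fixes W :: "'a::euclidean_space set"
 assumes W: "open W" and \<phi>: "\<phi> \<in> test_functions U" and x: "x \<in> W"
 shows "point_eval W (abs_L2 \<phi>) x = \<phi> x"
proof (rule point_eval_eqI[OF W _ _ x])
 show "continuous_on W \<phi>" by (rule smooth_imp_continuous[OF test_functions_smooth[OF \<phi>]])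
 show "AE x in lebesgue. x \<in> W --> \<phi> x = rep_L2 (abs_L2 \<phi>) x"
  using L2_rep_test[OF \<phi>] unfolding AE_lebesgue_iff L2_rep_def by (auto elim: eventually_mono)
qed

lemma diff_bounded_mono:
 assumes "diff_bounded r m W M f" "0 <= M" "M <= M'"
 shows "diff_bounded r m W M' f"
proof -
 have "ennreal ((M * norm w powr m)^2) <= ennreal ((M' * norm w powr m)^2)" for w :: 'a
  using assms by (intro ennreal_leI power_mono mult_right_mono) auto
 thus ?thesis using assms(1) unfolding diff_bounded_def by (meson order_trans)
qed

theorem sampling_inequality_H:
 fixes W :: "'a::euclidean_space set"
 assumes L: "bounded_Lipschitz_domain W" and m: "real DIM('a) / 2 < m"
 shows "\<exists>C>0. \<forall>n\<ge>1. \<exists>x :: nat => 'a. (\<forall>i<n. x i \<in> W) \<and> (\<forall>u\<in>H_space m W.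
  (\<forall>i<n. point_eval W u (x i) = 0) --> norm u <= C * real n powr (- m / real DIM('a)) * H_norm m W u)"
proof -
 have W: "open W" using L by (simp add: bounded_Lipschitz_domain_def)
 have Wb [measurable]: "W \<in> sets borel" using W by simp
 have m0: "0 < m" using m by (meson le_less_trans divide_nonneg_pos of_nat_0_le_iff zero_less_numeral)
 obtain C1 where C1: "0 < C1" "\<And>u f. u \<in> H_space m W ==> L2_rep u f ==> diff_bounded (diff_order m) m W (C1 * H_norm m W u) f"
  using diff_bounded_H[OF W m0] by blast
 obtain c where c: "\<forall>u\<in>H_space m W. good_representative m W c u" using point_eval_H[OF W m] by blast
 obtain C where C: "0 < C" "\<forall>n\<ge>1. \<exists>x :: nat => 'a. good_samples (diff_order m) m W C n x"
  using sampling_inequality[OF L diff_order_pos[OF m0] m] by (elim exE conjE) (rule that)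
 show ?thesis
 proof (intro exI[of _ "sqrt C * (C1 + 1)"] conjI allI impI)
  fix n :: nat assume "1 <= n"
  with C(2) have "\<exists>x :: nat => 'a. good_samples (diff_order m) m W C n x" by (simp only:)
  then obtain x :: "nat => 'a" where x: "\<And>i. i < n ==> x i \<in> W" and sam: "\<And>g M. borel_fun g ==>
   continuous_on W g ==> diff_bounded (diff_order m) m W M g ==> (\<And>i. i < n ==> g (x i) = 0) ==>
   (\<integral>\<^sup>+y. indicator W y * ennreal ((g y)^2) \<partial>lborel) <= ennreal (M^2) ==>
   (\<integral>\<^sup>+y. indicator W y * ennreal ((g y)^2) \<partial>lborel) <= ennreal (C * M^2 * (real n powr (- m / real DIM('a)))^2)"
   by (elim exE conjE) (rule that, blast, blast)
  show "\<exists>x :: nat => 'a. (\<forall>i<n. x i \<in> W) \<and> (\<forall>u\<in>H_space m W. (\<forall>i<n. point_eval W u (x i) = 0) -->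
   norm u <= sqrt C * (C1 + 1) * real n powr (- m / real DIM('a)) * H_norm m W u)"
  proof (rule exI[of _ x], intro conjI ballI allI impI x)
   fix u assume u: "u \<in> H_space m W" and z: "\<forall>i<n. point_eval W u (x i) = 0"
   let ?H = "H_norm m W u" and ?g = "\<lambda>x. indicator W x * point_eval W u x"
   let ?M = "(C1 + 1) * ?H" and ?p = "real n powr (- m / real DIM('a))"
   have H: "0 <= ?H" by (rule H_norm_nonneg)
   have pc: "continuous_on W (point_eval W u)" and pr: "AE x in lborel. x \<in> W --> point_eval W u x = rep_L2 u x"
    using c u unfolding AE_lebesgue_iff by auto
   have gb: "borel_fun ?g" using borel_measurable_continuous_on_indicator[OF Wb pc] by simp
   have "AE x in lborel. x \<notin> W --> rep_L2 u x = 0" using u H_space_subset_L2_on by (auto simp: L2_on_def AE_lebesgue_iff)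
   hence "AE x in lborel. rep_L2 u x = ?g x" using pr by eventually_elim (auto simp: indicator_def)
   hence rep: "L2_rep u ?g" using gb by (simp add: L2_rep_def)
   have eq: "(\<integral>\<^sup>+y. indicator W y * ennreal ((?g y)^2) \<partial>lborel) = ennreal ((norm u)^2)"
    unfolding L2_rep_norm[OF rep, symmetric] by (intro nn_integral_cong) (auto simp: indicator_def)
   \<comment> \<open>The summand 1 in \<open>C1 + 1\<close> provides the a priori bound demanded by
     \<open>good_samples\<close>.\<close>
   have "norm u <= ?M" using norm_le_H_norm[OF W u] H C1(1) by (simp add: distrib_right add_increasing)
   hence "(norm u)^2 <= ?M^2" by (intro power_mono) auto
   moreover have "diff_bounded (diff_order m) m W ?M ?g"
    by (rule diff_bounded_mono[OF C1(2)[OF u rep]]) (use C1(1) H in \<open>auto simp: distrib_right\<close>)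
   moreover have "continuous_on W ?g" using pc by (rule continuous_on_eq) simp
   moreover have "?g (x i) = 0" if "i < n" for i using z that by simp
   ultimately have "ennreal ((norm u)^2) <= ennreal (C * ?M^2 * ?p^2)" using sam[OF gb, of ?M] unfolding eq by (simp add: ennreal_leI)
   hence "(norm u)^2 <= C * ?M^2 * ?p^2" using C(1) by (subst (asm) ennreal_le_iff) auto
   also have "\<dots> = (sqrt C * ?M * ?p)^2" using C(1) by (simp add: power_mult_distrib)
   finally have "norm u <= sqrt C * ?M * ?p" by (rule power2_le_imp_le) (intro mult_nonneg_nonneg, use C(1) C1(1) H in auto)
   thus "norm u <= sqrt C * (C1 + 1) * ?p * ?H" by (simp add: mult_ac)
  qed
 qed (use C(1) C1(1) in simp)
qed

subsection \<open>Fooling functions\<close>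

lemma unit_bump_ex:
 "\<exists>B :: 'a::euclidean_space => real. B \<in> test_functions (box 0 One) \<and> (\<forall>x. 0 <= B x) \<and> 0 < (LINT x|lborel. B x)"
proof -
 define B :: "'a => real" where "B = box_bump ((1 / 4) *\<^sub>R One) ((3 / 4) *\<^sub>R One)"
 have B: "B \<in> test_functions (box 0 One)"
 proof (rule test_functionsI)
  show "smooth B" unfolding B_def by (rule smooth_box_bump)
  show "x \<in> cbox ((1 / 4) *\<^sub>R One) ((3 / 4) *\<^sub>R One)" if "B x \<noteq> 0" for x
   using that box_bump_eq_0[of x "(1 / 4) *\<^sub>R One" "(3 / 4) *\<^sub>R One"] box_subset_cbox unfolding B_def by blast
  show "cbox ((1 / 4) *\<^sub>R One) ((3 / 4) *\<^sub>R One) \<subseteq> (box 0 One :: 'a set)" by (force simp: mem_box inner_sum_left_Basis)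
 qed simp
 have nn: "0 <= B x" for x by (simp add: B_def box_bump_nonneg)
 have int: "integrable lborel B" by (rule integrable_test[OF B])
 have "(LINT x|lborel. B x) \<noteq> 0"
 proof
  assume "(LINT x|lborel. B x) = 0"
  hence "AE x in lborel. B x = 0" using integral_nonneg_eq_0_iff_AE[OF int] nn by simp
  hence "AE x in lebesgue. x \<in> UNIV --> B x = 0" by (simp add: AE_lebesgue_iff)
  from continuous_AE_eq[OF open_UNIV _ continuous_on_const this, of "(1 / 2) *\<^sub>R One"]
  have "B ((1 / 2) *\<^sub>R One) = 0" using smooth_imp_continuous[OF test_functions_smooth[OF B]] by simp
  moreover have "(1 / 2) *\<^sub>R One \<in> box ((1 / 4) *\<^sub>R One) ((3 / 4) *\<^sub>R (One :: 'a))"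
   by (simp add: mem_box inner_sum_left_Basis)
  ultimately show False using box_bump_pos_iff unfolding B_def by (metis less_irrefl)
 qed
 moreover have "0 <= (LINT x|lborel. B x)" using nn by simp
 ultimately have "0 < (LINT x|lborel. B x)" by linarith
 thus ?thesis using B nn by blast
qed

lemma L2_rep_sum: "finite I ==> (\<And>i. i \<in> I ==> L2_rep (u i) (f i)) ==> L2_rep (\<Sum>i\<in>I. u i) (\<lambda>x. \<Sum>i\<in>I. f i x)"
 by (induction I rule: finite_induct) (auto intro: L2_rep_zero L2_rep_add)

lemma abs_L2_test_sum:
 assumes "finite I" "\<And>i. i \<in> I ==> f i \<in> test_functions U"
 shows "abs_L2 (\<lambda>x. \<Sum>i\<in>I. f i x) = (\<Sum>i\<in>I. abs_L2 (f i))"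
 by (rule L2_rep_eqI[OF L2_rep_test[OF test_functions_sum[OF assms(2)]] L2_rep_sum[OF assms(1) L2_rep_test[OF assms(2)]]]) auto

lemma norm_sum_disjoint_tests:
 fixes f :: "'i => 'a::euclidean_space => real"
 assumes I: "finite I" and f: "\<And>i. i \<in> I ==> f i \<in> test_functions U"
  and disj: "\<And>i j x. i \<in> I ==> j \<in> I ==> f i x \<noteq> 0 ==> f j x \<noteq> 0 ==> i = j"
 shows "(norm (abs_L2 (\<lambda>x. \<Sum>i\<in>I. f i x)))^2 = (\<Sum>i\<in>I. (norm (abs_L2 (f i)))^2)"
proof -
 have "inner (abs_L2 (f i)) (abs_L2 (f j)) = 0" if "i \<in> I" "j \<in> I" "i \<noteq> j" for i j
 proof -
  have "(\<lambda>x. f i x * f j x) = (\<lambda>x. 0)" using disj[of i j] that by (fastforce simp: fun_eq_iff)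
  thus ?thesis using L2_rep_inner[OF L2_rep_test[OF f[OF that(1)]] L2_rep_test[OF f[OF that(2)]]] by (simp only:) simp
 qed
 hence "pairwise (\<lambda>i j. orthogonal (abs_L2 (f i)) (abs_L2 (f j))) I" by (auto simp: pairwise_def orthogonal_def)
 moreover have "abs_L2 (\<lambda>x. \<Sum>i\<in>I. f i x) = (\<Sum>i\<in>I. abs_L2 (f i))" by (rule abs_L2_test_sum[OF I]) (rule f)
 ultimately show ?thesis using norm_sum_Pythagorean[OF I] by simp
qed

text \<open>A fixed cube in \<open>W\<close> is divided into at least \<open>2 n\<close> small ones;
  \<open>n\<close> points meet at most \<open>n\<close> of them, and bumps on the others are added.
  The sum is nonnegative and \<open>G\<close> is bounded below on the cube, so the pairing stays
  above a constant. Disjoint supports and scaling control the derivatives.\<close>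

theorem fooling_functions:
 fixes W :: "'a::euclidean_space set"
 assumes W: "open W" "W \<noteq> {}" and \<sigma>: "0 < \<sigma>"
 shows "\<exists>G\<in>test_functions W. \<exists>c>0. \<exists>C>0. \<forall>n\<ge>1. \<forall>x :: nat => 'a. \<exists>\<phi>\<in>test_functions W.
  (\<forall>i<n. \<phi> (x i) = 0) \<and> H_norm \<sigma> W (abs_L2 \<phi>) <= C * real n powr (\<sigma> / real DIM('a)) \<and> c <= inner (abs_L2 \<phi>) (abs_L2 G)"
proof -
 let ?d = "DIM('a)"
 obtain p e where p: "p \<in> W" "0 < e" "ball p e \<subseteq> W" using W by (metis open_contains_ball ex_in_conv)
 \<comment> \<open>Small enough for the enlarged cube, whose points differ from \<open>p\<close> by
   at most \<open>2 * \<rho>\<close> in each coordinate, to lie within distance \<open>e / 2\<close>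
   of \<open>p\<close>.\<close>
 define \<rho> where "\<rho> = e / (4 * real ?d)"
 have \<rho>: "0 < \<rho>" using p by (simp add: \<rho>_def)
 have sub: "cbox (p - \<rho> *\<^sub>R One) (p + (2 * \<rho>) *\<^sub>R One) \<subseteq> W"
 proof
  fix y assume "y \<in> cbox (p - \<rho> *\<^sub>R One) (p + (2 * \<rho>) *\<^sub>R One)"
  hence "\<bar>(y - p) \<bullet> b\<bar> <= 2 * \<rho>" if "b \<in> Basis" for b
   using that \<rho> by (fastforce simp: mem_box inner_diff_left inner_add_left inner_sum_left_Basis abs_le_iff)
  hence "norm (y - p) <= (\<Sum>b\<in>(Basis :: 'a set). 2 * \<rho>)" by (intro order_trans[OF norm_le_l1] sum_mono)
  also have "\<dots> < e" using p(2) by (simp add: \<rho>_def)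
  finally show "y \<in> W" using p(3) by (auto simp: dist_norm norm_minus_commute)
 qed
 define G where "G = box_bump (p - \<rho> *\<^sub>R One) (p + (2 * \<rho>) *\<^sub>R One)"
 have G: "G \<in> test_functions W"
 proof (rule test_functionsI[OF _ _ compact_cbox sub])
  show "smooth G" unfolding G_def by (rule smooth_box_bump)
  show "x \<in> cbox (p - \<rho> *\<^sub>R One) (p + (2 * \<rho>) *\<^sub>R One)" if "G x \<noteq> 0" for x
   using that box_bump_eq_0 box_subset_cbox unfolding G_def by blast
 qed
 let ?Q = "cbox p (p + \<rho> *\<^sub>R One)"
 have Qsub: "?Q \<subseteq> box (p - \<rho> *\<^sub>R One) (p + (2 * \<rho>) *\<^sub>R One)"
  using \<rho> by (fastforce simp: mem_box inner_diff_left inner_add_left inner_sum_left_Basis)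
 have QO: "?Q \<subseteq> W" using Qsub sub box_subset_cbox by blast
 have "p \<in> ?Q" using \<rho> by (simp add: mem_box inner_add_left inner_sum_left_Basis)
 then obtain z where z: "z \<in> ?Q" "\<And>y. y \<in> ?Q ==> G z <= G y"
  using continuous_attains_inf[OF compact_cbox _ smooth_imp_continuous[OF test_functions_smooth[OF G]], of p "p + \<rho> *\<^sub>R One"] by auto
 define c0 where "c0 = G z"
 have c0: "0 < c0" using z(1) Qsub unfolding c0_def G_def by (subst box_bump_pos_iff) blast
 obtain B :: "'a => real" where B: "B \<in> test_functions (box 0 One)" "\<And>x. 0 <= B x" "0 < (LINT x|lborel. B x)" using unit_bump_ex by blast
 have Bs: "smooth B" by (rule test_functions_smooth[OF B(1)])
 define \<beta> where "\<beta> = (LINT x|lborel. B x)"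
 let ?r = "diff_order \<sigma>"
 let ?L = "{bs :: 'a list. set bs \<subseteq> Basis \<and> length bs <= ?r}"
 define A where "A = (\<Sum>bs\<in>?L. \<rho> ^ ?d * ((1 / \<rho>) ^ length bs)^2 * (norm (abs_L2 (partial_derivs (rev bs) B)))^2)"
 have A0: "0 <= A" unfolding A_def using \<rho> by (intro sum_nonneg) auto
 obtain C where C: "0 < C" "\<And>u K N. u \<in> Sobolev ?r W ==> 0 <= K ==> 1 <= N ==> norm u <= K ==>
  Sobolev_norm ?r W u <= K * N ^ ?r ==> H_norm \<sigma> W u <= C * (K * N powr \<sigma>)" using H_norm_le[OF W(1) \<sigma>] by blast
 have c_pos: "0 < c0 * \<rho> ^ ?d * \<beta> / 2" using c0 \<rho> B(3) by (simp add: \<beta>_def)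
 have C_pos: "0 < C * (sqrt A + 1) * 4 powr \<sigma>" using C(1) A0 by (simp add: add_nonneg_pos)
 show ?thesis
 proof (rule bexI[OF _ G], rule exI[of _ "c0 * \<rho> ^ ?d * \<beta> / 2"], rule conjI[OF c_pos],
   rule exI[of _ "C * (sqrt A + 1) * 4 powr \<sigma>"], rule conjI[OF C_pos], intro allI impI)
  fix n :: nat and x :: "nat => 'a" assume n: "1 <= n"
  \<comment> \<open>The least integer with \<open>N ^ d >= 2 n\<close>, so that at least half of the
    cubes stay free of sample points.\<close>
  define N where "N = nat \<lceil>(2 * real n) powr (1 / ?d)\<rceil>"
  have n2: "1 <= (2 * real n) powr (1 / ?d)" using n by (intro ge_one_powr_ge_zero) auto
  have N_ge: "(2 * real n) powr (1 / ?d) <= real N" unfolding N_def by linarith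
  have N1: "1 <= real N" using n2 N_ge by linarith
  have "real N <= (2 * real n) powr (1 / ?d) + 1" using n2 unfolding N_def by linarith
  also have "\<dots> <= 2 * (2 * real n) powr (1 / ?d)" using n2 by linarith
  also have "(2 * real n) powr (1 / ?d) = 2 powr (1 / ?d) * real n powr (1 / ?d)" by (simp add: powr_mult)
  also have "2 powr (1 / real ?d) <= 2 powr 1" by (intro powr_mono) auto
  finally have N_le: "real N <= 4 * real n powr (1 / ?d)" by (simp add: mult_right_mono)
  have Nd: "2 * real n <= real N ^ ?d"
  proof -
   have "2 * real n = ((2 * real n) powr (1 / ?d)) powr real ?d" using n by (simp add: powr_powr)
   also have "\<dots> <= real N powr real ?d" using N_ge by (intro powr_mono2) auto
   also have "\<dots> = real N ^ ?d" using N1 by (intro powr_realpow) simp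
   finally show ?thesis .
  qed
  define h where "h = \<rho> / real N"
  have h: "0 < h" using \<rho> N1 by (simp add: h_def)
  have hN: "h * real N = \<rho>" using N1 by (simp add: h_def)
  define q where "q i = p + h *\<^sub>R (\<Sum>b\<in>Basis. real (i b) *\<^sub>R b)" for i :: "'a => nat"
  \<comment> \<open>Takes the small cube with index \<open>i\<close> to the unit cube, where the
    bump \<open>B\<close> lives.\<close>
  define T where "T i y = (1 / h) *\<^sub>R y + (- ((1 / h) *\<^sub>R q i))" for i y
  have T_coord: "T i y \<bullet> b = (y - p) \<bullet> b / h - real (i b)" if "b \<in> Basis" for i y b
   using that h by (simp add: T_def q_def inner_add_left inner_diff_left inner_sum_left_Basis field_simps)
  have T_inv: "T i (q i + h *\<^sub>R v) = v" for i v using h by (simp add: T_def scaleR_add_right)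
  let ?P = "PiE (Basis :: 'a set) (\<lambda>_. {..<N})"
  have fP: "finite ?P" by (intro finite_PiE) auto
  have T_inj: "i = j" if ij: "i \<in> ?P" "j \<in> ?P" and b: "T i y \<in> box 0 One" "T j y \<in> box 0 One" for i j y
  proof (rule PiE_ext[OF ij])
   fix k :: 'a assume k: "k \<in> Basis"
   have "0 < T i y \<bullet> k" "T i y \<bullet> k < 1" "0 < T j y \<bullet> k" "T j y \<bullet> k < 1"
    using b k by (auto simp: mem_box inner_sum_left_Basis)
   hence "\<bar>real (i k) - real (j k)\<bar> < 1" unfolding T_coord[OF k] by linarith
   thus "i k = j k" by linarith
  qed
  have T_Q: "y \<in> ?Q" if i: "i \<in> ?P" and b: "T i y \<in> box 0 One" for i y unfolding mem_box
  proof
   fix k :: 'a assume k: "k \<in> Basis"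
   have t: "0 < (y - p) \<bullet> k / h - real (i k)" "(y - p) \<bullet> k / h - real (i k) < 1"
    using b k unfolding T_coord[OF k, symmetric] by (auto simp: mem_box inner_sum_left_Basis)
   have "i k < N" using PiE_mem[OF i k] by simp
   hence "0 <= (y - p) \<bullet> k / h" "(y - p) \<bullet> k / h <= real N" using t by linarith+
   hence "0 <= (y - p) \<bullet> k" "(y - p) \<bullet> k <= h * real N" using h by (auto simp: zero_le_divide_iff divide_le_eq mult.commute)
   thus "p \<bullet> k <= y \<bullet> k \<and> y \<bullet> k <= (p + \<rho> *\<^sub>R One) \<bullet> k"
    using k unfolding hN by (simp add: inner_diff_left inner_add_left inner_sum_left_Basis)
  qed
  define J where "J = {i \<in> ?P. \<forall>k<n. T i (x k) \<notin> box 0 One}"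
  have JP: "J \<subseteq> ?P" by (auto simp: J_def)
  have fJ: "finite J" using finite_subset[OF JP fP] .
  have cardJ: "real N ^ ?d / 2 <= real (card J)" "real (card J) <= real N ^ ?d"
  proof -
   have cP: "card ?P = N ^ ?d" by (simp add: card_PiE)
   have "card (?P - J) <= card (\<Union>k\<in>{..<n}. {i \<in> ?P. T i (x k) \<in> box 0 One})" using fP by (intro card_mono) (auto simp: J_def)
   also have "\<dots> <= (\<Sum>k<n. card {i \<in> ?P. T i (x k) \<in> box 0 One})" by (rule card_UN_le) simp
   \<comment> \<open>The open cubes are disjoint, so each sample point rules out at most one of
     them.\<close>
   also have "\<dots> <= (\<Sum>k<n. 1)"
   proof (rule sum_mono)
    fix k
    have "finite {i \<in> ?P. T i (x k) \<in> box 0 One}" using fP by simp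
    hence "card {i \<in> ?P. T i (x k) \<in> box 0 One} <= Suc 0" using T_inj by (subst card_le_Suc0_iff_eq) blast+
    thus "card {i \<in> ?P. T i (x k) \<in> box 0 One} <= 1" by simp
   qed
   finally have "card (?P - J) <= n" by simp
   moreover have "card (?P - J) = N ^ ?d - card J" using cP card_Diff_subset[OF fJ JP] by simp
   moreover have "card J <= N ^ ?d" using card_mono[OF fP JP] cP by simp
   ultimately have "real N ^ ?d - real n <= real (card J)" "real (card J) <= real N ^ ?d" by (simp_all flip: of_nat_power add: of_nat_diff)
   thus "real N ^ ?d / 2 <= real (card J)" "real (card J) <= real N ^ ?d" using Nd by linarith+
  qed
  define g where "g i y = B (T i y)" for i y
  have g_aff: "g i = (\<lambda>y. B ((1 / h) *\<^sub>R y + (- ((1 / h) *\<^sub>R q i))))" for i by (simp add: g_def T_def fun_eq_iff)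
  have g_test: "g i \<in> test_functions W" if i: "i \<in> J" for i
  proof -
   obtain K where K: "compact K" "K \<subseteq> box 0 One" "\<And>y. y \<notin> K ==> B y = 0" using test_functionsE[OF B(1)] by metis
   show ?thesis
   proof (rule test_functionsI)
    show "smooth (g i)" unfolding g_aff by (rule smooth_affine[OF Bs])
    show "compact ((\<lambda>v. q i + h *\<^sub>R v) ` K)" by (intro compact_continuous_image K continuous_intros)
    show "y \<in> (\<lambda>v. q i + h *\<^sub>R v) ` K" if "g i y \<noteq> 0" for y
    proof (rule image_eqI)
     show "T i y \<in> K" using that K(3) unfolding g_def by blast
     show "y = q i + h *\<^sub>R T i y" using h by (simp add: T_def scaleR_diff_right)
    qed
    show "(\<lambda>v. q i + h *\<^sub>R v) ` K \<subseteq> W"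
    proof clarify
     fix v assume "v \<in> K"
     hence "T i (q i + h *\<^sub>R v) \<in> box 0 One" using K(2) by (auto simp: T_inv)
     with T_Q[of i] i JP QO show "q i + h *\<^sub>R v \<in> W" by blast
    qed
   qed
  qed
  define \<phi> where "\<phi> y = (\<Sum>i\<in>J. g i y)" for y
  have \<phi>: "\<phi> \<in> test_functions W" unfolding \<phi>_def[abs_def] by (rule test_functions_sum[OF g_test])
  have zero: "\<phi> (x k) = 0" if "k < n" for k unfolding \<phi>_def g_def
   by (rule sum.neutral) (use that in \<open>auto simp: J_def intro!: test_functions_zero_outside[OF B(1)]\<close>)
  have gm: "g i \<in> borel_measurable borel" if "i \<in> J" for i by (rule test_functions_borel[OF g_test[OF that]])
  have "c0 * (h ^ ?d * \<beta>) <= inner (abs_L2 (g i)) (abs_L2 G)" if i: "i \<in> J" for i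
  proof -
   have int: "integrable lborel (\<lambda>y. g i y * G y)" by (rule L2_rep_integrable[OF L2_rep_test[OF g_test[OF i]] L2_rep_test[OF G]])
   have "(LINT y|lborel. g i y) = h ^ ?d * \<beta>" using lborel_integral_affine[OF gm[OF i], of h "q i"] h by (simp add: g_def T_inv \<beta>_def)
   hence "c0 * (h ^ ?d * \<beta>) = (LINT y|lborel. c0 * g i y)" by simp
   also have "\<dots> <= (LINT y|lborel. g i y * G y)"
   proof (rule integral_mono[OF integrable_mult_right[OF integrable_test[OF g_test[OF i]]] int])
    fix y
    show "c0 * g i y <= g i y * G y"
    proof (cases "T i y \<in> box 0 One")
     case True
     hence "c0 <= G y" using z(2) T_Q i JP unfolding c0_def by blast
     hence "c0 * g i y <= G y * g i y" by (rule mult_right_mono) (simp add: g_def B(2))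
     thus ?thesis by (simp only: mult.commute)
    next
     case False
     hence "g i y = 0" unfolding g_def by (intro test_functions_zero_outside[OF B(1)])
     thus ?thesis by simp
    qed
   qed
   also have "\<dots> = inner (abs_L2 (g i)) (abs_L2 G)" by (rule L2_rep_inner[OF L2_rep_test[OF g_test[OF i]] L2_rep_test[OF G], symmetric])
   finally show ?thesis .
  qed
  hence "real (card J) * (c0 * (h ^ ?d * \<beta>)) <= (\<Sum>i\<in>J. inner (abs_L2 (g i)) (abs_L2 G))"
   using sum_bounded_below[of J "c0 * (h ^ ?d * \<beta>)"] by simp
  also have "\<dots> = inner (abs_L2 \<phi>) (abs_L2 G)"
  proof -
   have "abs_L2 \<phi> = (\<Sum>i\<in>J. abs_L2 (g i))" unfolding \<phi>_def[abs_def] by (rule abs_L2_test_sum[OF fJ]) (rule g_test)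
   thus ?thesis by (simp add: inner_sum_left)
  qed
  finally have "real (card J) * (c0 * (h ^ ?d * \<beta>)) <= inner (abs_L2 \<phi>) (abs_L2 G)" .
  moreover have "c0 * \<rho> ^ ?d * \<beta> / 2 <= real (card J) * (c0 * (h ^ ?d * \<beta>))"
  proof -
   have "real N ^ ?d / 2 * (c0 * (h ^ ?d * \<beta>)) <= real (card J) * (c0 * (h ^ ?d * \<beta>))"
    using cardJ(1) c0 h B(3) by (intro mult_right_mono) (auto simp: \<beta>_def)
   thus ?thesis by (simp add: hN[symmetric] power_mult_distrib mult_ac)
  qed
  ultimately have low: "c0 * \<rho> ^ ?d * \<beta> / 2 <= inner (abs_L2 \<phi>) (abs_L2 G)" by (rule order_trans[rotated])
  \<comment> \<open>Squared norms of disjoint bumps add up: at most \<open>N ^ d\<close> bumps, each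
    contributing \<open>h ^ d\<close> and \<open>(1 / h) ^ (2 k)\<close> for derivatives of order
    \<open>k\<close>, while \<open>h * N = \<rho>\<close>.\<close>
  have wd: "(norm (weak_deriv W bs (abs_L2 \<phi>)))^2 <=
    (real N ^ length bs)^2 * (\<rho> ^ ?d * ((1 / \<rho>) ^ length bs)^2 * (norm (abs_L2 (partial_derivs (rev bs) B)))^2)" if bs: "set bs \<subseteq> Basis" for bs
  proof -
   let ?D = "partial_derivs (rev bs) B"
   have rbs: "set (rev bs) \<subseteq> Basis" using bs by simp
   have D: "?D \<in> test_functions (box 0 One)" by (rule test_functions_partial_derivs[OF B(1) rbs])
   have Dg: "partial_derivs (rev bs) (g i) = (\<lambda>y. (1 / h) ^ length bs * ?D (T i y))" for i
    unfolding g_aff partial_derivs_affine[OF Bs rbs] by (simp add: T_def)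
   have Dg_test: "partial_derivs (rev bs) (g i) \<in> test_functions W" if "i \<in> J" for i
    by (rule test_functions_partial_derivs[OF g_test[OF that] rbs])
   have "weak_deriv W bs (abs_L2 \<phi>) = abs_L2 (partial_derivs (rev bs) \<phi>)" by (rule test_weak_deriv(2)[OF W(1) \<phi> bs])
   also have "partial_derivs (rev bs) \<phi> = (\<lambda>y. \<Sum>i\<in>J. partial_derivs (rev bs) (g i) y)"
    unfolding \<phi>_def[abs_def] by (rule partial_derivs_sum[OF test_functions_smooth[OF g_test] rbs])
   finally have "(norm (weak_deriv W bs (abs_L2 \<phi>)))^2 = (norm (abs_L2 (\<lambda>y. \<Sum>i\<in>J. partial_derivs (rev bs) (g i) y)))^2" by simp
   also have "\<dots> = (\<Sum>i\<in>J. (norm (abs_L2 (partial_derivs (rev bs) (g i))))^2)"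
   proof (rule norm_sum_disjoint_tests[OF fJ Dg_test])
    fix i j y assume ij: "i \<in> J" "j \<in> J" and "partial_derivs (rev bs) (g i) y \<noteq> 0" "partial_derivs (rev bs) (g j) y \<noteq> 0"
    hence "?D (T i y) \<noteq> 0" "?D (T j y) \<noteq> 0" unfolding Dg by auto
    hence "T i y \<in> box 0 One" "T j y \<in> box 0 One" using test_functions_zero_outside[OF D] by blast+
    thus "i = j" using T_inj ij JP by blast
   qed
   also have "\<dots> = (\<Sum>i\<in>J. h ^ ?d * ((1 / h) ^ length bs)^2 * (norm (abs_L2 ?D))^2)"
   proof (rule sum.cong[OF refl])
    fix i assume i: "i \<in> J"
    have [measurable]: "borel_fun ?D" by (rule test_functions_borel[OF D])
    have [measurable]: "partial_derivs (rev bs) (g i) \<in> borel_measurable borel" by (rule test_functions_borel[OF Dg_test[OF i]])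
    have "ennreal ((norm (abs_L2 (partial_derivs (rev bs) (g i))))^2) = sq_int (partial_derivs (rev bs) (g i))"
     by (rule L2_rep_norm[OF L2_rep_test[OF Dg_test[OF i]], symmetric])
    also have "\<dots> = ennreal (\<bar>h\<bar> ^ ?d) * sq_int (\<lambda>y. partial_derivs (rev bs) (g i) (q i + h *\<^sub>R y))"
     using h by (intro nn_integral_lborel_affine) auto
    also have "sq_int (\<lambda>y. partial_derivs (rev bs) (g i) (q i + h *\<^sub>R y)) =
      (\<integral>\<^sup>+y. ennreal (((1 / h) ^ length bs)^2) * ennreal ((?D y)^2) \<partial>lborel)"
     unfolding Dg T_inv by (simp add: power_mult_distrib ennreal_mult)
    also have "\<dots> = ennreal (((1 / h) ^ length bs)^2) * ennreal ((norm (abs_L2 ?D))^2)"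
     by (subst nn_integral_cmult) (auto simp: L2_rep_norm[OF L2_rep_test[OF D]])
    also have "ennreal (\<bar>h\<bar> ^ ?d) * \<dots> = ennreal (h ^ ?d * ((1 / h) ^ length bs)^2 * (norm (abs_L2 ?D))^2)"
     using h by (simp add: ennreal_mult mult.assoc)
    finally show "(norm (abs_L2 (partial_derivs (rev bs) (g i))))^2 = h ^ ?d * ((1 / h) ^ length bs)^2 * (norm (abs_L2 ?D))^2"
     using h by (subst (asm) ennreal_inj) auto
   qed
   also have "\<dots> = real (card J) * (h ^ ?d * ((1 / h) ^ length bs)^2 * (norm (abs_L2 ?D))^2)" by simp
   also have "\<dots> <= real N ^ ?d * (h ^ ?d * ((1 / h) ^ length bs)^2 * (norm (abs_L2 ?D))^2)" using cardJ(2) h by (intro mult_right_mono) auto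
   also have "\<dots> = (h * real N) ^ ?d * (((1 / h) ^ length bs)^2 * (norm (abs_L2 ?D))^2)" by (simp add: power_mult_distrib mult_ac)
   also have "1 / h = real N * (1 / \<rho>)" by (simp add: h_def)
   finally show ?thesis unfolding hN by (simp add: power_mult_distrib power_divide mult_ac)
  qed
  have u: "abs_L2 \<phi> \<in> Sobolev ?r W" by (rule test_in_Sobolev[OF W(1) \<phi>])
  have "(Sobolev_norm ?r W (abs_L2 \<phi>))^2 = (\<Sum>bs\<in>?L. (norm (weak_deriv W bs (abs_L2 \<phi>)))^2)"
   unfolding Sobolev_norm_def by (rule real_sqrt_pow2) (simp add: sum_nonneg)
  also have "\<dots> <= (\<Sum>bs\<in>?L. (real N ^ ?r)^2 * (\<rho> ^ ?d * ((1 / \<rho>) ^ length bs)^2 * (norm (abs_L2 (partial_derivs (rev bs) B)))^2))"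
  proof (rule sum_mono)
   fix bs assume "bs \<in> ?L"
   hence bs: "set bs \<subseteq> Basis" "length bs <= ?r" by auto
   have "(real N ^ length bs)^2 <= (real N ^ ?r)^2" using N1 bs(2) by (intro power_mono power_increasing) auto
   thus "(norm (weak_deriv W bs (abs_L2 \<phi>)))^2 <= (real N ^ ?r)^2 * (\<rho> ^ ?d * ((1 / \<rho>) ^ length bs)^2 * (norm (abs_L2 (partial_derivs (rev bs) B)))^2)"
    using \<rho> by (intro order_trans[OF wd[OF bs(1)]] mult_right_mono) auto
  qed
  also have "\<dots> = (sqrt A * real N ^ ?r)^2" unfolding sum_distrib_left[symmetric] A_def[symmetric] using A0 by (simp add: power_mult_distrib)
  finally have S: "Sobolev_norm ?r W (abs_L2 \<phi>) <= sqrt A * real N ^ ?r" by (rule power2_le_imp_le) (simp add: A0)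
  have "(norm (abs_L2 \<phi>))^2 <= \<rho> ^ ?d * ((1 / \<rho>) ^ length ([] :: 'a list))^2 * (norm (abs_L2 (partial_derivs (rev []) B)))^2"
   using wd[of "[]"] weak_deriv_Nil[OF W(1) test_in_L2_on[OF \<phi>]] by simp
  also have "\<dots> <= A" unfolding A_def using \<rho> by (intro member_le_sum finite_derivs) auto
  finally have n0: "norm (abs_L2 \<phi>) <= sqrt A" using real_le_rsqrt by blast
  have "H_norm \<sigma> W (abs_L2 \<phi>) <= C * (sqrt A * real N powr \<sigma>)" by (rule C(2)[OF u _ N1 n0 S]) (simp add: A0)
  also have "\<dots> <= C * ((sqrt A + 1) * (4 * real n powr (1 / ?d)) powr \<sigma>)"
   using C(1) A0 N_le \<sigma> by (intro mult_left_mono mult_mono powr_mono2) auto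
  also have "(4 * real n powr (1 / ?d)) powr \<sigma> = 4 powr \<sigma> * real n powr (\<sigma> / ?d)" by (simp add: powr_mult powr_powr)
  finally have H: "H_norm \<sigma> W (abs_L2 \<phi>) <= C * (sqrt A + 1) * 4 powr \<sigma> * real n powr (\<sigma> / ?d)" by (simp add: mult_ac)
  show "\<exists>\<phi>\<in>test_functions W. (\<forall>i<n. \<phi> (x i) = 0) \<and> H_norm \<sigma> W (abs_L2 \<phi>) <= C * (sqrt A + 1) * 4 powr \<sigma> * real n powr (\<sigma> / real ?d) \<and>
    c0 * \<rho> ^ ?d * \<beta> / 2 <= inner (abs_L2 \<phi>) (abs_L2 G)" using \<phi> zero H low by blast
 qed
qed

subsection \<open>Minimal norm interpolation in a Hilbert space\<close>

text \<open>The spaces are subsets of one type and carry inner products other than that of the type,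
  so the inner product is a parameter and completeness is stated for sequences in
  \<open>V\<close>.\<close>

locale hilbert_carrier =
 fixes V :: "'v::real_vector set" and ip :: "'v => 'v => real"
 assumes subspace: "subspace V"
  and ip_sym: "u \<in> V ==> v \<in> V ==> ip u v = ip v u"
  and ip_add: "u \<in> V ==> v \<in> V ==> w \<in> V ==> ip (u + v) w = ip u w + ip v w"
  and ip_scale: "u \<in> V ==> v \<in> V ==> ip (c *\<^sub>R u) v = c * ip u v"
  and ip_pos: "u \<in> V ==> u \<noteq> 0 ==> 0 < ip u u"
  and complete: "range X \<subseteq> V ==> (\<And>E. 0 < E ==> \<exists>M. \<forall>m\<ge>M. \<forall>n\<ge>M. sqrt (ip (X m - X n) (X m - X n)) < E) ==>
   \<exists>l\<in>V. (\<lambda>n. sqrt (ip (X n - l) (X n - l))) \<longlonglongrightarrow> 0"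
begin

definition nrm :: "'v => real" where "nrm u = sqrt (ip u u)"

lemma V_closed [simp]: "0 \<in> V" "u \<in> V ==> v \<in> V ==> u + v \<in> V" "u \<in> V ==> c *\<^sub>R u \<in> V" "u \<in> V ==> v \<in> V ==> u - v \<in> V"
 using subspace by (auto simp: subspace_0 subspace_add subspace_scale subspace_diff)

lemma ip_add_right: "u \<in> V ==> v \<in> V ==> w \<in> V ==> ip w (u + v) = ip w u + ip w v" by (simp add: ip_sym[of w] ip_add)

lemma ip_scale_right: "u \<in> V ==> v \<in> V ==> ip v (c *\<^sub>R u) = c * ip v u" by (simp add: ip_sym[of v] ip_scale)

lemma ip_diff: "u \<in> V ==> v \<in> V ==> w \<in> V ==> ip (u - v) w = ip u w - ip v w"
 using ip_add[of u "(-1) *\<^sub>R v" w] ip_scale[of v w "-1"] V_closed(3)[of v "-1"] by simp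

lemma ip_diff_right: "u \<in> V ==> v \<in> V ==> w \<in> V ==> ip w (u - v) = ip w u - ip w v" by (simp add: ip_sym[of w] ip_diff)

lemmas ip_simps = ip_add ip_add_right ip_scale ip_scale_right ip_diff ip_diff_right

lemma ip_nonneg: "u \<in> V ==> 0 <= ip u u" using ip_pos[of u] ip_scale[of 0 0 0] by (cases "u = 0") auto

lemma nrm_square: "u \<in> V ==> (nrm u)^2 = ip u u" by (simp add: nrm_def ip_nonneg)

lemma nrm_nonneg: "u \<in> V ==> 0 <= nrm u" by (simp add: nrm_def ip_nonneg)

lemma Cauchy_Schwarz:
 assumes u: "u \<in> V" and v: "v \<in> V"
 shows "ip u v <= nrm u * nrm v"
proof (cases "v = 0")
 case True
 thus ?thesis using u ip_scale_right[of 0 u 0] nrm_nonneg[of u] nrm_nonneg[of 0] by simp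
next
 case False
 hence vv: "0 < ip v v" using v by (rule ip_pos[rotated])
 let ?t = "ip u v / ip v v"
 have "0 <= ip (u - ?t *\<^sub>R v) (u - ?t *\<^sub>R v)" using u v by (intro ip_nonneg) simp
 also have "\<dots> = ip u u - 2 * ?t * ip u v + ?t^2 * ip v v" using u v by (simp add: ip_simps ip_sym[of v u] power2_eq_square algebra_simps)
 also have "\<dots> = ip u u - (ip u v)^2 / ip v v" using vv by (simp add: field_simps power2_eq_square)
 finally have "(ip u v)^2 <= ip u u * ip v v" using vv by (simp add: field_simps)
 also have "\<dots> = (nrm u * nrm v)^2" using u v by (simp add: nrm_square power_mult_distrib)
 finally show ?thesis by (rule power2_le_imp_le) (simp add: u v nrm_nonneg)
qed

lemma nrm_triangle:
 assumes u: "u \<in> V" and v: "v \<in> V"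
 shows "nrm (u + v) <= nrm u + nrm v"
proof (rule power2_le_imp_le)
 have "(nrm (u + v))^2 = (nrm u)^2 + 2 * ip u v + (nrm v)^2" using u v by (simp add: nrm_square ip_simps ip_sym[of v u])
 also have "\<dots> <= (nrm u + nrm v)^2" using Cauchy_Schwarz[OF u v] by (simp add: power2_sum)
 finally show "(nrm (u + v))^2 <= (nrm u + nrm v)^2" .
qed (simp add: u v nrm_nonneg)

lemma nrm_scale: "u \<in> V ==> nrm (c *\<^sub>R u) = \<bar>c\<bar> * nrm u"
 by (simp add: nrm_def ip_simps real_sqrt_mult flip: power2_eq_square mult.assoc)

text \<open>As for closed convex sets: by the parallelogram law a minimising sequence is Cauchy.
  Closure under midpoints is all the convexity this takes.\<close>

lemma min_norm_ex:
 assumes A: "A \<noteq> {}" "A \<subseteq> V" and mid: "\<And>u v. u \<in> A ==> v \<in> A ==> (1 / 2) *\<^sub>R (u + v) \<in> A"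
  and closed: "\<And>X l. range X \<subseteq> A ==> l \<in> V ==> (\<lambda>n. nrm (X n - l)) \<longlonglongrightarrow> 0 ==> l \<in> A"
 shows "\<exists>w\<in>A. \<forall>u\<in>A. ip w w <= ip u u"
proof -
 define m where "m = (INF u\<in>A. ip u u)"
 have bdd: "bdd_below ((\<lambda>u. ip u u) ` A)" using A ip_nonneg by (intro bdd_belowI2[of _ 0]) auto
 have m_le: "m <= ip u u" if "u \<in> A" for u unfolding m_def using bdd that by (rule cINF_lower)
 have "\<exists>u\<in>A. ip u u < m + 1 / Suc n" for n using cINF_less_iff[OF A(1) bdd, of "m + 1 / Suc n"] by (simp add: m_def)
 hence "\<exists>X. \<forall>n. X n \<in> A \<and> ip (X n) (X n) < m + 1 / Suc n" by (intro choice allI) blast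
 then obtain X where X: "\<And>n. X n \<in> A" "\<And>n. ip (X n) (X n) < m + 1 / Suc n" by blast
 have XV: "X n \<in> V" for n using X(1) A by blast
 have gap: "ip (X i - X j) (X i - X j) <= 2 / Suc i + 2 / Suc j" for i j
 proof -
  have "m <= ip ((1 / 2) *\<^sub>R (X i + X j)) ((1 / 2) *\<^sub>R (X i + X j))" by (intro m_le mid X)
  also have "\<dots> = (1 / 4) * ip (X i + X j) (X i + X j)" using XV by (simp add: ip_scale ip_scale_right)
  finally have "4 * m <= ip (X i + X j) (X i + X j)" by simp
  moreover have "ip (X i - X j) (X i - X j) + ip (X i + X j) (X i + X j) = 2 * ip (X i) (X i) + 2 * ip (X j) (X j)" using XV by (simp add: ip_simps)
  ultimately have "ip (X i - X j) (X i - X j) <= 2 * (1 / Suc i) + 2 * (1 / Suc j)" using X(2)[of i] X(2)[of j] by argo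
  thus ?thesis by simp
 qed
 have "\<exists>l\<in>V. (\<lambda>n. sqrt (ip (X n - l) (X n - l))) \<longlonglongrightarrow> 0"
 proof (rule complete)
  show "range X \<subseteq> V" using XV by blast
  fix e :: real assume e: "0 < e"
  hence "0 < e^2 / 4" by simp
  then obtain M where M: "inverse (real (Suc M)) < e^2 / 4" using reals_Archimedean by blast
  show "\<exists>M. \<forall>i\<ge>M. \<forall>j\<ge>M. sqrt (ip (X i - X j) (X i - X j)) < e"
  proof (intro exI[of _ M] allI impI)
   fix i j assume "M <= i" "M <= j"
   hence "2 / Suc i <= 2 / Suc M" "2 / Suc j <= 2 / Suc M" by (auto intro!: divide_left_mono)
   moreover have "2 / Suc M < e^2 / 2" using M by (simp add: field_simps)
   ultimately have "ip (X i - X j) (X i - X j) < e^2" using gap[of i j] by argo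
   hence "sqrt (ip (X i - X j) (X i - X j)) < sqrt (e^2)" by (rule real_sqrt_less_mono)
   thus "sqrt (ip (X i - X j) (X i - X j)) < e" using e by simp
  qed
 qed
 then obtain l where l: "l \<in> V" "(\<lambda>n. nrm (X n - l)) \<longlonglongrightarrow> 0" unfolding nrm_def by blast
 have lA: "l \<in> A" by (rule closed[OF _ l]) (use X in auto)
 have "nrm l <= sqrt m"
 proof (rule LIMSEQ_le_const)
  have "(\<lambda>n. sqrt (m + 1 / real (Suc n)) + nrm (X n - l)) \<longlonglongrightarrow> sqrt (m + 0) + 0"
   by (intro tendsto_add tendsto_real_sqrt tendsto_const l(2) LIMSEQ_Suc[OF lim_1_over_n])
  thus "(\<lambda>n. sqrt (m + 1 / real (Suc n)) + nrm (X n - l)) \<longlonglongrightarrow> sqrt m" by simp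
  show "\<exists>N. \<forall>n\<ge>N. nrm l <= sqrt (m + 1 / real (Suc n)) + nrm (X n - l)"
  proof (intro exI allI impI)
   fix n
   have "nrm l = nrm (X n + (-1) *\<^sub>R (X n - l))" by simp
   also have "\<dots> <= nrm (X n) + nrm ((-1) *\<^sub>R (X n - l))" by (intro nrm_triangle V_closed XV l)
   also have "nrm ((-1) *\<^sub>R (X n - l)) = nrm (X n - l)" using nrm_scale[of "X n - l" "-1"] XV l(1) by simp
   also have "nrm (X n) <= sqrt (m + 1 / real (Suc n))" unfolding nrm_def using X(2)[of n] by (intro real_sqrt_le_mono) simp
   finally show "nrm l <= sqrt (m + 1 / real (Suc n)) + nrm (X n - l)" by simp
  qed
 qed
 hence "ip l l <= m" unfolding nrm_def by simp
 thus ?thesis using lA m_le by (intro bexI[of _ l] ballI) (rule order_trans)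
qed

definition functional :: "('v => real) => bool" where
 "functional f \<longleftrightarrow> (\<forall>u\<in>V. \<forall>v\<in>V. f (u + v) = f u + f v) \<and> (\<forall>c. \<forall>u\<in>V. f (c *\<^sub>R u) = c * f u) \<and> (\<exists>C. \<forall>u\<in>V. \<bar>f u\<bar> <= C * nrm u)"

lemma functional_add: "functional f ==> u \<in> V ==> v \<in> V ==> f (u + v) = f u + f v"
 and functional_scale: "functional f ==> u \<in> V ==> f (c *\<^sub>R u) = c * f u" by (auto simp: functional_def)

lemma functional_diff: "functional f ==> u \<in> V ==> v \<in> V ==> f (u - v) = f u - f v"
 using functional_add[of f u "(-1) *\<^sub>R v"] functional_scale[of f v "-1"] V_closed(3)[of v "-1"] by simp

lemma functional_tendsto:
 assumes f: "functional f" and X: "range X \<subseteq> V" and l: "l \<in> V" "(\<lambda>n. nrm (X n - l)) \<longlonglongrightarrow> 0"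
 shows "(\<lambda>n. f (X n)) \<longlonglongrightarrow> f l"
proof -
 obtain C where C: "\<And>u. u \<in> V ==> \<bar>f u\<bar> <= C * nrm u" using f unfolding functional_def by blast
 have "(\<lambda>n. f (X n) - f l) \<longlonglongrightarrow> 0"
 proof (rule tendsto_0_le[OF l(2), where K = C], intro always_eventually allI)
  fix n
  have XV: "X n \<in> V" using X by blast
  show "norm (f (X n) - f l) <= norm (nrm (X n - l)) * C"
   using C[of "X n - l"] XV l(1) nrm_nonneg[of "X n - l"] by (simp add: functional_diff[OF f, symmetric] mult.commute)
 qed
 thus ?thesis by (simp add: LIM_zero_iff)
qed

text \<open>\<open>w\<close> has least norm among the elements with the prescribed values;
  perturbing it within the common kernel shows that it is orthogonal to that kernel.\<close>

lemma spline_step: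
 fixes n :: nat
 assumes f: "\<And>i. i <= n ==> functional (f i)" and v: "v \<in> V" "\<And>i. i < n ==> f i v = 0" "f n v \<noteq> 0"
 shows "\<exists>w\<in>V. (\<forall>i<n. f i w = 0) \<and> f n w = 1 \<and> (\<forall>k\<in>V. (\<forall>i\<le>n. f i k = 0) --> ip w k = 0)"
proof -
 define A where "A = {u \<in> V. (\<forall>i<n. f i u = 0) \<and> f n u = 1}"
 have "\<exists>w\<in>A. \<forall>u\<in>A. ip w w <= ip u u"
 proof (rule min_norm_ex)
  have "f i ((1 / f n v) *\<^sub>R v) = (1 / f n v) * f i v" if "i <= n" for i using f[OF that] v(1) by (rule functional_scale)
  hence "(1 / f n v) *\<^sub>R v \<in> A" using v unfolding A_def by auto
  thus "A \<noteq> {}" by blast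
  show "A \<subseteq> V" by (auto simp: A_def)
  show "(1 / 2) *\<^sub>R (u + v) \<in> A" if "u \<in> A" "v \<in> A" for u v using that f by (auto simp: A_def functional_scale functional_add)
  fix X l assume X: "range X \<subseteq> A" and l: "l \<in> V" "(\<lambda>n. nrm (X n - l)) \<longlonglongrightarrow> 0"
  have lim: "(\<lambda>m. f i (X m)) \<longlonglongrightarrow> f i l" if "i <= n" for i
   using X by (intro functional_tendsto f that l) (auto simp: A_def)
  have "f i l = 0" if "i < n" for i using lim[of i] X that LIMSEQ_unique[of "\<lambda>m. 0" "f i l" 0] by (auto simp: A_def image_subset_iff)
  moreover have "f n l = 1" using lim[of n] X LIMSEQ_unique[of "\<lambda>m. 1" "f n l" 1] by (auto simp: A_def image_subset_iff)
  ultimately show "l \<in> A" using l(1) by (simp add: A_def)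
 qed
 then obtain w where w: "w \<in> A" "\<And>u. u \<in> A ==> ip w w <= ip u u" by blast
 have wV: "w \<in> V" using w by (simp add: A_def)
 have "ip w k = 0" if k: "k \<in> V" "\<And>i. i <= n ==> f i k = 0" for k
 proof (cases "k = 0")
  case True
  thus ?thesis using ip_scale_right[of 0 w 0] wV by simp
 next
  case False
  \<comment> \<open>The value of \<open>t\<close> that minimises the quadratic
    \<open>ip (w + t k) (w + t k)\<close>.\<close>
  let ?t = "- (ip w k / ip k k)"
  have kk: "0 < ip k k" using False k(1) by (rule ip_pos[rotated])
  have "w + ?t *\<^sub>R k \<in> A" using w(1) k f by (auto simp: A_def functional_add functional_scale simp del: scaleR_minus_left)
  hence "ip w w <= ip (w + ?t *\<^sub>R k) (w + ?t *\<^sub>R k)" by (rule w(2))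
  also have "\<dots> = ip w w + 2 * ?t * ip w k + ?t^2 * ip k k"
   using wV k(1) by (simp add: ip_simps ip_sym[of k w] power2_eq_square algebra_simps del: scaleR_minus_left)
  also have "\<dots> = ip w w - (ip w k)^2 / ip k k" using kk by (simp add: field_simps power2_eq_square)
  finally have "(ip w k)^2 / ip k k <= 0" by simp
  hence "(ip w k)^2 <= 0" using kk by (simp add: divide_le_0_iff)
  thus ?thesis by simp
 qed
 thus ?thesis using w(1) wV by (intro bexI[of _ w]) (auto simp: A_def)
qed

lemma functional_sum: "functional f ==> (\<And>i. i \<in> I ==> h i \<in> V) ==> (\<Sum>i\<in>I. c i *\<^sub>R h i) \<in> V \<and> f (\<Sum>i\<in>I. c i *\<^sub>R h i) = (\<Sum>i\<in>I. c i * f (h i))"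
 using functional_scale[of f 0 0] by (induction I rule: infinite_finite_induct) (auto simp: functional_add functional_scale)

text \<open>The spline interpolant \<open>\<Sum>i<n. f\<^sub>i(u) h\<^sub>i\<close> need not be the orthogonal projection of \<open>u\<close>; all
 that is used is that the interpolation error does not exceed \<open>u\<close> in norm.\<close>

lemma spline_ex:
 fixes n :: nat
 assumes "\<And>i. i < n ==> functional (f i)"
 shows "\<exists>h. (\<forall>i<n. h i \<in> V) \<and> (\<forall>u\<in>V. (\<forall>j<n. f j (u - (\<Sum>i<n. f i u *\<^sub>R h i)) = 0) \<and> nrm (u - (\<Sum>i<n. f i u *\<^sub>R h i)) <= nrm u)"
 using assms
proof (induction n)
 case (Suc n)
 then obtain h where h: "\<And>i. i < n ==> h i \<in> V" "\<And>u j. u \<in> V ==> j < n ==> f j (u - (\<Sum>i<n. f i u *\<^sub>R h i)) = 0"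
  "\<And>u. u \<in> V ==> nrm (u - (\<Sum>i<n. f i u *\<^sub>R h i)) <= nrm u" by fastforce
 define P where "P u = (\<Sum>i<n. f i u *\<^sub>R h i)" for u
 have fn: "functional (f n)" using Suc.prems by simp
 have PV: "P u \<in> V" and fP: "f n (P u) = (\<Sum>i<n. f i u * f n (h i))" for u
  using functional_sum[OF fn, of "{..<n}" h "\<lambda>i. f i u"] h(1) by (auto simp: P_def)
 show ?case
 proof (cases "\<forall>v\<in>V. (\<forall>i<n. f i v = 0) --> f n v = 0")
  case True
  \<comment> \<open>Here \<open>f n\<close> vanishes on the common kernel of the earlier
    functionals, so the old interpolant already matches it and the new spline function can be
    0.\<close>
  have "f n (u - P u) = 0" if "u \<in> V" for u using True that PV[of u] h(2)[OF that] by (auto simp: P_def)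
  thus ?thesis using h by (intro exI[of _ "h(n := 0)"]) (auto simp: less_Suc_eq P_def)
 next
  case False
  then obtain w where w: "w \<in> V" "\<And>i. i < n ==> f i w = 0" "f n w = 1" "\<And>k. k \<in> V ==> (\<forall>i\<le>n. f i k = 0) ==> ip w k = 0"
   using spline_step[of n f] Suc.prems by (metis less_Suc_eq_le)
  \<comment> \<open>The residual is corrected by \<open>f n (u - P u)\<close> times
    \<open>w\<close>; expanding this coefficient changes the earlier spline functions as
    well.\<close>
  define h' where "h' i = (if i < n then h i - f n (h i) *\<^sub>R w else w)" for i
  have eq: "u - (\<Sum>i<Suc n. f i u *\<^sub>R h' i) = (u - P u) - f n (u - P u) *\<^sub>R w" if u: "u \<in> V" for u
  proof -
   have "(\<Sum>i<Suc n. f i u *\<^sub>R h' i) = (\<Sum>i<n. f i u *\<^sub>R h i - (f i u * f n (h i)) *\<^sub>R w) + f n u *\<^sub>R w"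
    by (simp add: h'_def scaleR_diff_right)
   also have "\<dots> = P u - f n (P u) *\<^sub>R w + f n u *\<^sub>R w" unfolding fP by (simp add: P_def sum_subtractf scaleR_sum_left)
   also have "\<dots> = P u + f n (u - P u) *\<^sub>R w" using u PV by (simp add: functional_diff[OF fn] scaleR_diff_left)
   finally show ?thesis by simp
  qed
  show ?thesis
  proof (rule exI[of _ h'], intro conjI allI impI ballI)
   show "h' i \<in> V" if "i < Suc n" for i using that h(1) w(1) by (auto simp: h'_def)
   fix u assume u: "u \<in> V"
   let ?g = "u - P u" and ?a = "f n (u - P u)"
   have gV: "?g \<in> V" using u PV by simp
   have ker: "f j (?g - ?a *\<^sub>R w) = 0" if "j <= n" for j using that h(2)[OF u, of j] w gV Suc.prems[of j]
    by (cases "j < n") (auto simp: functional_diff functional_scale P_def le_less)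
   show "f j (u - (\<Sum>i<Suc n. f i u *\<^sub>R h' i)) = 0" if "j < Suc n" for j unfolding eq[OF u] using that by (intro ker) simp
   let ?k = "?g - ?a *\<^sub>R w"
   have kV: "?k \<in> V" using gV w(1) by simp
   \<comment> \<open>The corrected residual lies in the common kernel, hence is orthogonal to
     \<open>w\<close>; by Pythagoras the correction cannot lengthen it.\<close>
   have wk: "ip w ?k = 0" using ker by (intro w(4) kV) blast
   have "?g = ?k + ?a *\<^sub>R w" by simp
   hence "ip ?g ?g = ip (?k + ?a *\<^sub>R w) (?k + ?a *\<^sub>R w)" by simp
   also have "\<dots> = ip ?k ?k + ?a * (?a * ip w w)"
    using kV w(1) wk ip_sym[OF kV w(1)] by (simp only: ip_add ip_add_right ip_scale ip_scale_right V_closed) simp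
   finally have "ip ?k ?k <= ip ?g ?g" using ip_nonneg[OF w(1)] by (simp add: mult.assoc[symmetric] mult_nonneg_nonneg)
   hence "nrm ?k <= nrm ?g" by (simp add: nrm_def)
   also have "\<dots> <= nrm u" using h(3)[OF u] by (simp add: P_def)
   finally show "nrm (u - (\<Sum>i<Suc n. f i u *\<^sub>R h' i)) <= nrm u" unfolding eq[OF u] .
  qed
 qed
qed simp

end

lemma Hilbert_norm_on_carrier:
 assumes N: "Hilbert_norm_on V N" and V: "subspace V"
 obtains ip where "hilbert_carrier V ip" "\<And>u. u \<in> V ==> N u = hilbert_carrier.nrm ip u"
proof -
 obtain ip :: "'a => 'a => real" where ip: "\<forall>u\<in>V. \<forall>v\<in>V. ip u v = ip v u"
  "\<forall>u\<in>V. \<forall>v\<in>V. \<forall>w\<in>V. ip (u + v) w = ip u w + ip v w" "\<forall>c. \<forall>u\<in>V. \<forall>v\<in>V. ip (c *\<^sub>R u) v = c * ip u v"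
  "\<forall>u\<in>V. u \<noteq> 0 --> ip u u > 0" and N_eq: "\<forall>u\<in>V. N u = sqrt (ip u u)"
  and complete: "\<forall>X :: nat => 'a. range X \<subseteq> V \<and> (\<forall>e>0. \<exists>M. \<forall>m\<ge>M. \<forall>n\<ge>M. N (X m - X n) < e) -->
    (\<exists>l\<in>V. (\<lambda>n. N (X n - l)) \<longlonglongrightarrow> 0)"
  using N unfolding Hilbert_norm_on_def by (elim exE conjE) (rule that)
 have "hilbert_carrier V ip"
 proof
  fix X :: "nat => 'a"
  assume X: "range X \<subseteq> V" and C: "\<And>e. 0 < e ==> \<exists>M. \<forall>m\<ge>M. \<forall>n\<ge>M. sqrt (ip (X m - X n) (X m - X n)) < e"
  have N_diff: "N (X m - v) = sqrt (ip (X m - v) (X m - v))" if "v \<in> V" for m v using X that N_eq subspace_diff[OF V] by blast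
  have N_diff': "N (X m - X n) = sqrt (ip (X m - X n) (X m - X n))" for m n using X by (intro N_diff) blast
  have "\<exists>l\<in>V. (\<lambda>n. N (X n - l)) \<longlonglongrightarrow> 0" using complete X C by (simp add: N_diff')
  then obtain l where "l \<in> V" "(\<lambda>n. N (X n - l)) \<longlonglongrightarrow> 0" by blast
  thus "\<exists>l\<in>V. (\<lambda>n. sqrt (ip (X n - l) (X n - l))) \<longlonglongrightarrow> 0" using N_diff[of l] by (intro bexI[of _ l]) simp_all
 qed (use ip V in auto)
 thus thesis by (rule that) (simp add: N_eq hilbert_carrier.nrm_def[OF \<open>hilbert_carrier V ip\<close>])
qed

subsection \<open>Sampling numbers and functions vanishing at the sample points\<close>

text \<open>\<open>2 u\<close> is the difference of the two errors \<open>u - y\<close> and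
  \<open>- u - y\<close>.\<close>

lemma (in hilbert_carrier) le_max_of_antipodal:
 assumes u: "u \<in> V" and y: "y \<in> V"
 shows "nrm u <= max (nrm (u - y)) (nrm ((-1) *\<^sub>R u - y))"
proof -
 have "2 * nrm u = nrm (2 *\<^sub>R u)" using u by (simp add: nrm_scale)
 also have "2 *\<^sub>R u = (u - y) + (-1) *\<^sub>R ((-1) *\<^sub>R u - y)" by (simp add: scaleR_2)
 also have "nrm \<dots> <= nrm (u - y) + nrm ((-1) *\<^sub>R ((-1) *\<^sub>R u - y))"
  using u y V_closed(3)[of u "-1"] V_closed(3)[of "(-1) *\<^sub>R u - y" "-1"] by (intro nrm_triangle) auto
 also have "nrm ((-1) *\<^sub>R ((-1) *\<^sub>R u - y)) = nrm ((-1) *\<^sub>R u - y)"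
  using nrm_scale[of "(-1) *\<^sub>R u - y" "-1"] u y V_closed(3)[of u "-1"] by simp
 finally show ?thesis by simp
qed

text \<open>Both sampling numbers equal the smallest norm of \<open>S\<close> on the functions that vanish at \<open>n\<close>
 points: arbitrary methods cannot tell such a function from its negative, and spline
 interpolation followed by \<open>S\<close> is a linear method attaining this bound.\<close>

lemma sampling_numbers_eq:
 fixes S :: "'a::euclidean_space L2 => 'v::real_vector"
 assumes F: "hilbert_carrier F ipF" and NF: "\<And>f. f \<in> F ==> NF f = hilbert_carrier.nrm ipF f"
  and H: "hilbert_carrier H ipH" and NH: "\<And>u. u \<in> H ==> NH u = hilbert_carrier.nrm ipH u"
  and pe: "\<And>x. x \<in> W ==> hilbert_carrier.functional F ipF (\<lambda>f. point_eval W f x)"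
  and S: "\<And>f. f \<in> F ==> S f \<in> H" "\<And>f g. S (f + g) = S f + S g" "\<And>c f. S (c *\<^sub>R f) = c *\<^sub>R S f"
 shows "sampling_number n W S F NF H NH = linear_sampling_number n W S F NF H NH"
  and "linear_sampling_number n W S F NF H NH =
   (INF x\<in>{x :: nat => 'a. \<forall>i<n. x i \<in> W}. SUP f\<in>{f \<in> F. NF f <= 1 \<and> (\<forall>i<n. point_eval W f (x i) = 0)}. ennreal (NH (S f)))"
proof -
 interpret F: hilbert_carrier F ipF by (rule F)
 interpret H: hilbert_carrier H ipH by (rule H)
 define R where "R x = (SUP f\<in>{f \<in> F. NF f <= 1 \<and> (\<forall>i<n. point_eval W f (x i) = 0)}. ennreal (NH (S f)))" for x :: "nat => 'a"
 let ?X = "{x :: nat => 'a. \<forall>i<n. x i \<in> W}"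
 have sumH: "(\<Sum>i<n. c i *\<^sub>R h i) \<in> H" if "\<And>i. i < n ==> h i \<in> H" for c h
  using that by (intro subspace_sum[OF H.subspace] H.V_closed) auto
 have lin_sub: "linear_sampling_methods n W H \<subseteq> sampling_methods n W H"
 proof
  fix A assume "A \<in> linear_sampling_methods n W H"
  then obtain h x where hx: "A = (\<lambda>f. \<Sum>i<n. point_eval W f (x i) *\<^sub>R h i)" "\<forall>i<n. x i \<in> W" "\<forall>i<n. h i \<in> H"
   by (auto simp: linear_sampling_methods_def)
  define \<phi> where "\<phi> ys = (\<Sum>i<n. (ys ! i) *\<^sub>R h i)" for ys
  have "A = (\<lambda>f. \<phi> (map (\<lambda>i. point_eval W f (x i)) [0..<n]))" by (simp add: hx \<phi>_def)
  moreover have "\<phi> ys \<in> H" for ys unfolding \<phi>_def using hx(3) by (intro sumH) blast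
  ultimately show "A \<in> sampling_methods n W H" unfolding sampling_methods_def using hx(2) by blast
 qed
 have le: "sampling_number n W S F NF H NH <= linear_sampling_number n W S F NF H NH"
  unfolding sampling_number_def linear_sampling_number_def by (rule INF_superset_mono[OF lin_sub]) simp
 have lower: "(INF x\<in>?X. R x) <= sampling_number n W S F NF H NH" unfolding sampling_number_def
 proof (rule INF_greatest)
  fix A assume "A \<in> sampling_methods n W H"
  then obtain \<phi> x where A: "A = (\<lambda>f. \<phi> (map (\<lambda>i. point_eval W f (x i)) [0..<n]))" and x: "\<forall>i<n. x i \<in> W"
   and \<phi>: "\<forall>ys. length ys = n --> \<phi> ys \<in> H" by (auto simp: sampling_methods_def)
  \<comment> \<open>The answer of the method to zero data, which it gives to \<open>f\<close> and to
    its negative alike.\<close>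
  define y where "y = \<phi> (map (\<lambda>i. 0) [0..<n])"
  have y: "y \<in> H" using \<phi> by (simp add: y_def)
  have Ay: "A f = y" if "\<forall>i<n. point_eval W f (x i) = 0" for f unfolding A y_def using that by (intro arg_cong[of _ _ \<phi>] map_cong) auto
  have "R x <= worst_case_error S A F NF NH" unfolding R_def
  proof (rule SUP_least)
   fix f assume f: "f \<in> {f \<in> F. NF f <= 1 \<and> (\<forall>i<n. point_eval W f (x i) = 0)}"
   let ?g = "(-1) *\<^sub>R f"
   have g: "?g \<in> F" "NF ?g <= 1" "\<forall>i<n. point_eval W ?g (x i) = 0"
    using f F.V_closed(3)[of f "-1"] F.nrm_scale[of f "-1"] x F.functional_scale[OF pe, of _ f "-1"] by (auto simp: NF)
   have Sg: "S ?g = (-1) *\<^sub>R S f" by (rule S(3))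
   have e: "ennreal (NH (S h - y)) <= worst_case_error S A F NF NH" if "h \<in> F" "NF h <= 1" "\<forall>i<n. point_eval W h (x i) = 0" for h
    unfolding worst_case_error_def using that Ay[OF that(3)] by (intro SUP_upper2[of h]) auto
   have Sf: "S f \<in> H" using f S(1) by blast
   have "NH (S f) <= max (NH (S f - y)) (NH (S ?g - y))"
    using H.le_max_of_antipodal[OF Sf y] Sf y H.V_closed(3)[OF Sf, of "-1"] unfolding Sg by (simp add: NH)
   hence "ennreal (NH (S f)) <= max (ennreal (NH (S f - y))) (ennreal (NH (S ?g - y)))" by (auto simp: le_max_iff_disj ennreal_leI)
   also have "\<dots> <= worst_case_error S A F NF NH" using e[of f] e[OF g] f by simp
   finally show "ennreal (NH (S f)) <= worst_case_error S A F NF NH" .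
  qed
  thus "(INF x\<in>?X. R x) <= worst_case_error S A F NF NH" using x by (intro INF_lower2[of x]) auto
 qed
 have upper: "linear_sampling_number n W S F NF H NH <= (INF x\<in>?X. R x)"
 proof (rule INF_greatest)
  fix x assume x: "x \<in> ?X"
  have pe_fn: "F.functional (\<lambda>f. point_eval W f (x i))" if "i < n" for i using pe x that by blast
  obtain h where h0: "\<forall>i<n. h i \<in> F" and h1: "\<forall>f\<in>F. (\<forall>j<n. point_eval W (f - (\<Sum>i<n. point_eval W f (x i) *\<^sub>R h i)) (x j) = 0) \<and>
   F.nrm (f - (\<Sum>i<n. point_eval W f (x i) *\<^sub>R h i)) <= F.nrm f"
  proof -
   have "\<exists>h. (\<forall>i<n. h i \<in> F) \<and> (\<forall>f\<in>F. (\<forall>j<n. point_eval W (f - (\<Sum>i<n. point_eval W f (x i) *\<^sub>R h i)) (x j) = 0) \<and>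
    F.nrm (f - (\<Sum>i<n. point_eval W f (x i) *\<^sub>R h i)) <= F.nrm f)"
    by (rule F.spline_ex[of n "\<lambda>i f. point_eval W f (x i)"]) (rule pe_fn)
   thus thesis by (elim exE conjE) (rule that)
  qed
  have h: "h i \<in> F" if "i < n" for i using h0 that by blast
  \<comment> \<open>Its error at \<open>f\<close> is \<open>S\<close> applied to the spline
    residual, which vanishes at the points and is no longer than \<open>f\<close>.\<close>
  define A where "A f = (\<Sum>i<n. point_eval W f (x i) *\<^sub>R S (h i))" for f
  have "A \<in> linear_sampling_methods n W H" unfolding linear_sampling_methods_def A_def[abs_def]
   by (intro CollectI exI[of _ "\<lambda>i. S (h i)"] exI[of _ x]) (use x h S(1) in auto)
  moreover have "worst_case_error S A F NF NH <= R x" unfolding worst_case_error_def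
  proof (rule SUP_least)
   fix f assume f: "f \<in> {f \<in> F. NF f <= 1}"
   let ?P = "\<Sum>i<n. point_eval W f (x i) *\<^sub>R h i"
   have S0: "S 0 = 0" using S(3)[of 0 0] by simp
   have SP: "S (\<Sum>i\<in>I. c i *\<^sub>R h i) = (\<Sum>i\<in>I. c i *\<^sub>R S (h i))" for c I
    by (induction I rule: infinite_finite_induct) (auto simp: S0 S(2,3))
   have "S f = S ((f - ?P) + ?P)" by simp
   also have "\<dots> = S (f - ?P) + A f" unfolding S(2) SP A_def by simp
   finally have Sf: "S f - A f = S (f - ?P)" by simp
   have PF: "?P \<in> F" using h by (intro subspace_sum[OF F.subspace] F.V_closed) auto
   have fP: "f - ?P \<in> F" using f PF by simp
   have "NF (f - ?P) <= 1" using conjunct2[OF bspec[OF h1, of f]] f fP NF[of f] NF[OF fP] by simp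
   thus "ennreal (NH (S f - A f)) <= R x" unfolding Sf R_def using conjunct1[OF bspec[OF h1, of f]] f fP by (intro SUP_upper) auto
  qed
  ultimately show "linear_sampling_number n W S F NF H NH <= R x"
   unfolding linear_sampling_number_def by (rule INF_lower2[where f = "\<lambda>A. worst_case_error S A F NF NH"])
 qed
 show "sampling_number n W S F NF H NH = linear_sampling_number n W S F NF H NH" using le order_trans[OF upper lower] by (rule antisym)
 show "linear_sampling_number n W S F NF H NH =
   (INF x\<in>?X. SUP f\<in>{f \<in> F. NF f <= 1 \<and> (\<forall>i<n. point_eval W f (x i) = 0)}. ennreal (NH (S f)))"
  using antisym[OF upper order_trans[OF lower le]] unfolding R_def .
qed

subsection \<open>The embedding of \<open>L\<^sub>2\<close> into \<open>H\<^sup>-\<^sup>s\<close>\<close>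

lemma weak_deriv_scaleR:
 assumes W: "open W" and u: "u \<in> Sobolev m W" and bs: "set bs \<subseteq> Basis" "length bs <= m"
 shows "weak_deriv W bs (c *\<^sub>R u) = c *\<^sub>R weak_deriv W bs u"
proof -
 have uO: "u \<in> L2_on W" using u by (simp add: Sobolev_def)
 have Wb: "W \<in> sets borel" using W by simp
 note d = Sobolev_weak_deriv[OF W u bs]
 have cd: "c *\<^sub>R weak_deriv W bs u \<in> L2_on W" by (rule L2_on_scaleR[OF d(1)])
 have "is_weak_deriv W bs (c *\<^sub>R u) (c *\<^sub>R weak_deriv W bs u)"
  using d by (simp add: is_weak_deriv_iff[OF Wb _ _ bs(1)] uO cd L2_on_scaleR[OF uO] mult.left_commute)
 thus ?thesis by (intro weak_deriv_eqI W L2_on_scaleR uO cd bs)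
qed

lemma H_norm_scaleR_le:
 assumes W: "open W" and u: "u \<in> H_space s W"
 shows "H_norm s W (c *\<^sub>R u) <= \<bar>c\<bar> * H_norm s W u"
proof (cases "s \<in> \<nat>")
 case True
 let ?m = "nat \<lfloor>s\<rfloor>"
 have "(\<Sum>bs\<in>{bs. set bs \<subseteq> Basis \<and> length bs <= ?m}. (norm (weak_deriv W bs (c *\<^sub>R u)))^2) =
   c^2 * (\<Sum>bs\<in>{bs. set bs \<subseteq> Basis \<and> length bs <= ?m}. (norm (weak_deriv W bs u))^2)"
  unfolding sum_distrib_left using u True by (intro sum.cong refl) (simp add: H_space_def weak_deriv_scaleR[OF W] power_mult_distrib)
 thus ?thesis using True by (simp add: H_norm_def Sobolev_norm_def real_sqrt_mult)
next
 case False
 hence fin: "Besov_integral s W u < \<infinity>" using u by (simp add: H_space_def Besov_def)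
 have "enn2real (Besov_integral s W (c *\<^sub>R u)) <= enn2real (ennreal (c^2) * Besov_integral s W u)"
  using fin by (intro enn2real_mono Besov_integral_scaleR_le[OF W]) (auto simp: ennreal_mult_less_top)
 hence "sqrt (enn2real (Besov_integral s W (c *\<^sub>R u))) <= sqrt (c^2 * enn2real (Besov_integral s W u))" by (simp add: enn2real_mult)
 thus ?thesis using False by (simp add: H_norm_def Besov_norm_def real_sqrt_mult distrib_left)
qed

lemma abs_L2_zero: "abs_L2 (\<lambda>x. 0) = 0" by (simp add: zero_L2_def)

lemma subspace_H_space:
 assumes W: "open W" and s: "0 < s"
 shows "subspace (H_space s W)" using test_in_H_space[OF W s test_functions_zero] H_space_add[OF W] H_space_scaleR[OF W]
 by (simp add: subspace_def abs_L2_zero)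

lemma H_norm_zero:
 assumes W: "open W" and s: "0 < s"
 shows "H_norm s W 0 = 0" using H_norm_scaleR_le[OF W, of 0 s 0] H_norm_nonneg[of s W 0] subspace_0[OF subspace_H_space[OF W s]] by simp

text \<open>A difference of order 0 is a restriction, so linearity and the norm bound are inherited
  from \<open>diff_L2\<close>.\<close>

lemma restrict_L2_eq: "restrict_L2 W u = diff_L2 0 W 0 u" by (simp add: restrict_L2_def diff_L2_def diff_domain_def fwd_diff_def)

lemma norm_restrict_L2_le: "open W ==> norm (restrict_L2 W u) <= norm u"
 using norm_diff_L2_le[of W 0 0 u] by (simp add: restrict_L2_eq fwd_diff_const_def)

lemma abs_L2_test_scale: "\<phi> \<in> test_functions U ==> abs_L2 (\<lambda>x. c * \<phi> x) = c *\<^sub>R abs_L2 \<phi>"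
 by (rule L2_rep_eqI[OF L2_rep_test[OF test_functions_scale] L2_rep_scaleR[OF L2_rep_test]]) auto

lemma abs_L2_test_add:
 "\<phi> \<in> test_functions U ==> g \<in> test_functions U ==> abs_L2 (\<lambda>x. \<phi> x + g x) = abs_L2 \<phi> + abs_L2 g"
 by (rule L2_rep_eqI[OF L2_rep_test[OF test_functions_add] L2_rep_add[OF L2_rep_test L2_rep_test]]) auto

lemma test_in_H0_space:
 assumes W: "open W" and s: "0 < s" and \<phi>: "\<phi> \<in> test_functions W"
 shows "abs_L2 \<phi> \<in> H0_space s W" unfolding H0_space_def using test_in_H_space[OF assms] \<phi> H_norm_zero[OF W s]
 by (auto intro!: bexI[of _ \<phi>])

text \<open>The sum of two approximations calls for a triangle inequality for \<open>H_norm\<close>.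
  It is borrowed from the equivalent Hilbert norm, at the price of the factor
  \<open>C * C\<close>.\<close>

lemma subspace_H0_space:
 assumes W: "open W" and s: "0 < s" and NH: "Hilbert_norm_for s W NH"
 shows "subspace (H0_space s W)"
proof -
 note sub = subspace_H_space[OF W s]
 obtain ip where "hilbert_carrier (H_space s W) ip" and N: "\<And>u. u \<in> H_space s W ==> NH u = hilbert_carrier.nrm ip u"
  using Hilbert_norm_on_carrier[OF _ sub] NH unfolding Hilbert_norm_for_def by blast
 then interpret H: hilbert_carrier "H_space s W" ip by simp
 obtain C where C: "0 < C" "\<And>u. u \<in> H_space s W ==> NH u <= C * H_norm s W u" "\<And>u. u \<in> H_space s W ==> H_norm s W u <= C * NH u"
  using NH unfolding Hilbert_norm_for_def equivalent_norms_on_def by blast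
 have tri: "H_norm s W (u + v) <= C * C * (H_norm s W u + H_norm s W v)" if u: "u \<in> H_space s W" and v: "v \<in> H_space s W" for u v
 proof -
  have "H_norm s W (u + v) <= C * NH (u + v)" using u v by (intro C) simp
  also have "NH (u + v) <= NH u + NH v" using H.nrm_triangle[OF u v] u v by (simp add: N)
  also have "\<dots> <= C * H_norm s W u + C * H_norm s W v" by (intro add_mono C u v)
  finally show ?thesis using C(1) by (simp add: algebra_simps)
 qed
 have test: "abs_L2 \<phi> \<in> H_space s W" if "\<phi> \<in> test_functions W" for \<phi> by (rule test_in_H_space[OF W s that])
 show ?thesis
 proof (rule subspaceI)
  show "0 \<in> H0_space s W" using test_in_H0_space[OF W s test_functions_zero] by (simp add: abs_L2_zero)
 next
  fix u v assume "u \<in> H0_space s W" "v \<in> H0_space s W"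
  hence u: "u \<in> H_space s W" "\<And>d. 0 < d ==> \<exists>\<phi>\<in>test_functions W. H_norm s W (u - abs_L2 \<phi>) < d"
   and v: "v \<in> H_space s W" "\<And>d. 0 < d ==> \<exists>\<phi>\<in>test_functions W. H_norm s W (v - abs_L2 \<phi>) < d"
   by (auto simp: H0_space_def)
  have "\<exists>\<phi>\<in>test_functions W. H_norm s W (u + v - abs_L2 \<phi>) < d" if d: "0 < d" for d
  proof -
   have e: "0 < d / (2 * (C * C))" using d C(1) by simp
   obtain \<phi> g where \<phi>: "\<phi> \<in> test_functions W" "H_norm s W (u - abs_L2 \<phi>) < d / (2 * (C * C))"
    and g: "g \<in> test_functions W" "H_norm s W (v - abs_L2 g) < d / (2 * (C * C))" using u(2)[OF e] v(2)[OF e] by blast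
   have eq: "u + v - abs_L2 (\<lambda>x. \<phi> x + g x) = (u - abs_L2 \<phi>) + (v - abs_L2 g)" by (simp add: abs_L2_test_add[OF \<phi>(1) g(1)])
   have "H_norm s W (u + v - abs_L2 (\<lambda>x. \<phi> x + g x)) <= C * C * (H_norm s W (u - abs_L2 \<phi>) + H_norm s W (v - abs_L2 g))"
    unfolding eq by (intro tri H.V_closed u(1) v(1) test \<phi>(1) g(1))
   also have "\<dots> < C * C * (d / (2 * (C * C)) + d / (2 * (C * C)))" using \<phi>(2) g(2) C(1) by (intro mult_strict_left_mono) auto
   also have "\<dots> = d" using C(1) by simp
   finally show ?thesis using test_functions_add[OF \<phi>(1) g(1)] by blast
  qed
  thus "u + v \<in> H0_space s W" using u(1) v(1) by (simp add: H0_space_def)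
 next
  fix c u assume "u \<in> H0_space s W"
  hence u: "u \<in> H_space s W" "\<And>d. 0 < d ==> \<exists>\<phi>\<in>test_functions W. H_norm s W (u - abs_L2 \<phi>) < d" by (auto simp: H0_space_def)
  have "\<exists>\<phi>\<in>test_functions W. H_norm s W (c *\<^sub>R u - abs_L2 \<phi>) < d" if d: "0 < d" for d
  proof -
   have e: "0 < d / (\<bar>c\<bar> + 1)" using d by simp
   obtain \<phi> where \<phi>: "\<phi> \<in> test_functions W" "H_norm s W (u - abs_L2 \<phi>) < d / (\<bar>c\<bar> + 1)" using u(2)[OF e] by blast
   have "H_norm s W (c *\<^sub>R u - abs_L2 (\<lambda>x. c * \<phi> x)) <= \<bar>c\<bar> * H_norm s W (u - abs_L2 \<phi>)"
    using H_norm_scaleR_le[OF W, of "u - abs_L2 \<phi>" s c] u(1) test[OF \<phi>(1)] by (simp add: abs_L2_test_scale[OF \<phi>(1)] scaleR_diff_right)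
   also have "\<dots> <= (\<bar>c\<bar> + 1) * H_norm s W (u - abs_L2 \<phi>)" by (intro mult_right_mono) (auto simp: H_norm_nonneg)
   also have "\<dots> < d" using \<phi>(2) by (simp add: field_simps)
   finally show ?thesis using test_functions_scale[OF \<phi>(1)] by blast
  qed
  thus "c *\<^sub>R u \<in> H0_space s W" using u(1) by (simp add: H0_space_def)
 qed
qed

lemma subspace_Htilde_space:
 assumes W: "open W" and s: "0 < s"
 shows "subspace (Htilde_space s W)"
proof (rule subspaceI)
 note U = subspace_H_space[OF open_UNIV s]
 have r0: "restrict_L2 W 0 = 0" using norm_restrict_L2_le[OF W, of 0] by simp
 hence "0 \<in> supported_extensions s W 0" using subspace_0[OF U] by (simp add: supported_extensions_def L2_on_zero)
 thus "0 \<in> Htilde_space s W" by (auto simp: Htilde_space_def L2_on_zero)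
 show "u + v \<in> Htilde_space s W" if "u \<in> Htilde_space s W" "v \<in> Htilde_space s W" for u v
 proof -
  have "supported_extensions s W u \<noteq> {}" "supported_extensions s W v \<noteq> {}" using that by (auto simp: Htilde_space_def)
  then obtain g h where "g \<in> supported_extensions s W u" "h \<in> supported_extensions s W v" by blast
  hence "g + h \<in> supported_extensions s W (u + v)"
   by (auto simp: supported_extensions_def L2_on_add restrict_L2_eq diff_L2_add[OF W] intro: subspace_add[OF U])
  thus ?thesis using that by (auto simp: Htilde_space_def L2_on_add)
 qed
 show "c *\<^sub>R u \<in> Htilde_space s W" if "u \<in> Htilde_space s W" for c u
 proof -
  have "supported_extensions s W u \<noteq> {}" using that by (auto simp: Htilde_space_def)
  then obtain g where "g \<in> supported_extensions s W u" by blast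
  hence "c *\<^sub>R g \<in> supported_extensions s W (c *\<^sub>R u)"
   by (auto simp: supported_extensions_def L2_on_scaleR restrict_L2_eq diff_L2_scaleR[OF W] intro: subspace_scale[OF U])
  thus ?thesis using that by (auto simp: Htilde_space_def L2_on_scaleR)
 qed
qed

text \<open>These facts hide the two definitions of the predual: afterwards no argument
  distinguishes whether \<open>s - 1/2\<close> is a natural number.\<close>

lemma
 assumes W: "open W" and s: "0 < s" and NH: "Hilbert_norm_for s W NH"
 shows subspace_predual: "subspace (predual_space s W)"
  and norm_le_predual_norm: "u \<in> predual_space s W ==> norm u <= predual_norm s W u"
  and test_in_predual_ball: "\<psi> \<in> test_functions W ==> \<exists>a>0. a *\<^sub>R abs_L2 \<psi> \<in> predual_space s W \<and> predual_norm s W (a *\<^sub>R abs_L2 \<psi>) <= 1"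
proof -
 show "subspace (predual_space s W)" using subspace_H0_space[OF assms] subspace_Htilde_space[OF W s] by (simp add: predual_space_def)
 show "norm u <= predual_norm s W u" if u: "u \<in> predual_space s W"
 proof (cases "s - 1 / 2 \<in> \<nat>")
  case True
  have "norm u <= Htilde_norm s W u" unfolding Htilde_norm_def
  proof (rule cINF_greatest)
   show "supported_extensions s W u \<noteq> {}" using u True by (simp add: predual_space_def Htilde_space_def)
   fix g assume "g \<in> supported_extensions s W u"
   hence g: "g \<in> H_space s UNIV" "restrict_L2 W g = u" by (auto simp: supported_extensions_def)
   have "norm u <= norm g" using norm_restrict_L2_le[OF W, of g] g(2) by simp
   also have "\<dots> <= H_norm s UNIV g" by (rule norm_le_H_norm[OF open_UNIV g(1)])
   finally show "norm u <= H_norm s UNIV g" .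
  qed
  thus ?thesis using True by (simp add: predual_norm_def)
 next
  case False
  thus ?thesis using u norm_le_H_norm[OF W, of u s] by (simp add: predual_norm_def predual_space_def H0_space_def)
 qed
 assume \<psi>: "\<psi> \<in> test_functions W"
 \<comment> \<open>In the tilde case the norm is that of the extension by zero to the whole space,
   otherwise the norm on \<open>W\<close>.\<close>
 define Z where "Z = (if s - 1 / 2 \<in> \<nat> then UNIV else W)"
 have Z: "open Z" "W \<subseteq> Z" using W by (auto simp: Z_def)
 define a where "a = 1 / (1 + H_norm s Z (abs_L2 \<psi>))"
 have a: "0 < a" using H_norm_nonneg[of s Z "abs_L2 \<psi>"] by (simp add: a_def)
 have \<psi>Z: "\<psi> \<in> test_functions Z" using \<psi> test_functions_mono[OF Z(2)] by blast
 have a\<psi>: "(\<lambda>x. a * \<psi> x) \<in> test_functions W" "(\<lambda>x. a * \<psi> x) \<in> test_functions Z" using \<psi> \<psi>Z by (auto intro: test_functions_scale)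
 have eq: "a *\<^sub>R abs_L2 \<psi> = abs_L2 (\<lambda>x. a * \<psi> x)" by (simp add: abs_L2_test_scale[OF \<psi>])
 have "H_norm s Z (a *\<^sub>R abs_L2 \<psi>) <= \<bar>a\<bar> * H_norm s Z (abs_L2 \<psi>)" by (rule H_norm_scaleR_le[OF Z(1) test_in_H_space[OF Z(1) s \<psi>Z]])
 also have "\<dots> <= 1" using a H_norm_nonneg[of s Z "abs_L2 \<psi>"] by (simp add: a_def)
 finally have le1: "H_norm s Z (a *\<^sub>R abs_L2 \<psi>) <= 1" .
 have memW: "a *\<^sub>R abs_L2 \<psi> \<in> H_space s Z" unfolding eq by (rule test_in_H_space[OF Z(1) s a\<psi>(2)])
 have "a *\<^sub>R abs_L2 \<psi> \<in> predual_space s W \<and> predual_norm s W (a *\<^sub>R abs_L2 \<psi>) <= 1"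
 proof (cases "s - 1 / 2 \<in> \<nat>")
  case True
  let ?g = "a *\<^sub>R abs_L2 \<psi>"
  have gO: "?g \<in> L2_on W" unfolding eq by (rule test_in_L2_on[OF a\<psi>(1)])
  have rep: "L2_rep ?g (\<lambda>x. a * \<psi> x)" unfolding eq by (rule L2_rep_test[OF a\<psi>(1)])
  have "restrict_L2 W ?g = ?g" unfolding restrict_L2_eq by (rule L2_rep_eqI[OF L2_rep_diff_L2[OF W rep] rep])
    (auto intro!: AE_I2 simp: fwd_diff_def diff_domain_def indicator_def test_functions_zero_outside[OF \<psi>])
  moreover have "?g \<in> L2_on (closure W)" by (rule L2_onI[OF rep]) (use test_functions_zero_outside[OF \<psi>] closure_subset in fastforce)
  ultimately have ext: "?g \<in> supported_extensions s W ?g" using memW True by (simp add: supported_extensions_def Z_def)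
  have "Htilde_norm s W ?g <= H_norm s UNIV ?g" unfolding Htilde_norm_def by (rule cINF_lower[OF bdd_belowI2[of _ 0] ext]) (rule H_norm_nonneg)
  thus ?thesis using True ext gO le1 by (auto simp: predual_space_def predual_norm_def Htilde_space_def Z_def)
 next
  case False
  have "a *\<^sub>R abs_L2 \<psi> \<in> H0_space s W" unfolding eq by (rule test_in_H0_space[OF W s a\<psi>(1)])
  thus ?thesis using False le1 by (simp add: predual_space_def predual_norm_def Z_def)
 qed
 with a show "\<exists>a>0. a *\<^sub>R abs_L2 \<psi> \<in> predual_space s W \<and> predual_norm s W (a *\<^sub>R abs_L2 \<psi>) <= 1" by blast
qed

text \<open>The upper bound reflects that the predual norm dominates the \<open>L\<^sub>2\<close>
  norm. For the lower bound the functional is tested with a multiple of \<open>g\<close> in the unit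
  ball.\<close>

lemma
 assumes W: "open W" and s: "0 < s" and NH: "Hilbert_norm_for s W NH"
 shows Hneg_embed_in: "Hneg_embed s W f \<in> Hneg_space s W"
  and Hneg_norm_embed_le: "Hneg_norm s W (Hneg_embed s W f) <= norm f"
  and Hneg_norm_embed_ge: "g \<in> test_functions W ==> \<exists>c>0. \<forall>f. c * \<bar>f \<bullet> abs_L2 g\<bar> <= Hneg_norm s W (Hneg_embed s W f)"
proof -
 let ?V = "predual_space s W" and ?N = "predual_norm s W"
 note sub = subspace_predual[OF assms] and le = norm_le_predual_norm[OF assms]
 have dual: "\<bar>f \<bullet> u\<bar> <= norm f * ?N u" if "u \<in> ?V" for f u
  by (rule order_trans[OF Cauchy_Schwarz_ineq2 mult_left_mono[OF le[OF that]]]) simp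
 have "(\<forall>u\<in>?V. \<bar>Hneg_embed s W f u\<bar> <= norm f * ?N u)" by (simp add: Hneg_embed_def dual)
 thus "Hneg_embed s W f \<in> Hneg_space s W" unfolding Hneg_space_def dual_space_def
  using subspace_add[OF sub] subspace_scale[OF sub] by (auto simp: Hneg_embed_def inner_add_right)
 have bd: "\<bar>Hneg_embed s W f u\<bar> <= norm f" if "u \<in> {u \<in> ?V. ?N u <= 1}" for u f
  using dual[of u f] that mult_left_mono[of "?N u" 1 "norm f"] by (auto simp: Hneg_embed_def)
 have "0 \<in> {u \<in> ?V. ?N u <= 1}" using test_in_predual_ball[OF assms test_functions_zero] by (auto simp: abs_L2_zero)
 hence ne: "{u \<in> ?V. ?N u <= 1} \<noteq> {}" by blast
 show "Hneg_norm s W (Hneg_embed s W f) <= norm f" unfolding Hneg_norm_def dual_norm_def by (rule cSUP_least[OF ne bd])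
 assume "g \<in> test_functions W"
 then obtain a where a: "0 < a" "a *\<^sub>R abs_L2 g \<in> {u \<in> ?V. ?N u <= 1}" using test_in_predual_ball[OF assms] by blast
 have "a * \<bar>f \<bullet> abs_L2 g\<bar> <= Hneg_norm s W (Hneg_embed s W f)" for f
 proof -
  have "a * \<bar>f \<bullet> abs_L2 g\<bar> = \<bar>Hneg_embed s W f (a *\<^sub>R abs_L2 g)\<bar>" using a by (simp add: Hneg_embed_def abs_mult)
  also have "\<dots> <= Hneg_norm s W (Hneg_embed s W f)"
   unfolding Hneg_norm_def dual_norm_def by (intro cSUP_upper a bdd_aboveI2[of _ _ "norm f"] bd)
  finally show ?thesis .
 qed
 with a(1) show "\<exists>c>0. \<forall>f. c * \<bar>f \<bullet> abs_L2 g\<bar> <= Hneg_norm s W (Hneg_embed s W f)" by blast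
qed

text \<open>Passing through the isomorphism, the embedding of \<open>L\<^sub>2\<close> and the
  equivalence of \<open>NH\<close> with \<open>H_norm\<close> leaves an upper bound by the
  \<open>L\<^sub>2\<close> norm and a lower bound by a single pairing; the rate rests on these
  two.\<close>

lemma
 fixes S :: "('a::euclidean_space L2 => real) => 'a L2"
 assumes W: "open W" and s: "0 < s" and NH: "Hilbert_norm_for s W NH"
  and iso: "isomorphism_on (Hneg_space s W) (Hneg_norm s W) (H0_space s W) (H_norm s W) S"
 shows solution_in_H_space: "S (Hneg_embed s W f) \<in> H_space s W"
  and solution_add: "S (Hneg_embed s W (f + g)) = S (Hneg_embed s W f) + S (Hneg_embed s W g)"
  and solution_scaleR: "S (Hneg_embed s W (c *\<^sub>R f)) = c *\<^sub>R S (Hneg_embed s W f)"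
  and solution_le: "\<exists>C>0. \<forall>f. NH (S (Hneg_embed s W f)) <= C * norm f"
  and solution_ge: "q \<in> test_functions W ==> \<exists>c>0. \<forall>f. c * \<bar>f \<bullet> abs_L2 q\<bar> <= NH (S (Hneg_embed s W f))"
proof -
 let ?D = "Hneg_space s W" and ?e = "Hneg_embed s W"
 note eD = Hneg_embed_in[OF W s NH]
 have add: "\<forall>f\<in>?D. \<forall>g\<in>?D. S (\<lambda>u. f u + g u) = S f + S g" and scale: "\<forall>c. \<forall>f\<in>?D. S (\<lambda>u. c * f u) = c *\<^sub>R S f"
  and bij: "bij_betw S ?D (H0_space s W)" using iso unfolding isomorphism_on_def by blast+
 obtain C1 where C1: "\<And>f. f \<in> ?D ==> H_norm s W (S f) <= C1 * Hneg_norm s W f" using iso unfolding isomorphism_on_def by blast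
 obtain C2 where C2: "\<And>y. y \<in> H0_space s W ==> Hneg_norm s W (inv_into ?D S y) <= C2 * H_norm s W y"
  using iso unfolding isomorphism_on_def by blast
 obtain C where C: "0 < C" "\<And>u. u \<in> H_space s W ==> NH u <= C * H_norm s W u" "\<And>u. u \<in> H_space s W ==> H_norm s W u <= C * NH u"
  using NH unfolding Hilbert_norm_for_def equivalent_norms_on_def by blast
 have mem0: "S (?e f) \<in> H0_space s W" for f using bij eD by (rule bij_betw_apply)
 show mem: "S (?e f) \<in> H_space s W" for f using mem0[of f] by (simp add: H0_space_def)
 have "?e (f + g) = (\<lambda>u. ?e f u + ?e g u)" by (auto simp: Hneg_embed_def inner_add_left)
 thus "S (?e (f + g)) = S (?e f) + S (?e g)" using add eD by simp
 have "?e (c *\<^sub>R f) = (\<lambda>u. c * ?e f u)" by (auto simp: Hneg_embed_def)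
 thus "S (?e (c *\<^sub>R f)) = c *\<^sub>R S (?e f)" using scale eD by simp
 \<comment> \<open>\<open>isomorphism_on\<close> says nothing about the sign of its constants;
   \<open>\<bar>C1\<bar> + 1\<close> is positive in any case.\<close>
 have "NH (S (?e f)) <= C * (\<bar>C1\<bar> + 1) * norm f" for f
 proof -
  have N0: "0 <= Hneg_norm s W (?e f)" using Hneg_norm_embed_ge[OF W s NH test_functions_zero] by (auto simp: abs_L2_zero)
  have "NH (S (?e f)) <= C * H_norm s W (S (?e f))" by (rule C(2)[OF mem])
  also have "\<dots> <= C * ((\<bar>C1\<bar> + 1) * norm f)"
  proof (rule mult_left_mono)
   have "H_norm s W (S (?e f)) <= C1 * Hneg_norm s W (?e f)" by (rule C1[OF eD])
   also have "\<dots> <= (\<bar>C1\<bar> + 1) * norm f" using N0 by (intro mult_mono Hneg_norm_embed_le[OF W s NH]) auto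
   finally show "H_norm s W (S (?e f)) <= (\<bar>C1\<bar> + 1) * norm f" .
  qed (use C(1) in simp)
  finally show ?thesis by (simp add: mult.assoc)
 qed
 thus "\<exists>C>0. \<forall>f. NH (S (?e f)) <= C * norm f" using C(1) by (intro exI[of _ "C * (\<bar>C1\<bar> + 1)"]) simp
 assume "q \<in> test_functions W"
 then obtain a where a: "0 < a" "\<And>f. a * \<bar>f \<bullet> abs_L2 q\<bar> <= Hneg_norm s W (?e f)" using Hneg_norm_embed_ge[OF W s NH] by blast
 let ?K = "(\<bar>C2\<bar> + 1) * C"
 have K: "0 < ?K" using C(1) by simp
 have "a / ?K * \<bar>f \<bullet> abs_L2 q\<bar> <= NH (S (?e f))" for f
 proof -
  have "inv_into ?D S (S (?e f)) = ?e f" using bij eD by (intro inv_into_f_f) (auto simp: bij_betw_def)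
  hence "Hneg_norm s W (?e f) <= C2 * H_norm s W (S (?e f))" using C2[OF mem0[of f]] by simp
  also have "\<dots> <= (\<bar>C2\<bar> + 1) * (C * NH (S (?e f)))" using H_norm_nonneg by (intro mult_mono C(3)[OF mem]) auto
  finally have "a * \<bar>f \<bullet> abs_L2 q\<bar> <= ?K * NH (S (?e f))" using a(2)[of f] by (simp add: mult.assoc)
  thus ?thesis using K by (simp add: pos_divide_le_eq mult.commute)
 qed
 moreover have "0 < a / ?K" using a(1) K by simp
 ultimately show "\<exists>c>0. \<forall>f. c * \<bar>f \<bullet> abs_L2 q\<bar> <= NH (S (?e f))" by blast
qed

theorem theorem5:
  fixes \<Omega> :: "'a::euclidean_space set" and s t :: real
    and S :: "('a L2 \<Rightarrow> real) \<Rightarrow> 'a L2"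
    and NF NH :: "'a L2 \<Rightarrow> real"
  defines "F \<equiv> H_space (- s + t) \<Omega>" and "H \<equiv> H_space s \<Omega>"
    and "S\<^sub>F \<equiv> (\<lambda>f. S (Hneg_embed s \<Omega> f))"
  assumes "bounded_Lipschitz_domain \<Omega>"
    and "s > 0"
    and "isomorphism_on (Hneg_space s \<Omega>) (Hneg_norm s \<Omega>) (H0_space s \<Omega>) (H_norm s \<Omega>) S"
    and "t > s + real DIM('a) / 2"
    and "Hilbert_norm_for (- s + t) \<Omega> NF"
    and "Hilbert_norm_for s \<Omega> NH"
  shows "(\<forall>n\<ge>1. sampling_number n \<Omega> S\<^sub>F F NF H NH = linear_sampling_number n \<Omega> S\<^sub>F F NF H NH) \<and>
         weakly_equivalent (\<lambda>n. linear_sampling_number n \<Omega> S\<^sub>F F NF H NH)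
           (\<lambda>n. real n powr ((s - t) / real DIM('a)))"
proof -
 let ?\<sigma> = "- s + t" and ?d = "real DIM('a)"
 have \<Omega>: "open \<Omega>" "\<Omega> \<noteq> {}" using assms(4) by (auto simp: bounded_Lipschitz_domain_def)
 have \<sigma>: "?d / 2 < ?\<sigma>" using assms(7) by simp
 have \<sigma>0: "0 < ?\<sigma>" using \<sigma> by (meson le_less_trans divide_nonneg_pos of_nat_0_le_iff zero_less_numeral)
 note s = assms(5) and iso = assms(6) and NF = assms(8) and NH = assms(9)
 note sol = \<Omega>(1) s NH iso
 obtain ipF where ipF: "hilbert_carrier F ipF" and NF_eq: "\<And>u. u \<in> F ==> NF u = hilbert_carrier.nrm ipF u"
  using Hilbert_norm_on_carrier[OF _ subspace_H_space[OF \<Omega>(1) \<sigma>0]] NF unfolding Hilbert_norm_for_def F_def by blast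
 obtain ipH where ipH: "hilbert_carrier H ipH" and NH_eq: "\<And>u. u \<in> H ==> NH u = hilbert_carrier.nrm ipH u"
  using Hilbert_norm_on_carrier[OF _ subspace_H_space[OF \<Omega>(1) s]] NH unfolding Hilbert_norm_for_def H_def by blast
 interpret F: hilbert_carrier F ipF by (rule ipF)
 obtain C where C: "0 < C" "\<And>u. u \<in> F ==> NF u <= C * H_norm ?\<sigma> \<Omega> u" "\<And>u. u \<in> F ==> H_norm ?\<sigma> \<Omega> u <= C * NF u"
  using NF unfolding Hilbert_norm_for_def equivalent_norms_on_def F_def by blast
 \<comment> \<open>Here \<open>t > s + d / 2\<close> makes function values bounded functionals, as
   spline interpolation in \<open>F\<close> requires.\<close>
 have pe: "F.functional (\<lambda>f. point_eval \<Omega> f x)" if x: "x \<in> \<Omega>" for x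
 proof -
  obtain c where c: "\<And>u. u \<in> F ==> \<bar>point_eval \<Omega> u x\<bar> <= c x * H_norm ?\<sigma> \<Omega> u"
   using point_eval_H[OF \<Omega>(1) \<sigma>] x unfolding F_def by blast
  have "\<bar>point_eval \<Omega> u x\<bar> <= \<bar>c x\<bar> * C * F.nrm u" if u: "u \<in> F" for u
  proof -
   have "\<bar>point_eval \<Omega> u x\<bar> <= c x * H_norm ?\<sigma> \<Omega> u" by (rule c[OF u])
   also have "\<dots> <= \<bar>c x\<bar> * (C * NF u)" using H_norm_nonneg by (intro mult_mono C(3)[OF u]) auto
   finally show ?thesis using NF_eq[OF u] by (simp add: mult.assoc)
  qed
  thus ?thesis
   unfolding F.functional_def using point_eval_add[OF \<Omega>(1) \<sigma> _ x] point_eval_scaleR[OF \<Omega>(1) \<sigma> _ x] unfolding F_def by blast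
 qed
 have SH: "S\<^sub>F f \<in> H" for f unfolding S\<^sub>F_def H_def by (rule solution_in_H_space[OF sol])
 have S_add: "S\<^sub>F (f + g) = S\<^sub>F f + S\<^sub>F g" and S_scale: "S\<^sub>F (c *\<^sub>R f) = c *\<^sub>R S\<^sub>F f" for f g c
  unfolding S\<^sub>F_def using solution_add[OF sol] solution_scaleR[OF sol] by auto
 have eq1: "sampling_number n \<Omega> S\<^sub>F F NF H NH = linear_sampling_number n \<Omega> S\<^sub>F F NF H NH"
  and eq2: "linear_sampling_number n \<Omega> S\<^sub>F F NF H NH =
   (INF x\<in>{x :: nat => 'a. \<forall>i<n. x i \<in> \<Omega>}. SUP f\<in>{f \<in> F. NF f <= 1 \<and> (\<forall>i<n. point_eval \<Omega> f (x i) = 0)}. ennreal (NH (S\<^sub>F f)))" for n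
  by (rule sampling_numbers_eq[OF ipF NF_eq ipH NH_eq pe SH S_add S_scale]; assumption)+
 obtain C1 where C1: "0 < C1" "\<And>f. NH (S\<^sub>F f) <= C1 * norm f" using solution_le[OF sol] unfolding S\<^sub>F_def by blast
 obtain C2 where C2: "0 < C2" "\<forall>n\<ge>1. \<exists>x :: nat => 'a. (\<forall>i<n. x i \<in> \<Omega>) \<and> (\<forall>u\<in>H_space ?\<sigma> \<Omega>.
  (\<forall>i<n. point_eval \<Omega> u (x i) = 0) --> norm u <= C2 * real n powr (- ?\<sigma> / ?d) * H_norm ?\<sigma> \<Omega> u)"
  using sampling_inequality_H[OF assms(4) \<sigma>] by (elim exE conjE) (rule that)
 obtain \<psi> c3 C3 where \<psi>: "\<psi> \<in> test_functions \<Omega>" and c3: "0 < c3" and C3: "0 < C3"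
  and fool: "\<forall>n\<ge>1. \<forall>x :: nat => 'a. \<exists>\<phi>\<in>test_functions \<Omega>. (\<forall>i<n. \<phi> (x i) = 0) \<and>
   H_norm ?\<sigma> \<Omega> (abs_L2 \<phi>) <= C3 * real n powr (?\<sigma> / ?d) \<and> c3 <= inner (abs_L2 \<phi>) (abs_L2 \<psi>)"
  using fooling_functions[OF \<Omega> \<sigma>0] by (elim bexE exE conjE) (rule that)
 obtain c4 where c4: "0 < c4" "\<And>f. c4 * \<bar>f \<bullet> abs_L2 \<psi>\<bar> <= NH (S\<^sub>F f)" using solution_ge[OF sol \<psi>] unfolding S\<^sub>F_def by blast
 let ?R = "\<lambda>n x. SUP f\<in>{f \<in> F. NF f <= 1 \<and> (\<forall>i<n. point_eval \<Omega> f (x i) = 0)}. ennreal (NH (S\<^sub>F f))"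
 have exp: "(s - t) / ?d = - ?\<sigma> / ?d" by simp
 \<comment> \<open>One good choice of points bounds the infimum: the norm of the solution is at most
   a multiple of the \<open>L\<^sub>2\<close> norm of a function vanishing at them.\<close>
 have upper: "linear_sampling_number n \<Omega> S\<^sub>F F NF H NH <= ennreal (C1 * C2 * C * real n powr ((s - t) / ?d))" if n: "1 <= n" for n
 proof -
  let ?p = "real n powr (- ?\<sigma> / ?d)"
  obtain x :: "nat => 'a" where x: "\<forall>i<n. x i \<in> \<Omega>" and sam: "\<forall>u\<in>H_space ?\<sigma> \<Omega>.
   (\<forall>i<n. point_eval \<Omega> u (x i) = 0) --> norm u <= C2 * ?p * H_norm ?\<sigma> \<Omega> u"
   using C2(2)[rule_format, OF n] by (elim exE conjE) (rule that)
  have "?R n x <= ennreal (C1 * C2 * C * ?p)"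
  proof (rule SUP_least)
   fix f assume f: "f \<in> {f \<in> F. NF f <= 1 \<and> (\<forall>i<n. point_eval \<Omega> f (x i) = 0)}"
   have "H_norm ?\<sigma> \<Omega> f <= C * NF f" using f C(3) by blast
   also have "\<dots> <= C" using f C(1) by (simp add: mult_left_le)
   finally have H: "H_norm ?\<sigma> \<Omega> f <= C" .
   have "NH (S\<^sub>F f) <= C1 * norm f" by (rule C1)
   also have "\<dots> <= C1 * (C2 * ?p * H_norm ?\<sigma> \<Omega> f)" using f sam C1(1) unfolding F_def by (intro mult_left_mono) auto
   also have "\<dots> <= C1 * (C2 * ?p * C)" using H C1(1) C2(1) by (intro mult_left_mono) auto
   finally show "ennreal (NH (S\<^sub>F f)) <= ennreal (C1 * C2 * C * ?p)" by (intro ennreal_leI) (simp add: mult_ac)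
  qed
  thus ?thesis unfolding eq2 exp using x by (intro INF_lower2[of x]) auto
 qed
 \<comment> \<open>For every choice of points a fooling function is scaled into the unit ball of
   \<open>F\<close> by the factor \<open>a\<close>, of order \<open>n powr ((s - t) / d)\<close>,
   and its pairing with \<open>\<psi>\<close> retains exactly this factor.\<close>
 have lower: "ennreal (c4 * c3 / (C * C3) * real n powr ((s - t) / ?d)) <= linear_sampling_number n \<Omega> S\<^sub>F F NF H NH" if n: "1 <= n" for n
  unfolding eq2
 proof (rule INF_greatest)
  fix x :: "nat => 'a" assume x: "x \<in> {x. \<forall>i<n. x i \<in> \<Omega>}"
  let ?p = "real n powr (?\<sigma> / ?d)"
  obtain \<phi> where \<phi>: "\<phi> \<in> test_functions \<Omega>" "\<forall>i<n. \<phi> (x i) = 0" "H_norm ?\<sigma> \<Omega> (abs_L2 \<phi>) <= C3 * ?p"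
   "c3 <= inner (abs_L2 \<phi>) (abs_L2 \<psi>)" using fool n by blast
  have p: "0 < ?p" using n by simp
  define a where "a = 1 / (C * C3 * ?p)"
  have a: "0 < a" using C(1) C3 p by (simp add: a_def)
  let ?f = "a *\<^sub>R abs_L2 \<phi>"
  have \<phi>F: "abs_L2 \<phi> \<in> F" unfolding F_def by (rule test_in_H_space[OF \<Omega>(1) \<sigma>0 \<phi>(1)])
  have fF: "?f \<in> F" using \<phi>F by simp
  have "NF ?f = a * NF (abs_L2 \<phi>)" using NF_eq[OF fF] NF_eq[OF \<phi>F] F.nrm_scale[OF \<phi>F, of a] a by simp
  also have "\<dots> <= a * (C * (C3 * ?p))" using a C(1) \<phi>(3) by (intro mult_left_mono order_trans[OF C(2)[OF \<phi>F]]) auto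
  also have "\<dots> = 1" using C(1) C3 p by (simp add: a_def)
  finally have "NF ?f <= 1" .
  moreover have "point_eval \<Omega> ?f (x i) = 0" if "i < n" for i
   using x that \<phi>(2) F.functional_scale[OF pe \<phi>F] point_eval_test[OF \<Omega>(1) \<phi>(1)] by simp
  ultimately have mem: "?f \<in> {f \<in> F. NF f <= 1 \<and> (\<forall>i<n. point_eval \<Omega> f (x i) = 0)}" using fF by simp
  have "c4 * c3 / (C * C3) * real n powr ((s - t) / ?d) = c4 * (a * c3)"
  proof -
   have "(s - t) / ?d = - (?\<sigma> / ?d)" by (simp only: exp minus_divide_left)
   hence "real n powr ((s - t) / ?d) = 1 / ?p" by (simp only: powr_minus_divide)
   thus ?thesis by (simp add: a_def)
  qed
  also have "\<dots> <= c4 * \<bar>?f \<bullet> abs_L2 \<psi>\<bar>" using c4(1) a \<phi>(4) by (intro mult_left_mono) (auto simp: abs_mult)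
  also have "\<dots> <= NH (S\<^sub>F ?f)" by (rule c4(2))
  finally show "ennreal (c4 * c3 / (C * C3) * real n powr ((s - t) / ?d)) <= ?R n x" by (intro SUP_upper2[OF mem] ennreal_leI)
 qed
 have "0 < c4 * c3 / (C * C3)" "0 < C1 * C2 * C" using c4 c3 C C3 C1 C2 by auto
 hence "weakly_equivalent (\<lambda>n. linear_sampling_number n \<Omega> S\<^sub>F F NF H NH) (\<lambda>n. real n powr ((s - t) / ?d))"
  unfolding weakly_equivalent_def using upper lower by blast
 thus ?thesis using eq1 by simp
qed

end
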